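(* Let $K$ be an algebraic number field ($[K:\mathbb{Q}]<\infty$) with ring of integers $\mathfrak{O}_K$. Let $g>0$ be an integer and let $f(x)=x^{2g+1}+a_1x^{2g}+a_2x^{2g-1}+\cdots+a_{2g}x+a_{2g+1}$ be an irreducible polynomial of odd degree $2g+1$ with coefficients in $\mathfrak{O}_K$. Let $K_f$ be the minimal splitting field of $f$ over $K$, let $\theta\in K_f$ be a root of $f$, and let $\mathfrak{F}=\{\alpha\in\mathfrak{O}_{K(\theta)} : \alpha\,\mathfrak{O}_{K(\theta)}\subset\mathfrak{O}_K[\theta]\}$ be the conductor of $\mathfrak{O}_K[\theta]$. Let $\mathfrak{p}$ be a prime ideal of $\mathfrak{O}_K$ which is relatively prime to $2$ and to the conductor $\mathfrak{F}$, and assume that $f(x)$ has no multiple root over $\mathfrak{O}_K/\mathfrak{p}$, i.e. the reduction of $f$ modulo $\mathfrak{p}$ has no multiple root. Let $J_{f,\mathfrak{p}}$ be the Jacobian variety of a projective non-singular irreducible model $C_{f,\mathfrak{p}}$, of genus $g$, of the curve $y^2=f(x)$ over $\mathfrak{O}_K/\mathfrak{p}$. Then $\mathfrak{p}$ splits completely in $K_f$ if and only if $J_{f,\mathfrak{p}}(2)\cong(\mathbb{Z}/2\mathbb{Z})^{\oplus 2g}$.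
   Context: $J_{f,\mathfrak{p}}(2)$ denotes the group of $2$-torsion points of $J_{f,\mathfrak{p}}$ that are rational over the residue field $\mathfrak{O}_K/\mathfrak{p}$. For a number field $L$, $\mathfrak{O}_L$ denotes its ring of integers. The conductor $\mathfrak{F}$ is an ideal of $\mathfrak{O}_{K(\theta)}$; "$\mathfrak{p}$ is relatively prime to $\mathfrak{F}$" means $\mathfrak{p}\mathfrak{O}_{K(\theta)}+\mathfrak{F}=\mathfrak{O}_{K(\theta)}$, and "$\mathfrak{p}$ is relatively prime to $2$" means $\mathfrak{p}+2\mathfrak{O}_K=\mathfrak{O}_K$. The curve $y^2=f(x)$ over $\mathfrak{O}_K/\mathfrak{p}$ is the one defined by the reduction of $f$ modulo $\mathfrak{p}$. *)

theory Defs
  imports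
    "HOL-Algebra.Algebra"
    "HOL-Algebra.Algebraic_Closure_Type"
    "HOL-Computational_Algebra.Computational_Algebra"
begin

section \<open>Number fields and rings of integers\<close>

text \<open>
  Number fields are subfields of an arbitrary ambient field of characteristic zero, which is
  viewed as a HOL-Algebra ring by means of the library constant \<open>ring_of_type_algebra\<close>.
\<close>

abbreviation ambient :: "'a::field ring" where
  "ambient \<equiv> ring_of_type_algebra"

definition number_field :: "'a::field_char_0 set \<Rightarrow> bool" where
  "number_field K \<longleftrightarrow> subfield K ambient \<and> ring.finite_dimension ambient \<rat> K"

definition ring_of_integers :: "'a::field_char_0 set \<Rightarrow> 'a ring" where
  "ring_of_integers L = ambient\<lparr>carrier := {x \<in> L. algebraic_int x}\<rparr>"

definition polys_over :: "'a::field set \<Rightarrow> 'a poly set" where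
  "polys_over S = {q. set (coeffs q) \<subseteq> S}"

definition poly_ring_over :: "'a::field set \<Rightarrow> 'a poly ring" where
  "poly_ring_over S = ring_of_type_algebra\<lparr>carrier := polys_over S\<rparr>"

definition splitting_field_of :: "'a::field set \<Rightarrow> 'a poly \<Rightarrow> 'a set \<Rightarrow> bool" where
  "splitting_field_of K f L \<longleftrightarrow>
     (\<exists>c rs. f = smult c (\<Prod>r\<leftarrow>rs. [:-r, 1:]) \<and> set rs \<subseteq> L) \<and>
     L = generate_field ambient (K \<union> {r. poly f r = 0})"

definition simple_ext :: "'a::field set \<Rightarrow> 'a \<Rightarrow> 'a set" where
  "simple_ext K \<theta> = generate_field ambient (insert \<theta> K)"

text \<open>The conductor of \<open>\<OO>\<^sub>K[\<theta>]\<close> in the ring of integers of \<open>K(\<theta>)\<close>.\<close>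

definition conductor :: "'a::field_char_0 set \<Rightarrow> 'a \<Rightarrow> 'a set" where
  "conductor K \<theta> =
     {\<alpha> \<in> carrier (ring_of_integers (simple_ext K \<theta>)).
        \<forall>\<beta> \<in> carrier (ring_of_integers (simple_ext K \<theta>)).
          \<alpha> * \<beta> \<in> (\<lambda>q. poly q \<theta>) ` polys_over (carrier (ring_of_integers K))}"

text \<open>
  The extension of \<open>\<pp>\<close> to \<open>\<OO>\<^sub>L\<close> is a product of \<open>[L:K]\<close> pairwise different prime ideals.
\<close>

definition splits_completely :: "'a::field_char_0 set \<Rightarrow> 'a set \<Rightarrow> 'a set \<Rightarrow> bool" where
  "splits_completely K L \<pp> \<longleftrightarrow>
     (let OL = ring_of_integers L in
      \<exists>Ps. distinct Ps \<and> length Ps = ring.dim ambient K L \<and>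
           (\<forall>P\<in>set Ps. primeideal P OL) \<and>
           Idl\<^bsub>OL\<^esub> \<pp> = foldr (ideal_prod OL) Ps (carrier OL))"


section \<open>Residue fields and their algebraic closures\<close>

definition residue_field :: "'a::field_char_0 set \<Rightarrow> 'a set \<Rightarrow> 'a set ring" where
  "residue_field K \<pp> = ring_of_integers K Quot \<pp>"

text \<open>
  The algebraically closed type \<open>'k\<close> is an algebraic closure of the field \<open>R\<close> through \<open>\<iota>\<close>.
\<close>

definition algebraic_closure_via :: "('r, 'm) ring_scheme \<Rightarrow> ('r \<Rightarrow> 'k::alg_closed_field) \<Rightarrow> bool" where
  "algebraic_closure_via R \<iota> \<longleftrightarrow>
     \<iota> \<in> ring_hom R ambient \<and>
     (\<forall>z. \<exists>q \<in> polys_over (\<iota> ` carrier R). q \<noteq> 0 \<and> poly q z = 0)"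

text \<open>The reduction of \<open>f\<close> modulo \<open>\<pp>\<close>, with coefficients viewed in the algebraic closure.\<close>

definition reduction ::
    "'a::field_char_0 set \<Rightarrow> 'a set \<Rightarrow> ('a set \<Rightarrow> 'k::alg_closed_field) \<Rightarrow> 'a poly \<Rightarrow> 'k poly" where
  "reduction K \<pp> \<iota> f = map_poly (\<lambda>a. \<iota> (\<pp> +>\<^bsub>ring_of_integers K\<^esub> a)) f"


section \<open>The curve \<open>y\<^sup>2 = f(x)\<close> and its Jacobian\<close>

text \<open>
  The function field of the curve over the algebraically closed field \<open>'k\<close>: the pair \<open>(a, b)\<close>
  stands for \<open>a + b y\<close>, where \<open>a\<close> and \<open>b\<close> are rational functions in \<open>x\<close> and \<open>y\<^sup>2 = f(x)\<close>.
\<close>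

type_synonym 'k ff = "'k poly fract \<times> 'k poly fract"

definition function_field :: "'k::alg_closed_field poly \<Rightarrow> 'k ff ring" where
  "function_field f =
     \<lparr>carrier = UNIV,
      monoid.mult = (\<lambda>(a, b) (c, d). (a * c + b * d * Fract f 1, a * d + b * c)),
      one = (1, 0),
      ring.zero = (0, 0),
      add = (\<lambda>(a, b) (c, d). (a + c, b + d))\<rparr>"

definition ff_const :: "'k::alg_closed_field \<Rightarrow> 'k ff" where
  "ff_const c = (Fract [:c:] 1, 0)"

definition ff_x :: "'k::alg_closed_field ff" where
  "ff_x = (Fract [:0, 1:] 1, 0)"

definition ff_y :: "'k::alg_closed_field ff" where
  "ff_y = (0, 1)"

text \<open>
  The points of the projective non-singular model over the algebraically closed field \<open>'k\<close> are
  the places of the function field, represented by their normalised discrete valuations (the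
  order functions at the points). The value at zero carries no information and is fixed to
  be zero, so that distinct functions are distinct points.
\<close>

definition curve_points :: "'k::alg_closed_field poly \<Rightarrow> ('k ff \<Rightarrow> int) set" where
  "curve_points f =
     (let F = function_field f; Z = \<zero>\<^bsub>F\<^esub> in
      {v. v Z = 0 \<and>
          (\<forall>a b. a \<noteq> Z \<longrightarrow> b \<noteq> Z \<longrightarrow> v (a \<otimes>\<^bsub>F\<^esub> b) = v a + v b) \<and>
          (\<forall>a b. a \<noteq> Z \<longrightarrow> b \<noteq> Z \<longrightarrow> a \<oplus>\<^bsub>F\<^esub> b \<noteq> Z \<longrightarrow> v (a \<oplus>\<^bsub>F\<^esub> b) \<ge> min (v a) (v b)) \<and>
          (\<forall>c. c \<noteq> 0 \<longrightarrow> v (ff_const c) = 0) \<and>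
          (\<exists>a. a \<noteq> Z \<and> v a = 1)})"

abbreviation divisor_group :: "'k::alg_closed_field poly \<Rightarrow> (('k ff \<Rightarrow> int) \<Rightarrow>\<^sub>0 int) monoid" where
  "divisor_group f \<equiv> free_Abelian_group (curve_points f)"

text \<open>Since \<open>'k\<close> is algebraically closed, every point has degree one.\<close>

definition divisor_degree :: "(('k::alg_closed_field ff \<Rightarrow> int) \<Rightarrow>\<^sub>0 int) \<Rightarrow> int" where
  "divisor_degree D = (\<Sum>v\<in>Poly_Mapping.keys D. Poly_Mapping.lookup D v)"

definition degree_zero_divisor_group ::
    "'k::alg_closed_field poly \<Rightarrow> (('k ff \<Rightarrow> int) \<Rightarrow>\<^sub>0 int) monoid" where
  "degree_zero_divisor_group f =
     (divisor_group f)\<lparr>carrier := {D \<in> carrier (divisor_group f). divisor_degree D = 0}\<rparr>"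

definition principal_divisors ::
    "'k::alg_closed_field poly \<Rightarrow> (('k ff \<Rightarrow> int) \<Rightarrow>\<^sub>0 int) set" where
  "principal_divisors f =
     {D \<in> carrier (divisor_group f).
        \<exists>h. h \<noteq> \<zero>\<^bsub>function_field f\<^esub> \<and> (\<forall>v\<in>curve_points f. Poly_Mapping.lookup D v = v h)}"

text \<open>
  The group of geometric points of the Jacobian variety: divisor classes of degree zero on
  the curve over the algebraic closure.
\<close>

definition jacobian :: "'k::alg_closed_field poly \<Rightarrow> (('k ff \<Rightarrow> int) \<Rightarrow>\<^sub>0 int) set monoid" where
  "jacobian f = degree_zero_divisor_group f Mod principal_divisors f"

text \<open>
  The absolute Galois group of a subfield \<open>k\<close> of \<open>'k\<close> (over which \<open>'k\<close> is algebraic), and its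
  action on the function field through the constants, fixing \<open>x\<close> and \<open>y\<close>. This makes sense
  when \<open>f\<close> has coefficients in \<open>k\<close>.
\<close>

definition absolute_galois :: "'k::alg_closed_field set \<Rightarrow> ('k \<Rightarrow> 'k) set" where
  "absolute_galois k = {\<sigma> \<in> ring_iso ambient ambient. \<forall>c\<in>k. \<sigma> c = c}"

definition ff_galois :: "'k::alg_closed_field set \<Rightarrow> 'k poly \<Rightarrow> ('k ff \<Rightarrow> 'k ff) set" where
  "ff_galois k f =
     {\<tau> \<in> ring_iso (function_field f) (function_field f).
        \<tau> ff_x = ff_x \<and> \<tau> ff_y = ff_y \<and>
        (\<exists>\<sigma>\<in>absolute_galois k. \<forall>c. \<tau> (ff_const c) = ff_const (\<sigma> c))}"

text \<open>The conjugate of a point \<open>v\<close> is \<open>v \<circ> \<tau>\<^sup>-\<^sup>1\<close>; it is extended linearly to divisors.\<close>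

definition divisor_conj ::
    "('k::alg_closed_field ff \<Rightarrow> 'k ff) \<Rightarrow> (('k ff \<Rightarrow> int) \<Rightarrow>\<^sub>0 int) \<Rightarrow> (('k ff \<Rightarrow> int) \<Rightarrow>\<^sub>0 int)" where
  "divisor_conj \<tau> = frag_extend (\<lambda>v. frag_of (v \<circ> inv_into UNIV \<tau>))"

text \<open>
  The points of the Jacobian that are rational over \<open>k\<close> (for perfect \<open>k\<close>) are the
  Galois-invariant divisor classes. Invariance is required of the class, not of a
  representing divisor.
\<close>

definition jacobian_rational_points ::
    "'k::alg_closed_field set \<Rightarrow> 'k poly \<Rightarrow> (('k ff \<Rightarrow> int) \<Rightarrow>\<^sub>0 int) set set" where
  "jacobian_rational_points k f =
     {c \<in> carrier (jacobian f). \<forall>\<tau>\<in>ff_galois k f. divisor_conj \<tau> ` c = c}"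

definition jacobian_rational_2_torsion ::
    "'k::alg_closed_field set \<Rightarrow> 'k poly \<Rightarrow> (('k ff \<Rightarrow> int) \<Rightarrow>\<^sub>0 int) set monoid" where
  "jacobian_rational_2_torsion k f =
     (jacobian f)\<lparr>carrier := {c \<in> jacobian_rational_points k f.
                               c \<otimes>\<^bsub>jacobian f\<^esub> c = \<one>\<^bsub>jacobian f\<^esub>}\<rparr>"

end

theory Submission
  imports Defs "Jordan_Normal_Form.Char_Poly"
begin

text \<open>
  Both sides of the equivalence say that all roots of the reduction \<open>F\<close> of \<open>f\<close> lie in the residue
  field \<open>k = \<OO>\<^sub>K / \<pp>\<close>, viewed inside the algebraically closed field \<open>'k\<close>. Since \<open>2\<close> is invertible in
  \<open>k\<close> and \<open>F\<close> has no multiple root, \<open>y\<^sup>2 = F(x)\<close> is a curve with one point at infinity and \<open>2 g + 1\<close>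
  further branch points \<open>(a, 0)\<close>.

  The Jacobian. The points of the curve are determined explicitly: over a branch point and over infinity
  the valuation is the order of the norm to \<open>k(x)\<close>, over any other \<open>a\<close> there is one point for each
  square root of \<open>F(a)\<close>. Let \<open>e\<^sub>S\<close> be the sum of the divisors \<open>(a, 0) - \<infinity>\<close> for \<open>a\<close> in a set \<open>S\<close> of
  roots. If \<open>2 D = div h\<close>, the norm of \<open>h\<close> is a square, and an instance of Hilbert's Theorem 90 writes
  \<open>h\<close> as a rational function of \<open>x\<close> times a square; hence \<open>D\<close> is equivalent to some \<open>e\<^sub>S\<close>. Moreover \<open>e\<^sub>S\<close> is
  principal only if \<open>S\<close> is empty or contains all roots. So the 2-torsion has \<open>2\<^sup>2\<^sup>g\<close> elements, and
  the rational 2-torsion is isomorphic to \<open>(\<int>/2)\<^sup>2\<^sup>g\<close> only if all of it is rational. The Frobenius map of \<open>k\<close>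
  lifts to the function field and permutes the \<open>e\<^sub>S\<close> as it permutes the roots; it fixes the class of
  \<open>(a, 0) - \<infinity>\<close> only if it fixes \<open>a\<close>, because the complement of \<open>a\<close> among the roots has \<open>2 g \<noteq> 1\<close>
  elements. This is the content of \<open>rational_2_torsion_full_iff\<close>.

  The splitting. Let \<open>G\<close> be the Galois group of \<open>K\<^sub>f / K\<close>; its order is \<open>[K\<^sub>f : K]\<close>. It permutes the primes
  over \<open>\<pp>\<close> transitively, so \<open>\<pp>\<close> splits completely precisely if the extension of \<open>\<pp>\<close> is the intersection
  of the conjugates of a prime \<open>P\<close> with trivial decomposition group. If the decomposition group is
  trivial, a trace shows that every residue class modulo \<open>P\<close> meets \<open>\<OO>\<^sub>K\<close>; applied to the roots of \<open>f\<close>,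
  this factors \<open>f\<close> modulo \<open>\<pp>\<close>. Conversely, suppose that \<open>f\<close> is congruent modulo \<open>\<pp>\<close> to the product of \<open>x - c\<close>
  for incongruent \<open>c\<close> in a set \<open>C\<close>. A prime \<open>P\<close> over \<open>\<pp>\<close> sends each root \<open>r\<close> to one \<open>c(r)\<close>, and the
  product over \<open>r\<close> of the Lagrange polynomials that belong to \<open>c(r)\<close>, evaluated at \<open>r\<close>, is an element
  \<open>e\<close> that is \<open>1\<close> modulo \<open>P\<close> and orthogonal to its other conjugates modulo the extension of \<open>\<pp>\<close>. Such an
  \<open>e\<close> forces both the trivial decomposition group and the equality of the extension with the
  intersection, without any multiplicative ideal theory. This is the content of
  \<open>splits_completely_iff_roots_residual\<close>.

  Three facts about integers carry the arithmetic: algebraic integers form an integrally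
  closed ring (characteristic polynomials of integer matrices), a prime ideal that contains a nonzero
  integer is maximal, and \<open>k\<close> is finite because all elements of \<open>K\<close> satisfy primitive integral polynomials of
  bounded degree.
\<close>

section \<open>Subrings, polynomials over them and homomorphisms\<close>

definition subring_set :: "'a::comm_ring_1 set \<Rightarrow> bool" where
  "subring_set E \<longleftrightarrow> 1 \<in> E \<and> (\<forall>x\<in>E. \<forall>y\<in>E. x - y \<in> E \<and> x * y \<in> E)"

definition subfield_set :: "'a::field set \<Rightarrow> bool" where
  "subfield_set E \<longleftrightarrow> subring_set E \<and> (\<forall>x\<in>E. inverse x \<in> E)"

definition ring_hom_on :: "'a::comm_ring_1 set \<Rightarrow> ('a \<Rightarrow> 'b::comm_ring_1) \<Rightarrow> bool" where
  "ring_hom_on E \<sigma> \<longleftrightarrow> \<sigma> 1 = 1 \<and> (\<forall>x\<in>E. \<forall>y\<in>E. \<sigma> (x + y) = \<sigma> x + \<sigma> y \<and> \<sigma> (x * y) = \<sigma> x * \<sigma> y)"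

lemma subfield_imp_subring [dest]: "subfield_set E \<Longrightarrow> subring_set E" by (simp add: subfield_set_def)

context
  fixes E :: "'a::comm_ring_1 set"
  assumes E: "subring_set E"
begin

lemma sr_one: "1 \<in> E" and sr_diff: "x \<in> E \<Longrightarrow> y \<in> E \<Longrightarrow> x - y \<in> E"
  and sr_mult: "x \<in> E \<Longrightarrow> y \<in> E \<Longrightarrow> x * y \<in> E"
  using E by (auto simp: subring_set_def)

lemma sr_zero: "0 \<in> E" using sr_diff[OF sr_one sr_one] by simp

lemma sr_uminus: "x \<in> E \<Longrightarrow> - x \<in> E" using sr_diff[OF sr_zero] by simp

lemma sr_add: "x \<in> E \<Longrightarrow> y \<in> E \<Longrightarrow> x + y \<in> E" using sr_diff[of x "- y"] sr_uminus[of y] by simp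

lemma sr_sum: "(\<And>i. i \<in> I \<Longrightarrow> h i \<in> E) \<Longrightarrow> sum h I \<in> E"
  by (induction I rule: infinite_finite_induct) (auto intro: sr_zero sr_add)

lemma sr_prod: "(\<And>i. i \<in> I \<Longrightarrow> h i \<in> E) \<Longrightarrow> prod h I \<in> E"
  by (induction I rule: infinite_finite_induct) (auto intro: sr_one sr_mult)

lemma sr_power: "x \<in> E \<Longrightarrow> x ^ n \<in> E"
  by (induction n) (auto intro: sr_one sr_mult)

lemma sr_of_nat: "of_nat n \<in> E"
  by (induction n) (auto intro: sr_zero sr_add sr_one)

lemma sr_of_int: "of_int n \<in> E"
  by (cases n rule: int_cases2) (auto intro: sr_of_nat sr_uminus)

end

lemmas sr_closed = sr_zero sr_one sr_add sr_diff sr_uminus sr_mult sr_sum sr_prod sr_power sr_of_int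

lemma subring_UNIV [simp]: "subring_set UNIV" by (simp add: subring_set_def)
lemma subfield_UNIV [simp]: "subfield_set UNIV" by (simp add: subfield_set_def)

lemma sf_inverse: "subfield_set E \<Longrightarrow> x \<in> E \<Longrightarrow> inverse x \<in> E" by (simp add: subfield_set_def)

lemma sf_divide: "subfield_set E \<Longrightarrow> x \<in> E \<Longrightarrow> y \<in> E \<Longrightarrow> x / y \<in> E"
  by (simp add: divide_inverse sr_mult subfield_imp_subring sf_inverse)

context
  fixes E :: "'a::field set"
  assumes E: "subring_set E"
begin

lemma polys_over_iff: "p \<in> polys_over E \<longleftrightarrow> (\<forall>i. coeff p i \<in> E)"
proof
  assume "p \<in> polys_over E"
  then have "coeff p i \<in> E" for i
    using coeff_in_coeffs[of p i] coeff_eq_0[of p i] sr_zero[OF E]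
    by (cases "p \<noteq> 0 \<and> i \<le> degree p") (auto simp: polys_over_def subset_iff)
  then show "\<forall>i. coeff p i \<in> E" by blast
qed (auto simp: polys_over_def coeffs_def)

lemma po_zero: "0 \<in> polys_over E" by (simp add: polys_over_def)
lemma po_const: "c \<in> E \<Longrightarrow> [:c:] \<in> polys_over E"
  by (auto simp: polys_over_iff coeff_pCons sr_zero[OF E] split: nat.splits)
lemma po_pCons: "c \<in> E \<Longrightarrow> p \<in> polys_over E \<Longrightarrow> pCons c p \<in> polys_over E"
  by (auto simp: polys_over_iff coeff_pCons split: nat.splits)
lemma po_one: "1 \<in> polys_over E" using po_const[OF sr_one[OF E]] by (simp add: one_pCons)
lemma po_add: "p \<in> polys_over E \<Longrightarrow> q \<in> polys_over E \<Longrightarrow> p + q \<in> polys_over E"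
  by (simp add: polys_over_iff sr_add[OF E])
lemma po_diff: "p \<in> polys_over E \<Longrightarrow> q \<in> polys_over E \<Longrightarrow> p - q \<in> polys_over E"
  by (simp add: polys_over_iff sr_diff[OF E])
lemma po_mult: "p \<in> polys_over E \<Longrightarrow> q \<in> polys_over E \<Longrightarrow> p * q \<in> polys_over E"
  by (auto simp: polys_over_iff coeff_mult intro!: sr_sum[OF E] sr_mult[OF E])
lemma po_smult: "c \<in> E \<Longrightarrow> p \<in> polys_over E \<Longrightarrow> smult c p \<in> polys_over E"
  by (auto simp: polys_over_iff intro!: sr_mult[OF E])
lemma po_monom: "c \<in> E \<Longrightarrow> monom c n \<in> polys_over E"
  by (auto simp: polys_over_iff sr_zero[OF E])
lemma po_prod: "(\<And>i. i \<in> I \<Longrightarrow> h i \<in> polys_over E) \<Longrightarrow> prod h I \<in> polys_over E"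
  by (induction I rule: infinite_finite_induct) (auto intro: po_one po_mult)
lemma po_sum: "(\<And>i. i \<in> I \<Longrightarrow> h i \<in> polys_over E) \<Longrightarrow> sum h I \<in> polys_over E"
  by (induction I rule: infinite_finite_induct) (auto intro: po_zero po_add)
lemma po_linear: "c \<in> E \<Longrightarrow> [:-c, 1:] \<in> polys_over E"
  by (intro po_pCons po_zero sr_uminus[OF E] sr_one[OF E])
lemma po_pderiv: "p \<in> polys_over E \<Longrightarrow> pderiv p \<in> polys_over E"
  unfolding polys_over_iff coeff_pderiv by (auto intro!: sr_mult[OF E] sr_of_nat[OF E] sr_add[OF E] sr_one[OF E])

lemma poly_in: "p \<in> polys_over E \<Longrightarrow> x \<in> E \<Longrightarrow> poly p x \<in> E"
  unfolding poly_altdef polys_over_iff by (intro sr_sum[OF E] sr_mult[OF E] sr_power[OF E]) auto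

end

lemma polys_over_mono: "E \<subseteq> E' \<Longrightarrow> polys_over E \<subseteq> polys_over E'" by (auto simp: polys_over_def)

lemma polys_over_UNIV [simp]: "polys_over UNIV = UNIV" by (simp add: polys_over_def)

context
  fixes E :: "'a::field set" and \<sigma> :: "'a \<Rightarrow> 'b::field"
  assumes E: "subring_set E" and hom: "ring_hom_on E \<sigma>"
begin

lemma rh_one: "\<sigma> 1 = 1" and rh_add: "x \<in> E \<Longrightarrow> y \<in> E \<Longrightarrow> \<sigma> (x + y) = \<sigma> x + \<sigma> y"
  and rh_mult: "x \<in> E \<Longrightarrow> y \<in> E \<Longrightarrow> \<sigma> (x * y) = \<sigma> x * \<sigma> y"
  using hom by (auto simp: ring_hom_on_def)

lemma rh_zero: "\<sigma> 0 = 0"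
proof -
  have "\<sigma> 0 + \<sigma> 0 = \<sigma> 0" using rh_add[OF sr_zero[OF E] sr_zero[OF E]] by (simp only: add_0_left)
  then show ?thesis by (simp only: add_cancel_left_left)
qed

lemma rh_uminus: "x \<in> E \<Longrightarrow> \<sigma> (- x) = - \<sigma> x"
  using rh_add[of x "- x"] sr_uminus[OF E, of x] rh_zero by (simp add: eq_neg_iff_add_eq_0 add.commute)

lemma rh_diff: "x \<in> E \<Longrightarrow> y \<in> E \<Longrightarrow> \<sigma> (x - y) = \<sigma> x - \<sigma> y"
  using rh_add[of x "- y"] rh_uminus[of y] sr_uminus[OF E, of y] by simp

lemma rh_sum: "(\<And>i. i \<in> I \<Longrightarrow> h i \<in> E) \<Longrightarrow> \<sigma> (sum h I) = (\<Sum>i\<in>I. \<sigma> (h i))"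
  by (induction I rule: infinite_finite_induct) (auto simp: rh_zero rh_add sr_sum[OF E])

lemma rh_prod: "(\<And>i. i \<in> I \<Longrightarrow> h i \<in> E) \<Longrightarrow> \<sigma> (prod h I) = (\<Prod>i\<in>I. \<sigma> (h i))"
  by (induction I rule: infinite_finite_induct) (auto simp: rh_one rh_mult sr_prod[OF E])

lemma rh_power: "x \<in> E \<Longrightarrow> \<sigma> (x ^ n) = \<sigma> x ^ n"
  by (induction n) (auto simp: rh_one rh_mult sr_power[OF E])

lemma rh_of_nat: "\<sigma> (of_nat n) = of_nat n"
  by (induction n) (auto simp: rh_zero rh_one rh_add sr_of_nat[OF E] sr_one[OF E])

lemma rh_of_int: "\<sigma> (of_int n) = of_int n"
  by (cases n rule: int_cases2) (auto simp: rh_of_nat rh_uminus sr_of_nat[OF E])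

lemma coeff_rh [simp]: "coeff (map_poly \<sigma> p) i = \<sigma> (coeff p i)"
  by (rule coeff_map_poly) (rule rh_zero)

lemma rh_degree_aux: "\<sigma> (lead_coeff p) \<noteq> 0 \<Longrightarrow> degree (map_poly \<sigma> p) = degree p"
  by (intro antisym degree_le le_degree) (auto simp: coeff_eq_0 rh_zero)

lemma rh_poly_add: "p \<in> polys_over E \<Longrightarrow> q \<in> polys_over E \<Longrightarrow> map_poly \<sigma> (p + q) = map_poly \<sigma> p + map_poly \<sigma> q"
  by (rule poly_eqI) (simp add: rh_add polys_over_iff[OF E])

lemma rh_poly_diff: "p \<in> polys_over E \<Longrightarrow> q \<in> polys_over E \<Longrightarrow> map_poly \<sigma> (p - q) = map_poly \<sigma> p - map_poly \<sigma> q"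
  by (rule poly_eqI) (simp add: rh_diff polys_over_iff[OF E])

lemma rh_poly_mult: "p \<in> polys_over E \<Longrightarrow> q \<in> polys_over E \<Longrightarrow> map_poly \<sigma> (p * q) = map_poly \<sigma> p * map_poly \<sigma> q"
proof (rule poly_eqI)
  fix n assume *: "p \<in> polys_over E" "q \<in> polys_over E"
  have "\<sigma> (\<Sum>i\<le>n. coeff p i * coeff q (n - i)) = (\<Sum>i\<le>n. \<sigma> (coeff p i * coeff q (n - i)))"
    using * by (intro rh_sum sr_mult[OF E]) (auto simp: polys_over_iff[OF E])
  also have "\<dots> = (\<Sum>i\<le>n. \<sigma> (coeff p i) * \<sigma> (coeff q (n - i)))"
    using * by (intro sum.cong rh_mult) (auto simp: polys_over_iff[OF E])
  finally show "coeff (map_poly \<sigma> (p * q)) n = coeff (map_poly \<sigma> p * map_poly \<sigma> q) n"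
    by (simp add: coeff_mult)
qed

lemma rh_poly_linear: "c \<in> E \<Longrightarrow> map_poly \<sigma> [:-c, 1:] = [:- \<sigma> c, 1:]"
  by (rule poly_eqI) (auto simp: coeff_pCons rh_uminus rh_one rh_zero split: nat.splits)

lemma rh_poly_const: "map_poly \<sigma> [:c:] = [:\<sigma> c:]"
  by (rule poly_eqI) (auto simp: coeff_pCons rh_zero split: nat.splits)

lemma rh_poly_one: "map_poly \<sigma> 1 = 1"
  using rh_poly_const[of 1] by (simp add: rh_one one_pCons)

lemma rh_poly_prod:
  "(\<And>i. i \<in> I \<Longrightarrow> h i \<in> polys_over E) \<Longrightarrow> map_poly \<sigma> (prod h I) = (\<Prod>i\<in>I. map_poly \<sigma> (h i))"
  by (induction I rule: infinite_finite_induct) (auto simp: rh_poly_one rh_poly_mult po_prod[OF E])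

lemma rh_poly_eval: "p \<in> polys_over E \<Longrightarrow> x \<in> E \<Longrightarrow> poly (map_poly \<sigma> p) (\<sigma> x) = \<sigma> (poly p x)"
proof (induction p)
  case (pCons c p)
  have c: "c \<in> E" and p: "p \<in> polys_over E"
    using pCons(3) spec[OF pCons(3)[unfolded polys_over_iff[OF E]], of 0]
      spec[OF pCons(3)[unfolded polys_over_iff[OF E]], of "Suc _"] 
    by (auto simp: polys_over_iff[OF E])
  have "map_poly \<sigma> (pCons c p) = pCons (\<sigma> c) (map_poly \<sigma> p)"
    by (rule poly_eqI) (auto simp: coeff_pCons split: nat.splits)
  then show ?case using pCons(2)[OF p pCons(4)] poly_in[OF E p pCons(4)] c pCons(4)
    by (simp add: rh_add rh_mult sr_mult[OF E])
qed (simp add: rh_zero)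

end

lemma rh_nonzero:
  assumes E: "subfield_set E" and hom: "ring_hom_on E (\<sigma> :: 'a::field \<Rightarrow> 'b::field)" and x: "x \<in> E" "x \<noteq> 0"
  shows "\<sigma> x \<noteq> 0"
proof
  note E' = subfield_imp_subring[OF E]
  assume "\<sigma> x = 0"
  then have "\<sigma> (x * inverse x) = 0" using rh_mult[OF E' hom x(1) sf_inverse[OF E x(1)]] by simp
  then show False using x rh_one[OF E' hom] by simp
qed

lemma rh_inj:
  assumes E: "subfield_set E" and hom: "ring_hom_on E (\<sigma> :: 'a::field \<Rightarrow> 'b::field)"
  shows "inj_on \<sigma> E"
proof (rule inj_onI)
  note E' = subfield_imp_subring[OF E]
  fix x y assume "x \<in> E" "y \<in> E" "\<sigma> x = \<sigma> y"
  then have "x - y \<in> E" "\<sigma> (x - y) = 0" using rh_diff[OF E' hom] sr_diff[OF E'] by auto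
  then have "x - y = 0" using rh_nonzero[OF E hom, of "x - y"] by blast
  then show "x = y" by simp
qed

lemma rh_inverse:
  assumes E: "subfield_set E" and hom: "ring_hom_on E (\<sigma> :: 'a::field \<Rightarrow> 'b::field)" and x: "x \<in> E"
  shows "\<sigma> (inverse x) = inverse (\<sigma> x)"
proof (cases "x = 0")
  case True then show ?thesis using rh_zero[OF subfield_imp_subring[OF E] hom] by simp
next
  case False
  note E' = subfield_imp_subring[OF E]
  have "\<sigma> x * \<sigma> (inverse x) = 1"
    using rh_mult[OF E' hom x sf_inverse[OF E x]] rh_one[OF E' hom] False by simp
  then show ?thesis by (metis inverse_unique)
qed

lemma rh_degree:
  assumes E: "subfield_set E" and hom: "ring_hom_on E (\<sigma> :: 'a::field \<Rightarrow> 'b::field)" and p: "p \<in> polys_over E"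
  shows "degree (map_poly \<sigma> p) = degree p"
proof (cases "p = 0")
  case False
  note E' = subfield_imp_subring[OF E]
  have "\<sigma> (lead_coeff p) \<noteq> 0" using False p by (intro rh_nonzero[OF E hom]) (auto simp: polys_over_iff[OF E'])
  then show ?thesis by (rule rh_degree_aux[OF E' hom])
qed simp

lemma rh_degree_monic:
  assumes E: "subring_set E" and hom: "ring_hom_on E (\<sigma> :: 'a::field \<Rightarrow> 'b::field)" and p: "lead_coeff p = 1"
  shows "degree (map_poly \<sigma> p) = degree p" "lead_coeff (map_poly \<sigma> p) = 1"
proof -
  show "degree (map_poly \<sigma> p) = degree p" by (rule rh_degree_aux[OF E hom]) (simp add: p rh_one[OF E hom])
  then show "lead_coeff (map_poly \<sigma> p) = 1" using coeff_rh[OF E hom] p rh_one[OF E hom] by simp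
qed

lemma ambient_simps:
  "carrier ambient = (UNIV :: 'b::field set)" "x \<otimes>\<^bsub>ambient\<^esub> y = x * (y :: 'b)" "x \<oplus>\<^bsub>ambient\<^esub> y = x + (y :: 'b)"
  "\<one>\<^bsub>ambient\<^esub> = (1 :: 'b)" "\<zero>\<^bsub>ambient\<^esub> = (0 :: 'b)"
  by (simp_all add: ring_of_type_algebra_def)

lemma absolute_galois_iff: "\<sigma> \<in> absolute_galois k \<longleftrightarrow> bij \<sigma> \<and> (\<forall>x y. \<sigma> (x * y) = \<sigma> x * \<sigma> y) \<and>
    (\<forall>x y. \<sigma> (x + y) = \<sigma> x + \<sigma> y) \<and> \<sigma> 1 = 1 \<and> (\<forall>c\<in>k. \<sigma> c = c)" for k :: "'b::alg_closed_field set"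
  by (auto simp: absolute_galois_def ring_iso_def Ring.ring_hom_def ambient_simps)

section \<open>Minimal polynomials and simple extensions\<close>

definition is_min_poly :: "'a::field set \<Rightarrow> 'a \<Rightarrow> 'a poly \<Rightarrow> bool" where
  "is_min_poly E \<theta> m \<longleftrightarrow> m \<in> polys_over E \<and> lead_coeff m = 1 \<and> poly m \<theta> = 0 \<and>
     (\<forall>q\<in>polys_over E. q \<noteq> 0 \<longrightarrow> poly q \<theta> = 0 \<longrightarrow> degree m \<le> degree q)"

definition adjoin :: "'a::field set \<Rightarrow> 'a \<Rightarrow> 'a set" where
  "adjoin E \<theta> = (\<lambda>h. poly h \<theta>) ` polys_over E"

lemma po_divide:
  assumes E: "subring_set E" and m: "m \<in> polys_over E" "lead_coeff m = 1" and h: "h \<in> polys_over E"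
  obtains q r where "q \<in> polys_over E" "r \<in> polys_over E" "h = m * q + r" "r = 0 \<or> degree r < degree m"
proof -
  have "\<exists>q r. q \<in> polys_over E \<and> r \<in> polys_over E \<and> h = m * q + r \<and> (r = 0 \<or> degree r < degree m)"
    using h
  proof (induction "degree h" arbitrary: h rule: less_induct)
    case less
    show ?case
    proof (cases "h = 0 \<or> degree h < degree m")
      case True
      then show ?thesis using less.prems po_zero[OF E] by (intro exI[of _ 0] exI[of _ h]) auto
    next
      case False
      let ?t = "monom (lead_coeff h) (degree h - degree m)"
      have t: "?t \<in> polys_over E" using less.prems by (intro po_monom[OF E]) (simp add: polys_over_iff[OF E])
      let ?h = "h - m * ?t"
      have h': "?h \<in> polys_over E" by (intro po_diff[OF E] po_mult[OF E] m t less.prems)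
      have m0: "m \<noteq> 0" using m(2) by auto
      have t0: "?t \<noteq> 0" using False by simp
      have dt: "degree (m * ?t) = degree h" using m0 t0 False by (simp add: degree_mult_eq degree_monom_eq)
      have lt: "coeff (m * ?t) (degree h) = lead_coeff h"
        using lead_coeff_mult[of m ?t] m(2) False unfolding dt by (simp add: degree_monom_eq)
      show ?thesis
      proof (cases "degree h = 0")
        case True
        then have "degree m = 0" using False by simp
        then have "m = 1" using m(2) by (metis degree_eq_zeroE lead_coeff_pCons(2) one_pCons)
        then show ?thesis using less.prems po_zero[OF E] by (intro exI[of _ h] exI[of _ 0]) auto
      next
        case dh: False
        have "degree ?h < degree h"
        proof (rule degree_lessI)
          show "?h \<noteq> 0 \<or> 0 < degree h" using dh by simp
          show "\<forall>k\<ge>degree h. coeff ?h k = 0"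
          proof (intro allI impI)
            fix k assume k: "k \<ge> degree h"
            show "coeff ?h k = 0"
            proof (cases "k = degree h")
              case True then show ?thesis using lt by simp
            next
              case False
              then have "coeff h k = 0" "coeff (m * ?t) k = 0" using k dt by (auto intro: coeff_eq_0)
              then show ?thesis by simp
            qed
          qed
        qed
        then obtain q r where "q \<in> polys_over E" "r \<in> polys_over E" "?h = m * q + r" "r = 0 \<or> degree r < degree m"
          using less.hyps[OF _ h'] by blast
        then show ?thesis using t po_add[OF E]
          by (intro exI[of _ "q + ?t"] exI[of _ r]) (auto simp: algebra_simps)
      qed
    qed
  qed
  then show ?thesis using that by blast
qed

lemma min_poly_exists:
  assumes E: "subfield_set E" and q: "q \<in> polys_over E" "q \<noteq> 0" "poly q \<theta> = 0"
  obtains m where "is_min_poly E \<theta> m"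
proof -
  let ?P = "\<lambda>q. q \<in> polys_over E \<and> q \<noteq> 0 \<and> poly q \<theta> = 0"
  obtain p where p: "?P p" and min: "\<And>q. ?P q \<Longrightarrow> degree p \<le> degree q"
    using ex_has_least_nat[of ?P q degree] q by blast
  note E' = subfield_imp_subring[OF E]
  let ?m = "smult (inverse (lead_coeff p)) p"
  have "lead_coeff p \<in> E" using p by (simp add: polys_over_iff[OF E'])
  then have "?m \<in> polys_over E" using p by (intro po_smult[OF E'] sf_inverse[OF E]) auto
  then have "is_min_poly E \<theta> ?m" using p min by (auto simp: is_min_poly_def)
  then show ?thesis by (rule that)
qed

lemma min_poly_dvd:
  assumes E: "subfield_set E" and m: "is_min_poly E \<theta> m" and h: "h \<in> polys_over E" "poly h \<theta> = 0"
  obtains q where "q \<in> polys_over E" "h = m * q"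
proof -
  note E' = subfield_imp_subring[OF E]
  have m': "m \<in> polys_over E" "lead_coeff m = 1" "poly m \<theta> = 0"
    "\<And>q. q \<in> polys_over E \<Longrightarrow> q \<noteq> 0 \<Longrightarrow> poly q \<theta> = 0 \<Longrightarrow> degree m \<le> degree q"
    using m by (auto simp: is_min_poly_def)
  obtain q r where qr: "q \<in> polys_over E" "r \<in> polys_over E" "h = m * q + r" "r = 0 \<or> degree r < degree m"
    by (rule po_divide[OF E' m'(1,2) h(1)])
  have "poly r \<theta> = 0" using h(2) m'(3) qr(3) by simp
  then have "r = 0" using m'(4)[OF qr(2)] qr(4) by force
  then show ?thesis using that qr by simp
qed

lemma min_poly_degree_pos: "is_min_poly E \<theta> m \<Longrightarrow> degree m > 0"
proof (rule ccontr)
  assume "is_min_poly E \<theta> m" "\<not> degree m > 0"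
  then show False unfolding is_min_poly_def by (elim conjE) (metis degree_eq_zeroE gr0I lead_coeff_pCons(2) pCons_eq_0_iff poly_const_conv zero_neq_one)
qed

lemma adjoin_contains: "subring_set E \<Longrightarrow> E \<subseteq> adjoin E \<theta>" "subring_set E \<Longrightarrow> \<theta> \<in> adjoin E \<theta>"
proof -
  assume E: "subring_set E"
  show "E \<subseteq> adjoin E \<theta>"
  proof
    fix x assume "x \<in> E"
    then show "x \<in> adjoin E \<theta>" unfolding adjoin_def using po_const[OF E] by (intro image_eqI[of _ _ "[:x:]"]) auto
  qed
  have "[:0, 1:] \<in> polys_over E" by (intro po_pCons[OF E] po_zero[OF E] sr_zero[OF E] sr_one[OF E])
  then show "\<theta> \<in> adjoin E \<theta>" unfolding adjoin_def by (intro image_eqI[of _ _ "[:0, 1:]"]) auto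
qed

lemma adjoin_least: "subring_set F \<Longrightarrow> E \<subseteq> F \<Longrightarrow> \<theta> \<in> F \<Longrightarrow> adjoin E \<theta> \<subseteq> F"
  unfolding adjoin_def using poly_in[of F] polys_over_mono[of E F] by blast

lemma subring_adjoin: assumes E: "subring_set E" shows "subring_set (adjoin E \<theta>)"
proof -
  have "x - y \<in> adjoin E \<theta> \<and> x * y \<in> adjoin E \<theta>" if xy: "x \<in> adjoin E \<theta>" "y \<in> adjoin E \<theta>" for x y
  proof -
    obtain p q where pq: "p \<in> polys_over E" "x = poly p \<theta>" "q \<in> polys_over E" "y = poly q \<theta>"
      using xy unfolding adjoin_def by blast
    have "x - y = poly (p - q) \<theta>" "x * y = poly (p * q) \<theta>" using pq by simp_all
    then show ?thesis unfolding adjoin_def using po_diff[OF E pq(1,3)] po_mult[OF E pq(1,3)] by blast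
  qed
  moreover have "1 \<in> adjoin E \<theta>" using adjoin_contains(1)[OF E] sr_one[OF E] by blast
  ultimately show ?thesis unfolding subring_set_def by blast
qed

lemma subfield_adjoin:
  assumes E: "subfield_set E" and q: "q \<in> polys_over E" "q \<noteq> 0" "poly q \<theta> = 0"
  shows "subfield_set (adjoin E \<theta>)"
proof -
  note E' = subfield_imp_subring[OF E]
  note A = subring_adjoin[OF E', of \<theta>]
  obtain m where m: "is_min_poly E \<theta> m" by (rule min_poly_exists[OF E q])
  have m': "m \<in> polys_over E" "lead_coeff m = 1" "poly m \<theta> = 0"
    "\<And>q. q \<in> polys_over E \<Longrightarrow> q \<noteq> 0 \<Longrightarrow> poly q \<theta> = 0 \<Longrightarrow> degree m \<le> degree q"
    using m by (auto simp: is_min_poly_def)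
  have m0: "m \<noteq> 0" using m'(2) by auto
  have in_adj: "poly h \<theta> \<in> adjoin E \<theta>" if "h \<in> polys_over E" for h using that by (simp add: adjoin_def)
  have inv: "inverse (poly h \<theta>) \<in> adjoin E \<theta>" if "h \<in> polys_over E" "h \<noteq> 0" "degree h < degree m" for h
    using that
  proof (induction "degree h" arbitrary: h rule: less_induct)
    case less
    have lc: "lead_coeff h \<in> E" "lead_coeff h \<noteq> 0" using less.prems by (auto simp: polys_over_iff[OF E'])
    show ?case
    proof (cases "degree h = 0")
      case True
      then have "poly h \<theta> = lead_coeff h" by (metis degree_eq_zeroE lead_coeff_pCons(2) poly_pCons poly_0 mult_zero_right add_0_right)
      then show ?thesis using sf_inverse[OF E lc(1)] adjoin_contains(1)[OF E'] by auto
    next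
      case False
      let ?h = "smult (inverse (lead_coeff h)) h"
      have h': "?h \<in> polys_over E" "lead_coeff ?h = 1" "degree ?h = degree h"
        using less.prems lc by (auto intro!: po_smult[OF E'] sf_inverse[OF E])
      obtain q r where qr: "q \<in> polys_over E" "r \<in> polys_over E" "m = ?h * q + r" "r = 0 \<or> degree r < degree ?h"
        by (rule po_divide[OF E' h'(1,2) m'(1)])
      have r0: "r \<noteq> 0"
      proof
        assume "r = 0"
        then have mq: "m = ?h * q" using qr by simp
        then have nz: "?h \<noteq> 0" "q \<noteq> 0" using m0 by auto
        then have dm: "degree m = degree h + degree q" using degree_mult_eq[OF nz] h'(3) unfolding mq by simp
        have "poly ?h \<theta> * poly q \<theta> = 0" using m'(3) unfolding mq poly_mult .
        then have "poly ?h \<theta> = 0 \<or> poly q \<theta> = 0" by (rule mult_eq_0_iff[THEN iffD1])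
        then show False
        proof
          assume "poly ?h \<theta> = 0"
          then show False using m'(4)[OF h'(1) nz(1)] h'(3) less.prems(3) by simp
        next
          assume "poly q \<theta> = 0"
          then show False using m'(4)[OF qr(1) nz(2)] dm False by simp
        qed
      qed
      then have dr: "degree r < degree h" using qr(4) h'(3) by simp
      have rv: "poly r \<theta> \<noteq> 0" using m'(4)[OF qr(2) r0] dr less.prems(3) by auto
      have eq: "poly r \<theta> = - (poly ?h \<theta> * poly q \<theta>)"
        using m'(3) unfolding qr(3) by (simp add: eq_neg_iff_add_eq_0 add.commute mult.assoc)
      then have hv: "poly h \<theta> \<noteq> 0" using rv by auto
      have "inverse (poly r \<theta>) \<in> adjoin E \<theta>" using less.hyps[OF dr qr(2) r0] dr less.prems(3) by simp
      moreover have "inverse (poly h \<theta>) = - (inverse (lead_coeff h) * poly q \<theta> * inverse (poly r \<theta>))"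
      proof -
        have "inverse (lead_coeff h) * poly q \<theta> * poly h \<theta> = - poly r \<theta>" using eq by simp
        then have "inverse (lead_coeff h) * poly q \<theta> = - poly r \<theta> * inverse (poly h \<theta>)"
          using hv by (simp add: field_simps)
        then show ?thesis using rv by simp
      qed
      moreover have "inverse (lead_coeff h) \<in> adjoin E \<theta>" using sf_inverse[OF E lc(1)] adjoin_contains(1)[OF E'] by auto
      ultimately show ?thesis using in_adj[OF qr(1)] by (simp add: sr_uminus[OF A] sr_mult[OF A])
    qed
  qed
  have "inverse x \<in> adjoin E \<theta>" if x: "x \<in> adjoin E \<theta>" for x
  proof -
    obtain h where h: "h \<in> polys_over E" "x = poly h \<theta>" using x unfolding adjoin_def by blast
    obtain q r where qr: "q \<in> polys_over E" "r \<in> polys_over E" "h = m * q + r" "r = 0 \<or> degree r < degree m"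
      by (rule po_divide[OF E' m'(1,2) h(1)])
    have x_r: "x = poly r \<theta>" using h qr(3) m'(3) by simp
    show ?thesis
    proof (cases "r = 0")
      case True then show ?thesis using x_r sr_zero[OF A] by simp
    next
      case False then show ?thesis using inv[OF qr(2) False] qr(4) x_r by simp
    qed
  qed
  then show ?thesis using A by (simp add: subfield_set_def)
qed

lemma adjoin_low_degree:
  assumes E: "subring_set E" and m: "is_min_poly E \<theta> m" and x: "x \<in> adjoin E \<theta>"
  obtains r where "r \<in> polys_over E" "x = poly r \<theta>" "r = 0 \<or> degree r < degree m"
proof -
  have m': "m \<in> polys_over E" "lead_coeff m = 1" "poly m \<theta> = 0" using m by (auto simp: is_min_poly_def)
  obtain h where h: "h \<in> polys_over E" "x = poly h \<theta>" using x unfolding adjoin_def by blast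
  obtain q r where qr: "q \<in> polys_over E" "r \<in> polys_over E" "h = m * q + r" "r = 0 \<or> degree r < degree m"
    by (rule po_divide[OF E m'(1,2) h(1)])
  have "x = poly r \<theta>" using h qr(3) m'(3) by simp
  then show ?thesis using that qr by blast
qed

text \<open>A homomorphism extends to a simple extension by sending \<open>\<theta>\<close> to any root of the image of
  its minimal polynomial.\<close>

lemma extend_hom_adjoin:
  assumes E: "subfield_set E" and hom: "ring_hom_on E \<sigma>" and m: "is_min_poly E \<theta> m"
    and \<beta>: "poly (map_poly \<sigma> m) \<beta> = (0 :: 'b :: field)"
  obtains \<sigma>' where "ring_hom_on (adjoin E \<theta>) \<sigma>'" "\<And>x. x \<in> E \<Longrightarrow> \<sigma>' x = \<sigma> x" "\<sigma>' \<theta> = \<beta>"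
    "\<And>h. h \<in> polys_over E \<Longrightarrow> \<sigma>' (poly h \<theta>) = poly (map_poly \<sigma> h) \<beta>"
proof -
  note E' = subfield_imp_subring[OF E]
  define \<sigma>' where "\<sigma>' x = poly (map_poly \<sigma> (SOME h. h \<in> polys_over E \<and> poly h \<theta> = x)) \<beta>" for x
  have eval: "\<sigma>' (poly h \<theta>) = poly (map_poly \<sigma> h) \<beta>" if h: "h \<in> polys_over E" for h
  proof -
    define h' where "h' = (SOME h'. h' \<in> polys_over E \<and> poly h' \<theta> = poly h \<theta>)"
    have h': "h' \<in> polys_over E" "poly h' \<theta> = poly h \<theta>"
      using someI[of "\<lambda>h'. h' \<in> polys_over E \<and> poly h' \<theta> = poly h \<theta>" h] h unfolding h'_def by auto
    have "h' - h \<in> polys_over E" "poly (h' - h) \<theta> = 0" using po_diff[OF E' h'(1) h] h'(2) by simp_all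
    then obtain q where q: "q \<in> polys_over E" "h' - h = m * q" by (rule min_poly_dvd[OF E m])
    have "map_poly \<sigma> h' - map_poly \<sigma> h = map_poly \<sigma> m * map_poly \<sigma> q"
      using rh_poly_diff[OF E' hom h'(1) h] rh_poly_mult[OF E' hom _ q(1), of m] m q(2) by (simp add: is_min_poly_def)
    then have "poly (map_poly \<sigma> h' - map_poly \<sigma> h) \<beta> = 0" using \<beta> by simp
    then show ?thesis unfolding \<sigma>'_def h'_def[symmetric] by simp
  qed
  have "\<sigma>' x = \<sigma> x" if "x \<in> E" for x
    using eval[OF po_const[OF E' that]] rh_poly_const[OF E' hom, of x] by simp
  moreover have "\<sigma>' \<theta> = \<beta>"
  proof -
    have "[:0, 1:] \<in> polys_over E" by (intro po_pCons[OF E'] po_zero[OF E'] sr_zero[OF E'] sr_one[OF E'])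
    moreover have "map_poly \<sigma> [:0, 1:] = [:0, 1:]"
      using rh_poly_linear[OF E' hom sr_zero[OF E']] rh_zero[OF E' hom] by simp
    ultimately show ?thesis using eval[of "[:0, 1:]"] by simp
  qed
  moreover have "ring_hom_on (adjoin E \<theta>) \<sigma>'"
  proof -
    have "\<sigma>' (x + y) = \<sigma>' x + \<sigma>' y \<and> \<sigma>' (x * y) = \<sigma>' x * \<sigma>' y"
      if xy: "x \<in> adjoin E \<theta>" "y \<in> adjoin E \<theta>" for x y
    proof -
      obtain p q where pq: "p \<in> polys_over E" "x = poly p \<theta>" "q \<in> polys_over E" "y = poly q \<theta>"
        using xy unfolding adjoin_def by blast
      have "x + y = poly (p + q) \<theta>" "x * y = poly (p * q) \<theta>" using pq by simp_all
      then show ?thesis using pq po_add[OF E' pq(1,3)] po_mult[OF E' pq(1,3)]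
        by (simp add: eval rh_poly_add[OF E' hom] rh_poly_mult[OF E' hom] del: poly_add poly_mult) simp
    qed
    moreover have "\<sigma>' 1 = 1" using eval[OF po_one[OF E']] rh_poly_one[OF E' hom] by simp
    ultimately show ?thesis by (simp add: ring_hom_on_def)
  qed
  ultimately show ?thesis using that eval by blast
qed

text \<open>A factor and its cofactor have at most as many roots as their degrees, and together all roots.\<close>

lemma card_roots_factor:
  assumes fin: "finite R" and eq: "p * q = (\<Prod>r\<in>R. [:-r, 1 :: 'a::field:])"
  shows "card {x. poly p x = 0} = degree p" "{x. poly p x = 0} \<subseteq> R"
proof -
  have nz: "p * q \<noteq> 0" unfolding eq using fin by simp
  then have p0: "p \<noteq> 0" and q0: "q \<noteq> 0" by auto
  have roots: "{x. poly (p * q) x = 0} = R" unfolding eq poly_prod using fin by (auto simp: prod_zero_iff)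
  have "degree (p * q) = card R" unfolding eq by (subst degree_prod_eq_sum_degree) simp_all
  then have "card {x. poly (p * q) x = 0} = degree p + degree q" using roots degree_mult_eq[OF p0 q0] by simp
  moreover have "{x. poly (p * q) x = 0} = {x. poly p x = 0} \<union> {x. poly q x = 0}" by auto
  then have "card {x. poly (p * q) x = 0} \<le> card {x. poly p x = 0} + card {x. poly q x = 0}"
    using card_Un_le[of "{x. poly p x = 0}" "{x. poly q x = 0}"] by simp
  moreover have "card {x. poly p x = 0} \<le> degree p" "card {x. poly q x = 0} \<le> degree q"
    using card_poly_roots_bound p0 q0 by blast+
  ultimately show "card {x. poly p x = 0} = degree p" by linarith
  show "{x. poly p x = 0} \<subseteq> R" using roots by auto
qed

section \<open>The Galois group of a splitting field\<close>

locale splitting_field =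
  fixes K L :: "'a::field_char_0 set" and f :: "'a poly" and R :: "'a set"
  assumes K: "subfield_set K" and f_over: "f \<in> polys_over K"
    and f_eq: "f = (\<Prod>r\<in>R. [:-r, 1:])" and fin_R: "finite R"
    and L: "subfield_set L" and K_L: "K \<subseteq> L" and R_L: "R \<subseteq> L"
    and L_least: "\<And>E. subfield_set E \<Longrightarrow> K \<subseteq> E \<Longrightarrow> R \<subseteq> E \<Longrightarrow> L \<subseteq> E"
begin

lemmas K' = subfield_imp_subring[OF K] and L' = subfield_imp_subring[OF L]

fun adjoins :: "'a set \<Rightarrow> 'a list \<Rightarrow> 'a set" where
  "adjoins E [] = E"
| "adjoins E (\<theta> # ts) = adjoins (adjoin E \<theta>) ts"

lemma f_nz: "f \<noteq> 0" using f_eq fin_R by simp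

lemma root_iff: "poly f x = 0 \<longleftrightarrow> x \<in> R"
  unfolding f_eq poly_prod using fin_R by (auto simp: prod_zero_iff)

lemma f_over_mono: "K \<subseteq> E \<Longrightarrow> f \<in> polys_over E" using f_over polys_over_mono by blast

lemma subfield_adjoin_root: "subfield_set E \<Longrightarrow> K \<subseteq> E \<Longrightarrow> r \<in> R \<Longrightarrow> subfield_set (adjoin E r)"
  by (rule subfield_adjoin[of E f]) (auto simp: f_over_mono f_nz root_iff)

lemma adjoins_props:
  "subfield_set E \<Longrightarrow> K \<subseteq> E \<Longrightarrow> set ts \<subseteq> R \<Longrightarrow>
    subfield_set (adjoins E ts) \<and> E \<subseteq> adjoins E ts \<and> set ts \<subseteq> adjoins E ts"
proof (induction ts arbitrary: E)
  case (Cons t ts)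
  note E' = subfield_imp_subring[OF Cons.prems(1)]
  have A: "subfield_set (adjoin E t)" "K \<subseteq> adjoin E t" "set ts \<subseteq> R"
    using subfield_adjoin_root[of E t] Cons.prems adjoin_contains[OF E', of t] by auto
  show ?case using Cons.IH[OF A] adjoin_contains[OF E', of t] by auto
qed simp

lemma adjoins_eq_L:
  assumes "subfield_set E" "K \<subseteq> E" "E \<subseteq> L" "set ts = R" shows "adjoins E ts = L"
proof
  have "adjoins E ts \<subseteq> L" if "E \<subseteq> L" "set ts \<subseteq> R" for E ts
    using that
  proof (induction ts arbitrary: E)
    case (Cons t ts)
    have "adjoin E t \<subseteq> L" using Cons.prems R_L by (intro adjoin_least[OF L']) auto
    then show ?case using Cons by simp
  qed simp
  then show "adjoins E ts \<subseteq> L" using assms by simp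
  show "L \<subseteq> adjoins E ts"
    using adjoins_props[OF assms(1,2), of ts] assms by (intro L_least) auto
qed

lemma hom_fixes_f: 
  assumes "subring_set E" "ring_hom_on E \<sigma>" "\<And>x. x \<in> K \<Longrightarrow> \<sigma> x = x" shows "map_poly \<sigma> f = f"
proof (rule poly_eqI)
  fix i
  have "coeff f i \<in> K" using f_over by (simp add: polys_over_iff[OF K'])
  then show "coeff (map_poly \<sigma> f) i = coeff f i" using assms(3) by (simp add: coeff_rh[OF assms(1,2)])
qed

text \<open>The minimal polynomial of a root over an intermediate field divides \<open>f\<close>, hence so does its image
  under a homomorphism that fixes \<open>K\<close>; so the image splits with distinct roots.\<close>

lemma min_poly_image:
  assumes E: "subfield_set E" "K \<subseteq> E" and hom: "ring_hom_on E \<sigma>" "\<And>x. x \<in> K \<Longrightarrow> \<sigma> x = x"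
    and r: "r \<in> R" and m: "is_min_poly E r m"
  shows "card {x. poly (map_poly \<sigma> m) x = 0} = degree m" "{x. poly (map_poly \<sigma> m) x = 0} \<subseteq> R"
proof -
  note E' = subfield_imp_subring[OF E(1)]
  have m': "m \<in> polys_over E" using m by (simp add: is_min_poly_def)
  have f0: "poly f r = 0" using r by (simp add: root_iff)
  obtain q where q: "q \<in> polys_over E" "f = m * q"
    by (rule min_poly_dvd[OF E(1) m f_over_mono[OF E(2)] f0])
  have "map_poly \<sigma> m * map_poly \<sigma> q = (\<Prod>r\<in>R. [:-r, 1:])"
    using rh_poly_mult[OF E' hom(1) m' q(1)] hom_fixes_f[OF E' hom] q(2) f_eq by simp
  note c = card_roots_factor[OF fin_R this]
  show "card {x. poly (map_poly \<sigma> m) x = 0} = degree m" using c(1) rh_degree[OF E(1) hom(1) m'] by simp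
  show "{x. poly (map_poly \<sigma> m) x = 0} \<subseteq> R" by (rule c(2))
qed

lemma extend_hom:
  assumes "subfield_set E" "K \<subseteq> E" "set ts \<subseteq> R" "ring_hom_on E \<sigma>" "\<And>x. x \<in> K \<Longrightarrow> \<sigma> x = x"
  shows "\<exists>\<sigma>'. ring_hom_on (adjoins E ts) \<sigma>' \<and> (\<forall>x\<in>E. \<sigma>' x = \<sigma> x)"
  using assms
proof (induction ts arbitrary: E \<sigma>)
  case Nil then show ?case by auto
next
  case (Cons t ts)
  note E' = subfield_imp_subring[OF Cons.prems(1)]
  have t: "t \<in> R" using Cons.prems by simp
  obtain m where m: "is_min_poly E t m"
    by (rule min_poly_exists[OF Cons.prems(1) f_over_mono[OF Cons.prems(2)] f_nz]) (use t in \<open>auto simp: root_iff\<close>)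
  have "card {x. poly (map_poly \<sigma> m) x = 0} \<noteq> 0"
    using min_poly_image(1)[OF Cons.prems(1,2,4,5) t m] min_poly_degree_pos[OF m] by simp
  then obtain \<beta> where \<beta>: "poly (map_poly \<sigma> m) \<beta> = 0" by (metis (mono_tags, lifting) Collect_empty_eq card.empty)
  obtain \<sigma>1 where s1: "ring_hom_on (adjoin E t) \<sigma>1" "\<And>x. x \<in> E \<Longrightarrow> \<sigma>1 x = \<sigma> x"
    by (rule extend_hom_adjoin[OF Cons.prems(1,4) m \<beta>]) blast
  have "K \<subseteq> adjoin E t" using Cons.prems(2) adjoin_contains(1)[OF E', of t] by blast
  moreover have "\<sigma>1 x = x" if "x \<in> K" for x using s1(2)[of x] Cons.prems(2,5) that by auto
  ultimately obtain \<sigma>' where "ring_hom_on (adjoins (adjoin E t) ts) \<sigma>'" "\<forall>x\<in>adjoin E t. \<sigma>' x = \<sigma>1 x"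
    using Cons.IH[OF subfield_adjoin_root[OF Cons.prems(1,2) t] _ _ s1(1)] Cons.prems(3) by auto
  then show ?case using s1(2) adjoin_contains(1)[OF E', of t] by (intro exI[of _ \<sigma>'] conjI ballI) auto
qed

text \<open>Extending the automorphisms by the identity outside \<open>L\<close> makes equality of automorphisms plain equality
  of functions.\<close>

definition Gal :: "('a \<Rightarrow> 'a) set" where
  "Gal = {\<sigma>. ring_hom_on L \<sigma> \<and> (\<forall>x\<in>K. \<sigma> x = x) \<and> (\<forall>x. x \<notin> L \<longrightarrow> \<sigma> x = x)}"

lemma Gal_hom: "\<sigma> \<in> Gal \<Longrightarrow> ring_hom_on L \<sigma>" and Gal_fix: "\<sigma> \<in> Gal \<Longrightarrow> x \<in> K \<Longrightarrow> \<sigma> x = x"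
  and Gal_outside: "\<sigma> \<in> Gal \<Longrightarrow> x \<notin> L \<Longrightarrow> \<sigma> x = x"
  by (auto simp: Gal_def)

lemma Gal_root: assumes "\<sigma> \<in> Gal" "r \<in> R" shows "\<sigma> r \<in> R"
proof -
  have "map_poly \<sigma> f = f" using hom_fixes_f[OF L' Gal_hom] Gal_fix assms by blast
  then have "poly f (\<sigma> r) = \<sigma> (poly f r)"
    using rh_poly_eval[OF L' Gal_hom[OF assms(1)] f_over_mono[OF K_L], of r] assms(2) R_L by auto
  also have "\<dots> = 0" using assms(2) root_iff[of r] rh_zero[OF L' Gal_hom[OF assms(1)]] by simp
  finally show ?thesis by (simp add: root_iff)
qed

lemma subfield_equalizer:
  assumes F: "subfield_set F" and E: "subfield_set E" and hom: "ring_hom_on F \<sigma>" "ring_hom_on F \<tau>" 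
  shows "subfield_set {x \<in> F. \<sigma> x = (\<tau> x :: 'a)}" "subfield_set {x \<in> F. \<sigma> x \<in> E}"
proof -
  note F' = subfield_imp_subring[OF F] and E' = subfield_imp_subring[OF E]
  show "subfield_set {x \<in> F. \<sigma> x = \<tau> x}"
    unfolding subfield_set_def subring_set_def
    by (auto simp: sr_closed[OF F'] sf_inverse[OF F] rh_one[OF F' hom(1)] rh_one[OF F' hom(2)] rh_diff[OF F' hom(1)]
      rh_diff[OF F' hom(2)] rh_mult[OF F' hom(1)] rh_mult[OF F' hom(2)] rh_inverse[OF F hom(1)] rh_inverse[OF F hom(2)])
  show "subfield_set {x \<in> F. \<sigma> x \<in> E}"
    unfolding subfield_set_def subring_set_def
    by (auto simp: sr_closed[OF F'] sf_inverse[OF F] rh_one[OF F' hom(1)] rh_diff[OF F' hom(1)]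
      rh_mult[OF F' hom(1)] rh_inverse[OF F hom(1)] sr_closed[OF E'] sf_inverse[OF E])
qed

lemma Gal_L: assumes "\<sigma> \<in> Gal" "x \<in> L" shows "\<sigma> x \<in> L"
proof -
  note hom = Gal_hom[OF assms(1)]
  have "L \<subseteq> {x \<in> L. \<sigma> x \<in> L}"
    by (rule L_least[OF subfield_equalizer(2)[OF L L hom hom]])
       (use K_L R_L Gal_fix[OF assms(1)] Gal_root[OF assms(1)] in auto)
  then show ?thesis using assms(2) by blast
qed

lemma Gal_eqI: assumes "\<sigma> \<in> Gal" "\<tau> \<in> Gal" "\<And>r. r \<in> R \<Longrightarrow> \<sigma> r = \<tau> r" shows "\<sigma> = \<tau>"
proof
  fix x
  have "L \<subseteq> {x \<in> L. \<sigma> x = \<tau> x}"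
    by (rule L_least[OF subfield_equalizer(1)[OF L L Gal_hom[OF assms(1)] Gal_hom[OF assms(2)]]])
       (use K_L R_L Gal_fix[OF assms(1)] Gal_fix[OF assms(2)] assms(3) in auto)
  then show "\<sigma> x = \<tau> x" using Gal_outside[OF assms(1)] Gal_outside[OF assms(2)] by (cases "x \<in> L") auto
qed

lemma finite_Gal: "finite Gal"
proof -
  have "inj_on (\<lambda>\<sigma>. restrict \<sigma> R) Gal"
  proof (rule inj_onI)
    fix \<sigma> \<tau> assume *: "\<sigma> \<in> Gal" "\<tau> \<in> Gal" "restrict \<sigma> R = restrict \<tau> R"
    have "\<sigma> r = \<tau> r" if "r \<in> R" for r using fun_cong[OF *(3), of r] that by simp
    then show "\<sigma> = \<tau>" by (rule Gal_eqI[OF *(1,2)])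
  qed
  moreover have "(\<lambda>\<sigma>. restrict \<sigma> R) ` Gal \<subseteq> R \<rightarrow>\<^sub>E R" using Gal_root by auto
  moreover have "finite (R \<rightarrow>\<^sub>E R)" using fin_R by (simp add: finite_PiE)
  ultimately show ?thesis using finite_subset finite_imageD by metis
qed

lemma id_Gal: "id \<in> Gal" by (auto simp: Gal_def ring_hom_on_def)

lemma comp_Gal: assumes "\<sigma> \<in> Gal" "\<tau> \<in> Gal" shows "\<sigma> \<circ> \<tau> \<in> Gal"
  using assms Gal_L[OF assms(2)] unfolding Gal_def ring_hom_on_def by auto

lemma Gal_inj: "\<sigma> \<in> Gal \<Longrightarrow> inj_on \<sigma> L" by (rule rh_inj[OF L Gal_hom])

lemma inv_Gal: assumes s: "\<sigma> \<in> Gal" obtains \<tau> where "\<tau> \<in> Gal" "\<tau> \<circ> \<sigma> = id" "\<sigma> \<circ> \<tau> = id"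
proof -
  have inj: "inj_on (\<lambda>\<tau>. \<sigma> \<circ> \<tau>) Gal"
  proof (rule inj_onI)
    fix \<tau> \<rho> assume *: "\<tau> \<in> Gal" "\<rho> \<in> Gal" "\<sigma> \<circ> \<tau> = \<sigma> \<circ> \<rho>"
    have "\<tau> r = \<rho> r" if r: "r \<in> R" for r
    proof (rule inj_onD[OF Gal_inj[OF s]])
      show "\<sigma> (\<tau> r) = \<sigma> (\<rho> r)" using fun_cong[OF *(3), of r] by simp
      show "\<tau> r \<in> L" "\<rho> r \<in> L" using Gal_L[OF *(1)] Gal_L[OF *(2)] r R_L by auto
    qed
    then show "\<tau> = \<rho>" by (rule Gal_eqI[OF *(1,2)])
  qed
  have "(\<lambda>\<tau>. \<sigma> \<circ> \<tau>) ` Gal = Gal"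
    by (rule endo_inj_surj[OF finite_Gal _ inj]) (use comp_Gal[OF s] in auto)
  then obtain \<tau> where t: "\<tau> \<in> Gal" "\<sigma> \<circ> \<tau> = id" using id_Gal by (metis imageE)
  have "\<tau> \<circ> \<sigma> = id"
  proof (rule inj_onD[OF inj])
    show "\<sigma> \<circ> (\<tau> \<circ> \<sigma>) = \<sigma> \<circ> id" using t(2) by (metis comp_assoc comp_id id_comp)
  qed (use t(1) s comp_Gal id_Gal in auto)
  then show ?thesis using that t by blast
qed

lemma hom_imp_Gal:
  assumes E: "subfield_set E" "K \<subseteq> E" "E \<subseteq> L" and hom: "ring_hom_on E \<tau>" "\<And>x. x \<in> K \<Longrightarrow> \<tau> x = x"
  obtains \<sigma> where "\<sigma> \<in> Gal" "\<And>x. x \<in> E \<Longrightarrow> \<sigma> x = \<tau> x"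
proof -
  obtain ts where ts: "set ts = R" using finite_list[OF fin_R] by blast
  obtain \<sigma> where \<sigma>: "ring_hom_on (adjoins E ts) \<sigma>" "\<forall>x\<in>E. \<sigma> x = \<tau> x"
    using extend_hom[OF E(1,2) _ hom, of ts] ts by auto
  have aL: "adjoins E ts = L" by (rule adjoins_eq_L[OF E ts])
  define \<sigma>' where "\<sigma>' x = (if x \<in> L then \<sigma> x else x)" for x
  have "ring_hom_on L \<sigma>'" using \<sigma>(1) unfolding aL ring_hom_on_def \<sigma>'_def
    by (auto simp: sr_one[OF L'] sr_add[OF L'] sr_mult[OF L'])
  moreover have ext: "\<sigma>' x = \<tau> x" if "x \<in> E" for x using \<sigma>(2) that E(3) by (auto simp: \<sigma>'_def)
  moreover have "\<sigma>' x = x" if "x \<in> K" for x using ext[of x] hom(2)[of x] E(2) that by auto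
  moreover have "\<sigma>' x = x" if "x \<notin> L" for x using that by (simp add: \<sigma>'_def)
  ultimately have "\<sigma>' \<in> Gal" by (simp add: Gal_def)
  then show ?thesis using that ext by blast
qed

text \<open>The fixed field of the Galois group is \<open>K\<close>: descending along a tower in which the roots are
  adjoined one by one, an invariant element is a polynomial in the last root that takes the same value at all
  conjugates of that root, hence a constant.\<close>

lemma fixed_in_base:
  assumes "subfield_set E" "K \<subseteq> E" "E \<subseteq> L" "set ts \<subseteq> R" "adjoins E ts = L" "x \<in> L"
    and invariant: "\<And>\<sigma>. \<sigma> \<in> Gal \<Longrightarrow> (\<And>y. y \<in> E \<Longrightarrow> \<sigma> y = y) \<Longrightarrow> \<sigma> x = x"
  shows "x \<in> E"
  using assms
proof (induction ts arbitrary: E)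
  case (Cons t ts)
  note E = Cons.prems(1) and E' = subfield_imp_subring[OF Cons.prems(1)]
  have t: "t \<in> R" using Cons.prems by simp
  have AL: "adjoin E t \<subseteq> L" using Cons.prems R_L by (intro adjoin_least[OF L']) auto
  have KA: "K \<subseteq> adjoin E t" using Cons.prems(2) adjoin_contains(1)[OF E', of t] by blast
  have A: "subfield_set (adjoin E t)" by (rule subfield_adjoin_root[OF Cons.prems(1,2) t])
  have "x \<in> adjoin E t"
  proof (rule Cons.IH[OF A KA AL])
    show "\<sigma> x = x" if "\<sigma> \<in> Gal" "\<And>y. y \<in> adjoin E t \<Longrightarrow> \<sigma> y = y" for \<sigma>
      using Cons.prems(7)[OF that(1)] that(2) adjoin_contains(1)[OF E', of t] by blast
  qed (use Cons.prems in auto)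
  obtain m where m: "is_min_poly E t m"
    by (rule min_poly_exists[OF E f_over_mono[OF Cons.prems(2)] f_nz]) (use t in \<open>auto simp: root_iff\<close>)
  obtain h where h: "h \<in> polys_over E" "x = poly h t" "h = 0 \<or> degree h < degree m"
    by (rule adjoin_low_degree[OF E' m \<open>x \<in> adjoin E t\<close>])
  have id: "ring_hom_on E (\<lambda>x. x)" by (simp add: ring_hom_on_def)
  have mid: "map_poly (\<lambda>x. x) p = p" for p :: "'a poly" by (simp add: map_poly_id')
  have val: "poly h \<beta> = x" if \<beta>: "poly m \<beta> = 0" for \<beta>
  proof -
    obtain \<tau> where \<tau>: "ring_hom_on (adjoin E t) \<tau>" "\<And>y. y \<in> E \<Longrightarrow> \<tau> y = y"
      "\<And>h. h \<in> polys_over E \<Longrightarrow> \<tau> (poly h t) = poly h \<beta>"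
      using extend_hom_adjoin[OF E id m, of \<beta>] \<beta> unfolding mid by blast
    obtain \<sigma> where \<sigma>: "\<sigma> \<in> Gal" "\<And>y. y \<in> adjoin E t \<Longrightarrow> \<sigma> y = \<tau> y"
      by (rule hom_imp_Gal[OF A KA AL \<tau>(1)]) (use \<tau>(2) Cons.prems(2) in auto)
    have "\<sigma> y = y" if "y \<in> E" for y using \<sigma>(2) \<tau>(2) that adjoin_contains(1)[OF E', of t] by auto
    then have "\<sigma> x = x" by (rule Cons.prems(7)[OF \<sigma>(1)])
    then show ?thesis using \<sigma>(2)[OF \<open>x \<in> adjoin E t\<close>] \<tau>(3)[OF h(1)] h(2) by simp
  qed
  have "h - [:x:] = 0"
  proof (rule ccontr)
    assume nz: "h - [:x:] \<noteq> 0"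
    have "card {y. poly m y = 0} \<le> card {y. poly (h - [:x:]) y = 0}"
      using val nz by (intro card_mono poly_roots_finite) auto
    also have "\<dots> \<le> degree (h - [:x:])" by (rule card_poly_roots_bound[OF nz])
    also have "\<dots> < degree m" using h(3) min_poly_degree_pos[OF m] by (intro degree_diff_less) auto
    also have "\<dots> = card {y. poly m y = 0}"
      using min_poly_image(1)[OF E Cons.prems(2) id _ t m] unfolding mid by simp
    finally show False by simp
  qed
  then have "x = coeff h 0" by simp
  then show ?case using h(1) by (simp add: polys_over_iff[OF E'])
qed simp

lemma fixed_imp_in_K:
  assumes "x \<in> L" "\<And>\<sigma>. \<sigma> \<in> Gal \<Longrightarrow> \<sigma> x = x" shows "x \<in> K"
proof -
  obtain ts where ts: "set ts = R" using finite_list[OF fin_R] by blast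
  show ?thesis
    by (rule fixed_in_base[OF K order_refl K_L _ adjoins_eq_L[OF K order_refl K_L ts] assms(1)])
       (use ts assms(2) in auto)
qed

lemma sum_Gal_fixed:
  assumes x: "x \<in> L" shows "(\<Sum>\<sigma>\<in>Gal. \<sigma> x) \<in> K" "(\<Prod>\<sigma>\<in>Gal. \<sigma> x) \<in> K"
proof -
  have reindex: "(\<lambda>\<tau>. \<sigma> \<circ> \<tau>) ` Gal = Gal" "inj_on (\<lambda>\<tau>. \<sigma> \<circ> \<tau>) Gal" if s: "\<sigma> \<in> Gal" for \<sigma>
  proof -
    obtain \<rho> where r: "\<rho> \<in> Gal" "\<rho> \<circ> \<sigma> = id" "\<sigma> \<circ> \<rho> = id" by (rule inv_Gal[OF s])
    show inj: "inj_on (\<lambda>\<tau>. \<sigma> \<circ> \<tau>) Gal"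
      by (rule inj_on_inverseI[of _ "\<lambda>\<tau>. \<rho> \<circ> \<tau>"]) (simp add: comp_assoc[symmetric] r(2))
    show "(\<lambda>\<tau>. \<sigma> \<circ> \<tau>) ` Gal = Gal"
      by (rule endo_inj_surj[OF finite_Gal _ inj]) (use comp_Gal[OF s] in auto)
  qed
  show "(\<Sum>\<sigma>\<in>Gal. \<sigma> x) \<in> K"
  proof (rule fixed_imp_in_K)
    show "(\<Sum>\<sigma>\<in>Gal. \<sigma> x) \<in> L" using Gal_L x by (intro sr_sum[OF L']) auto
    fix \<sigma> assume s: "\<sigma> \<in> Gal"
    have "\<sigma> (\<Sum>\<tau>\<in>Gal. \<tau> x) = (\<Sum>\<tau>\<in>Gal. \<sigma> (\<tau> x))" using Gal_L x by (intro rh_sum[OF L' Gal_hom[OF s]]) auto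
    also have "\<dots> = (\<Sum>\<tau>\<in>(\<lambda>\<tau>. \<sigma> \<circ> \<tau>) ` Gal. \<tau> x)" by (simp add: sum.reindex[OF reindex(2)[OF s]])
    finally show "\<sigma> (\<Sum>\<tau>\<in>Gal. \<tau> x) = (\<Sum>\<tau>\<in>Gal. \<tau> x)" unfolding reindex(1)[OF s] .
  qed
  show "(\<Prod>\<sigma>\<in>Gal. \<sigma> x) \<in> K"
  proof (rule fixed_imp_in_K)
    show "(\<Prod>\<sigma>\<in>Gal. \<sigma> x) \<in> L" using Gal_L x by (intro sr_prod[OF L']) auto
    fix \<sigma> assume s: "\<sigma> \<in> Gal"
    have "\<sigma> (\<Prod>\<tau>\<in>Gal. \<tau> x) = (\<Prod>\<tau>\<in>Gal. \<sigma> (\<tau> x))" using Gal_L x by (intro rh_prod[OF L' Gal_hom[OF s]]) auto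
    also have "\<dots> = (\<Prod>\<tau>\<in>(\<lambda>\<tau>. \<sigma> \<circ> \<tau>) ` Gal. \<tau> x)" by (simp add: prod.reindex[OF reindex(2)[OF s]])
    finally show "\<sigma> (\<Prod>\<tau>\<in>Gal. \<tau> x) = (\<Prod>\<tau>\<in>Gal. \<tau> x)" unfolding reindex(1)[OF s] .
  qed
qed

end

lemma subring_ambientD: "subring E (ambient :: 'a::field ring) \<Longrightarrow> subring_set E"
proof -
  assume s: "subring E (ambient :: 'a ring)"
  interpret A: field "ambient :: 'a ring" by rule
  have one: "1 \<in> E" using subringE(3)[OF s] by (simp add: ambient_simps)
  have mult: "x * y \<in> E" if "x \<in> E" "y \<in> E" for x y using subringE(6)[OF s that] by (simp add: ambient_simps)
  have add: "x + y \<in> E" if "x \<in> E" "y \<in> E" for x y using subringE(7)[OF s that] by (simp add: ambient_simps)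
  have neg: "- x \<in> E" if "x \<in> E" for x
  proof -
    have "\<ominus>\<^bsub>ambient\<^esub> x = - x" using A.minus_equality[of "- x" x] by (simp add: ambient_simps)
    then show ?thesis using subringE(5)[OF s that] by simp
  qed
  show ?thesis unfolding subring_set_def using one mult add neg by (metis diff_conv_add_uminus)
qed

lemma subfield_ambientD: assumes s: "subfield E (ambient :: 'a::field ring)" shows "subfield_set E"
proof -
  interpret A: field "ambient :: 'a ring" by rule
  have E: "subring_set E" by (rule subring_ambientD[OF subfieldE(1)[OF s]])
  have "inverse x \<in> E" if x: "x \<in> E" for x
  proof (cases "x = 0")
    case True then show ?thesis using x by simp
  next
    case False
    then have "x \<in> E - {\<zero>\<^bsub>ambient\<^esub>}" using x by (simp add: ambient_simps)
    then have "inv\<^bsub>ambient\<^esub> x \<in> E" "x * inv\<^bsub>ambient\<^esub> x = 1" 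
      using A.subfield_m_inv[OF s, of x] by (auto simp: ambient_simps)
    then show ?thesis using False by (metis inverse_unique)
  qed
  then show ?thesis using E by (simp add: subfield_set_def)
qed

lemma subfield_ambientI: assumes s: "subfield_set E" shows "subfield E (ambient :: 'a::field ring)"
proof -
  interpret A: field "ambient :: 'a ring" by rule
  note E' = subfield_imp_subring[OF s]
  have neg: "\<ominus>\<^bsub>ambient\<^esub> x = - x" for x :: 'a using A.minus_equality[of "- x" x] by (simp add: ambient_simps)
  have "subring E (ambient :: 'a ring)"
    by (rule A.subringI) (auto simp: ambient_simps neg sr_closed[OF E'])
  then show ?thesis
  proof (rule A.subfieldI')
    fix x assume "x \<in> E - {\<zero>\<^bsub>ambient\<^esub>}"
    then have x: "x \<in> E" "x \<noteq> 0" by (auto simp: ambient_simps)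
    have "inv\<^bsub>ambient\<^esub> x = inverse x" by (rule A.comm_inv_char) (use x in \<open>simp_all add: ambient_simps\<close>)
    then show "inv\<^bsub>ambient\<^esub> x \<in> E" using sf_inverse[OF s x(1)] by simp
  qed
qed

lemma generate_field_eq_least:
  fixes H :: "'a::field set"
  shows "subfield_set (generate_field ambient H)" "H \<subseteq> generate_field ambient H"
    "subfield_set E \<Longrightarrow> H \<subseteq> E \<Longrightarrow> generate_field ambient H \<subseteq> E"
proof -
  interpret A: field "ambient :: 'a ring" by rule
  show "subfield_set (generate_field ambient H)"
    by (rule subfield_ambientD, rule A.generate_field_is_subfield) (simp add: ambient_simps)
  show "H \<subseteq> generate_field ambient H" using A.generate_fieldE(2)[of H "generate_field ambient H"] by (simp add: ambient_simps)
  show "generate_field ambient H \<subseteq> E" if "subfield_set E" "H \<subseteq> E"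
    by (rule A.generate_field_min_subfield1) (use that subfield_ambientI in \<open>auto simp: ambient_simps\<close>)
qed

lemma ambient_combine:
  fixes Ks Us :: "'a::field list"
  shows "ring.combine ambient Ks Us = (\<Sum>i<min (length Ks) (length Us). Ks ! i * Us ! i)"
proof -
  interpret A: field "ambient :: 'a ring" by rule
  show ?thesis
  proof (induction Ks Us rule: A.combine.induct)
    case (1 k Ks u Us)
    then show ?case by (simp add: ambient_simps sum.lessThan_Suc_shift del: sum.lessThan_Suc)
  qed (simp_all add: ambient_simps)
qed

lemma interpolation:
  assumes E: "subfield_set E" and fin: "finite A" and A: "A \<subseteq> E" and v: "\<And>a. a \<in> A \<Longrightarrow> v a \<in> E"
  obtains p where "p \<in> polys_over E" "\<And>a. a \<in> A \<Longrightarrow> poly p a = v a" "p = 0 \<or> degree p < card A"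
proof -
  note E' = subfield_imp_subring[OF E]
  have "\<exists>p. p \<in> polys_over E \<and> (\<forall>a\<in>A. poly p a = v a) \<and> (p = 0 \<or> degree p < card A)"
    using fin A v
  proof (induction A rule: finite_induct)
    case empty then show ?case using po_zero[OF E'] by auto
  next
    case (insert b A)
    then obtain p where p: "p \<in> polys_over E" "\<forall>a\<in>A. poly p a = v a" "p = 0 \<or> degree p < card A" by auto
    define M where "M = (\<Prod>a\<in>A. [:-a, 1:])"
    have M: "M \<in> polys_over E" unfolding M_def using insert.prems by (intro po_prod[OF E'] po_linear[OF E']) auto
    have M0: "poly M a = 0" if "a \<in> A" for a unfolding M_def poly_prod using that insert.hyps by auto
    have Mb: "poly M b \<noteq> 0" unfolding M_def poly_prod using insert.hyps by auto
    have dM: "degree M = card A" unfolding M_def by (subst degree_prod_eq_sum_degree) simp_all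
    define c where "c = (v b - poly p b) / poly M b"
    have c: "c \<in> E" unfolding c_def
      using insert.prems p(1) M by (intro sf_divide[OF E] sr_diff[OF E'] poly_in[OF E']) auto
    let ?p = "p + smult c M"
    have "?p \<in> polys_over E" by (intro po_add[OF E'] po_smult[OF E'] p c M)
    moreover have "poly ?p a = v a" if "a \<in> insert b A" for a
    proof (cases "a = b")
      case True then show ?thesis using Mb by (simp add: c_def)
    next
      case False then show ?thesis using that M0[of a] p(2) by simp
    qed
    moreover have "?p = 0 \<or> degree ?p < card (insert b A)"
    proof -
      have "degree (smult c M) \<le> card A" using dM by (metis degree_smult_le)
      moreover have "degree p \<le> card A" using p(3) by auto
      ultimately have "degree ?p \<le> card A" by (rule degree_add_le[rotated])
      then show ?thesis using insert.hyps by simp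
    qed
    ultimately show ?case by blast
  qed
  then show ?thesis using that by blast
qed

context splitting_field
begin

text \<open>Different automorphisms agree on \<open>\<Sum> t\<^sup>i r\<^sub>i\<close>, where the \<open>r\<^sub>i\<close> are the roots, only for finitely many integers \<open>t\<close>.\<close>

lemma primitive_element: obtains \<gamma> where "\<gamma> \<in> L" "inj_on (\<lambda>\<sigma>. \<sigma> \<gamma>) Gal"
proof -
  obtain rs where rs: "set rs = R" using finite_list[OF fin_R] by blast
  let ?n = "length rs"
  define \<gamma> where "\<gamma> t = (\<Sum>i<?n. of_nat t ^ i * rs ! i)" for t
  have rsL: "rs ! i \<in> L" if "i < ?n" for i using that rs R_L nth_mem by blast
  have summand: "of_nat t ^ i * rs ! i \<in> L" if "i < ?n" for i t
    using rsL[OF that] by (intro sr_mult[OF L'] sr_power[OF L'] sr_of_nat[OF L'])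
  have \<gamma>L: "\<gamma> t \<in> L" for t unfolding \<gamma>_def using summand by (intro sr_sum[OF L']) auto
  have s\<gamma>: "\<sigma> (\<gamma> t) = (\<Sum>i<?n. of_nat t ^ i * \<sigma> (rs ! i))" if s: "\<sigma> \<in> Gal" for \<sigma> t
  proof -
    note hom = Gal_hom[OF s]
    have "\<sigma> (\<gamma> t) = (\<Sum>i<?n. \<sigma> (of_nat t ^ i * rs ! i))" unfolding \<gamma>_def using summand by (intro rh_sum[OF L' hom]) auto
    also have "\<dots> = (\<Sum>i<?n. of_nat t ^ i * \<sigma> (rs ! i))"
      by (rule sum.cong) (auto simp: rh_mult[OF L' hom] rh_power[OF L' hom] rh_of_nat[OF L' hom] sr_power[OF L'] sr_of_nat[OF L'] rsL)
    finally show ?thesis .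
  qed
  define q where "q \<sigma> \<tau> = (\<Sum>i<?n. monom (\<sigma> (rs ! i) - \<tau> (rs ! i)) i)" for \<sigma> \<tau> :: "'a \<Rightarrow> 'a"
  have evalq: "poly (q \<sigma> \<tau>) (of_nat t) = \<sigma> (\<gamma> t) - \<tau> (\<gamma> t)" if "\<sigma> \<in> Gal" "\<tau> \<in> Gal" for \<sigma> \<tau> t
    unfolding q_def s\<gamma>[OF that(1)] s\<gamma>[OF that(2)] poly_sum sum_subtractf[symmetric]
    by (rule sum.cong) (simp_all add: poly_monom algebra_simps)
  have q0: "q \<sigma> \<tau> \<noteq> 0" if st: "\<sigma> \<in> Gal" "\<tau> \<in> Gal" "\<sigma> \<noteq> \<tau>" for \<sigma> \<tau>
  proof -
    obtain r where r: "r \<in> R" "\<sigma> r \<noteq> \<tau> r" using Gal_eqI[OF st(1,2)] st(3) by blast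
    then obtain i where i: "i < ?n" "rs ! i = r" using rs by (metis in_set_conv_nth)
    have "coeff (q \<sigma> \<tau>) i = \<sigma> r - \<tau> r" unfolding q_def coeff_sum using i by simp
    then show ?thesis using r(2) by auto
  qed
  let ?bad = "\<Union>p\<in>{p \<in> Gal \<times> Gal. fst p \<noteq> snd p}. {t. poly (q (fst p) (snd p)) (of_nat t) = 0}"
  have bad: "finite ?bad"
  proof (rule finite_UN_I)
    show "finite {p \<in> Gal \<times> Gal. fst p \<noteq> snd p}" using finite_Gal by simp
    fix p assume "p \<in> {p \<in> Gal \<times> Gal. fst p \<noteq> snd p}"
    then have "q (fst p) (snd p) \<noteq> 0" using q0 by auto
    then have "finite {x. poly (q (fst p) (snd p)) x = 0}" by (rule poly_roots_finite)
    then have "finite (of_nat -` {x. poly (q (fst p) (snd p)) x = 0})"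
      by (rule finite_vimageI) (simp add: inj_of_nat)
    then show "finite {t. poly (q (fst p) (snd p)) (of_nat t) = 0}" by (simp add: vimage_def)
  qed
  obtain t where t: "t \<notin> ?bad" using ex_new_if_finite[OF infinite_UNIV_nat bad] by (elim exE)
  have "inj_on (\<lambda>\<sigma>. \<sigma> (\<gamma> t)) Gal"
  proof (rule inj_onI, rule ccontr)
    fix \<sigma> \<tau> assume st: "\<sigma> \<in> Gal" "\<tau> \<in> Gal" "\<sigma> (\<gamma> t) = \<tau> (\<gamma> t)" "\<sigma> \<noteq> \<tau>"
    then have "poly (q \<sigma> \<tau>) (of_nat t) = 0" using evalq[OF st(1,2), of t] by simp
    then show False using t st by auto
  qed
  then show ?thesis by (rule that[OF \<gamma>L])
qed

text \<open>The powers of a primitive element up to the order of the Galois group are a basis: independent, as a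
  relation would have all conjugates as roots; spanning, by interpolation through the conjugates.\<close>

theorem dim_eq_card_Gal: "ring.dim ambient K L = card Gal"
proof -
  interpret A: field "ambient :: 'a ring" by rule
  obtain \<gamma> where \<gamma>: "\<gamma> \<in> L" "inj_on (\<lambda>\<sigma>. \<sigma> \<gamma>) Gal" by (rule primitive_element)
  let ?n = "card Gal" and ?C = "(\<lambda>\<sigma>. \<sigma> \<gamma>) ` Gal"
  have cardC: "card ?C = ?n" by (rule card_image[OF \<gamma>(2)])
  have CL: "?C \<subseteq> L" using Gal_L \<gamma>(1) by auto
  have conj: "poly p (\<sigma> \<gamma>) = \<sigma> (poly p \<gamma>)" if p: "p \<in> polys_over K" and s: "\<sigma> \<in> Gal" for p \<sigma>
  proof -
    have pL: "p \<in> polys_over L" using p polys_over_mono[OF K_L] by blast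
    have "map_poly \<sigma> p = p"
      using p Gal_fix[OF s] by (intro poly_eqI) (simp add: coeff_rh[OF L' Gal_hom[OF s]] polys_over_iff[OF K'])
    then show ?thesis using rh_poly_eval[OF L' Gal_hom[OF s] pL \<gamma>(1)] by simp
  qed
  have vanish: "p = 0" if "p = 0 \<or> degree p < ?n" "\<And>x. x \<in> ?C \<Longrightarrow> poly p x = 0" for p :: "'a poly"
  proof (rule ccontr)
    assume nz: "p \<noteq> 0"
    have "card ?C \<le> card {x. poly p x = 0}" using that(2) nz by (intro card_mono poly_roots_finite) auto
    also have "\<dots> \<le> degree p" by (rule card_poly_roots_bound[OF nz])
    finally show False using that(1) nz cardC by simp
  qed
  define Us where "Us = map (\<lambda>i. \<gamma> ^ i) [0..<?n]"
  have len: "length Us = ?n" by (simp add: Us_def)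
  have comb: "ring.combine ambient Ks Us = poly (\<Sum>i<min (length Ks) ?n. monom (Ks ! i) i) \<gamma>" for Ks :: "'a list"
    unfolding ambient_combine len poly_sum by (rule sum.cong) (auto simp: Us_def poly_monom)
  have pK: "(\<Sum>i<min (length Ks) ?n. monom (Ks ! i) i) \<in> polys_over K" if "set Ks \<subseteq> K" for Ks
    using that nth_mem by (intro po_sum[OF K'] po_monom[OF K']) fastforce
  have cf: "coeff (\<Sum>i<N. monom (h i) i) j = (if j < N then h j else 0)" for N :: nat and h :: "nat \<Rightarrow> 'a" and j
    unfolding coeff_sum by simp
  have deg: "(\<Sum>i<min (length Ks) ?n. monom (Ks ! i) i) = 0 \<or> degree (\<Sum>i<min (length Ks) ?n. monom (Ks ! i) i) < ?n" for Ks :: "'a list"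
  proof (cases "?n = 0")
    case False
    have "degree (\<Sum>i<min (length Ks) ?n. monom (Ks ! i) i) < ?n"
      by (rule degree_lessI) (use False in \<open>simp_all add: cf\<close>)
    then show ?thesis ..
  qed simp
  have "A.independent K Us"
  proof (rule A.trivial_combine_imp_independent[OF subfield_ambientI[OF K]])
    show "set Us \<subseteq> carrier ambient" by (simp add: ambient_simps)
    fix Ks assume Ks: "set Ks \<subseteq> K" "A.combine Ks Us = \<zero>\<^bsub>ambient\<^esub>"
    let ?p = "\<Sum>i<min (length Ks) ?n. monom (Ks ! i) i"
    have "poly ?p \<gamma> = 0" using Ks(2) unfolding comb ambient_simps .
    then have "poly ?p (\<sigma> \<gamma>) = 0" if "\<sigma> \<in> Gal" for \<sigma>
      using conj[OF pK[OF Ks(1)] that] rh_zero[OF L' Gal_hom[OF that]] by simp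
    then have p0: "?p = 0" using vanish[OF deg] by blast
    show "set (take (length Us) Ks) \<subseteq> {\<zero>\<^bsub>ambient\<^esub>}"
    proof
      fix c assume "c \<in> set (take (length Us) Ks)"
      then obtain i where i: "i < length Ks" "i < ?n" "c = Ks ! i" unfolding len by (auto simp: in_set_conv_nth)
      then have "c = coeff ?p i" by (simp add: cf)
      then show "c \<in> {\<zero>\<^bsub>ambient\<^esub>}" using p0 by (simp add: ambient_simps)
    qed
  qed
  moreover have "A.Span K Us = L"
  proof -
    have "A.Span K Us = {A.combine Ks Us | Ks. length Ks = length Us \<and> set Ks \<subseteq> K}"
      by (rule A.Span_eq_combine_set_length_version[OF subfield_ambientI[OF K]]) (simp add: ambient_simps)
    also have "\<dots> = L"
    proof (intro equalityI subsetI)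
      fix x assume "x \<in> {A.combine Ks Us | Ks. length Ks = length Us \<and> set Ks \<subseteq> K}"
      then obtain Ks where "set Ks \<subseteq> K" "x = A.combine Ks Us" by blast
      then show "x \<in> L" using poly_in[OF L' _ \<gamma>(1)] pK[of Ks] polys_over_mono[OF K_L] unfolding comb by blast
    next
      fix x assume x: "x \<in> L"
      have vL: "(inv_into Gal (\<lambda>\<sigma>. \<sigma> \<gamma>) a) x \<in> L" if "a \<in> ?C" for a
        by (rule Gal_L[OF inv_into_into[OF that] x])
      obtain p where p: "p \<in> polys_over L" "\<And>a. a \<in> ?C \<Longrightarrow> poly p a = (inv_into Gal (\<lambda>\<sigma>. \<sigma> \<gamma>) a) x" "p = 0 \<or> degree p < card ?C"
        by (rule interpolation[OF L finite_imageI[OF finite_Gal] CL vL]) (assumption, rule that, assumption+)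
      have val: "poly p (\<sigma> \<gamma>) = \<sigma> x" if "\<sigma> \<in> Gal" for \<sigma>
        using p(2)[of "\<sigma> \<gamma>"] that inv_into_f_f[OF \<gamma>(2) that] by auto
      have "p \<in> polys_over K"
      proof (unfold polys_over_iff[OF K'], intro allI fixed_imp_in_K)
        fix i show "coeff p i \<in> L" using p(1) by (simp add: polys_over_iff[OF L'])
        fix \<sigma> assume s: "\<sigma> \<in> Gal"
        obtain \<rho> where r: "\<rho> \<in> Gal" "\<rho> \<circ> \<sigma> = id" "\<sigma> \<circ> \<rho> = id" by (rule inv_Gal[OF s])
        have "map_poly \<sigma> p - p = 0"
        proof (rule vanish)
          have "degree (map_poly \<sigma> p) = degree p" by (rule rh_degree[OF L Gal_hom[OF s] p(1)])
          then show "map_poly \<sigma> p - p = 0 \<or> degree (map_poly \<sigma> p - p) < ?n"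
            using p(3) degree_diff_less[of "map_poly \<sigma> p" ?n p] unfolding cardC by (cases "p = 0") auto
          fix y assume "y \<in> ?C"
          then obtain \<tau> where t: "\<tau> \<in> Gal" "y = \<tau> \<gamma>" by blast
          have rt: "\<rho> \<circ> \<tau> \<in> Gal" by (rule comp_Gal[OF r(1) t(1)])
          have srt: "\<sigma> ((\<rho> \<circ> \<tau>) z) = \<tau> z" for z using fun_cong[OF r(3), of "\<tau> z"] by simp
          have "poly (map_poly \<sigma> p) (\<sigma> ((\<rho> \<circ> \<tau>) \<gamma>)) = \<sigma> (poly p ((\<rho> \<circ> \<tau>) \<gamma>))"
            by (rule rh_poly_eval[OF L' Gal_hom[OF s] p(1) Gal_L[OF rt \<gamma>(1)]])
          then have "poly (map_poly \<sigma> p) y = \<tau> x" unfolding srt val[OF rt] t(2) .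
          then show "poly (map_poly \<sigma> p - p) y = 0" using val[OF t(1)] t(2) by simp
        qed
        then have "map_poly \<sigma> p = p" by simp
        then show "\<sigma> (coeff p i) = coeff p i" using coeff_rh[OF L' Gal_hom[OF s], of p i] by simp
      qed
      define Ks where "Ks = map (coeff p) [0..<?n]"
      have pn: "(\<Sum>i<min (length Ks) ?n. monom (Ks ! i) i) = p"
      proof (rule poly_eqI)
        fix j
        have "coeff p j = 0" if "j \<ge> ?n" using p(3) that cardC by (auto intro: coeff_eq_0)
        then show "coeff (\<Sum>i<min (length Ks) ?n. monom (Ks ! i) i) j = coeff p j" unfolding cf by (auto simp: Ks_def)
      qed
      have "poly p \<gamma> = x" using val[OF id_Gal] by simp
      then have "x = A.combine Ks Us" unfolding comb pn ..
      moreover have "length Ks = length Us" by (simp add: Ks_def len)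
      moreover have "set Ks \<subseteq> K" using \<open>p \<in> polys_over K\<close> by (auto simp: Ks_def polys_over_iff[OF K'])
      ultimately show "x \<in> {A.combine Ks Us | Ks. length Ks = length Us \<and> set Ks \<subseteq> K}" by blast
    qed
    finally show ?thesis .
  qed
  ultimately have "A.dimension (length Us) K L" by (rule A.dimensionI[OF subfield_ambientI[OF K]])
  then have "(A.dim over K) L = length Us" by (rule A.dimI[OF subfield_ambientI[OF K]])
  then show ?thesis by (simp add: over_def len)
qed

end

section \<open>Algebraic integers form an integrally closed ring\<close>

definition zspan :: "'a::field_char_0 set \<Rightarrow> 'a set" where
  "zspan V = range (\<lambda>c. \<Sum>v\<in>V. of_int (c v) * v)"

text \<open>An element that multiplies a nonzero finitely generated group into itself is an eigenvalue of an
  integer matrix, hence a root of its monic characteristic polynomial.\<close>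

lemma zstabilizer_imp_algebraic_int:
  fixes x :: "'a::field_char_0"
  assumes fin: "finite V" and v0: "v0 \<in> V" "v0 \<noteq> 0" and stab: "\<And>v. v \<in> V \<Longrightarrow> x * v \<in> zspan V"
  shows "algebraic_int x"
proof -
  obtain vs where vs: "set vs = V" "distinct vs" using finite_distinct_list[OF fin] by blast
  let ?n = "length vs"
  have "\<exists>c. x * v = (\<Sum>w\<in>V. of_int (c w) * w)" if "v \<in> V" for v using stab[OF that] by (auto simp: zspan_def)
  then obtain c where c: "\<And>v. v \<in> V \<Longrightarrow> x * v = (\<Sum>w\<in>V. of_int (c v w) * w)" by metis
  define A where "A = mat ?n ?n (\<lambda>(i, j). c (vs ! i) (vs ! j) :: int)"
  have A: "A \<in> carrier_mat ?n ?n" by (simp add: A_def)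
  define u where "u = vec ?n (\<lambda>i. vs ! i)"
  have "map_mat of_int A *\<^sub>v u = x \<cdot>\<^sub>v u"
  proof (rule eq_vecI)
    show "dim_vec (map_mat of_int A *\<^sub>v u) = dim_vec (x \<cdot>\<^sub>v u)" by (simp add: A_def u_def)
    fix i assume "i < dim_vec (x \<cdot>\<^sub>v u)"
    then have i: "i < ?n" by (simp add: u_def)
    then have "vs ! i \<in> V" using vs nth_mem by blast
    then have "x * vs ! i = (\<Sum>w\<in>set vs. of_int (c (vs ! i) w) * w)" using c vs by simp
    also have "\<dots> = (\<Sum>j<?n. of_int (c (vs ! i) (vs ! j)) * vs ! j)"
      using sum.reindex_bij_betw[OF bij_betw_nth[OF vs(2) refl refl], of "\<lambda>w. of_int (c (vs ! i) w) * w"] by simp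
    also have "\<dots> = (map_mat of_int A *\<^sub>v u) $ i"
      using i by (simp add: A_def u_def scalar_prod_def atLeast0LessThan)
    finally show "(map_mat of_int A *\<^sub>v u) $ i = (x \<cdot>\<^sub>v u) $ i" using i by (simp add: u_def)
  qed
  moreover have "u \<noteq> 0\<^sub>v ?n"
  proof
    assume u0: "u = 0\<^sub>v ?n"
    obtain i where i: "i < ?n" "vs ! i = v0" using v0(1) vs by (metis in_set_conv_nth)
    then have "v0 = u $ i" by (simp add: u_def)
    then show False using u0 i v0(2) by simp
  qed
  ultimately have "eigenvalue (map_mat of_int A) x"
    unfolding eigenvalue_def eigenvector_def by (intro exI[of _ u]) (simp add: A_def u_def)
  then have "poly (char_poly (map_mat of_int A)) x = 0"
    using eigenvalue_root_char_poly[of "map_mat of_int A" ?n x] A by simp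
  then have "poly (map_poly of_int (char_poly A)) x = 0" using of_int_hom.char_poly_hom[OF A] by metis
  moreover have "lead_coeff (char_poly A) = 1" using degree_monic_char_poly[OF A] by simp
  ultimately show ?thesis unfolding algebraic_int_altdef_ipoly by blast
qed

lemma zspanI: "x = (\<Sum>v\<in>V. of_int (c v) * v) \<Longrightarrow> x \<in> zspan V"
  unfolding zspan_def by blast

lemma zspan_superset: assumes "finite V" "v \<in> V" shows "v \<in> zspan V"
proof -
  have "v = (\<Sum>w\<in>V. of_int (if w = v then 1 else 0) * w)" using assms by (simp add: if_distrib[of "\<lambda>c. c * _"] if_distrib[of of_int] cong: if_cong)
  then show ?thesis by (rule zspanI)
qed

lemma zspan_add: assumes "x \<in> zspan V" "y \<in> zspan V" shows "x + y \<in> zspan V"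
proof -
  obtain c d where "x = (\<Sum>v\<in>V. of_int (c v) * v)" "y = (\<Sum>v\<in>V. of_int (d v) * v)" using assms by (auto simp: zspan_def)
  then have "x + y = (\<Sum>v\<in>V. of_int (c v + d v) * v)" by (simp add: sum.distrib algebra_simps)
  then show ?thesis by (rule zspanI)
qed

lemma zspan_int_mult: assumes "x \<in> zspan V" shows "of_int n * x \<in> zspan V"
proof -
  obtain c where "x = (\<Sum>v\<in>V. of_int (c v) * v)" using assms by (auto simp: zspan_def)
  then have "of_int n * x = (\<Sum>v\<in>V. of_int (n * c v) * v)" by (simp add: sum_distrib_left algebra_simps)
  then show ?thesis by (rule zspanI)
qed

lemma zspan_zero: "0 \<in> zspan V"
  unfolding zspan_def by (rule range_eqI[of _ _ "\<lambda>_. 0"]) simp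

lemma zspan_sum: "(\<And>i. i \<in> I \<Longrightarrow> h i \<in> zspan V) \<Longrightarrow> sum h I \<in> zspan V"
  by (induction I rule: infinite_finite_induct) (auto intro: zspan_zero zspan_add)

lemma zspan_uminus: "x \<in> zspan V \<Longrightarrow> - x \<in> zspan V"
  using zspan_int_mult[of x V "-1"] by simp

lemma zspan_mult_subset:
  assumes "\<And>v. v \<in> V \<Longrightarrow> y * v \<in> zspan W" "x \<in> zspan V" shows "y * x \<in> zspan W"
proof -
  obtain c where "x = (\<Sum>v\<in>V. of_int (c v) * v)" using assms by (auto simp: zspan_def)
  then have "y * x = (\<Sum>v\<in>V. of_int (c v) * (y * v))" by (simp add: sum_distrib_left mult.left_commute)
  then show ?thesis using assms by (auto intro!: zspan_sum zspan_int_mult)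
qed

definition zstabilizer :: "'a::field_char_0 set \<Rightarrow> 'a set" where
  "zstabilizer V = {x. \<forall>v\<in>zspan V. x * v \<in> zspan V}"

lemma zstabilizer_iff: "finite V \<Longrightarrow> x \<in> zstabilizer V \<longleftrightarrow> (\<forall>v\<in>V. x * v \<in> zspan V)"
proof
  assume V: "finite V" and "x \<in> zstabilizer V"
  then show "\<forall>v\<in>V. x * v \<in> zspan V" using zspan_superset[OF V] by (simp add: zstabilizer_def)
next
  assume "\<forall>v\<in>V. x * v \<in> zspan V"
  then show "x \<in> zstabilizer V" using zspan_mult_subset[of V x V] by (simp add: zstabilizer_def)
qed

lemma zstabilizer_ring:
  "of_int n \<in> zstabilizer V"
  "x \<in> zstabilizer V \<Longrightarrow> y \<in> zstabilizer V \<Longrightarrow> x + y \<in> zstabilizer V"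
  "x \<in> zstabilizer V \<Longrightarrow> y \<in> zstabilizer V \<Longrightarrow> x * y \<in> zstabilizer V"
  by (simp_all add: zstabilizer_def zspan_int_mult distrib_right zspan_add mult.assoc)

text \<open>\<open>W\<close> consists of the products of elements of \<open>V\<close> with the powers of \<open>\<theta>\<close> below the degree of its equation.\<close>

lemma zstabilizer_extend:
  fixes \<theta> :: "'a::field_char_0"
  assumes fin: "finite V" "1 \<in> V" and p: "lead_coeff p = 1" "poly p \<theta> = 0" "\<And>i. coeff p i \<in> zstabilizer V"
  obtains W where "finite W" "1 \<in> W" "\<theta> \<in> zstabilizer W" "zstabilizer V \<subseteq> zstabilizer W"
proof -
  let ?d = "degree p"
  define W where "W = (\<lambda>(k, v). \<theta> ^ k * v) ` ({..<?d} \<times> V)"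
  have d: "?d > 0"
  proof (rule ccontr)
    assume "\<not> ?d > 0"
    then have "p = [:1:]" using p(1) by (metis degree_eq_zeroE gr0I lead_coeff_pCons(2))
    then show False using p(2) by simp
  qed
  have finW: "finite W" using fin by (simp add: W_def)
  have memW: "\<theta> ^ k * v \<in> zspan W" if "k < ?d" "v \<in> zspan V" for k v
  proof (rule zspan_mult_subset[OF _ that(2)])
    fix w assume "w \<in> V"
    then have "\<theta> ^ k * w \<in> W" unfolding W_def using that(1) by (intro image_eqI[of _ _ "(k, w)"]) auto
    then show "\<theta> ^ k * w \<in> zspan W" by (rule zspan_superset[OF finW])
  qed
  have "y \<in> zstabilizer W" if y: "y \<in> zstabilizer V" for y
    unfolding zstabilizer_iff[OF finW]
  proof
    fix w assume "w \<in> W"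
    then obtain k v where kv: "k < ?d" "v \<in> V" "w = \<theta> ^ k * v" by (auto simp: W_def)
    have "y * v \<in> zspan V" using y kv(2) by (simp add: zstabilizer_iff[OF fin(1)])
    then have "\<theta> ^ k * (y * v) \<in> zspan W" by (rule memW[OF kv(1)])
    then show "y * w \<in> zspan W" unfolding kv(3) by (simp add: mult.left_commute)
  qed
  moreover have "\<theta> \<in> zstabilizer W"
    unfolding zstabilizer_iff[OF finW]
  proof
    fix w assume "w \<in> W"
    then obtain k v where kv: "k < ?d" "v \<in> V" "w = \<theta> ^ k * v" by (auto simp: W_def)
    have v: "v \<in> zspan V" by (rule zspan_superset[OF fin(1) kv(2)])
    have eq: "\<theta> * w = \<theta> ^ Suc k * v" unfolding kv(3) by (simp add: mult.assoc)
    show "\<theta> * w \<in> zspan W"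
    proof (cases "Suc k < ?d")
      case True then show ?thesis unfolding eq by (rule memW[OF _ v])
    next
      case False
      then have k: "Suc k = ?d" using kv(1) by simp
      have "0 = (\<Sum>i\<le>?d. coeff p i * \<theta> ^ i)" using p(2) by (simp add: poly_altdef)
      also have "{..?d} = insert ?d {..<?d}" by auto
      finally have "\<theta> ^ ?d = - (\<Sum>i<?d. coeff p i * \<theta> ^ i)" using p(1) by (simp add: eq_neg_iff_add_eq_0)
      then have "\<theta> * w = - (\<Sum>i<?d. \<theta> ^ i * (coeff p i * v))"
        unfolding eq k by (simp add: sum_distrib_left sum_distrib_right mult_ac)
      moreover have "(\<Sum>i<?d. \<theta> ^ i * (coeff p i * v)) \<in> zspan W"
        using p(3) v by (intro zspan_sum memW) (auto simp: zstabilizer_def)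
      ultimately show ?thesis by (simp add: zspan_uminus)
    qed
  qed
  moreover have "1 \<in> W" unfolding W_def using d fin(2) by (intro image_eqI[of _ _ "(0, 1)"]) auto
  ultimately show ?thesis using that finW by blast
qed

lemma algebraic_ints_stabilize:
  assumes "finite C" "\<And>c. c \<in> C \<Longrightarrow> algebraic_int c"
  shows "\<exists>V. finite V \<and> 1 \<in> V \<and> C \<subseteq> zstabilizer (V :: 'a::field_char_0 set)"
  using assms
proof (induction C rule: finite_induct)
  case empty then show ?case by (intro exI[of _ "{1}"]) auto
next
  case (insert c C)
  then obtain V :: "'a set" where V: "finite V" "1 \<in> V" "C \<subseteq> zstabilizer V" by auto
  obtain p where p: "poly (map_poly of_int p) c = 0" "lead_coeff p = 1"
    using insert.prems[of c] by (auto simp: algebraic_int_altdef_ipoly)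
  have "degree (map_poly of_int p :: 'a poly) = degree p" by (rule degree_map_poly) simp
  then have "lead_coeff (map_poly of_int p :: 'a poly) = 1" using p(2) by (simp add: coeff_map_poly)
  then obtain W where "finite W" "1 \<in> W" "c \<in> zstabilizer W" "zstabilizer V \<subseteq> zstabilizer W"
    by (rule zstabilizer_extend[OF V(1,2) _ p(1)]) (simp add: coeff_map_poly zstabilizer_ring)
  then show ?case using V(3) by blast
qed

lemma zstabilizer_algebraic_int: "finite V \<Longrightarrow> 1 \<in> V \<Longrightarrow> x \<in> zstabilizer V \<Longrightarrow> algebraic_int x"
  by (rule zstabilizer_imp_algebraic_int[of V 1]) (auto simp: zstabilizer_iff)

lemma
  fixes x y :: "'a::field_char_0"
  assumes "algebraic_int x" "algebraic_int y"
  shows algebraic_int_plus: "algebraic_int (x + y)" and algebraic_int_times: "algebraic_int (x * y)"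
proof -
  obtain V :: "'a set" where V: "finite V" "1 \<in> V" "{x, y} \<subseteq> zstabilizer V"
    using algebraic_ints_stabilize[of "{x, y}"] assms by auto
  then show "algebraic_int (x + y)" "algebraic_int (x * y)"
    using zstabilizer_algebraic_int[OF V(1,2)] zstabilizer_ring(2,3)[of x V y] by auto
qed

lemma algebraic_int_integrally_closed:
  fixes x :: "'a::field_char_0"
  assumes p: "lead_coeff p = 1" "poly p x = 0" "\<And>i. algebraic_int (coeff p i)"
  shows "algebraic_int x"
proof -
  obtain V :: "'a set" where V: "finite V" "1 \<in> V" "set (coeffs p) \<subseteq> zstabilizer V"
  proof -
    have "algebraic_int c" if "c \<in> set (coeffs p)" for c using that p(3) by (auto simp: coeffs_def split: if_splits)
    then show ?thesis using algebraic_ints_stabilize[of "set (coeffs p)"] that by blast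
  qed
  have "coeff p i \<in> zstabilizer V" for i
  proof (cases "i \<le> degree p")
    case True
    have "p \<noteq> 0" using p(1) by auto
    then show ?thesis using V(3) coeff_in_coeffs[of p i] True by blast
  next
    case False then show ?thesis using zstabilizer_ring(1)[of 0 V] by (simp add: coeff_eq_0)
  qed
  then obtain W where W: "finite W" "1 \<in> W" "x \<in> zstabilizer W"
    by (rule zstabilizer_extend[OF V(1,2) p(1,2)])
  then show ?thesis by (rule zstabilizer_algebraic_int)
qed

section \<open>Ideals in rings of algebraic integers\<close>

definition ideal_set :: "'a::comm_ring_1 set \<Rightarrow> 'a set \<Rightarrow> bool" where
  "ideal_set S I \<longleftrightarrow> I \<subseteq> S \<and> 0 \<in> I \<and> (\<forall>x\<in>I. \<forall>y\<in>I. x + y \<in> I) \<and> (\<forall>s\<in>S. \<forall>x\<in>I. s * x \<in> I)"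

definition prime_set :: "'a::comm_ring_1 set \<Rightarrow> 'a set \<Rightarrow> bool" where
  "prime_set S P \<longleftrightarrow> ideal_set S P \<and> 1 \<notin> P \<and> (\<forall>a\<in>S. \<forall>b\<in>S. a * b \<in> P \<longrightarrow> a \<in> P \<or> b \<in> P)"

definition maximal_set :: "'a::comm_ring_1 set \<Rightarrow> 'a set \<Rightarrow> bool" where
  "maximal_set S P \<longleftrightarrow> ideal_set S P \<and> 1 \<notin> P \<and> (\<forall>x\<in>S. x \<notin> P \<longrightarrow> (\<exists>y\<in>S. x * y - 1 \<in> P))"

context
  fixes S I :: "'a::field set"
  assumes S: "subring_set S" and I: "ideal_set S I"
begin

lemma id_subset: "x \<in> I \<Longrightarrow> x \<in> S" and id_zero: "0 \<in> I"
  and id_add: "x \<in> I \<Longrightarrow> y \<in> I \<Longrightarrow> x + y \<in> I" and id_mult: "s \<in> S \<Longrightarrow> x \<in> I \<Longrightarrow> s * x \<in> I"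
  using I unfolding ideal_set_def by blast+

lemma id_mult': "s \<in> S \<Longrightarrow> x \<in> I \<Longrightarrow> x * s \<in> I" using id_mult by (simp add: mult.commute)

lemma id_uminus: "x \<in> I \<Longrightarrow> - x \<in> I" using id_mult[of "-1" x] sr_uminus[OF S sr_one[OF S]] by simp

lemma id_diff: "x \<in> I \<Longrightarrow> y \<in> I \<Longrightarrow> x - y \<in> I" using id_add[of x "- y"] id_uminus[of y] by simp

lemma id_diff_commute: "x - y \<in> I \<longleftrightarrow> y - x \<in> I" using id_uminus[of "x - y"] id_uminus[of "y - x"] by auto

lemma id_sum: "(\<And>i. i \<in> A \<Longrightarrow> h i \<in> I) \<Longrightarrow> sum h A \<in> I"
  by (induction A rule: infinite_finite_induct) (auto intro: id_zero id_add)

lemma id_prod_mem: "finite A \<Longrightarrow> a \<in> A \<Longrightarrow> h a \<in> I \<Longrightarrow> (\<And>i. i \<in> A \<Longrightarrow> h i \<in> S) \<Longrightarrow> prod h A \<in> I"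
  by (subst prod.remove[of A a]) (auto intro!: id_mult' sr_prod[OF S])

lemma id_mult_cong:
  assumes "x \<in> S" "y' \<in> S" "x - x' \<in> I" "y - y' \<in> I" shows "x * y - x' * y' \<in> I"
proof -
  have "x * (y - y') + y' * (x - x') \<in> I" using assms by (intro id_add id_mult)
  then show ?thesis by (simp add: algebra_simps)
qed

lemma id_prod_cong:
  assumes "finite A" "\<And>i. i \<in> A \<Longrightarrow> h i \<in> S" "\<And>i. i \<in> A \<Longrightarrow> h' i \<in> S" "\<And>i. i \<in> A \<Longrightarrow> h i - h' i \<in> I"
  shows "prod h A - prod h' A \<in> I"
  using assms
proof (induction A rule: finite_induct)
  case (insert a A)
  then show ?case by (simp, intro id_mult_cong sr_prod[OF S]) auto
qed (simp add: id_zero)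

definition ipoly :: "'a poly \<Rightarrow> bool" where "ipoly q \<longleftrightarrow> (\<forall>i. coeff q i \<in> I)"

lemma ipoly_add: "ipoly p \<Longrightarrow> ipoly q \<Longrightarrow> ipoly (p + q)" by (simp add: ipoly_def id_add)

lemma ipoly_mult: "p \<in> polys_over S \<Longrightarrow> ipoly q \<Longrightarrow> ipoly (p * q)"
  unfolding ipoly_def coeff_mult polys_over_iff[OF S] by (intro allI id_sum id_mult) auto

lemma ipoly_mult_cong:
  assumes "p \<in> polys_over S" "q' \<in> polys_over S" "ipoly (p - p')" "ipoly (q - q')"
  shows "ipoly (p * q - p' * q')"
proof -
  have "ipoly (p * (q - q') + q' * (p - p'))" using assms by (intro ipoly_add ipoly_mult)
  then show ?thesis by (simp add: algebra_simps)
qed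

lemma ipoly_prod_cong:
  assumes "finite A" "\<And>i. i \<in> A \<Longrightarrow> h i \<in> S" "\<And>i. i \<in> A \<Longrightarrow> h' i \<in> S" "\<And>i. i \<in> A \<Longrightarrow> h i - h' i \<in> I"
  shows "ipoly ((\<Prod>i\<in>A. [:- h i, 1:]) - (\<Prod>i\<in>A. [:- h' i, 1:]))"
  using assms
proof (induction A rule: finite_induct)
  case (insert a A)
  have "ipoly ([:- h a, 1:] * (\<Prod>i\<in>A. [:- h i, 1:]) - [:- h' a, 1:] * (\<Prod>i\<in>A. [:- h' i, 1:]))"
  proof (rule ipoly_mult_cong)
    show "[:- h a, 1:] \<in> polys_over S" using insert.prems by (intro po_linear[OF S]) simp
    show "(\<Prod>i\<in>A. [:- h' i, 1:]) \<in> polys_over S" using insert.prems by (intro po_prod[OF S] po_linear[OF S]) simp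
    have "h' a - h a \<in> I" using insert.prems(3)[of a] id_diff_commute by simp
    then show "ipoly ([:- h a, 1:] - [:- h' a, 1:])"
      by (auto simp: ipoly_def coeff_pCons id_zero split: nat.split)
  qed (use insert in auto)
  then show ?case unfolding prod.insert[OF insert.hyps(1,2)] .
qed (simp add: ipoly_def id_zero)

lemma ipoly_eval: "ipoly q \<Longrightarrow> x \<in> S \<Longrightarrow> poly q x \<in> I"
  unfolding poly_altdef ipoly_def by (intro id_sum id_mult' sr_power[OF S]) auto

end

lemma prime_set_ideal: "prime_set S P \<Longrightarrow> ideal_set S P" and prime_set_one: "prime_set S P \<Longrightarrow> 1 \<notin> P"
  and prime_setD: "prime_set S P \<Longrightarrow> a \<in> S \<Longrightarrow> b \<in> S \<Longrightarrow> a * b \<in> P \<Longrightarrow> a \<in> P \<or> b \<in> P"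
  unfolding prime_set_def by blast+

lemma maximal_set_ideal: "maximal_set S P \<Longrightarrow> ideal_set S P"
  unfolding maximal_set_def by blast+

lemma prime_set_prod:
  assumes S: "subring_set S" and P: "prime_set S P" and "finite A" "\<And>i. i \<in> A \<Longrightarrow> h i \<in> S" "prod h A \<in> P"
  obtains i where "i \<in> A" "h i \<in> P"
proof -
  have "\<exists>i\<in>A. h i \<in> P" using assms(3-)
  proof (induction A rule: finite_induct)
    case empty then show ?case using prime_set_one[OF P] by simp
  next
    case (insert a A)
    have "h a * prod h A \<in> P" using insert.hyps insert.prems by simp
    moreover have "prod h A \<in> S" using insert.prems by (intro sr_prod[OF S]) auto
    ultimately have "h a \<in> P \<or> prod h A \<in> P" using prime_setD[OF P] insert.prems by auto
    then show ?case using insert by auto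
  qed
  then show ?thesis using that by blast
qed

text \<open>Inverses modulo \<open>P\<close> come from integrality: in a monic integral relation of least degree that
  holds modulo \<open>P\<close>, the constant term is an integer outside \<open>P\<close>, hence invertible modulo \<open>P\<close>.\<close>

lemma prime_set_imp_maximal:
  fixes S :: "'a::field_char_0 set"
  assumes S: "subring_set S" and int: "\<And>x. x \<in> S \<Longrightarrow> algebraic_int x" and P: "prime_set S P"
    and N: "N \<noteq> 0" "of_int N \<in> P"
  shows "maximal_set S P"
proof -
  note I = prime_set_ideal[OF P]
  have int_inv: "\<exists>u. of_int (c * u - 1) \<in> P" if c: "of_int c \<notin> P" for c :: int
  proof -
    let ?Q = "\<lambda>n::nat. n > 0 \<and> of_int (int n) \<in> P"
    have "of_int \<bar>N\<bar> \<in> P" using N(2) id_uminus[OF S I N(2)] by (cases "N \<ge> 0") auto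
    then have "?Q (nat \<bar>N\<bar>)" using N(1) by simp
    then obtain l where l: "?Q l" and min: "\<And>n. ?Q n \<Longrightarrow> l \<le> n"
      using ex_has_least_nat[of ?Q "nat \<bar>N\<bar>" "\<lambda>x. x"] by blast
    let ?d = "gcd c (int l)"
    have dpos: "?d > 0" using l by simp
    obtain e where e: "int l = ?d * e" by (meson gcd_dvd2 dvdE)
    have epos: "e > 0" using e l dpos by (metis of_nat_0_less_iff zero_less_mult_pos)
    have d_nin: "of_int ?d \<notin> P"
    proof
      assume d: "of_int ?d \<in> P"
      obtain k where "c = ?d * k" by (meson gcd_dvd1 dvdE)
      then have "of_int c = of_int k * (of_int ?d :: 'a)" by (metis mult.commute of_int_mult)
      then show False using c id_mult[OF S I sr_of_int[OF S] d] by simp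
    qed
    have "of_int ?d * of_int e \<in> P" using l e by (metis of_int_mult)
    then have "of_int e \<in> P" using prime_setD[OF P sr_of_int[OF S] sr_of_int[OF S]] d_nin by blast
    then have "l \<le> nat e" using min[of "nat e"] epos by simp
    then have "int l \<le> e" using epos by simp
    then have "?d * e \<le> 1 * e" using e by simp
    then have "?d \<le> 1" using epos by simp
    then have "?d = 1" using dpos by linarith
    moreover obtain u w where "u * c + w * int l = ?d" using bezout_int by blast
    ultimately have "c * u - 1 = - (w * int l)" by (simp add: algebra_simps)
    then have "of_int (c * u - 1) = of_int (- w) * (of_int (int l) :: 'a)" by (metis minus_mult_left of_int_mult)
    then show ?thesis using id_mult[OF S I sr_of_int[OF S], of "of_int (int l)" "- w"] l by metis
  qed
  have "\<exists>y\<in>S. x * y - 1 \<in> P" if x: "x \<in> S" "x \<notin> P" for x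
  proof -
    let ?ev = "\<lambda>h::int poly. poly (map_poly of_int h) x"
    let ?H = "\<lambda>h::int poly. lead_coeff h = 1 \<and> ?ev h \<in> P"
    obtain h0 :: "int poly" where "?ev h0 = 0" "lead_coeff h0 = 1"
      using int[OF x(1)] by (auto simp: algebraic_int_altdef_ipoly)
    then have "?H h0" using id_zero[OF S I] by simp
    then obtain h where h: "?H h" and min: "\<And>h'. ?H h' \<Longrightarrow> degree h \<le> degree h'"
      using ex_has_least_nat[of ?H h0 degree] by blast
    obtain c h1 where ch: "h = pCons c h1" by (cases h)
    have evS: "?ev h' \<in> S" for h'
      by (rule poly_in[OF S _ x(1)]) (simp add: polys_over_iff[OF S] coeff_map_poly sr_of_int[OF S])
    have "map_poly of_int (pCons c h1) = pCons (of_int c) (map_poly of_int h1 :: 'a poly)"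
      by (rule poly_eqI) (simp add: coeff_map_poly coeff_pCons split: nat.split)
    then have ev: "?ev h = of_int c + x * ?ev h1" unfolding ch by simp
    have h10: "h1 \<noteq> 0"
    proof
      assume "h1 = 0"
      then have "?ev h = 1" using h ch by simp
      then show False using h prime_set_one[OF P] by simp
    qed
    have "of_int c \<notin> P"
    proof
      assume "of_int c \<in> P"
      then have "x * ?ev h1 \<in> P" using id_diff[OF S I, of "?ev h" "of_int c"] h ev by simp
      then have "?ev h1 \<in> P" using prime_setD[OF P x(1) evS] x(2) by blast
      moreover have "lead_coeff h1 = 1" using h h10 unfolding ch by simp
      ultimately have "degree h \<le> degree h1" using min by blast
      then show False using h10 unfolding ch by simp
    qed
    then obtain u where u: "of_int (c * u - 1) \<in> P" using int_inv by blast
    let ?y = "- (of_int u * ?ev h1)"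
    have yS: "?y \<in> S" by (intro sr_uminus[OF S] sr_mult[OF S] sr_of_int[OF S] evS)
    have "x * ?y - 1 = of_int (c * u - 1) - of_int u * ?ev h" unfolding ev by (simp add: algebra_simps)
    moreover have "of_int (c * u - 1) - of_int u * ?ev h \<in> P"
      using h by (intro id_diff[OF S I] u id_mult[OF S I] sr_of_int[OF S]) simp
    ultimately have "x * ?y - 1 \<in> P" by (simp only:)
    then show ?thesis using yS by (rule bexI)
  qed
  then show ?thesis using P I by (simp add: maximal_set_def prime_set_def)
qed

text \<open>Modulo \<open>I\<close> the element \<open>b\<close> is an inverse of \<open>2\<close>. Multiplying an integral equation for \<open>b\<close> by a power of \<open>2\<close>
  gives an integer in \<open>I\<close>; it is odd because the equation is monic.\<close>

lemma odd_int_in_ideal: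
  fixes S :: "'a::field_char_0 set"
  assumes S: "subring_set S" and I: "ideal_set S I" and b: "b \<in> S" "algebraic_int b" "2 * b - 1 \<in> I"
  obtains N where "N \<noteq> 0" "of_int N \<in> I"
proof -
  obtain h :: "int poly" where h: "poly (map_poly of_int h) b = 0" "lead_coeff h = 1"
    using b(2) by (auto simp: algebraic_int_altdef_ipoly)
  let ?d = "degree h"
  have dh: "degree (map_poly of_int h :: 'a poly) = ?d" by (rule degree_map_poly) simp
  define N where "N = (\<Sum>i\<le>?d. coeff h i * 2 ^ (?d - i))"
  have two: "2 * b \<in> S" unfolding mult_2 by (rule sr_add[OF S b(1) b(1)])
  have pow: "(2 * b) ^ i - 1 \<in> I" for i
  proof (induction i)
    case (Suc i)
    then show ?case using id_mult_cong[OF S I two sr_one[OF S] b(3) Suc] by simp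
  qed (simp add: id_zero[OF S I])
  have "of_int N = of_int N - 2 ^ ?d * poly (map_poly of_int h) b" using h by simp
  also have "\<dots> = (\<Sum>i\<le>?d. of_int (coeff h i * 2 ^ (?d - i)) * (1 - (2 * b) ^ i))"
  proof -
    have "2 ^ ?d * poly (map_poly of_int h) b = (\<Sum>i\<le>?d. of_int (coeff h i * 2 ^ (?d - i)) * (2 * b) ^ i)"
      unfolding poly_altdef dh sum_distrib_left
    proof (rule sum.cong[OF refl])
      fix i assume "i \<in> {..?d}"
      then have "(2 :: 'a) ^ ?d = 2 ^ (?d - i) * 2 ^ i" by (simp flip: power_add)
      then show "2 ^ ?d * (coeff (map_poly of_int h) i * b ^ i) = of_int (coeff h i * 2 ^ (?d - i)) * (2 * b) ^ i"
        by (simp add: coeff_map_poly power_mult_distrib)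
    qed
    then show ?thesis unfolding N_def by (simp add: of_int_sum sum_subtractf right_diff_distrib)
  qed
  also have "\<dots> \<in> I"
    using pow id_diff_commute[OF S I, of 1] by (intro id_sum[OF S I] id_mult[OF S I] sr_of_int[OF S]) simp
  finally have "of_int N \<in> I" .
  moreover have "odd N"
  proof -
    have "{..?d} = insert ?d {..<?d}" by auto
    then have "N = 1 + (\<Sum>i<?d. coeff h i * 2 ^ (?d - i))" using h(2) by (simp add: N_def)
    moreover have "even (\<Sum>i<?d. coeff h i * 2 ^ (?d - i))" by (rule dvd_sum) simp
    ultimately show ?thesis by simp
  qed
  ultimately show ?thesis using that[of N] by auto
qed

lemma distinct_maximal_comaximal:
  assumes S: "subring_set S" and P: "maximal_set S P" and Q: "maximal_set S (Q :: 'a::field set)" and ne: "P \<noteq> Q"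
  obtains e where "e \<in> Q" "e - 1 \<in> P"
proof (cases "P \<subseteq> Q")
  case True
  note IP = maximal_set_ideal[OF P] and IQ = maximal_set_ideal[OF Q]
  then obtain x where x: "x \<in> Q" "x \<notin> P" using ne True by blast
  then have "x \<in> S" using id_subset[OF S IQ] by blast
  then obtain y where "y \<in> S" "x * y - 1 \<in> P" using P x unfolding maximal_set_def by blast
  then show ?thesis using that[of "x * y"] id_mult'[OF S IQ _ x(1)] by blast
next
  case False
  note IP = maximal_set_ideal[OF P] and IQ = maximal_set_ideal[OF Q]
  then obtain x where x: "x \<in> P" "x \<notin> Q" using False by blast
  then have "x \<in> S" using id_subset[OF S IP] by blast
  then obtain y where y: "y \<in> S" "x * y - 1 \<in> Q" using Q x unfolding maximal_set_def by blast
  have "1 - x * y \<in> Q" using y(2) id_diff_commute[OF S IQ] by blast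
  moreover have "(1 - x * y) - 1 \<in> P" using id_uminus[OF S IP id_mult'[OF S IP y(1) x(1)]] by simp
  ultimately show ?thesis by (rule that)
qed

lemma crt_finite:
  assumes S: "subring_set S" and P: "maximal_set S (P :: 'a::field set)" and fin: "finite \<Q>"
    and \<Q>: "\<And>Q. Q \<in> \<Q> \<Longrightarrow> maximal_set S Q" "P \<notin> \<Q>"
  obtains e where "e \<in> S" "\<And>Q. Q \<in> \<Q> \<Longrightarrow> e \<in> Q" "e - 1 \<in> P"
proof -
  note IP = maximal_set_ideal[OF P]
  have "\<exists>e. e \<in> Q \<and> e - 1 \<in> P" if "Q \<in> \<Q>" for Q
    using distinct_maximal_comaximal[OF S P \<Q>(1)[OF that]] \<Q>(2) that by metis
  then obtain e where e: "\<And>Q. Q \<in> \<Q> \<Longrightarrow> e Q \<in> Q \<and> e Q - 1 \<in> P" by metis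
  have eS: "e Q \<in> S" if "Q \<in> \<Q>" for Q
    using id_subset[OF S maximal_set_ideal[OF \<Q>(1)[OF that]]] e[OF that] by blast
  have "prod e \<Q> - prod (\<lambda>_. 1) \<Q> \<in> P"
    using e eS by (intro id_prod_cong[OF S IP fin]) (auto simp: sr_one[OF S])
  moreover have "prod e \<Q> \<in> Q" if "Q \<in> \<Q>" for Q
    using e[OF that] eS by (intro id_prod_mem[OF S maximal_set_ideal[OF \<Q>(1)[OF that]] fin that]) auto
  moreover have "prod e \<Q> \<in> S" using eS by (intro sr_prod[OF S])
  ultimately show ?thesis using that by simp
qed

section \<open>Prime ideals in the ring of integers of a splitting field\<close>

definition ints :: "'a::field_char_0 set \<Rightarrow> 'a set" where "ints L = {x \<in> L. algebraic_int x}"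

lemma subring_ints: "subfield_set L \<Longrightarrow> subring_set (ints L)"
  unfolding subring_set_def ints_def
  using algebraic_int_plus[of _ "- _"] algebraic_int_times sr_closed[OF subfield_imp_subring, of L]
    int_imp_algebraic_int[of 1] by (auto simp del: algebraic_int_minus_iff dest: algebraic_int_minus)

locale integral_splitting_field = splitting_field K L f R
  for K L :: "'a::field_char_0 set" and f R +
  fixes p :: "'a set" and N :: int
  assumes f_int: "f \<in> polys_over (ints K)" and p_prime: "prime_set (ints K) p"
    and N: "N \<noteq> 0" "of_int N \<in> p"
begin

abbreviation "OK \<equiv> ints K"
abbreviation "OL \<equiv> ints L"

lemmas OK = subring_ints[OF K] and OL = subring_ints[OF L]
lemmas p_ideal = prime_set_ideal[OF p_prime]

lemma OK_OL: "OK \<subseteq> OL" using K_L by (auto simp: ints_def)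

lemma OL_K: "x \<in> OL \<Longrightarrow> x \<in> K \<Longrightarrow> x \<in> OK" by (simp add: ints_def)

lemma monic_f: "lead_coeff f = 1" unfolding f_eq lead_coeff_prod by simp

lemma R_OL: "R \<subseteq> OL"
proof
  fix r assume r: "r \<in> R"
  have "coeff f i \<in> OK" for i using f_int unfolding polys_over_iff[OF OK] by blast
  then have "algebraic_int (coeff f i)" for i by (simp add: ints_def)
  moreover have "poly f r = 0" using r root_iff[of r] by simp
  ultimately have "algebraic_int r" using algebraic_int_integrally_closed[OF monic_f] by blast
  then show "r \<in> OL" using r R_L by (auto simp: ints_def)
qed

lemma Gal_OL: assumes s: "\<sigma> \<in> Gal" and x: "x \<in> OL" shows "\<sigma> x \<in> OL"
proof -
  have xL: "x \<in> L" using x by (simp add: ints_def)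
  obtain h :: "int poly" where h: "poly (map_poly of_int h) x = 0" "lead_coeff h = 1"
    using x by (auto simp: ints_def algebraic_int_altdef_ipoly)
  have hL: "map_poly of_int h \<in> polys_over L"
    by (simp add: polys_over_iff[OF L'] coeff_map_poly sr_of_int[OF L'])
  have "map_poly \<sigma> (map_poly of_int h) = map_poly of_int h"
    by (rule poly_eqI) (simp add: coeff_rh[OF L' Gal_hom[OF s]] coeff_map_poly rh_of_int[OF L' Gal_hom[OF s]])
  then have "poly (map_poly of_int h) (\<sigma> x) = 0"
    using rh_poly_eval[OF L' Gal_hom[OF s] hL xL] h(1) rh_zero[OF L' Gal_hom[OF s]] by simp
  then have "algebraic_int (\<sigma> x)" using h(2) by (auto simp: algebraic_int_altdef_ipoly)
  then show ?thesis using Gal_L[OF s xL] by (simp add: ints_def)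
qed

lemma Gal_on_OL:
  assumes s: "\<sigma> \<in> Gal" and x: "x \<in> OL" and y: "y \<in> OL"
  shows "\<sigma> (x + y) = \<sigma> x + \<sigma> y" "\<sigma> (x * y) = \<sigma> x * \<sigma> y" "\<sigma> (x - y) = \<sigma> x - \<sigma> y" "\<sigma> 1 = 1" "\<sigma> 0 = 0"
  using x y rh_add[OF L' Gal_hom[OF s]] rh_mult[OF L' Gal_hom[OF s]] rh_diff[OF L' Gal_hom[OF s]]
    rh_one[OF L' Gal_hom[OF s]] rh_zero[OF L' Gal_hom[OF s]] by (auto simp: ints_def)

definition Tr :: "'a \<Rightarrow> 'a" where "Tr x = (\<Sum>\<sigma>\<in>Gal. \<sigma> x)"

lemma Tr_OK: "x \<in> OL \<Longrightarrow> Tr x \<in> OK"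
  unfolding Tr_def using Gal_OL by (intro OL_K sr_sum[OF OL] sum_Gal_fixed(1)) (auto simp: ints_def)

lemma Nm_OK: "x \<in> OL \<Longrightarrow> (\<Prod>\<sigma>\<in>Gal. \<sigma> x) \<in> OK"
  using Gal_OL by (intro OL_K sr_prod[OF OL] sum_Gal_fixed(2)) (auto simp: ints_def)

definition ext_ideal :: "'a set" where "ext_ideal = \<Inter>{I. ideal_set OL I \<and> p \<subseteq> I}"

lemma p_OK: "p \<subseteq> OK" using p_ideal by (simp add: ideal_set_def)
lemma p_OL: "p \<subseteq> OL" using p_OK OK_OL by blast

lemma ideal_set_self: "subring_set S \<Longrightarrow> ideal_set S S"
  by (simp add: ideal_set_def sr_closed)

lemma ext_ideal_ideal: "ideal_set OL ext_ideal"
proof -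
  have "OL \<in> {I. ideal_set OL I \<and> p \<subseteq> I}" using ideal_set_self[OF OL] p_OL by simp
  then have "ext_ideal \<subseteq> OL" unfolding ext_ideal_def by blast
  then show ?thesis unfolding ideal_set_def ext_ideal_def by blast
qed

lemma p_ext_ideal: "p \<subseteq> ext_ideal" unfolding ext_ideal_def by blast

lemma ext_ideal_least: "ideal_set OL I \<Longrightarrow> p \<subseteq> I \<Longrightarrow> ext_ideal \<subseteq> I" unfolding ext_ideal_def by blast

lemma ideal_set_vimage:
  assumes s: "\<sigma> \<in> Gal" and I: "ideal_set OL I" shows "ideal_set OL {x \<in> OL. \<sigma> x \<in> I}"
  unfolding ideal_set_def
  using Gal_on_OL[OF s] Gal_OL[OF s] id_zero[OF OL I] id_add[OF OL I] id_mult[OF OL I] sr_closed[OF OL] by auto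

lemma Gal_ext_ideal: assumes s: "\<sigma> \<in> Gal" and x: "x \<in> ext_ideal" shows "\<sigma> x \<in> ext_ideal"
proof -
  have "p \<subseteq> {x \<in> OL. \<sigma> x \<in> ext_ideal}"
  proof
    fix y assume y: "y \<in> p"
    then have "\<sigma> y = y" using Gal_fix[OF s] p_OK by (auto simp: ints_def)
    then show "y \<in> {x \<in> OL. \<sigma> x \<in> ext_ideal}" using y p_OL p_ext_ideal by auto
  qed
  from ext_ideal_least[OF ideal_set_vimage[OF s ext_ideal_ideal] this] show ?thesis using x by blast
qed

lemma p_maximal: "maximal_set OK p"
  by (rule prime_set_imp_maximal[OF OK _ p_prime N]) (simp add: ints_def)

definition lies_over :: "'a set \<Rightarrow> bool" where "lies_over P \<longleftrightarrow> prime_set OL P \<and> p \<subseteq> P"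

lemma over_ideal: "lies_over P \<Longrightarrow> ideal_set OL P" and over_prime: "lies_over P \<Longrightarrow> prime_set OL P" and over_p: "lies_over P \<Longrightarrow> p \<subseteq> P"
  using prime_set_ideal by (auto simp: lies_over_def)

lemma over_maximal: "lies_over P \<Longrightarrow> maximal_set OL P"
  by (rule prime_set_imp_maximal[OF OL _ over_prime N(1)]) (use N over_p in \<open>auto simp: ints_def\<close>)

lemma over_ext_ideal: "lies_over P \<Longrightarrow> ext_ideal \<subseteq> P"
  by (rule ext_ideal_least[OF over_ideal over_p])

lemma over_OK: assumes P: "lies_over P" and x: "x \<in> OK" "x \<in> P" shows "x \<in> p"
proof (rule ccontr)
  assume "x \<notin> p"
  then obtain y where y: "y \<in> OK" "x * y - 1 \<in> p" using p_maximal x(1) unfolding maximal_set_def by blast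
  note I = over_ideal[OF P]
  have "x * y \<in> P" using id_mult'[OF OL I _ x(2)] y(1) OK_OL by blast
  then have "1 \<in> P" using y(2) over_p[OF P] id_diff[OF OL I, of "x * y" "x * y - 1"] by auto
  then show False using prime_set_one[OF over_prime[OF P]] by simp
qed

lemma mem_image_Gal:
  assumes "\<rho> \<circ> \<sigma> = id" "\<sigma> \<circ> \<rho> = id" shows "x \<in> \<sigma> ` P \<longleftrightarrow> \<rho> x \<in> P"
proof
  assume "x \<in> \<sigma> ` P"
  then obtain y where y: "y \<in> P" "x = \<sigma> y" by blast
  then show "\<rho> x \<in> P" using fun_cong[OF assms(1), of y] by simp
next
  assume "\<rho> x \<in> P"
  moreover have "x = \<sigma> (\<rho> x)" using fun_cong[OF assms(2), of x] by simp
  ultimately show "x \<in> \<sigma> ` P" by blast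
qed

lemma over_image: assumes s: "\<sigma> \<in> Gal" and P: "lies_over P" shows "lies_over (\<sigma> ` P)"
proof -
  obtain \<rho> where r: "\<rho> \<in> Gal" "\<rho> \<circ> \<sigma> = id" "\<sigma> \<circ> \<rho> = id" by (rule inv_Gal[OF s])
  note m = mem_image_Gal[OF r(2,3)] and I = over_ideal[OF P]
  have "\<sigma> ` P \<subseteq> OL" using Gal_OL[OF s] id_subset[OF OL I] by blast
  then have eq: "\<sigma> ` P = {x \<in> OL. \<rho> x \<in> P}" using m by blast
  have "ideal_set OL (\<sigma> ` P)" unfolding eq by (rule ideal_set_vimage[OF r(1) I])
  moreover have "1 \<notin> \<sigma> ` P" unfolding m using prime_set_one[OF over_prime[OF P]] Gal_on_OL(4)[OF r(1) sr_one[OF OL] sr_one[OF OL]] by simp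
  moreover have "a \<in> \<sigma> ` P \<or> b \<in> \<sigma> ` P" if "a \<in> OL" "b \<in> OL" "a * b \<in> \<sigma> ` P" for a b
    using that prime_setD[OF over_prime[OF P], of "\<rho> a" "\<rho> b"] Gal_OL[OF r(1)] Gal_on_OL(2)[OF r(1) that(1,2)]
    unfolding m by auto
  moreover have "p \<subseteq> \<sigma> ` P"
  proof
    fix x assume x: "x \<in> p"
    then have "\<rho> x = x" using Gal_fix[OF r(1)] p_OK by (auto simp: ints_def)
    then show "x \<in> \<sigma> ` P" unfolding m using x over_p[OF P] by auto
  qed
  ultimately show ?thesis unfolding lies_over_def prime_set_def by blast
qed

lemma ideal_set_add_multiples:
  assumes M: "ideal_set OL M" and a: "a \<in> OL"
  shows "ideal_set OL {m + a * x | m x. m \<in> M \<and> x \<in> OL}"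
proof -
  let ?J = "{m + a * x | m x. m \<in> M \<and> x \<in> OL}"
  have "?J \<subseteq> OL" using id_subset[OF OL M] a by (auto intro!: sr_add[OF OL] sr_mult[OF OL])
  moreover have "0 \<in> ?J" using id_zero[OF OL M] sr_zero[OF OL] by force
  moreover have "u + v \<in> ?J" if uv: "u \<in> ?J" "v \<in> ?J" for u v
  proof -
    obtain m x m' x' where *: "m \<in> M" "x \<in> OL" "u = m + a * x" "m' \<in> M" "x' \<in> OL" "v = m' + a * x'" using uv by blast
    have "u + v = (m + m') + a * (x + x')" using * by (simp add: algebra_simps)
    then show ?thesis using id_add[OF OL M *(1,4)] sr_add[OF OL *(2,5)] by blast
  qed
  moreover have "s * u \<in> ?J" if su: "s \<in> OL" "u \<in> ?J" for s u
  proof -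
    obtain m x where *: "m \<in> M" "x \<in> OL" "u = m + a * x" using su by blast
    have "s * u = s * m + a * (s * x)" using * by (simp add: algebra_simps)
    then show ?thesis using id_mult[OF OL M su(1) *(1)] sr_mult[OF OL su(1) *(2)] by blast
  qed
  ultimately show ?thesis unfolding ideal_set_def by blast
qed

text \<open>Multiplied by a power of \<open>a\<close>, the integral equation of \<open>x\<close> becomes a monic equation for \<open>a x\<close>, hence for \<open>s\<close>
  modulo \<open>M\<close>, whose lower coefficients are multiples of \<open>a\<close>. So a power of \<open>s\<close> lies in \<open>p\<close>.\<close>

lemma integral_multiple_in_ideal:
  assumes M: "ideal_set OL M" "M \<inter> OK \<subseteq> p" and a: "a \<in> p" and x: "x \<in> OL" and s: "s \<in> OK" "s - a * x \<in> M"
  shows "s \<in> p"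
proof -
  obtain h :: "int poly" where h: "poly (map_poly of_int h) x = 0" "lead_coeff h = 1"
    using x by (auto simp: ints_def algebraic_int_altdef_ipoly)
  let ?d = "degree h"
  let ?c = "\<lambda>i. of_int (coeff h i) * a ^ (?d - i) :: 'a"
  have dh: "degree (map_poly of_int h :: 'a poly) = ?d" by (rule degree_map_poly) simp
  have aOK: "a \<in> OK" using a p_OK by blast
  have cOK: "?c i \<in> OK" for i by (intro sr_mult[OF OK] sr_power[OF OK] sr_of_int[OF OK] aOK)
  have axOL: "a * x \<in> OL" using aOK OK_OL x by (intro sr_mult[OF OL]) auto
  have sOL: "s \<in> OL" using s OK_OL by blast
  have pow: "s ^ i - (a * x) ^ i \<in> M" for i
  proof (induction i)
    case (Suc i)
    then show ?case using id_mult_cong[OF OL M(1) sOL sr_power[OF OL axOL] s(2) Suc] by simp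
  qed (simp add: id_zero[OF OL M(1)])
  have "a ^ ?d * poly (map_poly of_int h) x = (\<Sum>i\<le>?d. ?c i * (a * x) ^ i)"
    unfolding poly_altdef dh sum_distrib_left
  proof (rule sum.cong[OF refl])
    fix i assume "i \<in> {..?d}"
    then have "a ^ ?d = a ^ (?d - i) * a ^ i" by (simp flip: power_add)
    then show "a ^ ?d * (coeff (map_poly of_int h) i * x ^ i) = ?c i * (a * x) ^ i"
      by (simp add: coeff_map_poly power_mult_distrib)
  qed
  then have "(\<Sum>i\<le>?d. ?c i * s ^ i) = (\<Sum>i\<le>?d. ?c i * (s ^ i - (a * x) ^ i))"
    using h(1) by (simp add: right_diff_distrib sum_subtractf)
  also have "\<dots> \<in> M"
    using cOK OK_OL pow by (intro id_sum[OF OL M(1)] id_mult[OF OL M(1)]) auto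
  finally have "(\<Sum>i\<le>?d. ?c i * s ^ i) \<in> M" .
  moreover have "(\<Sum>i\<le>?d. ?c i * s ^ i) \<in> OK"
    by (intro sr_sum[OF OK] sr_mult[OF OK cOK] sr_power[OF OK s(1)])
  ultimately have tot: "(\<Sum>i\<le>?d. ?c i * s ^ i) \<in> p" using M(2) by blast
  have low: "(\<Sum>i<?d. ?c i * s ^ i) \<in> p"
  proof (rule id_sum[OF OK p_ideal])
    fix i assume "i \<in> {..<?d}"
    then have "?d - i = Suc (?d - i - 1)" by simp
    then have "a ^ (?d - i) = a ^ (?d - i - 1) * a" by (metis power_Suc2)
    then have "?c i * s ^ i = (of_int (coeff h i) * a ^ (?d - i - 1) * s ^ i) * a" by (simp add: mult_ac)
    also have "\<dots> \<in> p" using s(1) aOK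
      by (intro id_mult[OF OK p_ideal _ a] sr_mult[OF OK] sr_power[OF OK] sr_of_int[OF OK]) auto
    finally show "?c i * s ^ i \<in> p" .
  qed
  have "{..?d} = insert ?d {..<?d}" by auto
  then have "(\<Sum>i\<le>?d. ?c i * s ^ i) - (\<Sum>i<?d. ?c i * s ^ i) = s ^ ?d" using h(2) by simp
  then have "s ^ ?d \<in> p" using id_diff[OF OK p_ideal tot low] by simp
  moreover have "s ^ n \<in> p \<Longrightarrow> s \<in> p" for n
  proof (induction n)
    case 0 then show ?case using prime_set_one[OF p_prime] by simp
  next
    case (Suc n)
    then show ?case using prime_setD[OF p_prime s(1) sr_power[OF OK s(1)], of n] by auto
  qed
  ultimately show ?thesis by blast
qed

text \<open>An ideal that is maximal among those meeting \<open>OK\<close> inside \<open>p\<close> is prime; it contains \<open>p\<close> by integrality.\<close>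

lemma exists_prime_over: obtains P where "lies_over P"
proof -
  let ?A = "{I. ideal_set OL I \<and> I \<inter> OK \<subseteq> p}"
  have "{0} \<in> ?A" using id_zero[OF OK p_ideal] sr_zero[OF OL] by (auto simp: ideal_set_def)
  then have ne: "?A \<noteq> {}" by blast
  have "\<exists>M\<in>?A. \<forall>J\<in>?A. M \<subseteq> J \<longrightarrow> J = M"
  proof (rule subset_Zorn_nonempty[OF ne])
    fix C assume C: "C \<noteq> {}" "subset.chain ?A C"
    have mem: "ideal_set OL I" "I \<inter> OK \<subseteq> p" if "I \<in> C" for I using C(2) that unfolding subset.chain_def by blast+
    have tot: "I \<subseteq> J \<or> J \<subseteq> I" if "I \<in> C" "J \<in> C" for I J using C(2) that unfolding subset.chain_def by blast
    have "ideal_set OL (\<Union>C)"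
      unfolding ideal_set_def
    proof (intro conjI ballI)
      show "\<Union>C \<subseteq> OL" using mem(1) id_subset[OF OL] by blast
      show "0 \<in> \<Union>C" using C(1) mem(1) id_zero[OF OL] by blast
      show "x + y \<in> \<Union>C" if xy: "x \<in> \<Union>C" "y \<in> \<Union>C" for x y
      proof -
        obtain I J where IJ: "I \<in> C" "x \<in> I" "J \<in> C" "y \<in> J" using xy by blast
        then show ?thesis using tot[OF IJ(1,3)] id_add[OF OL mem(1)[OF IJ(1)], of x y] id_add[OF OL mem(1)[OF IJ(3)], of x y] by blast
      qed
      show "s * x \<in> \<Union>C" if sx: "s \<in> OL" "x \<in> \<Union>C" for s x
      proof -
        obtain I where I: "I \<in> C" "x \<in> I" using sx(2) by (rule UnionE)
        show ?thesis by (rule UnionI[OF I(1) id_mult[OF OL mem(1)[OF I(1)] sx(1) I(2)]])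
      qed
    qed
    then show "\<Union>C \<in> ?A" using mem(2) by blast
  qed
  then obtain M where M': "M \<in> ?A" and max': "\<forall>J\<in>?A. M \<subseteq> J \<longrightarrow> J = M" by (rule bexE)
  have M: "ideal_set OL M" "M \<inter> OK \<subseteq> p" using M' by simp_all
  have max: "J = M" if "ideal_set OL J" "J \<inter> OK \<subseteq> p" "M \<subseteq> J" for J using max' that by simp
  have ext: "\<exists>m x. m \<in> M \<and> x \<in> OL \<and> m + a * x \<in> OK \<and> m + a * x \<notin> p" if a: "a \<in> OL" "a \<notin> M" for a
  proof (rule ccontr)
    assume no: "\<not> ?thesis"
    let ?J = "{m + a * x | m x. m \<in> M \<and> x \<in> OL}"
    have "?J \<inter> OK \<subseteq> p" using no by blast
    moreover have "M \<subseteq> ?J"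
    proof
      fix m assume "m \<in> M"
      then have "m + a * 0 \<in> ?J" using sr_zero[OF OL] by blast
      then show "m \<in> ?J" by simp
    qed
    ultimately have "?J = M" by (intro max ideal_set_add_multiples[OF M(1) a(1)])
    moreover have "0 + a * 1 \<in> ?J" using id_zero[OF OL M(1)] sr_one[OF OL] by blast
    ultimately show False using a(2) by simp
  qed
  have "prime_set OL M"
    unfolding prime_set_def
  proof (intro conjI ballI impI)
    show "1 \<notin> M" using M(2) sr_one[OF OK] prime_set_one[OF p_prime] by blast
    fix a b assume ab: "a \<in> OL" "b \<in> OL" "a * b \<in> M"
    show "a \<in> M \<or> b \<in> M"
    proof (rule ccontr)
      assume "\<not> (a \<in> M \<or> b \<in> M)"
      then obtain m x n y where *: "m \<in> M" "x \<in> OL" "m + a * x \<in> OK" "m + a * x \<notin> p"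
        "n \<in> M" "y \<in> OL" "n + b * y \<in> OK" "n + b * y \<notin> p" using ext[OF ab(1)] ext[OF ab(2)] by blast
      have "(m + a * x) * (n + b * y) = (n + b * y) * m + (a * x) * n + (x * y) * (a * b)" by (simp add: algebra_simps)
      also have "\<dots> \<in> M" 
        using *(7) OK_OL by (intro id_add[OF OL M(1)] id_mult[OF OL M(1) _ *(1)] id_mult[OF OL M(1) _ *(5)]
          id_mult[OF OL M(1) _ ab(3)] sr_mult[OF OL] ab *) auto
      finally have "(m + a * x) * (n + b * y) \<in> p" using M(2) sr_mult[OF OK *(3,7)] by blast
      then show False using prime_setD[OF p_prime *(3,7)] * by blast
    qed
  qed (rule M(1))
  moreover have "p \<subseteq> M"
  proof
    fix a assume a: "a \<in> p"
    show "a \<in> M"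
    proof (rule ccontr)
      assume "a \<notin> M"
      then obtain m x where *: "m \<in> M" "x \<in> OL" "m + a * x \<in> OK" "m + a * x \<notin> p" using ext[of a] a p_OL by blast
      have "m + a * x \<in> p" by (rule integral_multiple_in_ideal[OF M a *(2,3)]) (use *(1) in simp)
      then show False using *(4) by simp
    qed
  qed
  ultimately show ?thesis using that by (simp add: lies_over_def)
qed

text \<open>Otherwise some \<open>e\<close> lies in all conjugates of \<open>P\<close> and is \<open>1\<close> modulo \<open>P'\<close>. The norm of \<open>1 - e\<close> lies in \<open>P'\<close>, hence in \<open>p\<close>
  and in \<open>P\<close>, but no conjugate of \<open>1 - e\<close> does.\<close>

lemma Gal_transitive:
  assumes P: "lies_over P" and P': "lies_over P'"
  obtains \<sigma> where "\<sigma> \<in> Gal" "P' = \<sigma> ` P"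
proof (rule ccontr)
  assume no: "\<not> thesis"
  let ?Q = "(\<lambda>\<sigma>. \<sigma> ` P) ` Gal"
  have nin: "P' \<notin> ?Q" using no that by blast
  obtain e where e: "e \<in> OL" "\<And>Q. Q \<in> ?Q \<Longrightarrow> e \<in> Q" "e - 1 \<in> P'"
    by (rule crt_finite[OF OL over_maximal[OF P'] finite_imageI[OF finite_Gal] _ nin])
       (use over_maximal over_image P in blast)+
  have x: "1 - e \<in> OL" by (intro sr_diff[OF OL] sr_one[OF OL] e)
  have "1 - e \<in> P'" using e(3) id_diff_commute[OF OL over_ideal[OF P']] by blast
  then have "(\<Prod>\<sigma>\<in>Gal. \<sigma> (1 - e)) \<in> P'"
    using Gal_OL[OF _ x] by (intro id_prod_mem[OF OL over_ideal[OF P'] finite_Gal id_Gal]) auto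
  then have "(\<Prod>\<sigma>\<in>Gal. \<sigma> (1 - e)) \<in> P" using over_OK[OF P' Nm_OK[OF x]] over_p[OF P] by blast
  then obtain \<sigma> where s: "\<sigma> \<in> Gal" "\<sigma> (1 - e) \<in> P"
    using prime_set_prod[OF OL over_prime[OF P] finite_Gal] Gal_OL[OF _ x] by metis
  obtain \<rho> where r: "\<rho> \<in> Gal" "\<rho> \<circ> \<sigma> = id" "\<sigma> \<circ> \<rho> = id" by (rule inv_Gal[OF s(1)])
  have "e \<in> \<rho> ` P" using e(2) r(1) by blast
  then have "\<sigma> e \<in> P" using mem_image_Gal[OF r(3,2)] by simp
  moreover have "\<sigma> (1 - e) = 1 - \<sigma> e"
    using Gal_on_OL(3)[OF s(1) sr_one[OF OL] e(1)] Gal_on_OL(4)[OF s(1) e(1) e(1)] by simp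
  ultimately have "1 \<in> P" using id_add[OF OL over_ideal[OF P], of "\<sigma> (1 - e)" "\<sigma> e"] s(2) by simp
  then show False using prime_set_one[OF over_prime[OF P]] by simp
qed

text \<open>If no automorphism but the identity fixes \<open>P\<close>, every residue class modulo \<open>P\<close> contains an
  element of \<open>OK\<close>: the trace of \<open>y e\<close>, where \<open>e\<close> is 1 modulo \<open>P\<close> and 0 modulo the conjugates of \<open>P\<close>.\<close>

lemma trivial_decomposition_imp_residue:
  assumes P: "lies_over P" and triv: "\<And>\<sigma>. \<sigma> \<in> Gal \<Longrightarrow> \<sigma> ` P = P \<Longrightarrow> \<sigma> = id" and y: "y \<in> OL"
  obtains c where "c \<in> OK" "y - c \<in> P"
proof -
  note I = over_ideal[OF P]
  let ?Q = "(\<lambda>\<sigma>. \<sigma> ` P) ` (Gal - {id})"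
  have nin: "P \<notin> ?Q"
  proof
    assume "P \<in> ?Q"
    then obtain \<sigma> where "\<sigma> \<in> Gal - {id}" "P = \<sigma> ` P" by (rule imageE)
    then show False using triv[of \<sigma>] by simp
  qed
  have fin: "finite ?Q" using finite_Gal by simp
  have max: "maximal_set OL Q" if "Q \<in> ?Q" for Q using that over_maximal over_image[OF _ P] by blast
  obtain e where e: "e \<in> OL" "\<And>Q. Q \<in> ?Q \<Longrightarrow> e \<in> Q" "e - 1 \<in> P"
    using crt_finite[OF OL over_maximal[OF P] fin max nin] by metis
  have se: "\<sigma> e \<in> P" if s: "\<sigma> \<in> Gal" "\<sigma> \<noteq> id" for \<sigma>
  proof -
    obtain \<rho> where r: "\<rho> \<in> Gal" "\<rho> \<circ> \<sigma> = id" "\<sigma> \<circ> \<rho> = id" by (rule inv_Gal[OF s(1)])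
    have "\<rho> \<noteq> id" using r(2) s(2) by auto
    then have "e \<in> \<rho> ` P" using e(2) r(1) by blast
    then show ?thesis using mem_image_Gal[OF r(3,2)] by simp
  qed
  have ye: "y * e \<in> OL" by (rule sr_mult[OF OL y e(1)])
  have "Tr (y * e) = y * e + (\<Sum>\<sigma>\<in>Gal - {id}. \<sigma> (y * e))"
    unfolding Tr_def using sum.remove[OF finite_Gal id_Gal, of "\<lambda>\<sigma>. \<sigma> (y * e)"] by simp
  then have "y - Tr (y * e) = - (y * (e - 1)) - (\<Sum>\<sigma>\<in>Gal - {id}. \<sigma> (y * e))" by (simp add: algebra_simps)
  also have "\<dots> \<in> P"
  proof (rule id_diff[OF OL I id_uminus[OF OL I id_mult[OF OL I y e(3)]] id_sum[OF OL I]])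
    fix \<sigma> assume "\<sigma> \<in> Gal - {id}"
    then show "\<sigma> (y * e) \<in> P" using se[of \<sigma>] Gal_on_OL(2)[of \<sigma> y e] y e(1) Gal_OL[of \<sigma> y] id_mult[OF OL I] by auto
  qed
  finally show ?thesis using that[OF Tr_OK[OF ye]] by simp
qed

text \<open>The coefficients of the difference lie in \<open>P\<close> and in \<open>K\<close>, hence in \<open>p\<close>.\<close>

lemma trivial_decomposition_imp_split:
  assumes P: "lies_over P" and triv: "\<And>\<sigma>. \<sigma> \<in> Gal \<Longrightarrow> \<sigma> ` P = P \<Longrightarrow> \<sigma> = id"
  obtains c where "\<And>r. r \<in> R \<Longrightarrow> c r \<in> OK" "\<And>i. coeff (f - (\<Prod>r\<in>R. [:- c r, 1:])) i \<in> p"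
proof -
  have "\<exists>c. c \<in> OK \<and> r - c \<in> P" if "r \<in> R" for r
    using trivial_decomposition_imp_residue[OF P triv, of r] that R_OL by blast
  then obtain c where c: "\<And>r. r \<in> R \<Longrightarrow> c r \<in> OK \<and> r - c r \<in> P" by metis
  have "ipoly P ((\<Prod>r\<in>R. [:- r, 1:]) - (\<Prod>r\<in>R. [:- c r, 1:]))"
    by (rule ipoly_prod_cong[OF OL over_ideal[OF P] fin_R]) (use c R_OL OK_OL in auto)
  then have inP: "coeff (f - (\<Prod>r\<in>R. [:- c r, 1:])) i \<in> P" for i
    unfolding f_eq[symmetric] ipoly_def[OF OL over_ideal[OF P]] by blast
  have "f - (\<Prod>r\<in>R. [:- c r, 1:]) \<in> polys_over OK"
    using c by (intro po_diff[OF OK] f_int po_prod[OF OK] po_linear[OF OK]) auto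
  then have "coeff (f - (\<Prod>r\<in>R. [:- c r, 1:])) i \<in> p" for i
    using over_OK[OF P _ inP] by (simp add: polys_over_iff[OF OK])
  then show ?thesis using that[of c] c by blast
qed

end

lemma prime_set_prod_Bex:
  assumes "subring_set S" "prime_set S P" "finite A" "\<And>i. i \<in> A \<Longrightarrow> h i \<in> S" "prod h A \<in> P"
  shows "\<exists>i\<in>A. h i \<in> P"
  by (rule prime_set_prod[OF assms]) (assumption, rule bexI)

context integral_splitting_field
begin

text \<open>Modulo \<open>P\<close> each root \<open>r\<close> is congruent to one \<open>c(r)\<close>. The element \<open>e\<close> is the product over \<open>r\<close> of the Lagrange polynomials
  that are \<open>1\<close> at \<open>c(r)\<close> and \<open>0\<close> at the rest of \<open>C\<close>, evaluated at \<open>r\<close>. If \<open>\<sigma>\<close> moves \<open>r\<close> to \<open>t\<close>, then \<open>e \<sigma>(e)\<close> contains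
  the Lagrange polynomials of \<open>c(t)\<close> and of \<open>c(r)\<close>, both at \<open>t\<close>; their product is a multiple of \<open>\<Prod> (t - c)\<close>,
  which lies in the extended ideal because \<open>f(t) = 0\<close>.\<close>

lemma split_imp_orthogonal:
  assumes C: "finite C" "C \<subseteq> OK" "card C = card R"
    and cong: "\<And>i. coeff (f - (\<Prod>c\<in>C. [:- c, 1:])) i \<in> p"
    and incong: "\<And>c d. c \<in> C \<Longrightarrow> d \<in> C \<Longrightarrow> c - d \<in> p \<Longrightarrow> c = d"
    and P: "lies_over P"
  obtains e where "e \<in> OL" "e - 1 \<in> P" "\<And>\<sigma>. \<sigma> \<in> Gal \<Longrightarrow> \<sigma> \<noteq> id \<Longrightarrow> e * \<sigma> e \<in> ext_ideal"
proof -
  note I = over_ideal[OF P] and Q = ext_ideal_ideal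
  let ?F = "\<Prod>c\<in>C. [:- c, 1:]"
  have ip: "ipoly ext_ideal (f - ?F)" using cong p_ext_ideal unfolding ipoly_def[OF OL Q] by blast
  have Fr: "(\<Prod>c\<in>C. r - c) \<in> ext_ideal" if r: "r \<in> R" for r
  proof -
    have "poly (f - ?F) r \<in> ext_ideal" by (rule ipoly_eval[OF OL Q ip]) (use r R_OL in blast)
    then have "- poly ?F r \<in> ext_ideal" using r root_iff[of r] by simp
    then have "poly ?F r \<in> ext_ideal" using id_uminus[OF OL Q, of "- poly ?F r"] by simp
    then show ?thesis by (simp add: poly_prod)
  qed
  have "\<exists>c\<in>C. r - c \<in> P" if r: "r \<in> R" for r
  proof -
    have "(\<Prod>c\<in>C. r - c) \<in> P" using Fr[OF r] over_ext_ideal[OF P] by blast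
    moreover have "r - c \<in> OL" if "c \<in> C" for c using r R_OL that C(2) OK_OL by (intro sr_diff[OF OL]) auto
    ultimately show ?thesis by (intro prime_set_prod_Bex[OF OL over_prime[OF P] C(1)])
  qed
  then obtain c where c: "\<And>r. r \<in> R \<Longrightarrow> c r \<in> C \<and> r - c r \<in> P" by metis
  have cOK: "c r \<in> OK" if "r \<in> R" for r using c[OF that] C(2) by blast
  have inj: "inj_on c R"
  proof (rule ccontr)
    assume "\<not> inj_on c R"
    then have "card (c ` R) < card R" using fin_R by (meson card_image_le eq_card_imp_inj_on le_neq_implies_less)
    moreover have sub: "c ` R \<subseteq> C" using c by blast
    ultimately have "c ` R \<noteq> C" using C(3) by auto
    then obtain d where d: "d \<in> C" "d \<notin> c ` R" using sub by blast
    have dOK: "d \<in> OK" using d C by blast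
    have ip2: "ipoly P ((\<Prod>r\<in>R. [:- r, 1:]) - (\<Prod>r\<in>R. [:- c r, 1:]))"
      by (rule ipoly_prod_cong[OF OL I fin_R]) (use c cOK R_OL OK_OL in auto)
    have ip1: "ipoly P (f - ?F)" using ip over_ext_ideal[OF P] unfolding ipoly_def[OF OL Q] ipoly_def[OF OL I] by blast
    have dOL: "d \<in> OL" using dOK OK_OL by blast
    have "poly ((\<Prod>r\<in>R. [:- r, 1:]) - (\<Prod>r\<in>R. [:- c r, 1:])) d \<in> P" by (rule ipoly_eval[OF OL I ip2 dOL])
    moreover have "poly (f - ?F) d \<in> P" by (rule ipoly_eval[OF OL I ip1 dOL])
    moreover have "poly ?F d = 0" using d(1) C(1) by (auto simp: poly_prod)
    ultimately have "poly f d - poly (\<Prod>r\<in>R. [:- c r, 1:]) d \<in> P" "poly f d \<in> P"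
      unfolding f_eq[symmetric] by simp_all
    from id_diff[OF OL I this(2,1)] have "(\<Prod>r\<in>R. d - c r) \<in> P" by (simp add: poly_prod)
    moreover have dcOK: "d - c r \<in> OK" if "r \<in> R" for r by (intro sr_diff[OF OK] dOK cOK that)
    ultimately have "(\<Prod>r\<in>R. d - c r) \<in> p" using over_OK[OF P] sr_prod[OF OK, of R "\<lambda>r. d - c r"] by blast
    then obtain r where r: "r \<in> R" "d - c r \<in> p"
      using prime_set_prod_Bex[OF OK p_prime fin_R, of "\<lambda>r. d - c r"] dcOK by blast
    then have "d = c r" using incong[OF d(1)] c[OF r(1)] by blast
    then show False using d(2) r(1) by blast
  qed
  have prodOK: "(\<Prod>s\<in>C - {x}. x - s) \<in> OK" if "x \<in> C" for x
    using C(2) that by (intro sr_prod[OF OK] sr_diff[OF OK]) auto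
  have "\<exists>u\<in>OK. u * (\<Prod>s\<in>C - {x}. x - s) - 1 \<in> p" if x: "x \<in> C" for x
  proof -
    have xsOK: "x - s \<in> OK" if "s \<in> C - {x}" for s using C(2) x that by (intro sr_diff[OF OK]) auto
    have "(\<Prod>s\<in>C - {x}. x - s) \<notin> p"
    proof
      assume "(\<Prod>s\<in>C - {x}. x - s) \<in> p"
      then obtain s where "s \<in> C - {x}" "x - s \<in> p"
        using prime_set_prod_Bex[OF OK p_prime, of "C - {x}" "\<lambda>s. x - s"] C(1) xsOK by blast
      then show False using incong[OF x] by blast
    qed
    then obtain u where "u \<in> OK" "(\<Prod>s\<in>C - {x}. x - s) * u - 1 \<in> p"
      using p_maximal prodOK[OF x] unfolding maximal_set_def by blast
    then show ?thesis by (metis mult.commute)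
  qed
  then obtain u where u: "\<And>x. x \<in> C \<Longrightarrow> u x \<in> OK \<and> u x * (\<Prod>s\<in>C - {x}. x - s) - 1 \<in> p" by metis
  define \<epsilon> where "\<epsilon> x y = u x * (\<Prod>s\<in>C - {x}. y - s)" for x y
  have \<epsilon>OL: "\<epsilon> x y \<in> OL" if "x \<in> C" "y \<in> OL" for x y
    unfolding \<epsilon>_def using u[OF that(1)] that(2) C(2) OK_OL
    by (intro sr_mult[OF OL] sr_prod[OF OL] sr_diff[OF OL]) auto
  define e where "e = (\<Prod>r\<in>R. \<epsilon> (c r) r)"
  have rOL: "r \<in> OL" if "r \<in> R" for r using that R_OL by blast
  have eOL: "e \<in> OL" unfolding e_def using c rOL by (intro sr_prod[OF OL] \<epsilon>OL) auto
  have "e - 1 \<in> P"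
  proof -
    have "\<epsilon> (c r) r - 1 \<in> P" if r: "r \<in> R" for r
    proof -
      have cr: "c r \<in> C" "r - c r \<in> P" using c[OF r] by blast+
      have uOL: "u (c r) \<in> OL" using u[OF cr(1)] OK_OL by blast
      have sOL: "s \<in> OL" if "s \<in> C" for s using that C(2) OK_OL by blast
      have "(\<Prod>s\<in>C - {c r}. r - s) - (\<Prod>s\<in>C - {c r}. c r - s) \<in> P"
        using cr rOL[OF r] sOL C(1) by (intro id_prod_cong[OF OL I]) (auto intro!: sr_diff[OF OL])
      then have "u (c r) * ((\<Prod>s\<in>C - {c r}. r - s) - (\<Prod>s\<in>C - {c r}. c r - s)) \<in> P" by (rule id_mult[OF OL I uOL])
      moreover have "u (c r) * (\<Prod>s\<in>C - {c r}. c r - s) - 1 \<in> P" using u[OF cr(1)] over_p[OF P] by blast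
      ultimately have "u (c r) * ((\<Prod>s\<in>C - {c r}. r - s) - (\<Prod>s\<in>C - {c r}. c r - s)) + (u (c r) * (\<Prod>s\<in>C - {c r}. c r - s) - 1) \<in> P"
        by (rule id_add[OF OL I])
      then show ?thesis unfolding \<epsilon>_def by (simp add: algebra_simps)
    qed
    then have "(\<Prod>r\<in>R. \<epsilon> (c r) r) - (\<Prod>r\<in>R. 1) \<in> P"
      using c rOL by (intro id_prod_cong[OF OL I fin_R]) (auto intro!: \<epsilon>OL sr_one[OF OL])
    then show ?thesis by (simp add: e_def)
  qed
  moreover have "e * \<sigma> e \<in> ext_ideal" if s: "\<sigma> \<in> Gal" "\<sigma> \<noteq> id" for \<sigma>
  proof -
    obtain r where r: "r \<in> R" "\<sigma> r \<noteq> r" using Gal_eqI[OF s(1) id_Gal] s(2) by auto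
    define t where "t = \<sigma> r"
    have t: "t \<in> R" "t \<noteq> r" using Gal_root[OF s(1) r(1)] r(2) by (simp_all add: t_def)
    have cne: "c r \<noteq> c t" using inj_onD[OF inj] t r(1) by metis
    have crC: "c r \<in> C" "c t \<in> C" using c t r by blast+
    have fixC: "\<sigma> x = x" if "x \<in> OK" for x using Gal_fix[OF s(1)] that by (simp add: ints_def)
    have s\<epsilon>: "\<sigma> (\<epsilon> (c q) q) = \<epsilon> (c q) (\<sigma> q)" if q: "q \<in> R" for q
    proof -
      have qC: "c q \<in> C" using c[OF q] by blast
      have L1: "x \<in> L" if "x \<in> OL" for x using that by (simp add: ints_def)
      have diffL: "q - s \<in> L" if "s \<in> C" for s using rOL[OF q] that C(2) OK_OL by (intro L1 sr_diff[OF OL]) auto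
      have "\<sigma> (\<epsilon> (c q) q) = \<sigma> (u (c q)) * \<sigma> (\<Prod>s\<in>C - {c q}. q - s)"
        unfolding \<epsilon>_def using u[OF qC] OK_OL
        by (intro rh_mult[OF L' Gal_hom[OF s(1)] L1 sr_prod[OF L' diffL]]) auto
      also have "\<sigma> (\<Prod>s\<in>C - {c q}. q - s) = (\<Prod>s\<in>C - {c q}. \<sigma> (q - s))"
        using diffL by (intro rh_prod[OF L' Gal_hom[OF s(1)]]) auto
      also have "\<dots> = (\<Prod>s\<in>C - {c q}. \<sigma> q - s)"
      proof (rule prod.cong[OF refl])
        fix x assume "x \<in> C - {c q}"
        then have x: "x \<in> OK" using C(2) by blast
        then show "\<sigma> (q - x) = \<sigma> q - x" using Gal_on_OL(3)[OF s(1) rOL[OF q], of x] OK_OL fixC[OF x] by auto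
      qed
      finally show ?thesis unfolding \<epsilon>_def using fixC u[OF qC] by simp
    qed
    have "\<sigma> e = (\<Prod>q\<in>R. \<sigma> (\<epsilon> (c q) q))"
      unfolding e_def
    proof (rule rh_prod[OF L' Gal_hom[OF s(1)]])
      fix i assume "i \<in> R"
      then have "\<epsilon> (c i) i \<in> OL" using c rOL by (intro \<epsilon>OL) auto
      then show "\<epsilon> (c i) i \<in> L" by (simp add: ints_def)
    qed
    also have "\<dots> = (\<Prod>q\<in>R. \<epsilon> (c q) (\<sigma> q))" by (rule prod.cong) (simp_all add: s\<epsilon>)
    also have "\<dots> = \<epsilon> (c r) t * (\<Prod>q\<in>R - {r}. \<epsilon> (c q) (\<sigma> q))" unfolding t_def by (rule prod.remove[OF fin_R r(1)])
    finally have se: "\<sigma> e = \<epsilon> (c r) t * (\<Prod>q\<in>R - {r}. \<epsilon> (c q) (\<sigma> q))" .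
    have ee: "e = \<epsilon> (c t) t * (\<Prod>q\<in>R - {t}. \<epsilon> (c q) q)" unfolding e_def by (rule prod.remove[OF fin_R t(1)])
    have factor: "\<epsilon> (c t) t * \<epsilon> (c r) t = (\<Prod>x\<in>C. t - x) * (u (c t) * u (c r) * (\<Prod>x\<in>C - {c r} - {c t}. t - x))"
    proof -
      have a: "(\<Prod>x\<in>C. t - x) = (t - c t) * (\<Prod>x\<in>C - {c t}. t - x)" by (rule prod.remove[OF C(1) crC(2)])
      have b: "(\<Prod>x\<in>C - {c r}. t - x) = (t - c t) * (\<Prod>x\<in>C - {c r} - {c t}. t - x)"
        by (rule prod.remove) (use C(1) crC cne in auto)
      show ?thesis unfolding \<epsilon>_def a b by (simp add: mult_ac)
    qed
    have tOL: "t - x \<in> OL" if "x \<in> C" for x using rOL[OF t(1)] that C(2) OK_OL by (intro sr_diff[OF OL]) auto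
    have rest: "u (c t) * u (c r) * (\<Prod>x\<in>C - {c r} - {c t}. t - x) \<in> OL"
      using u[OF crC(1)] u[OF crC(2)] OK_OL tOL by (intro sr_mult[OF OL] sr_prod[OF OL]) auto
    have "\<epsilon> (c t) t * \<epsilon> (c r) t \<in> ext_ideal" unfolding factor by (rule id_mult'[OF OL Q rest Fr[OF t(1)]])
    moreover have "(\<Prod>q\<in>R - {t}. \<epsilon> (c q) q) * (\<Prod>q\<in>R - {r}. \<epsilon> (c q) (\<sigma> q)) \<in> OL"
      using c rOL Gal_OL[OF s(1)] by (intro sr_mult[OF OL] sr_prod[OF OL] \<epsilon>OL) auto
    ultimately have "(\<epsilon> (c t) t * \<epsilon> (c r) t) * ((\<Prod>q\<in>R - {t}. \<epsilon> (c q) q) * (\<Prod>q\<in>R - {r}. \<epsilon> (c q) (\<sigma> q))) \<in> ext_ideal"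
      by (rule id_mult'[OF OL Q, rotated])
    moreover have "e * \<sigma> e = (\<epsilon> (c t) t * \<epsilon> (c r) t) * ((\<Prod>q\<in>R - {t}. \<epsilon> (c q) q) * (\<Prod>q\<in>R - {r}. \<epsilon> (c q) (\<sigma> q)))"
      by (subst se, subst ee) (simp only: mult_ac)
    ultimately show ?thesis by simp
  qed
  ultimately show ?thesis using that eOL by blast
qed

text \<open>The trace of \<open>e\<close> is \<open>1\<close> modulo \<open>p\<close>, so \<open>e\<close> is idempotent modulo the extended ideal. If all conjugates of \<open>x\<close> lie in \<open>P\<close>,
  the trace of \<open>x e\<close> lies in \<open>p\<close>; multiplied by \<open>e\<close> it leaves only \<open>x e\<close>. So \<open>x e\<close>, and likewise \<open>x \<sigma>(e)\<close> for
  every \<open>\<sigma>\<close>, lies in the extended ideal, and the sum over \<open>\<sigma>\<close> is \<open>x\<close> modulo this ideal.\<close>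

lemma orthogonal_imp:
  assumes P: "lies_over P" and e: "e \<in> OL" "e - 1 \<in> P"
    and orth: "\<And>\<sigma>. \<sigma> \<in> Gal \<Longrightarrow> \<sigma> \<noteq> id \<Longrightarrow> e * \<sigma> e \<in> ext_ideal"
  shows trivial_decomposition: "\<And>\<sigma>. \<sigma> \<in> Gal \<Longrightarrow> \<sigma> ` P = P \<Longrightarrow> \<sigma> = id"
    and Inter_conjugates: "\<And>x. x \<in> OL \<Longrightarrow> (\<And>\<sigma>. \<sigma> \<in> Gal \<Longrightarrow> \<sigma> x \<in> P) \<Longrightarrow> x \<in> ext_ideal"
proof -
  note I = over_ideal[OF P] and Q = ext_ideal_ideal
  have e_nin: "e \<notin> P"
  proof
    assume "e \<in> P"
    then have "1 \<in> P" using e(2) id_diff[OF OL I, of e "e - 1"] by simp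
    then show False using prime_set_one[OF over_prime[OF P]] by simp
  qed
  have se: "\<sigma> e \<in> P" if s: "\<sigma> \<in> Gal" "\<sigma> \<noteq> id" for \<sigma>
    using prime_setD[OF over_prime[OF P] e(1) Gal_OL[OF s(1) e(1)]] orth[OF s] over_ext_ideal[OF P] e_nin by blast
  show "\<sigma> = id" if s: "\<sigma> \<in> Gal" "\<sigma> ` P = P" for \<sigma>
  proof (rule ccontr)
    assume "\<sigma> \<noteq> id"
    then have "\<sigma> e \<in> P" by (rule se[OF s(1)])
    moreover have "\<sigma> (e - 1) \<in> P" using s(2) e(2) by blast
    then have "\<sigma> e - 1 \<in> P" using Gal_on_OL(3)[OF s(1) e(1) sr_one[OF OL]] Gal_on_OL(4)[OF s(1) e(1) e(1)] by simp
    ultimately have "1 \<in> P" using id_diff[OF OL I, of "\<sigma> e" "\<sigma> e - 1"] by simp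
    then show False using prime_set_one[OF over_prime[OF P]] by simp
  qed
  have Tr_split: "Tr x = x + (\<Sum>\<sigma>\<in>Gal - {id}. \<sigma> x)" for x
    unfolding Tr_def using sum.remove[OF finite_Gal id_Gal, of "\<lambda>\<sigma>. \<sigma> x"] by simp
  have "Tr e - 1 = (e - 1) + (\<Sum>\<sigma>\<in>Gal - {id}. \<sigma> e)" unfolding Tr_split by simp
  also have "\<dots> \<in> P" by (intro id_add[OF OL I] e(2) id_sum[OF OL I]) (use se in blast)
  finally have TrP: "Tr e - 1 \<in> P" .
  have "Tr e - 1 \<in> OK" by (intro sr_diff[OF OK] sr_one[OF OK] Tr_OK e)
  then have TrQ: "Tr e - 1 \<in> ext_ideal" using over_OK[OF P _ TrP] p_ext_ideal by blast
  have idem: "e * e - e \<in> ext_ideal"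
  proof -
    have "e * (Tr e - 1) - (\<Sum>\<sigma>\<in>Gal - {id}. e * \<sigma> e) \<in> ext_ideal"
      by (intro id_diff[OF OL Q] id_mult[OF OL Q e(1) TrQ] id_sum[OF OL Q]) (use orth in blast)
    moreover have "e * (Tr e - 1) - (\<Sum>\<sigma>\<in>Gal - {id}. e * \<sigma> e) = e * e - e"
      unfolding Tr_split by (simp add: algebra_simps sum_distrib_left)
    ultimately show ?thesis by simp
  qed
  have xe: "x * e \<in> ext_ideal" if x: "x \<in> OL" "\<And>\<sigma>. \<sigma> \<in> Gal \<Longrightarrow> \<sigma> x \<in> P" for x
  proof -
    have xeOL: "x * e \<in> OL" by (rule sr_mult[OF OL x(1) e(1)])
    have "Tr (x * e) \<in> P" unfolding Tr_def
    proof (rule id_sum[OF OL I])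
      fix \<sigma> assume s: "\<sigma> \<in> Gal"
      show "\<sigma> (x * e) \<in> P" unfolding Gal_on_OL(2)[OF s x(1) e(1)] by (rule id_mult'[OF OL I Gal_OL[OF s e(1)] x(2)[OF s]])
    qed
    then have "Tr (x * e) \<in> ext_ideal" using over_OK[OF P Tr_OK[OF xeOL]] p_ext_ideal by blast
    then have 1: "e * Tr (x * e) \<in> ext_ideal" by (rule id_mult[OF OL Q e(1)])
    have 2: "(\<Sum>\<sigma>\<in>Gal - {id}. e * \<sigma> (x * e)) \<in> ext_ideal"
    proof (rule id_sum[OF OL Q])
      fix \<sigma> assume "\<sigma> \<in> Gal - {id}"
      then have s: "\<sigma> \<in> Gal" "\<sigma> \<noteq> id" by auto
      have "\<sigma> x * (e * \<sigma> e) \<in> ext_ideal" by (rule id_mult[OF OL Q Gal_OL[OF s(1) x(1)] orth[OF s]])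
      then show "e * \<sigma> (x * e) \<in> ext_ideal" unfolding Gal_on_OL(2)[OF s(1) x(1) e(1)] by (simp add: mult_ac)
    qed
    have 3: "x * (e * e - e) \<in> ext_ideal" by (rule id_mult[OF OL Q x(1) idem])
    have "e * Tr (x * e) - (\<Sum>\<sigma>\<in>Gal - {id}. e * \<sigma> (x * e)) - x * (e * e - e) \<in> ext_ideal"
      by (intro id_diff[OF OL Q] 1 2 3)
    moreover have "e * Tr (x * e) - (\<Sum>\<sigma>\<in>Gal - {id}. e * \<sigma> (x * e)) - x * (e * e - e) = x * e"
      unfolding Tr_split by (simp add: algebra_simps sum_distrib_left)
    ultimately show ?thesis by simp
  qed
  show "x \<in> ext_ideal" if x: "x \<in> OL" "\<And>\<sigma>. \<sigma> \<in> Gal \<Longrightarrow> \<sigma> x \<in> P" for x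
  proof -
    have "x * \<tau> e \<in> ext_ideal" if t: "\<tau> \<in> Gal" for \<tau>
    proof -
      obtain \<rho> where r: "\<rho> \<in> Gal" "\<rho> \<circ> \<tau> = id" "\<tau> \<circ> \<rho> = id" by (rule inv_Gal[OF t])
      have rx: "\<rho> x \<in> OL" by (rule Gal_OL[OF r(1) x(1)])
      have "\<rho> x * e \<in> ext_ideal"
      proof (rule xe[OF rx])
        fix \<sigma> assume "\<sigma> \<in> Gal"
        then show "\<sigma> (\<rho> x) \<in> P" using x(2)[OF comp_Gal[OF _ r(1)], of \<sigma>] by simp
      qed
      then have "\<tau> (\<rho> x * e) \<in> ext_ideal" by (rule Gal_ext_ideal[OF t])
      moreover have "\<tau> (\<rho> x) = x" using fun_cong[OF r(3), of x] by simp
      ultimately show ?thesis unfolding Gal_on_OL(2)[OF t rx e(1)] by simp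
    qed
    then have "(\<Sum>\<tau>\<in>Gal. x * \<tau> e) \<in> ext_ideal" by (intro id_sum[OF OL Q])
    then have "x * Tr e \<in> ext_ideal" by (simp add: Tr_def sum_distrib_left)
    moreover have "x * (Tr e - 1) \<in> ext_ideal" by (rule id_mult[OF OL Q x(1) TrQ])
    ultimately have "x * Tr e - x * (Tr e - 1) \<in> ext_ideal" by (rule id_diff[OF OL Q])
    then show ?thesis by (simp add: algebra_simps)
  qed
qed

end

section \<open>Splitting of primes in terms of congruences\<close>

lemma ring_of_integers_eq: "ring_of_integers L = ambient\<lparr>carrier := ints L\<rparr>"
  by (simp add: ring_of_integers_def ints_def)

lemma sub_ambient_simps:
  "carrier (ambient\<lparr>carrier := S\<rparr>) = (S :: 'b::field set)" "x \<otimes>\<^bsub>ambient\<lparr>carrier := S\<rparr>\<^esub> y = x * y"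
  "x \<oplus>\<^bsub>ambient\<lparr>carrier := S\<rparr>\<^esub> y = x + y" "\<one>\<^bsub>ambient\<lparr>carrier := S\<rparr>\<^esub> = 1" "\<zero>\<^bsub>ambient\<lparr>carrier := S\<rparr>\<^esub> = 0"
  by (simp_all add: ring_of_type_algebra_def)

lemma cring_sub_ambient:
  assumes S: "subring_set (S :: 'b::field set)" shows "cring (ambient\<lparr>carrier := S\<rparr>)"
proof (rule cringI)
  show "abelian_group (ambient\<lparr>carrier := S\<rparr>)"
  proof (rule abelian_groupI, unfold sub_ambient_simps)
    fix x assume "x \<in> S"
    then show "\<exists>y\<in>S. y + x = 0" using sr_uminus[OF S] by (intro bexI[of _ "- x"]) auto
  qed (auto intro: sr_closed[OF S])
  show "Group.comm_monoid (ambient\<lparr>carrier := S\<rparr>)"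
    by (rule comm_monoidI, unfold sub_ambient_simps) (auto intro: sr_closed[OF S])
qed (unfold sub_ambient_simps, simp add: algebra_simps)

lemma ideal_iff_ideal_set:
  assumes S: "subring_set (S :: 'b::field set)"
  shows "ideal I (ambient\<lparr>carrier := S\<rparr>) \<longleftrightarrow> ideal_set S I"
proof
  assume "ideal I (ambient\<lparr>carrier := S\<rparr>)"
  then interpret I: ideal I "ambient\<lparr>carrier := S\<rparr>" .
  show "ideal_set S I"
    using I.a_subset additive_subgroup.zero_closed[OF I.additive_subgroup_axioms]
      additive_subgroup.a_closed[OF I.additive_subgroup_axioms] I.I_l_closed
    by (simp add: ideal_set_def sub_ambient_simps ambient_simps)
next
  assume I: "ideal_set S I"
  interpret R: cring "ambient\<lparr>carrier := S\<rparr>" by (rule cring_sub_ambient[OF S])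
  note [simp] = sub_ambient_simps ambient_simps
  have IS: "x \<in> S" if "x \<in> I" for x using id_subset[OF S I that] .
  have neg: "\<ominus>\<^bsub>ambient\<lparr>carrier := S\<rparr>\<^esub> x = - x" if "x \<in> S" for x
    by (rule R.minus_equality) (use that sr_uminus[OF S] in auto)
  show "ideal I (ambient\<lparr>carrier := S\<rparr>)"
  proof (rule idealI)
    show "ring (ambient\<lparr>carrier := S\<rparr>)" by (rule R.ring_axioms)
    show "subgroup I (add_monoid (ambient\<lparr>carrier := S\<rparr>))"
    proof (rule R.add.subgroupI)
      show "I \<subseteq> carrier (ambient\<lparr>carrier := S\<rparr>)" using IS by auto
      show "I \<noteq> {}" using id_zero[OF S I] by auto
      show "\<ominus>\<^bsub>ambient\<lparr>carrier := S\<rparr>\<^esub> a \<in> I" if "a \<in> I" for a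
        unfolding neg[OF IS[OF that]] by (rule id_uminus[OF S I that])
      show "a \<oplus>\<^bsub>ambient\<lparr>carrier := S\<rparr>\<^esub> b \<in> I" if "a \<in> I" "b \<in> I" for a b
        using id_add[OF S I that] by simp
    qed
  qed (use id_mult[OF S I] id_mult'[OF S I] in auto)
qed

lemma primeideal_iff_prime_set:
  assumes S: "subring_set (S :: 'b::field set)"
  shows "primeideal I (ambient\<lparr>carrier := S\<rparr>) \<longleftrightarrow> prime_set S I"
proof
  assume "primeideal I (ambient\<lparr>carrier := S\<rparr>)"
  then interpret I: primeideal I "ambient\<lparr>carrier := S\<rparr>" .
  have "1 \<notin> I" using I.one_imp_carrier I.I_notcarr by (auto simp: sub_ambient_simps ambient_simps)
  moreover have "ideal_set S I" using I.is_ideal ideal_iff_ideal_set[OF S] by blast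
  ultimately show "prime_set S I" using I.I_prime by (simp add: prime_set_def sub_ambient_simps ambient_simps)
next
  assume P: "prime_set S I"
  show "primeideal I (ambient\<lparr>carrier := S\<rparr>)"
  proof (rule primeidealI)
    show "ideal I (ambient\<lparr>carrier := S\<rparr>)" using prime_set_ideal[OF P] ideal_iff_ideal_set[OF S] by blast
    show "carrier (ambient\<lparr>carrier := S\<rparr>) \<noteq> I"
      using prime_set_one[OF P] sr_one[OF S] by (auto simp: sub_ambient_simps ambient_simps)
  qed (use cring_sub_ambient[OF S] prime_setD[OF P] in \<open>auto simp: sub_ambient_simps ambient_simps\<close>)
qed

lemma foldr_ideal_prod_subset:
  assumes R: "cring R" and "\<And>P. P \<in> set Ps \<Longrightarrow> ideal P R"
  shows "ideal (foldr (ideal_prod R) Ps (carrier R)) R \<and> (\<forall>P\<in>set Ps. foldr (ideal_prod R) Ps (carrier R) \<subseteq> P)"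
proof -
  interpret R: cring R by (rule R)
  show ?thesis using assms(2)
  proof (induction Ps)
    case Nil show ?case using R.oneideal by simp
  next
    case (Cons P Ps)
    define J where "J = foldr (ideal_prod R) Ps (carrier R)"
    have J: "ideal J R" "\<And>P. P \<in> set Ps \<Longrightarrow> J \<subseteq> P" using Cons unfolding J_def by auto
    have P: "ideal P R" using Cons.prems by simp
    have "ideal_prod R P J \<subseteq> P \<inter> J" by (rule R.ideal_prod_inter[OF P J(1)])
    then show ?case using R.ideal_prod_is_ideal[OF P J(1)] J(2) by (auto simp flip: J_def)
  qed
qed

text \<open>Each ideal is comaximal to the intersection of the later ones, so the product with this intersection is an intersection.\<close>

lemma foldr_ideal_prod_maximal:
  assumes S: "subring_set (S :: 'b::field set)"
  shows "distinct Ps \<Longrightarrow> (\<And>P. P \<in> set Ps \<Longrightarrow> maximal_set S P) \<Longrightarrow>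
    foldr (ideal_prod (ambient\<lparr>carrier := S\<rparr>)) Ps S = {x \<in> S. \<forall>P\<in>set Ps. x \<in> P}"
proof (induction Ps)
  case (Cons P Ps)
  interpret R: cring "ambient\<lparr>carrier := S\<rparr>" by (rule cring_sub_ambient[OF S])
  let ?R = "ambient\<lparr>carrier := S\<rparr>"
  define J where "J = {x \<in> S. \<forall>P\<in>set Ps. x \<in> P}"
  have J: "foldr (ideal_prod ?R) Ps S = J" using Cons by (simp add: J_def)
  have max: "maximal_set S P" using Cons.prems by simp
  have idl: "ideal Q ?R" if "Q \<in> set (P # Ps)" for Q
    using maximal_set_ideal[OF Cons.prems(2)[OF that]] ideal_iff_ideal_set[OF S] by blast
  have JI: "ideal J ?R"
    using foldr_ideal_prod_subset[OF R.is_cring, of Ps] idl J by (simp add: sub_ambient_simps)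
  have PI: "ideal P ?R" using idl by simp
  have iP: "ideal_set S P" by (rule maximal_set_ideal[OF max])
  have nin: "P \<notin> set Ps" using Cons.prems by simp
  have mx: "\<And>Q. Q \<in> set Ps \<Longrightarrow> maximal_set S Q" using Cons.prems by simp
  obtain e where e: "e \<in> S" "\<And>Q. Q \<in> set Ps \<Longrightarrow> e \<in> Q" "e - 1 \<in> P"
    using crt_finite[OF S max finite_set mx nin] by metis
  have eJ: "e \<in> J" using e by (simp add: J_def)
  have iJ: "ideal_set S J" using JI ideal_iff_ideal_set[OF S] by blast
  have "P <+>\<^bsub>?R\<^esub> J = carrier ?R"
  proof
    show "P <+>\<^bsub>?R\<^esub> J \<subseteq> carrier ?R"
      unfolding set_add_def' sub_ambient_simps using id_subset[OF S iP] id_subset[OF S iJ] by (auto intro: sr_add[OF S])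
    show "carrier ?R \<subseteq> P <+>\<^bsub>?R\<^esub> J"
    proof
      fix x assume "x \<in> carrier ?R"
      then have x: "x \<in> S" by (simp add: sub_ambient_simps)
      have "x * (1 - e) \<in> P" using id_mult[OF S iP x, of "1 - e"] id_diff_commute[OF S iP, of e 1] e(3) by blast
      moreover have "x * e \<in> J" by (rule id_mult[OF S iJ x eJ])
      moreover have "x = x * (1 - e) + x * e" by (simp add: algebra_simps)
      ultimately show "x \<in> P <+>\<^bsub>?R\<^esub> J" unfolding set_add_def' sub_ambient_simps by blast
    qed
  qed
  from R.ideal_prod_eq_inter[OF PI JI this] have "foldr (ideal_prod ?R) (P # Ps) S = P \<inter> J" by (simp add: J)
  then show ?case using id_subset[OF S iP] by (auto simp: J_def)
qed simp

context integral_splitting_field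
begin

lemma genideal_p: "Idl\<^bsub>ring_of_integers L\<^esub> p = ext_ideal"
  unfolding genideal_def ext_ideal_def ring_of_integers_eq ideal_iff_ideal_set[OF OL] ..

text \<open>All listed primes are conjugates of the first, and there are as many of them as automorphisms; so different
  automorphisms move the first prime to different places.\<close>

lemma splits_completely_imp_trivial:
  assumes "splits_completely K L p"
  obtains P where "lies_over P" "\<And>\<sigma>. \<sigma> \<in> Gal \<Longrightarrow> \<sigma> ` P = P \<Longrightarrow> \<sigma> = id"
proof -
  let ?R = "ambient\<lparr>carrier := OL\<rparr>"
  obtain Ps where Ps': "distinct Ps \<and> length Ps = card Gal \<and> (\<forall>P\<in>set Ps. primeideal P ?R) \<and>
      ext_ideal = foldr (ideal_prod ?R) Ps (carrier ?R)"
    using assms[unfolded splits_completely_def Let_def genideal_p dim_eq_card_Gal, unfolded ring_of_integers_eq]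
    by (rule exE)
  then have Ps: "distinct Ps" "length Ps = card Gal" "\<And>P. P \<in> set Ps \<Longrightarrow> primeideal P ?R"
    "ext_ideal = foldr (ideal_prod ?R) Ps (carrier ?R)" by simp_all
  have prime: "prime_set OL P" if "P \<in> set Ps" for P
    using Ps(3)[OF that] primeideal_iff_prime_set[OF OL] by blast
  have idl: "ideal P ?R" if "P \<in> set Ps" for P using prime_set_ideal[OF prime[OF that]] ideal_iff_ideal_set[OF OL] by blast
  have sub: "ext_ideal \<subseteq> P" if "P \<in> set Ps" for P
    unfolding Ps(4)
    by (rule bspec[OF conjunct2[OF foldr_ideal_prod_subset[OF cring_sub_ambient[OF OL] idl]] that])
  have lies: "lies_over P" if "P \<in> set Ps" for P
    unfolding lies_over_def using prime[OF that] sub[OF that] p_ext_ideal by blast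
  have "card Gal > 0" using finite_Gal id_Gal by (auto simp: card_gt_0_iff)
  then have "Ps \<noteq> []" using Ps(2) by auto
  then have P0: "Ps ! 0 \<in> set Ps" by simp
  let ?P = "Ps ! 0"
  have "set Ps \<subseteq> (\<lambda>\<sigma>. \<sigma> ` ?P) ` Gal"
  proof
    fix Q assume "Q \<in> set Ps"
    then obtain \<sigma> where "\<sigma> \<in> Gal" "Q = \<sigma> ` ?P" by (rule Gal_transitive[OF lies[OF P0] lies])
    then show "Q \<in> (\<lambda>\<sigma>. \<sigma> ` ?P) ` Gal" by (intro image_eqI[of Q _ \<sigma>])
  qed
  then have "card Gal \<le> card ((\<lambda>\<sigma>. \<sigma> ` ?P) ` Gal)"
    using card_mono[OF finite_imageI[OF finite_Gal]] distinct_card[OF Ps(1)] Ps(2) by metis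
  then have inj: "inj_on (\<lambda>\<sigma>. \<sigma> ` ?P) Gal"
    using card_image_le[OF finite_Gal, of "\<lambda>\<sigma>. \<sigma> ` ?P"] by (intro eq_card_imp_inj_on[OF finite_Gal]) simp
  show ?thesis
  proof (rule that[OF lies[OF P0]])
    fix \<sigma> assume "\<sigma> \<in> Gal" "\<sigma> ` ?P = ?P"
    then show "\<sigma> = id" using inj_onD[OF inj _ _ id_Gal, of \<sigma>] by simp
  qed
qed

lemma splits_completely_imp_congruence:
  assumes "splits_completely K L p"
  obtains c where "\<And>r. r \<in> R \<Longrightarrow> c r \<in> OK" "\<And>i. coeff (f - (\<Prod>r\<in>R. [:- c r, 1:])) i \<in> p"
proof -
  show ?thesis
  proof (rule splits_completely_imp_trivial[OF assms])
    fix P assume P: "lies_over P" and triv: "\<And>\<sigma>. \<sigma> \<in> Gal \<Longrightarrow> \<sigma> ` P = P \<Longrightarrow> \<sigma> = id"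
    show ?thesis
    proof (rule trivial_decomposition_imp_split[OF P])
      show "\<sigma> = id" if "\<sigma> \<in> Gal" "\<sigma> ` P = P" for \<sigma> using that by (rule triv)
      fix c assume "\<And>r. r \<in> R \<Longrightarrow> c r \<in> OK" "\<And>i. coeff (f - (\<Prod>r\<in>R. [:- c r, 1:])) i \<in> p"
      then show ?thesis by (rule that)
    qed
  qed
qed

lemma congruence_imp_splits_completely:
  assumes C: "finite C" "C \<subseteq> OK" "card C = card R"
    and cong: "\<And>i. coeff (f - (\<Prod>c\<in>C. [:- c, 1:])) i \<in> p"
    and incong: "\<And>c d. c \<in> C \<Longrightarrow> d \<in> C \<Longrightarrow> c - d \<in> p \<Longrightarrow> c = d"
  shows "splits_completely K L p"
proof -
  let ?R = "ambient\<lparr>carrier := OL\<rparr>"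
  obtain P where P: "lies_over P" by (rule exists_prime_over)
  obtain e where e: "e \<in> OL" "e - 1 \<in> P" "\<And>\<sigma>. \<sigma> \<in> Gal \<Longrightarrow> \<sigma> \<noteq> id \<Longrightarrow> e * \<sigma> e \<in> ext_ideal"
    using split_imp_orthogonal[OF C cong _ P] incong by metis
  have triv: "\<sigma> = id" if "\<sigma> \<in> Gal" "\<sigma> ` P = P" for \<sigma>
    by (rule trivial_decomposition[OF P e(1,2) _ that]) (rule e(3))
  have inter: "x \<in> ext_ideal" if "x \<in> OL" "\<And>\<sigma>. \<sigma> \<in> Gal \<Longrightarrow> \<sigma> x \<in> P" for x
  proof (rule Inter_conjugates[OF P e(1,2)])
    show "e * \<sigma> e \<in> ext_ideal" if "\<sigma> \<in> Gal" "\<sigma> \<noteq> id" for \<sigma> using that by (rule e(3))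
  qed (fact that)+
  obtain gs where gs: "set gs = Gal" "distinct gs" using finite_distinct_list[OF finite_Gal] by blast
  define Ps where "Ps = map (\<lambda>\<sigma>. \<sigma> ` P) gs"
  have "inj_on (\<lambda>\<sigma>. \<sigma> ` P) Gal"
  proof (rule inj_onI)
    fix \<sigma> \<tau> assume s: "\<sigma> \<in> Gal" and t: "\<tau> \<in> Gal" and eq: "\<sigma> ` P = \<tau> ` P"
    obtain \<rho> where r: "\<rho> \<in> Gal" "\<rho> \<circ> \<tau> = id" "\<tau> \<circ> \<rho> = id" by (rule inv_Gal[OF t])
    have "(\<rho> \<circ> \<sigma>) ` P = (\<rho> \<circ> \<tau>) ` P" unfolding image_comp[symmetric] eq ..
    then have "\<rho> \<circ> \<sigma> = id" using triv[OF comp_Gal[OF r(1) s]] r(2) by simp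
    then have "\<tau> \<circ> (\<rho> \<circ> \<sigma>) = \<tau>" by simp
    then show "\<sigma> = \<tau>" using r(3) by (simp flip: comp_assoc)
  qed
  then have d: "distinct Ps" using gs by (simp add: Ps_def distinct_map)
  have lies: "lies_over Q" if "Q \<in> set Ps" for Q
    using that gs over_image[OF _ P] by (auto simp: Ps_def)
  have "ext_ideal = {x \<in> OL. \<forall>Q\<in>set Ps. x \<in> Q}"
  proof (intro equalityI subsetI)
    fix x assume "x \<in> ext_ideal"
    then show "x \<in> {x \<in> OL. \<forall>Q\<in>set Ps. x \<in> Q}"
      using id_subset[OF OL ext_ideal_ideal, of x] over_ext_ideal[OF lies] by blast
  next
    fix x assume x: "x \<in> {x \<in> OL. \<forall>Q\<in>set Ps. x \<in> Q}"
    show "x \<in> ext_ideal"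
    proof (rule inter)
      show "x \<in> OL" using x by simp
      fix \<sigma> assume "\<sigma> \<in> Gal"
      then obtain \<rho> where r: "\<rho> \<in> Gal" "\<rho> \<circ> \<sigma> = id" "\<sigma> \<circ> \<rho> = id" by (rule inv_Gal)
      have "\<rho> ` P \<in> set Ps" using r(1) gs by (simp add: Ps_def)
      then have "x \<in> \<rho> ` P" using x by blast
      then show "\<sigma> x \<in> P" unfolding mem_image_Gal[OF r(3,2)] .
    qed
  qed
  also have "\<dots> = foldr (ideal_prod ?R) Ps OL"
    by (rule foldr_ideal_prod_maximal[OF OL d over_maximal[OF lies], symmetric])
  finally have "ext_ideal = foldr (ideal_prod ?R) Ps (carrier ?R)" by (simp add: sub_ambient_simps)
  moreover have "length Ps = card Gal" using gs distinct_card[of gs] by (simp add: Ps_def)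
  moreover have "\<forall>Q\<in>set Ps. primeideal Q ?R" using over_prime[OF lies] primeideal_iff_prime_set[OF OL] by simp
  ultimately have "distinct Ps \<and> length Ps = card Gal \<and> (\<forall>P\<in>set Ps. primeideal P (ring_of_integers L)) \<and>
      ext_ideal = foldr (ideal_prod (ring_of_integers L)) Ps (carrier (ring_of_integers L))"
    unfolding ring_of_integers_eq using d by simp
  then show ?thesis unfolding splits_completely_def Let_def genideal_p dim_eq_card_Gal by (rule exI)
qed

end

section \<open>Finiteness of the residue field\<close>

lemma common_denominator:
  "set ks \<subseteq> (\<rat> :: 'a::field_char_0 set) \<Longrightarrow> \<exists>D::int. D \<noteq> 0 \<and> (\<forall>k\<in>set ks. of_int D * k \<in> \<int>)"
proof (induction ks)
  case Nil show ?case by (intro exI[of _ 1]) simp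
next
  case (Cons k ks)
  then obtain D :: int where D: "D \<noteq> 0" "\<And>k. k \<in> set ks \<Longrightarrow> of_int D * k \<in> \<int>" by auto
  have "k \<in> \<rat>" using Cons.prems by simp
  then obtain a b :: int where ab: "b > 0" "k = of_int a / of_int b" by (auto elim!: Rats_cases')
  have "of_int (D * b) * k = of_int (D * a)" using ab by simp
  then have "of_int (D * b) * k \<in> \<int>" by (metis Ints_of_int)
  moreover have "of_int (D * b) * l \<in> \<int>" if "l \<in> set ks" for l
    using Ints_mult[OF Ints_of_int[of b] D(2)[OF that]] by (simp add: mult_ac)
  ultimately show ?case using D(1) ab(1) by (intro exI[of _ "D * b"]) auto
qed

text \<open>The powers of \<open>x\<close> up to the dimension are linearly dependent over \<open>\<rat>\<close>; denominators are cleared.\<close>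

lemma number_field_bounded_degree:
  assumes K: "number_field (K :: 'a::field_char_0 set)"
  obtains n where "\<And>x. x \<in> K \<Longrightarrow> \<exists>q::int poly. q \<noteq> 0 \<and> degree q \<le> n \<and> poly (map_poly of_int q) x = 0"
proof -
  interpret A: field "ambient :: 'a ring" by rule
  have sK: "subfield_set K" using K subfield_ambientD by (auto simp: number_field_def)
  note K' = subfield_imp_subring[OF sK]
  have Q: "subfield (\<rat> :: 'a set) ambient"
    by (rule subfield_ambientI) (auto simp: subfield_set_def subring_set_def)
  obtain n where n: "A.dimension n \<rat> K" using K unfolding number_field_def A.finite_dimension_def by blast
  show ?thesis
  proof (rule that[of n])
    fix x assume x: "x \<in> K"
    let ?Us = "map (\<lambda>i. x ^ i) [0..<Suc n]"
    have Us: "set ?Us \<subseteq> K" using x by (auto intro: sr_power[OF K'])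
    have "\<not> A.independent \<rat> ?Us"
    proof
      assume "A.independent \<rat> ?Us"
      from A.independent_length_le_dimension[OF Q n this Us] show False by simp
    qed
    then have "A.dependent \<rat> ?Us" by simp
    from A.dependent_imp_non_trivial_combine[OF Q _ this]
    obtain Ks where Ks: "length Ks = Suc n" "A.combine Ks ?Us = 0" "set Ks \<subseteq> \<rat>" "set Ks \<noteq> {0}"
      by (auto simp: ambient_simps)
    obtain D :: int where D: "D \<noteq> 0" "\<And>k. k \<in> set Ks \<Longrightarrow> of_int D * k \<in> \<int>" using common_denominator[OF Ks(3)] by blast
    then have "\<forall>k\<in>set Ks. \<exists>m. of_int m = of_int D * k" by (metis Ints_cases)
    then obtain m :: "'a \<Rightarrow> int" where m: "\<And>k. k \<in> set Ks \<Longrightarrow> of_int (m k) = of_int D * k" by metis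
    define q where "q = Poly (map m Ks)"
    have cq: "coeff q i = (if i < Suc n then m (Ks ! i) else 0)" for i
      using Ks(1) by (simp add: q_def nth_default_def)
    have dq: "degree q \<le> n" by (rule degree_le) (simp add: cq)
    have "poly (map_poly of_int q) x = (\<Sum>i\<le>n. coeff (map_poly of_int q) i * x ^ i)"
      unfolding poly_altdef using degree_map_poly_le[of "of_int :: int \<Rightarrow> 'a" q] dq
      by (intro sum.mono_neutral_left) (auto simp: coeff_eq_0)
    also have "\<dots> = (\<Sum>i<Suc n. of_int D * (Ks ! i * x ^ i))"
      unfolding lessThan_Suc_atMost[symmetric]
      by (rule sum.cong) (use Ks(1) in \<open>auto simp: coeff_map_poly cq m mult_ac\<close>)
    also have "\<dots> = of_int D * A.combine Ks ?Us"
      unfolding ambient_combine sum_distrib_left using Ks(1) by (intro sum.cong) (auto simp del: upt_Suc)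
    also have "\<dots> = 0" using Ks(2) by simp
    finally have root: "poly (map_poly of_int q) x = 0" .
    have "q \<noteq> 0"
    proof
      assume "q = 0"
      then have "m (Ks ! i) = 0" if "i < Suc n" for i using cq[of i] that by simp
      then have "k = 0" if "k \<in> set Ks" for k
        using m[OF that] D(1) that Ks(1) by (auto simp: in_set_conv_nth)
      then have "set Ks \<subseteq> {0}" by blast
      moreover have "set Ks \<noteq> {}" using Ks(1) by auto
      ultimately have "set Ks = {0}" using subset_singletonD by metis
      then show False using Ks(4) by simp
    qed
    then show "\<exists>q::int poly. q \<noteq> 0 \<and> degree q \<le> n \<and> poly (map_poly of_int q) x = 0" using dq root by blast
  qed
qed

lemma finite_bounded_polys:
  assumes "finite F" shows "finite {h :: 'k::field poly. degree h \<le> n \<and> (\<forall>i. coeff h i \<in> F)}"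
proof -
  let ?H = "{h :: 'k poly. degree h \<le> n \<and> (\<forall>i. coeff h i \<in> F)}"
  have "?H \<subseteq> Poly ` {xs. set xs \<subseteq> F \<and> length xs = Suc n}"
  proof
    fix h assume h: "h \<in> ?H"
    have "h = Poly (map (coeff h) [0..<Suc n])"
      using h by (intro poly_eqI) (auto simp: nth_default_def coeff_eq_0 simp del: upt_Suc)
    then show "h \<in> Poly ` {xs. set xs \<subseteq> F \<and> length xs = Suc n}" using h by (intro image_eqI) auto
  qed
  then show ?thesis using finite_lists_length_eq[OF assms] finite_subset by blast
qed

text \<open>Elements of \<open>K\<close> satisfy primitive integral polynomials of bounded degree. A primitive polynomial stays nonzero in
  positive characteristic, and only finitely many polynomials of bounded degree have coefficients in the prime field.\<close>

lemma finite_residue_image: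
  fixes K :: "'a::field_char_0 set" and \<phi> :: "'a \<Rightarrow> 'k::field"
  assumes K: "number_field K" and hom: "ring_hom_on (ints K) \<phi>" and N: "N \<noteq> 0" "of_int N = (0 :: 'k)"
  shows "finite (\<phi> ` ints K)"
proof -
  have OK: "subring_set (ints K)" using K subfield_ambientD by (intro subring_ints) (auto simp: number_field_def)
  obtain n where n: "\<And>x. x \<in> K \<Longrightarrow> \<exists>q::int poly. q \<noteq> 0 \<and> degree q \<le> n \<and> poly (map_poly of_int q) x = 0"
    by (rule number_field_bounded_degree[OF K]) blast
  have "int CHAR('k) dvd N" using N(2) by (simp add: of_int_eq_0_iff_char_dvd)
  then have "CHAR('k) > 0" using N(1) by (cases "CHAR('k) = 0") auto
  then have char: "CHAR('k) > 1" using prime_CHAR_semidom[where ?'a = 'k] prime_gt_1_nat by blast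
  define F where "F = range (of_int :: int \<Rightarrow> 'k)"
  have "F \<subseteq> of_int ` {0..<int CHAR('k)}"
  proof
    fix y assume "y \<in> F"
    then obtain i where i: "y = of_int i" by (auto simp: F_def)
    have "int CHAR('k) dvd i - i mod int CHAR('k)" by (simp add: minus_mod_eq_mult_div)
    then have "of_int (i - i mod int CHAR('k)) = (0 :: 'k)" by (simp only: of_int_eq_0_iff_char_dvd)
    then have "of_int i = (of_int (i mod int CHAR('k)) :: 'k)" by (simp only: of_int_diff right_minus_eq)
    then show "y \<in> of_int ` {0..<int CHAR('k)}" using i char by (intro image_eqI[of _ _ "i mod int CHAR('k)"]) auto
  qed
  then have finF: "finite F" using finite_subset by blast
  define H where "H = {h :: 'k poly. degree h \<le> n \<and> (\<forall>i. coeff h i \<in> F)} - {0}"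
  have "\<phi> ` ints K \<subseteq> (\<Union>h\<in>H. {z. poly h z = 0})"
  proof (rule image_subsetI)
    fix x assume x: "x \<in> ints K"
    then obtain q :: "int poly" where q: "q \<noteq> 0" "degree q \<le> n" "poly (map_poly of_int q) x = 0"
      using n[of x] by (auto simp: ints_def)
    define h where "h = primitive_part q"
    have "q = smult (content q) h" by (simp add: h_def)
    then have "(map_poly of_int q :: 'a poly) = smult (of_int (content q)) (map_poly of_int h)"
      by (metis map_poly_smult of_int_0 of_int_mult)
    then have root: "poly (map_poly of_int h) x = 0" using q(1,3) by simp
    have hO: "map_poly of_int h \<in> polys_over (ints K)"
      by (simp add: polys_over_iff[OF OK] coeff_map_poly sr_of_int[OF OK])
    define hk where "hk = (map_poly of_int h :: 'k poly)"
    have "map_poly \<phi> (map_poly of_int h) = hk"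
      by (rule poly_eqI) (simp add: coeff_rh[OF OK hom] coeff_map_poly rh_of_int[OF OK hom] hk_def)
    then have "poly hk (\<phi> x) = 0" using rh_poly_eval[OF OK hom hO x] root rh_zero[OF OK hom] by simp
    moreover have "hk \<noteq> 0"
    proof
      assume "hk = 0"
      then have "of_int (coeff h i) = (0 :: 'k)" for i
      proof -
        have "coeff hk i = of_int (coeff h i)" by (simp only: hk_def coeff_map_poly of_int_0)
        then show ?thesis using \<open>hk = 0\<close> by simp
      qed
      then have "int CHAR('k) dvd coeff h i" for i by (simp add: of_int_eq_0_iff_char_dvd)
      then have "int CHAR('k) dvd content h" by (simp add: const_poly_dvd_iff_dvd_content[symmetric] const_poly_dvd_iff)
      then show False using char q(1) by (simp add: h_def)
    qed
    moreover have "degree hk \<le> n"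
      using degree_map_poly_le[of "of_int :: int \<Rightarrow> 'k" h] q(2) by (simp add: hk_def h_def)
    moreover have "coeff hk i \<in> F" for i by (simp add: hk_def F_def coeff_map_poly)
    ultimately show "\<phi> x \<in> (\<Union>h\<in>H. {z. poly h z = 0})" by (auto simp: H_def)
  qed
  moreover have "finite (\<Union>h\<in>H. {z. poly h z = 0})"
    using finite_bounded_polys[OF finF, of n] by (intro finite_UN_I) (auto simp: H_def poly_roots_finite)
  ultimately show ?thesis using finite_subset by blast
qed

section \<open>The splitting field of an irreducible polynomial\<close>

lemma poly_ring_simps:
  "carrier (poly_ring_over K) = polys_over K" "x \<otimes>\<^bsub>poly_ring_over K\<^esub> y = x * y" "\<one>\<^bsub>poly_ring_over K\<^esub> = 1"
  by (simp_all add: poly_ring_over_def ring_of_type_algebra_def)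

text \<open>The minimal polynomial of a common root of \<open>f\<close> and its derivative would divide both.\<close>

lemma irreducible_imp_separable:
  fixes K :: "'a::field_char_0 set"
  assumes K: "subfield_set K" and f: "f \<in> polys_over K" and irr: "ring_irreducible\<^bsub>poly_ring_over K\<^esub> f"
    and deg: "degree f > 0" and r: "poly f r = 0"
  shows "poly (pderiv f) r \<noteq> 0"
proof
  assume r': "poly (pderiv f) r = 0"
  note K' = subfield_imp_subring[OF K]
  have f0: "f \<noteq> 0" using deg by auto
  obtain m where m: "is_min_poly K r m" by (rule min_poly_exists[OF K f f0 r])
  have mK: "m \<in> polys_over K" using m by (simp add: is_min_poly_def)
  obtain q where q: "q \<in> polys_over K" "f = m * q" by (rule min_poly_dvd[OF K m f r])
  obtain q' where q': "pderiv f = m * q'" by (rule min_poly_dvd[OF K m po_pderiv[OF K' f] r'])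
  have "pderiv f \<noteq> 0" using deg by (auto simp: pderiv_eq_0_iff)
  then have "degree m \<le> degree (pderiv f)" using dvd_imp_degree_le[of m "pderiv f"] q' by simp
  then have lt: "degree m < degree f" using deg by (simp add: degree_pderiv)
  have "properfactor (poly_ring_over K) m f"
    unfolding properfactor_def factor_def poly_ring_simps
  proof (intro conjI notI)
    show "\<exists>c\<in>polys_over K. f = m * c" using q by blast
    assume "\<exists>c\<in>polys_over K. m = f * c"
    then obtain c where c: "m = f * c" by blast
    have "m \<noteq> 0" using q f0 by auto
    then have "degree f \<le> degree m" using c dvd_imp_degree_le[of f m] by simp
    then show False using lt by simp
  qed
  then have "m \<in> Units (poly_ring_over K)"
    using irr mK unfolding ring_irreducible_def irreducible_def poly_ring_simps by blast
  then obtain u where "u * m = 1" unfolding Units_def poly_ring_simps by blast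
  then have "m dvd 1" by (metis dvd_triv_right)
  then have "degree m = 0" by (simp add: poly_dvd_1)
  then show False using min_poly_degree_pos[OF m] by simp
qed

text \<open>Separability makes the list of roots in a factorisation free of repetitions.\<close>

lemma splitting_field_instance:
  fixes K L :: "'a::field_char_0 set"
  assumes K: "subfield_set K" and f: "f \<in> polys_over K" and irr: "ring_irreducible\<^bsub>poly_ring_over K\<^esub> f"
    and deg: "degree f > 0" and monic: "lead_coeff f = 1" and L: "splitting_field_of K f L"
  shows "splitting_field K L f {r. poly f r = 0}"
proof -
  obtain c rs where rs: "f = smult c (\<Prod>r\<leftarrow>rs. [:-r, 1:])" "set rs \<subseteq> L"
    and Leq: "L = generate_field ambient (K \<union> {r. poly f r = 0})"
    using L unfolding splitting_field_of_def by blast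
  have "lead_coeff (\<Prod>r\<leftarrow>rs. [:-r, 1:]) = (1 :: 'a)" by (induction rs) (simp_all add: lead_coeff_mult del: mult_pCons_left)
  then have "c = 1" using monic unfolding rs(1) lead_coeff_smult by simp
  then have fp: "f = (\<Prod>r\<leftarrow>rs. [:-r, 1:])" using rs(1) by simp
  have roots: "{r. poly f r = 0} = set rs" unfolding fp by (induction rs) auto
  have "distinct rs"
  proof (rule ccontr)
    assume "\<not> distinct rs"
    then obtain xs ys zs y where rs': "rs = xs @ [y] @ ys @ [y] @ zs" using not_distinct_decomp by blast
    define P where "P us = (\<Prod>r\<leftarrow>us. [:-r, 1:])" for us :: "'a list"
    have h: "f = P xs * ([:-y, 1:] * (P ys * ([:-y, 1:] * P zs)))"
      unfolding P_def fp rs'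
      by (simp only: map_append prod_list.append list.map prod_list.Cons prod_list.Nil mult_1_right mult.assoc)
    have "poly f y = 0" unfolding h poly_mult by simp
    moreover have "poly (pderiv f) y = 0" unfolding h pderiv_mult poly_mult poly_add by simp
    ultimately have "poly f y = 0 \<and> poly (pderiv f) y = 0" ..
    then show False using irreducible_imp_separable[OF K f irr deg] by blast
  qed
  then have fR: "f = (\<Prod>r\<in>{r. poly f r = 0}. [:-r, 1:])"
    unfolding roots using fp by (simp add: prod.distinct_set_conv_list)
  show ?thesis
  proof
    show "finite {r. poly f r = 0}" unfolding roots by simp
    show "subfield_set L" "K \<subseteq> L" "{r. poly f r = 0} \<subseteq> L"
      unfolding Leq using generate_field_eq_least(1,2)[of "K \<union> {r. poly f r = 0}"] by blast+
    show "L \<subseteq> E" if "subfield_set E" "K \<subseteq> E" "{r. poly f r = 0} \<subseteq> E" for E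
      unfolding Leq by (rule generate_field_eq_least(3)) (use that in auto)
  qed (rule K f fR)+
qed

section \<open>Reduction modulo a prime\<close>

lemma residue_map:
  fixes K \<pp> :: "'a::field_char_0 set" and \<iota> :: "'a set \<Rightarrow> 'k::alg_closed_field"
  defines "\<phi> \<equiv> \<lambda>a. \<iota> (\<pp> +>\<^bsub>ring_of_integers K\<^esub> a)"
  assumes id: "ideal \<pp> (ring_of_integers K)" and \<iota>: "\<iota> \<in> Ring.ring_hom (residue_field K \<pp>) ambient"
  shows "ring_hom_on (ints K) \<phi>" "\<phi> ` ints K = \<iota> ` carrier (residue_field K \<pp>)" "\<And>a. a \<in> \<pp> \<Longrightarrow> \<phi> a = 0"
proof -
  let ?R = "ring_of_integers K"
  interpret I: ideal \<pp> ?R by (rule id)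
  have simps: "carrier ?R = ints K" "x \<otimes>\<^bsub>?R\<^esub> y = x * y" "x \<oplus>\<^bsub>?R\<^esub> y = x + y" "\<one>\<^bsub>?R\<^esub> = 1" "\<zero>\<^bsub>?R\<^esub> = 0" for x y
    by (simp_all add: ring_of_integers_def ints_def ring_of_type_algebra_def)
  have hom: "\<phi> \<in> Ring.ring_hom ?R ambient"
    using ring_hom_trans[OF I.rcos_ring_hom \<iota>[unfolded residue_field_def]] by (simp add: \<phi>_def comp_def)
  show "ring_hom_on (ints K) \<phi>"
    using ring_hom_add[OF hom] ring_hom_mult[OF hom] ring_hom_one[OF hom]
    unfolding ring_hom_on_def simps ambient_simps by blast
  show "\<phi> ` ints K = \<iota> ` carrier (residue_field K \<pp>)"
    by (auto simp: \<phi>_def residue_field_def FactRing_def A_RCOSETS_def' simps)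
  show "\<phi> a = 0" if a: "a \<in> \<pp>" for a
  proof -
    have "a \<in> carrier ?R" using a I.a_subset by blast
    then have "\<pp> +>\<^bsub>?R\<^esub> a = \<pp> +>\<^bsub>?R\<^esub> \<zero>\<^bsub>?R\<^esub>"
      using I.a_coset_join2[OF _ I.a_subgroup a] I.a_coset_join2[OF _ I.a_subgroup additive_subgroup.zero_closed[OF I.additive_subgroup_axioms]] by simp
    then have "\<phi> a = \<phi> \<zero>\<^bsub>?R\<^esub>" by (simp add: \<phi>_def)
    also have "\<dots> = \<zero>\<^bsub>ambient\<^esub>"
    proof (rule ring_hom_zero[OF hom I.ring_axioms])
      show "ring (ambient :: 'k ring)" by (rule field.is_ring) rule
    qed
    finally show ?thesis by (simp add: ambient_simps)
  qed
qed

lemma image_subring: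
  assumes S: "subring_set S" and hom: "ring_hom_on S (\<phi> :: 'a::field \<Rightarrow> 'b::field)" shows "subring_set (\<phi> ` S)"
proof -
  have "\<phi> 1 \<in> \<phi> ` S" using sr_one[OF S] by blast
  moreover have "\<phi> x - \<phi> y \<in> \<phi> ` S" "\<phi> x * \<phi> y \<in> \<phi> ` S" if "x \<in> S" "y \<in> S" for x y
    using that rh_diff[OF S hom that] rh_mult[OF S hom that] sr_diff[OF S that] sr_mult[OF S that] by (metis imageI)+
  ultimately show ?thesis using rh_one[OF S hom] by (auto simp: subring_set_def)
qed

section \<open>Complete splitting and the roots modulo the prime\<close>

lemma odd_residue:
  fixes K :: "'a::field_char_0 set"
  assumes "\<pp> <+>\<^bsub>ring_of_integers K\<^esub> (PIdl\<^bsub>ring_of_integers K\<^esub> 2) = carrier (ring_of_integers K)"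
    and K: "subfield_set K" and p: "ideal_set (ints K) \<pp>"
  obtains b where "b \<in> ints K" "2 * b - 1 \<in> \<pp>"
proof -
  note OK = subring_ints[OF K]
  have "1 \<in> \<pp> <+>\<^bsub>ring_of_integers K\<^esub> (PIdl\<^bsub>ring_of_integers K\<^esub> 2)"
    unfolding assms(1) using sr_one[OF OK] by (simp add: ring_of_integers_eq)
  then obtain h b where hb: "h \<in> \<pp>" "b \<in> ints K" "1 = h + b * 2"
    by (auto simp: set_add_def' cgenideal_def ring_of_integers_eq sub_ambient_simps ambient_simps)
  have "2 * b - 1 = - h" using hb(3) by (simp add: algebra_simps)
  then show ?thesis using that[OF hb(2)] id_uminus[OF OK p hb(1)] by simp
qed

text \<open>Congruences modulo \<open>p\<close> between polynomials over \<open>OK\<close> are equalities of their images under \<open>\<phi>\<close>. So \<open>f\<close> is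
  congruent to a product of linear factors over \<open>OK\<close> if and only if the image of \<open>f\<close> has all its roots in the image of \<open>OK\<close>.\<close>

lemma splits_completely_iff_roots_residual:
  fixes K L :: "'a::field_char_0 set" and \<phi> :: "'a \<Rightarrow> 'k::field"
  assumes "integral_splitting_field K L f R p N"
    and hom: "ring_hom_on (ints K) \<phi>" and ker: "\<And>a. a \<in> ints K \<Longrightarrow> \<phi> a = 0 \<longleftrightarrow> a \<in> p"
    and Z: "finite Z" "map_poly \<phi> f = (\<Prod>z\<in>Z. [:-z, 1:])" "card Z = degree f"
  shows "splits_completely K L p \<longleftrightarrow> Z \<subseteq> \<phi> ` ints K"
proof
  interpret integral_splitting_field K L f R p N by (rule assms(1))
  note coeff_phi = coeff_rh[OF OK hom]
  assume "splits_completely K L p"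
  then show "Z \<subseteq> \<phi> ` ints K"
  proof (rule splits_completely_imp_congruence)
    fix c assume c: "\<And>r. r \<in> R \<Longrightarrow> c r \<in> OK" and cong: "\<And>i. coeff (f - (\<Prod>r\<in>R. [:- c r, 1:])) i \<in> p"
    have lin: "[:- c r, 1:] \<in> polys_over OK" if "r \<in> R" for r by (rule po_linear[OF OK c[OF that]])
    have prodO: "(\<Prod>r\<in>R. [:- c r, 1:]) \<in> polys_over OK" by (rule po_prod[OF OK lin])
    have "map_poly \<phi> f - map_poly \<phi> (\<Prod>r\<in>R. [:- c r, 1:]) = 0"
    proof (rule poly_eqI)
      fix i
      have "\<phi> (coeff (f - (\<Prod>r\<in>R. [:- c r, 1:])) i) = 0" using cong[of i] p_OK ker by blast
      then show "coeff (map_poly \<phi> f - map_poly \<phi> (\<Prod>r\<in>R. [:- c r, 1:])) i = coeff 0 i"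
        unfolding rh_poly_diff[OF OK hom f_int prodO, symmetric] coeff_phi by simp
    qed
    moreover have "map_poly \<phi> (\<Prod>r\<in>R. [:- c r, 1:]) = (\<Prod>r\<in>R. map_poly \<phi> [:- c r, 1:])"
      by (rule rh_poly_prod[OF OK hom lin])
    moreover have "\<dots> = (\<Prod>r\<in>R. [:- \<phi> (c r), 1:])"
      by (rule prod.cong[OF refl rh_poly_linear[OF OK hom c]])
    ultimately have eq: "(\<Prod>z\<in>Z. [:-z, 1:]) = (\<Prod>r\<in>R. [:- \<phi> (c r), 1:])" using Z(2) by simp
    show ?thesis
    proof
      fix z assume z: "z \<in> Z"
      then have "poly (\<Prod>z\<in>Z. [:-z, 1:]) z = 0" using Z(1) by (auto simp: poly_prod prod_zero_iff)
      then have "(\<Prod>r\<in>R. z - \<phi> (c r)) = 0" unfolding eq by (simp add: poly_prod)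
      then obtain r where "r \<in> R" "z = \<phi> (c r)" using fin_R by (auto simp: prod_zero_iff)
      then show "z \<in> \<phi> ` ints K" using c by blast
    qed
  qed
next
  interpret integral_splitting_field K L f R p N by (rule assms(1))
  note coeff_phi = coeff_rh[OF OK hom]
  assume sub: "Z \<subseteq> \<phi> ` ints K"
  then have "\<forall>z\<in>Z. \<exists>a. a \<in> OK \<and> \<phi> a = z" by blast
  then obtain s where s: "\<And>z. z \<in> Z \<Longrightarrow> s z \<in> OK \<and> \<phi> (s z) = z" by metis
  have inj: "inj_on s Z" by (rule inj_onI) (metis s)
  let ?C = "s ` Z"
  show "splits_completely K L p"
  proof (rule congruence_imp_splits_completely)
    show "finite ?C" using Z(1) by simp
    show CO: "?C \<subseteq> OK" using s by blast
    have "degree f = (\<Sum>r\<in>R. degree [:-r, 1:])" unfolding f_eq by (rule degree_prod_eq_sum_degree) simp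
    then show "card ?C = card R" using card_image[OF inj] Z(3) by simp
    have lin: "[:- c, 1:] \<in> polys_over OK" if "c \<in> ?C" for c using CO that by (intro po_linear[OF OK]) blast
    have prodO: "(\<Prod>c\<in>?C. [:- c, 1:]) \<in> polys_over OK" by (rule po_prod[OF OK lin])
    have "map_poly \<phi> (\<Prod>c\<in>?C. [:- c, 1:]) = (\<Prod>c\<in>?C. map_poly \<phi> [:- c, 1:])"
      by (rule rh_poly_prod[OF OK hom lin])
    also have "\<dots> = (\<Prod>z\<in>Z. map_poly \<phi> [:- s z, 1:])" by (simp add: prod.reindex[OF inj])
    also have "\<dots> = (\<Prod>z\<in>Z. [:- z, 1:])"
    proof (rule prod.cong[OF refl])
      fix z assume "z \<in> Z"
      then show "map_poly \<phi> [:- s z, 1:] = [:- z, 1:]" using rh_poly_linear[OF OK hom, of "s z"] s by simp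
    qed
    finally have eq: "map_poly \<phi> (\<Prod>c\<in>?C. [:- c, 1:]) = map_poly \<phi> f" using Z(2) by simp
    show "coeff (f - (\<Prod>c\<in>?C. [:- c, 1:])) i \<in> p" for i
    proof -
      have "f - (\<Prod>c\<in>?C. [:- c, 1:]) \<in> polys_over OK" by (rule po_diff[OF OK f_int prodO])
      then have "coeff (f - (\<Prod>c\<in>?C. [:- c, 1:])) i \<in> OK" unfolding polys_over_iff[OF OK] by blast
      moreover have "\<phi> (coeff (f - (\<Prod>c\<in>?C. [:- c, 1:])) i) = 0"
        unfolding coeff_phi[symmetric] rh_poly_diff[OF OK hom f_int prodO] eq by simp
      ultimately show ?thesis using ker by blast
    qed
    show "c = d" if cd: "c \<in> ?C" "d \<in> ?C" "c - d \<in> p" for c d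
    proof -
      have "c \<in> OK" "d \<in> OK" using cd CO by blast+
      then have "\<phi> c - \<phi> d = 0" using rh_diff[OF OK hom, of c d] ker[of "c - d"] cd(3) sr_diff[OF OK, of c d] by simp
      then have "\<phi> c = \<phi> d" by simp
      moreover have "s (\<phi> c) = c" "s (\<phi> d) = d" using cd(1,2) s by auto
      ultimately show ?thesis by metis
    qed
  qed
qed

section \<open>The points of the projective line as valuations of the rational function field\<close>

text \<open>The value \<open>None\<close> stands for the point at infinity of the projective line.\<close>

definition poly_ord :: "'k::field option \<Rightarrow> 'k poly \<Rightarrow> int" where
  "poly_ord t p = (case t of None \<Rightarrow> - int (degree p) | Some a \<Rightarrow> int (order a p))"

definition ord :: "'k::field option \<Rightarrow> 'k poly fract \<Rightarrow> int" where
  "ord t r = (THE n. \<exists>p q. p \<noteq> 0 \<and> q \<noteq> 0 \<and> r = to_fract p / to_fract q \<and> n = poly_ord t p - poly_ord t q)"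

lemma poly_ord_mult: "p \<noteq> 0 \<Longrightarrow> q \<noteq> 0 \<Longrightarrow> poly_ord t (p * q) = poly_ord t p + poly_ord t q"
  by (auto simp: poly_ord_def order_mult degree_mult_eq split: option.split)

lemma poly_ord_add:
  assumes "p \<noteq> 0" "q \<noteq> 0" "p + q \<noteq> 0"
  shows "poly_ord t (p + q) \<ge> min (poly_ord t p) (poly_ord t q)"
proof (cases t)
  case None
  have "degree (p + q) \<le> max (degree p) (degree q)" by (rule degree_add_le_max)
  then show ?thesis using None by (auto simp: poly_ord_def)
next
  case (Some a)
  let ?n = "min (order a p) (order a q)"
  have "[:-a, 1:] ^ ?n dvd p + q"
    using assms by (intro dvd_add) (auto simp: order_divides)
  then have "?n \<le> order a (p + q)" using assms by (simp add: order_divides)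
  then show ?thesis using Some by (auto simp: poly_ord_def)
qed

lemma poly_ord_const [simp]: "c \<noteq> 0 \<Longrightarrow> poly_ord t [:c:] = 0"
  by (auto simp: poly_ord_def order_0I split: option.split)

lemma poly_ord_linear:
  "poly_ord t [:-a, 1:] = (case t of None \<Rightarrow> -1 | Some b \<Rightarrow> if a = b then 1 else 0)"
  using order_power_n_n[of a 1] by (auto simp: poly_ord_def order_0I split: option.split)

lemma fract_cases:
  fixes r :: "'b::idom fract"
  obtains p q where "q \<noteq> 0" "r = to_fract p / to_fract q"
  by (cases r) (auto simp: Fract_conv_to_fract)

lemma ord_quotient:
  assumes "p \<noteq> 0" "q \<noteq> 0"
  shows "ord t (to_fract p / to_fract q) = poly_ord t p - poly_ord t q"
proof -
  have "n = poly_ord t p - poly_ord t q"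
    if "p' \<noteq> 0" "q' \<noteq> 0" "to_fract p / to_fract q = to_fract p' / to_fract q'"
       "n = poly_ord t p' - poly_ord t q'" for n p' q'
  proof -
    have "to_fract (p * q') = to_fract (p' * q)"
      using that assms by (simp add: field_simps)
    then have "p * q' = p' * q" by (simp only: to_fract_eq_iff)
    then have "poly_ord t (p * q') = poly_ord t (p' * q)" by simp
    then show ?thesis using that assms by (simp add: poly_ord_mult)
  qed
  then show ?thesis unfolding ord_def using assms by (intro the_equality) blast+
qed

lemma ord_to_fract: "p \<noteq> 0 \<Longrightarrow> ord t (to_fract p) = poly_ord t p"
  using ord_quotient[of p 1 t] poly_ord_const[of 1 t] by (simp flip: one_pCons)

lemma fract_cases_nonzero:
  fixes r :: "'b::idom fract"
  assumes "r \<noteq> 0"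
  obtains p q where "p \<noteq> 0" "q \<noteq> 0" "r = to_fract p / to_fract q"
  using assms by (cases r rule: fract_cases) (metis div_0 to_fract_0)

lemma ord_mult:
  assumes "r \<noteq> 0" "s \<noteq> 0" shows "ord t (r * s) = ord t r + ord t s"
proof -
  obtain p q p' q' where *: "p \<noteq> 0" "q \<noteq> 0" "r = to_fract p / to_fract q"
    "p' \<noteq> 0" "q' \<noteq> 0" "s = to_fract p' / to_fract q'"
    using assms by (metis fract_cases_nonzero)
  have "r * s = to_fract (p * p') / to_fract (q * q')" using * by simp
  then have "ord t (r * s) = poly_ord t (p * p') - poly_ord t (q * q')"
    using * by (metis ord_quotient mult_eq_0_iff)
  then show ?thesis using * by (simp add: ord_quotient poly_ord_mult)
qed

lemma ord_add:
  assumes "r \<noteq> 0" "s \<noteq> 0" "r + s \<noteq> 0" shows "ord t (r + s) \<ge> min (ord t r) (ord t s)"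
proof -
  obtain p q p' q' where *: "p \<noteq> 0" "q \<noteq> 0" "r = to_fract p / to_fract q"
    "p' \<noteq> 0" "q' \<noteq> 0" "s = to_fract p' / to_fract q'"
    using assms by (metis fract_cases_nonzero)
  have rs: "r + s = to_fract (p * q' + p' * q) / to_fract (q * q')" using * by (simp add: field_simps)
  have nz: "p * q' + p' * q \<noteq> 0" using rs assms by (metis div_0 to_fract_0)
  have "ord t (r + s) = poly_ord t (p * q' + p' * q) - poly_ord t (q * q')"
    using * rs nz by (metis ord_quotient mult_eq_0_iff)
  then show ?thesis using * nz poly_ord_add[of "p * q'" "p' * q" t] 
    by (auto simp: ord_quotient poly_ord_mult)
qed

lemma ord_const [simp]: "c \<noteq> 0 \<Longrightarrow> ord t (to_fract [:c:]) = 0"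
  by (simp add: ord_to_fract)

lemma ord_one [simp]: "ord t 1 = 0"
  using ord_const[of 1 t] by (simp flip: one_pCons)

lemma ord_uminus [simp]: "r \<noteq> 0 \<Longrightarrow> ord t (- r) = ord t r"
proof -
  assume r: "r \<noteq> 0"
  have "[:-1:] = - (1 :: 'a poly)" by (simp add: one_pCons)
  then have "to_fract [:-1 :: 'a:] = -1" by (simp only: to_fract_uminus to_fract_1)
  then show ?thesis using ord_mult[of "to_fract [:-1:]" r t] ord_const[of "-1" t] r by simp
qed

lemma ord_inverse: "r \<noteq> 0 \<Longrightarrow> ord t (inverse r) = - ord t r"
  using ord_mult[of r "inverse r" t] by simp

lemma ord_divide: "r \<noteq> 0 \<Longrightarrow> s \<noteq> 0 \<Longrightarrow> ord t (r / s) = ord t r - ord t s"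
  by (simp add: divide_inverse ord_mult ord_inverse)

lemma ord_power: "r \<noteq> 0 \<Longrightarrow> ord t (r ^ n) = int n * ord t r"
  by (induction n) (auto simp: ord_mult algebra_simps)

lemma ord_power_int: "r \<noteq> 0 \<Longrightarrow> ord t (r powi n) = n * ord t r"
  by (auto simp: power_int_def ord_power ord_inverse)

lemma ord_prod: "(\<And>x. x \<in> A \<Longrightarrow> h x \<noteq> 0) \<Longrightarrow> ord t (\<Prod>x\<in>A. h x) = (\<Sum>x\<in>A. ord t (h x))"
  by (induction A rule: infinite_finite_induct) (auto simp: ord_mult)

abbreviation lin :: "'k::field \<Rightarrow> 'k poly fract" where
  "lin a \<equiv> to_fract [:-a, 1:]"

lemma lin_nonzero [simp]: "lin a \<noteq> 0" by simp

lemma ord_lin: "ord t (lin a) = (case t of None \<Rightarrow> -1 | Some b \<Rightarrow> if a = b then 1 else 0)"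
  by (simp add: ord_to_fract poly_ord_linear)

lemma poly_linear_decomp:
  fixes p :: "'k::field poly"
  obtains q where "p = [:poly p a:] + [:-a, 1:] * q"
proof -
  have "[:-a, 1:] dvd p - [:poly p a:]" by (simp add: poly_eq_0_iff_dvd[symmetric])
  then obtain q where "p - [:poly p a:] = [:-a, 1:] * q" by (auto simp: dvd_def)
  then show ?thesis using that by (metis add.commute diff_add_cancel)
qed

text \<open>Every nonzero rational function is obtained from constants and linear polynomials by products and
  inverses, because every polynomial splits.\<close>

lemma fract_linear_induct [consumes 1, case_names const lin mult inverse]:
  fixes r :: "'k::alg_closed_field poly fract"
  assumes "r \<noteq> 0" "\<And>c. c \<noteq> 0 \<Longrightarrow> P (to_fract [:c:])" "\<And>a. P (lin a)"
    and mult: "\<And>r s. r \<noteq> 0 \<Longrightarrow> s \<noteq> 0 \<Longrightarrow> P r \<Longrightarrow> P s \<Longrightarrow> P (r * s)"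
    and inv: "\<And>r. r \<noteq> 0 \<Longrightarrow> P r \<Longrightarrow> P (inverse r)"
  shows "P r"
proof -
  have poly: "P (to_fract p)" if p: "p \<noteq> 0" for p
  proof -
    obtain A where A: "p = smult (lead_coeff p) (\<Prod>x\<in>#A. [:- x, 1:])"
      using alg_closed_imp_factorization[OF p] by auto
    have "(\<Prod>x\<in>#A. [:- x, 1:]) \<noteq> 0 \<and> P (to_fract (\<Prod>x\<in>#A. [:- x, 1:]))"
    proof (induction A)
      case empty
      then show ?case using assms(2)[of 1] by (simp add: one_pCons)
    next
      case (add x A)
      let ?M = "\<Prod>x\<in>#A. [:- x, 1:]"
      have "(\<Prod>x\<in>#add_mset x A. [:- x, 1:]) = [:- x, 1:] * ?M"
        by (simp only: image_mset_add_mset prod_mset.add_mset)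
      moreover have "P (lin x * to_fract ?M)" using add by (intro mult assms(3)) auto
      moreover have "[:- x, 1:] * ?M \<noteq> 0" using add by (simp del: mult_pCons_left)
      ultimately show ?case by (metis to_fract_mult)
    qed
    moreover have "to_fract p = to_fract [:lead_coeff p:] * to_fract (\<Prod>x\<in>#A. [:- x, 1:])"
      by (subst A) (simp flip: to_fract_mult)
    ultimately show ?thesis using p assms(2)[of "lead_coeff p"]
      by (metis mult leading_coeff_0_iff pCons_eq_0_iff to_fract_eq_0_iff)
  qed
  obtain p q where *: "p \<noteq> 0" "q \<noteq> 0" "r = to_fract p / to_fract q"
    using assms(1) by (metis fract_cases_nonzero)
  have "P (to_fract p * inverse (to_fract q))"
    by (intro mult inv poly) (use * in auto)
  then show ?thesis using * by (simp add: divide_inverse)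
qed

text \<open>The multiplicities of all linear factors are even, and the leading constant has a square root.\<close>

lemma even_ord_imp_square:
  fixes r :: "'k::alg_closed_field poly fract"
  assumes "r \<noteq> 0"  and "\<And>a. even (ord (Some a) r)"
  obtains s where "s \<noteq> 0" "r = s ^ 2"
proof -
  have "\<exists>c s A. finite A \<and> c \<noteq> 0 \<and> s \<noteq> 0 \<and> r = to_fract [:c:] * s ^ 2 * (\<Prod>a\<in>A. lin a)"
    using assms(1)
  proof (induction r rule: fract_linear_induct)
    case (const c)
    have "to_fract [:c:] = to_fract [:c:] * 1 ^ 2 * (\<Prod>a\<in>{}. lin a)" by simp
    then show ?case using const by (metis finite.emptyI zero_neq_one)
  next
    case (lin a)
    have "lin a = to_fract [:1:] * 1 ^ 2 * (\<Prod>a\<in>{a}. lin a)" by (simp flip: one_pCons)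
    then show ?case by (metis finite.emptyI finite_insert zero_neq_one)
  next
    case (mult r r')
    then obtain c s A c' s' A' where *: "finite A" "c \<noteq> 0" "s \<noteq> 0" "r = to_fract [:c:] * s ^ 2 * (\<Prod>a\<in>A. lin a)"
      "finite A'" "c' \<noteq> 0" "s' \<noteq> 0" "r' = to_fract [:c':] * s' ^ 2 * (\<Prod>a\<in>A'. lin a)" by blast
    let ?S = "(A - A') \<union> (A' - A)"
    have "(\<Prod>a\<in>A. lin a) = (\<Prod>a\<in>A-A'. lin a) * (\<Prod>a\<in>A\<inter>A'. lin a)"
      by (subst prod.Int_Diff[OF *(1), of _ A']) (rule mult.commute)
    moreover have "(\<Prod>a\<in>A'. lin a) = (\<Prod>a\<in>A'-A. lin a) * (\<Prod>a\<in>A\<inter>A'. lin a)"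
      by (subst prod.Int_Diff[OF *(5), of _ A], subst Int_commute) (rule mult.commute)
    moreover have "(\<Prod>a\<in>?S. lin a) = (\<Prod>a\<in>A-A'. lin a) * (\<Prod>a\<in>A'-A. lin a)"
      by (rule prod.union_disjoint) (use * in auto)
    moreover have "to_fract [:c * c':] = to_fract [:c:] * to_fract [:c':]" by (simp flip: to_fract_mult)
    ultimately have "r * r' = to_fract [:c * c':] * (s * s' * (\<Prod>a\<in>A\<inter>A'. lin a)) ^ 2 * (\<Prod>a\<in>?S. lin a)"
      using * by (simp add: power2_eq_square algebra_simps)
    moreover have "(\<Prod>a\<in>A\<inter>A'. lin a) \<noteq> 0" using * by simp
    ultimately show ?case using * by (metis finite_Diff finite_UnI mult_eq_0_iff)
  next
    case (inverse r)
    then obtain c s A where *: "finite A" "c \<noteq> 0" "s \<noteq> 0" "r = to_fract [:c:] * s ^ 2 * (\<Prod>a\<in>A. lin a)" by blast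
    have "r * (1 / r) ^ 2 = inverse r" using inverse by (simp add: power2_eq_square field_simps)
    moreover define z where "z = 1 / r"
    ultimately have "inverse r = r * z ^ 2" by simp
    also have "\<dots> = to_fract [:c:] * (s * z) ^ 2 * (\<Prod>a\<in>A. lin a)"
      unfolding *(4) power_mult_distrib by (simp only: mult_ac)
    finally have "inverse r = to_fract [:c:] * (s * (1 / r)) ^ 2 * (\<Prod>a\<in>A. lin a)"
      unfolding z_def .
    then show ?case using * inverse by (metis mult_eq_0_iff divide_eq_0_iff zero_neq_one)
  qed
  then obtain c s A where *: "finite A" "c \<noteq> 0" "s \<noteq> 0" "r = to_fract [:c:] * s ^ 2 * (\<Prod>a\<in>A. lin a)" by blast
  have "ord (Some b) r = 2 * ord (Some b) s + (if b \<in> A then 1 else 0)" for b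
    using * by (simp add: ord_mult ord_power ord_prod ord_lin)
  then have "A = {}" using assms(2) by (metis all_not_in_conv even_add even_mult_iff even_numeral odd_one)
  moreover obtain d where "d ^ 2 = c" using nth_root_exists[of 2 c] by auto
  ultimately have "r = (to_fract [:d:] * s) ^ 2"
    using * by (simp add: power2_eq_square flip: to_fract_mult)
  moreover have "to_fract [:d:] * s \<noteq> 0" using * \<open>d ^ 2 = c\<close> by auto
  ultimately show ?thesis using that by blast
qed

text \<open>Without finite poles it is a polynomial, whose degree is bounded by zero at infinity.\<close>

lemma no_poles_imp_const:
  fixes r :: "'k::alg_closed_field poly fract"
  assumes "r \<noteq> 0" and "\<And>t. ord t r \<ge> 0"
  obtains c where "c \<noteq> 0" "r = to_fract [:c:]"
proof -
  let ?P = "\<lambda>q. \<exists>p. p \<noteq> 0 \<and> q \<noteq> 0 \<and> r = to_fract p / to_fract q"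
  obtain q0 where "?P q0" using fract_cases_nonzero[OF assms(1)] by metis
  then obtain q where q: "?P q" and min: "\<And>q'. ?P q' \<Longrightarrow> degree q \<le> degree q'"
    using ex_has_least_nat[of ?P q0 degree] by blast
  then obtain p where p: "p \<noteq> 0" "q \<noteq> 0" "r = to_fract p / to_fract q" by blast
  have "degree q = 0"
  proof (rule ccontr)
    assume "degree q \<noteq> 0"
    then obtain a where a: "poly q a = 0" using alg_closed_imp_poly_has_root by blast
    then have "order a q \<ge> 1" using p by (simp add: order_root Suc_leI)
    moreover have "int (order a p) - int (order a q) \<ge> 0"
      using assms(2)[of "Some a"] p by (simp add: ord_quotient poly_ord_def)
    ultimately have "poly p a = 0" using p by (simp add: order_root)
    then obtain p' q' where *: "p = [:-a, 1:] * p'" "q = [:-a, 1:] * q'"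
      using a by (auto simp: poly_eq_0_iff_dvd dvd_def)
    have "p' \<noteq> 0" "q' \<noteq> 0" using p * by auto
    moreover have "r = to_fract p' / to_fract q'"
      unfolding p(3) * to_fract_mult by (rule mult_divide_mult_cancel_left) simp
    ultimately have "degree q \<le> degree q'" using min by blast
    moreover have "degree q = Suc (degree q')" unfolding * using \<open>q' \<noteq> 0\<close> by (subst degree_mult_eq) auto
    ultimately show False by simp
  qed
  moreover from this have "degree p = 0" using assms(2)[of None] p by (simp add: ord_quotient poly_ord_def)
  ultimately obtain c d where cd: "p = [:c:]" "q = [:d:]" by (metis degree_eq_zeroE)
  then have nz: "c \<noteq> 0" "d \<noteq> 0" using p by auto
  have "to_fract [:c / d:] * to_fract [:d:] = to_fract [:c:]"
    using nz by (simp flip: to_fract_mult)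
  then have "r = to_fract [:c / d:] * to_fract [:d:] / to_fract [:d:]" using p(3) cd by (simp only:)
  also have "\<dots> = to_fract [:c / d:]" by (rule nonzero_mult_div_cancel_right) (use nz in simp)
  finally show ?thesis using that[of "c / d"] nz by simp
qed

lemma ord_add_less:
  assumes "r \<noteq> 0" "s \<noteq> 0" "ord t r < ord t s" shows "r + s \<noteq> 0" "ord t (r + s) = ord t r"
proof -
  show nz: "r + s \<noteq> 0" using assms by (metis add_eq_0_iff less_irrefl ord_uminus)
  have "ord t (r + s) \<ge> ord t r" using ord_add[of r s t] assms nz by simp
  moreover have "ord t r \<ge> min (ord t (r + s)) (ord t s)"
    using ord_add[of "r + s" "- s" t] assms nz by simp
  ultimately show "ord t (r + s) = ord t r" using assms by linarith
qed

lemma ord_surj: obtains r where "r \<noteq> 0" "ord t r = n"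
proof -
  define u :: "'a poly fract" where "u = (case t of None \<Rightarrow> inverse (lin 0) | Some a \<Rightarrow> lin a)"
  have "ord None (inverse (lin (0::'a))) = 1" 
    using ord_inverse[of "lin (0::'a)" None] ord_lin[of None "0::'a"] by simp
  then have "u \<noteq> 0" "ord t u = 1" unfolding u_def by (auto simp: ord_lin split: option.split)
  then have "u powi n \<noteq> 0" "ord t (u powi n) = n" by (simp_all add: ord_power_int)
  then show ?thesis using that by blast
qed

definition ord_ge :: "'k::field option \<Rightarrow> int \<Rightarrow> 'k poly fract \<Rightarrow> bool" where
  "ord_ge t n r \<longleftrightarrow> r = 0 \<or> ord t r \<ge> n"

lemma ord_ge_add: "ord_ge t n r \<Longrightarrow> ord_ge t n s \<Longrightarrow> ord_ge t n (r + s)"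
  unfolding ord_ge_def using ord_add[of r s t] by fastforce

lemma ord_ge_mult: "ord_ge t m r \<Longrightarrow> ord_ge t n s \<Longrightarrow> ord_ge t (m + n) (r * s)"
  unfolding ord_ge_def by (auto simp: ord_mult)

lemma ord_ge_uminus [simp]: "ord_ge t n (- r) \<longleftrightarrow> ord_ge t n r"
  unfolding ord_ge_def by (cases "r = 0") auto

lemma ord_ge_diff: "ord_ge t n r \<Longrightarrow> ord_ge t n s \<Longrightarrow> ord_ge t n (r - s)"
  using ord_ge_add[of t n r "- s"] by simp

lemma ord_ge_mono: "ord_ge t n r \<Longrightarrow> m \<le> n \<Longrightarrow> ord_ge t m r"
  unfolding ord_ge_def by auto

lemma ord_ge_const [simp]: "ord_ge t 0 (to_fract [:c:])"
  unfolding ord_ge_def by (cases "c = 0") auto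

text \<open>The curve \<open>y\<^sup>2 = f(x)\<close> over an algebraically closed field.\<close>

locale hyperelliptic_curve =
  fixes f :: "'k::alg_closed_field poly" and g :: nat
  assumes degree_f: "degree f = 2 * g + 1" and g_pos: "g > 0" and monic_f: "lead_coeff f = 1"
    and squarefree_f: "rsquarefree f" and two_nz: "(2 :: 'k) \<noteq> 0"
begin

abbreviation mul :: "'k ff \<Rightarrow> 'k ff \<Rightarrow> 'k ff" (infixl \<open>\<odot>\<close> 70) where "x \<odot> y \<equiv> x \<otimes>\<^bsub>function_field f\<^esub> y"
abbreviation pls :: "'k ff \<Rightarrow> 'k ff \<Rightarrow> 'k ff" (infixl \<open>\<boxplus>\<close> 65) where "x \<boxplus> y \<equiv> x \<oplus>\<^bsub>function_field f\<^esub> y"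
abbreviation Points :: "('k ff \<Rightarrow> int) set" where "Points \<equiv> curve_points f"

text \<open>The nontrivial automorphism over \<open>k(x)\<close>, that is, the hyperelliptic involution.\<close>

definition cnj :: "'k ff \<Rightarrow> 'k ff" where "cnj x = (fst x, - snd x)"
definition nrm :: "'k ff \<Rightarrow> 'k poly fract" where "nrm x = fst x ^ 2 - snd x ^ 2 * to_fract f"

lemma mul_eq: "x \<odot> y = (fst x * fst y + snd x * snd y * to_fract f, fst x * snd y + snd x * fst y)"
  by (simp add: function_field_def case_prod_beta to_fract_def)

lemma pls_eq: "x \<boxplus> y = (fst x + fst y, snd x + snd y)"
  by (simp add: function_field_def case_prod_beta)

lemma zero_eq: "\<zero>\<^bsub>function_field f\<^esub> = (0, 0)"
  by (simp add: function_field_def)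

lemma one_eq: "\<one>\<^bsub>function_field f\<^esub> = (1, 0)"
  by (simp add: function_field_def)

lemmas ff_eqs = mul_eq pls_eq zero_eq one_eq cnj_def nrm_def prod_eq_iff

lemma f_nz [simp]: "f \<noteq> 0" using degree_f by auto

lemma to_fract_f_nz [simp]: "to_fract f \<noteq> 0" by simp

lemma mul_comm: "x \<odot> y = y \<odot> x" by (simp add: ff_eqs algebra_simps)
lemma mul_assoc: "(x \<odot> y) \<odot> z = x \<odot> (y \<odot> z)" by (simp add: ff_eqs algebra_simps)
lemma mul_cnj: "x \<odot> cnj x = (nrm x, 0)" by (simp add: ff_eqs power2_eq_square algebra_simps)
lemma cnj_mul: "cnj (x \<odot> y) = cnj x \<odot> cnj y" by (simp add: ff_eqs)
lemma nrm_mul: "nrm (x \<odot> y) = nrm x * nrm y" by (simp add: ff_eqs power2_eq_square algebra_simps)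
lemma nrm_cnj [simp]: "nrm (cnj x) = nrm x" by (simp add: ff_eqs)
lemma cnj_cnj [simp]: "cnj (cnj x) = x" by (simp add: ff_eqs)
lemma cnj_eq_0 [simp]: "cnj x = (0, 0) \<longleftrightarrow> x = (0, 0)" by (simp add: ff_eqs)
lemma nrm_const [simp]: "nrm (r, 0) = r ^ 2" by (simp add: ff_eqs)
lemma mul_one [simp]: "(1, 0) \<odot> x = x" "x \<odot> (1, 0) = x" by (simp_all add: ff_eqs)
lemma mul_rat [simp]: "(r, 0) \<odot> (s, 0) = (r * s, 0)" by (simp add: ff_eqs)

lemma ord_None_f: "ord None (to_fract f) = - (2 * int g + 1)"
  by (simp add: ord_to_fract poly_ord_def degree_f)

lemma ord_Some_f: "ord (Some a) (to_fract f) = (if poly f a = 0 then 1 else 0)"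
  using squarefree_f f_nz order_root[of f a] unfolding rsquarefree_def
  by (cases "order a f = 0") (auto simp: ord_to_fract poly_ord_def dest: spec[of _ a])

lemma odd_ord_f: "odd (ord t (to_fract f)) \<longleftrightarrow> (case t of None \<Rightarrow> True | Some a \<Rightarrow> poly f a = 0)"
  by (auto simp: ord_None_f ord_Some_f split: option.split)

lemma nrm_eq_0_iff [simp]: "nrm x = 0 \<longleftrightarrow> x = (0, 0)"
proof
  assume "nrm x = 0"
  then have eq: "fst x ^ 2 = snd x ^ 2 * to_fract f" by (simp add: nrm_def)
  show "x = (0, 0)"
  proof (cases "snd x = 0")
    case True then show ?thesis using eq by (simp add: prod_eq_iff)
  next
    case False
    then have "fst x \<noteq> 0" using eq by auto
    then have "2 * ord None (fst x) = 2 * ord None (snd x) - (2 * int g + 1)"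
      using False arg_cong[OF eq, of "ord None"] by (simp add: ord_mult ord_power ord_None_f)
    then have "2 * (ord None (fst x) - ord None (snd x) + int g) = - 1" by simp
    then have "even (- 1 :: int)" by (metis dvd_triv_left)
    then show ?thesis by simp
  qed
qed (simp add: nrm_def)

lemma mul_eq_0_iff [simp]: "x \<odot> y = (0, 0) \<longleftrightarrow> x = (0, 0) \<or> y = (0, 0)"
  unfolding nrm_eq_0_iff[symmetric] nrm_mul mult_eq_0_iff ..

lemma ff_inverse: assumes "x \<noteq> (0, 0)" obtains y where "x \<odot> y = (1, 0)" "y \<noteq> (0, 0)"
proof -
  have "x \<odot> (cnj x \<odot> (1 / nrm x, 0)) = (1, 0)"
    using assms nrm_eq_0_iff[of x] unfolding mul_assoc[symmetric] mul_cnj mul_rat by simp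
  moreover from this have "cnj x \<odot> (1 / nrm x, 0) \<noteq> (0, 0)" by (auto simp: mul_eq)
  ultimately show ?thesis using that by blast
qed

section \<open>Elementary properties of valuations\<close>

lemma pointsI:
  assumes "v (0, 0) = 0" "\<And>x y. x \<noteq> (0, 0) \<Longrightarrow> y \<noteq> (0, 0) \<Longrightarrow> v (x \<odot> y) = v x + v y"
    "\<And>x y. x \<noteq> (0, 0) \<Longrightarrow> y \<noteq> (0, 0) \<Longrightarrow> x \<boxplus> y \<noteq> (0, 0) \<Longrightarrow> v (x \<boxplus> y) \<ge> min (v x) (v y)"
    "\<And>c. c \<noteq> 0 \<Longrightarrow> v (to_fract [:c:], 0) = 0"
    "x \<noteq> (0, 0)" "v x = 1"
  shows "v \<in> Points"
  unfolding curve_points_def Let_def zero_eq mem_Collect_eq ff_const_def to_fract_def[symmetric]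
  using assms by blast

lemma
  assumes "v \<in> Points"
  shows pt_zero: "v (0, 0) = 0"
    and pt_mul: "x \<noteq> (0, 0) \<Longrightarrow> y \<noteq> (0, 0) \<Longrightarrow> v (x \<odot> y) = v x + v y"
    and pt_add: "x \<noteq> (0, 0) \<Longrightarrow> y \<noteq> (0, 0) \<Longrightarrow> x \<boxplus> y \<noteq> (0, 0) \<Longrightarrow> v (x \<boxplus> y) \<ge> min (v x) (v y)"
    and pt_const: "c \<noteq> 0 \<Longrightarrow> v (to_fract [:c:], 0) = 0"
    and pt_surj: "\<exists>x. x \<noteq> (0, 0) \<and> v x = 1"
  using assms unfolding curve_points_def Let_def zero_eq mem_Collect_eq ff_const_def to_fract_def[symmetric]
  by blast+

lemma pt_one: "v \<in> Points \<Longrightarrow> v (1, 0) = 0"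
  using pt_const[of v 1] by (simp flip: one_pCons)

lemma pt_uminus: assumes "v \<in> Points" shows "v (- fst x, - snd x) = v x"
proof (cases "x = (0, 0)")
  case False
  have "[:-1:] = - (1 :: 'k poly)" by (simp add: one_pCons)
  then have "to_fract [:-1 :: 'k:] = -1" by (simp only: to_fract_uminus to_fract_1)
  then have "v (-1, 0) = 0" using pt_const[OF assms, of "-1"] by simp
  moreover have "(-1, 0) \<odot> x = (- fst x, - snd x)" by (simp add: ff_eqs)
  ultimately show ?thesis using pt_mul[OF assms, of "(-1, 0)" x] False by simp
qed simp

lemma pt_add_less:
  assumes "v \<in> Points" "x \<noteq> (0, 0)" "y \<noteq> (0, 0)" "v x < v y" shows "v (x \<boxplus> y) = v x"
proof -
  let ?n = "(- fst y, - snd y)"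
  have y: "v ?n = v y" "?n \<noteq> (0, 0)" "(x \<boxplus> y) \<boxplus> ?n = x" 
    using assms by (simp_all add: pt_uminus pls_eq prod_eq_iff)
  have nz: "x \<boxplus> y \<noteq> (0, 0)"
  proof
    assume "x \<boxplus> y = (0, 0)"
    then have "x = ?n" by (simp add: pls_eq prod_eq_iff add_eq_0_iff2)
    then show False using y assms by simp
  qed
  have "v (x \<boxplus> y) \<ge> v x" using pt_add[OF assms(1-3) nz] assms by simp
  moreover have "v x \<ge> min (v (x \<boxplus> y)) (v y)" using pt_add[OF assms(1) nz y(2)] assms y by simp
  ultimately show ?thesis using assms by linarith
qed

lemma pt_add_less': 
  assumes "v \<in> Points" "x \<noteq> (0, 0)" "y = (0, 0) \<or> v x < v y" shows "v (x \<boxplus> y) = v x"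
  using pt_add_less[of v x y] assms by (cases "y = (0, 0)") (auto simp: pls_eq)

lemma pt_rat_mult: "v \<in> Points \<Longrightarrow> r \<noteq> 0 \<Longrightarrow> s \<noteq> 0 \<Longrightarrow> v (r * s, 0) = v (r, 0) + v (s, 0)"
  using pt_mul[of v "(r, 0)" "(s, 0)"] by simp

lemma pt_rat_inverse: "v \<in> Points \<Longrightarrow> r \<noteq> 0 \<Longrightarrow> v (inverse r, 0) = - v (r, 0)"
  using pt_rat_mult[of v r "inverse r"] by (simp add: pt_one)

lemma pt_nrm: "v \<in> Points \<Longrightarrow> x \<noteq> (0, 0) \<Longrightarrow> v x + v (cnj x) = v (nrm x, 0)"
  using pt_mul[of v x "cnj x"] by (simp add: mul_cnj)

lemma pt_y: assumes "v \<in> Points" shows "2 * v (0, 1) = v (to_fract f, 0)"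
proof -
  have "(0, 1) \<odot> (0, 1) = (to_fract f, 0)" by (simp add: ff_eqs)
  then show ?thesis using pt_mul[OF assms, of "(0, 1)" "(0, 1)"] by simp
qed

lemma pt_snd: "v \<in> Points \<Longrightarrow> B \<noteq> 0 \<Longrightarrow> v (0, B) = v (B, 0) + v (0, 1)"
  using pt_mul[of v "(B, 0)" "(0, 1)"] by (simp add: mul_eq)

lemma split_ff: "(A, 0) \<boxplus> (0, B) = (A, B)" by (simp add: ff_eqs)

text \<open>A point takes a negative value on \<open>x\<close>, or a positive value on exactly one \<open>x - a\<close>; these
  values determine it on \<open>k(x)\<close>. If all these values were zero, the point would be trivial on the whole
  function field.\<close>

lemma point_over_line:
  assumes v: "v \<in> Points"
  obtains t c where "c > 0" "\<And>r. r \<noteq> 0 \<Longrightarrow> v (r, 0) = c * ord t r"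
proof -
  have ext: "v (r, 0) = c * ord t r" if "\<And>a. v (lin a, 0) = c * ord t (lin a)" "r \<noteq> 0" for r c t
    using that(2)
    by (induction r rule: fract_linear_induct)
       (simp_all add: pt_const v that(1) pt_rat_mult pt_rat_inverse ord_mult ord_inverse algebra_simps)
  have shift: "(lin b, 0) = (lin a, 0) \<boxplus> (to_fract [:a - b:], 0)" for a b
    by (simp add: pls_eq flip: to_fract_add)
  have const_cases: "(to_fract [:a - b:], 0) = (0, 0) \<or> v (to_fract [:a - b:], 0) = 0" for a b
    using pt_const[OF v, of "a - b"] by (cases "a = b") auto
  have shift_less: "v (lin b, 0) = v (lin a, 0)" if "v (lin a, 0) < 0" for a b
    unfolding shift[of b a] 
  proof (rule pt_add_less'[OF v])
    show "(to_fract [:a - b:], 0) = (0, 0) \<or> v (lin a, 0) < v (to_fract [:a - b:], 0)"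
      using that const_cases[of a b] by metis
  qed simp
  have shift_pos: "v (lin b, 0) = 0" if "v (lin a, 0) > 0" "a \<noteq> b" for a b
  proof -
    have "v ((to_fract [:a - b:], 0) \<boxplus> (lin a, 0)) = v (to_fract [:a - b:], 0)"
      using that pt_const[OF v, of "a - b"] by (intro pt_add_less'[OF v]) auto
    then show ?thesis using that pt_const[OF v, of "a - b"] by (simp add: shift[of b a] pls_eq add.commute)
  qed
  consider (neg) a where "v (lin a, 0) < 0" | (pos) a where "v (lin a, 0) > 0" | (zero) "\<And>a. v (lin a, 0) = 0"
    by (meson linorder_neqE)
  then show ?thesis
  proof cases
    case neg
    then have "v (lin b, 0) = (- v (lin a, 0)) * ord None (lin b)" for b
      using shift_less[of a b] unfolding ord_lin by simp
    then show ?thesis using ext[of "- v (lin a, 0)" None] neg that[of "- v (lin a, 0)" None]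
      by (meson neg_0_less_iff_less)
  next
    case pos
    then have "v (lin b, 0) = v (lin a, 0) * ord (Some a) (lin b)" for b
      using shift_pos[of a b] unfolding ord_lin by simp
    then show ?thesis using ext[of "v (lin a, 0)" "Some a"] pos that[of "v (lin a, 0)" "Some a"] by meson
  next
    case zero
    then have rat: "v (r, 0) = 0" if "r \<noteq> 0" for r using ext[of 0 None r] that by (metis mult_zero_left)
    have y: "v (0, B) = 0" if "B \<noteq> 0" for B using pt_snd[OF v that] pt_y[OF v] rat that by simp
    have nonneg: "v (A, B) \<ge> 0" for A B
    proof (cases "A = 0 \<or> B = 0")
      case True then show ?thesis using rat[of A] y[of B] pt_zero[OF v] by (cases "A = 0"; cases "B = 0") auto
    next
      case False then show ?thesis
        using pt_add[OF v, of "(A, 0)" "(0, B)"] rat[of A] y[of B] by (auto simp: pls_eq)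
    qed
    have "v x = 0" if "x \<noteq> (0, 0)" for x
      using pt_nrm[OF v that] rat[of "nrm x"] that nonneg[of "fst x" "snd x"] nonneg[of "fst (cnj x)" "snd (cnj x)"] by simp
    then have False using pt_surj[OF v] by (metis zero_neq_one)
    then show ?thesis ..
  qed
qed

section \<open>Points over a branch point\<close>

text \<open>The two terms of the norm have orders of different parity, so they cannot cancel.\<close>

lemma ord_nrm_branch:
  assumes "odd (ord t (to_fract f))" "(A, B) \<noteq> (0, 0)"
  shows "ord t (nrm (A, B)) = (let a = 2 * ord t A; b = 2 * ord t B + ord t (to_fract f)
    in if B = 0 then a else if A = 0 then b else min a b)"
proof -
  let ?a = "2 * ord t A" and ?b = "2 * ord t B + ord t (to_fract f)"
  have ne: "?a \<noteq> ?b" using assms(1) by presburger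
  have nrm: "nrm (A, B) = A ^ 2 + (- (B ^ 2 * to_fract f))" by (simp add: nrm_def)
  have A: "ord t (A ^ 2) = ?a" if "A \<noteq> 0" using that by (simp add: ord_power)
  have B: "ord t (- (B ^ 2 * to_fract f)) = ?b" if "B \<noteq> 0" 
    using that by (simp add: ord_mult ord_power)
  consider "B = 0" "A \<noteq> 0" | "A = 0" "B \<noteq> 0" | "A \<noteq> 0" "B \<noteq> 0" "?a < ?b" | "A \<noteq> 0" "B \<noteq> 0" "?b < ?a"
    using assms(2) ne by fastforce
  then show ?thesis
  proof cases
    case 3
    then show ?thesis
      unfolding nrm using ord_add_less(2)[of "A ^ 2" "- (B ^ 2 * to_fract f)" t] A B by simp
  next
    case 4
    then show ?thesis
      unfolding nrm add.commute[of "A ^ 2"]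
      using ord_add_less(2)[of "- (B ^ 2 * to_fract f)" "A ^ 2" t] A B by simp
  qed (use A B in \<open>auto simp: nrm_def\<close>)
qed

lemma ord_nrm_ge_iff:
  assumes "odd (ord t (to_fract f))" "x \<noteq> (0, 0)"
  shows "ord t (nrm x) \<ge> N \<longleftrightarrow>
    (fst x = 0 \<or> 2 * ord t (fst x) \<ge> N) \<and> (snd x = 0 \<or> 2 * ord t (snd x) + ord t (to_fract f) \<ge> N)"
  using assms by (cases x) (auto simp: ord_nrm_branch Let_def)

text \<open>A branch point is fixed by the involution and ramified over the line, so its valuation is the order of
  the norm.\<close>

definition branch_place :: "'k option \<Rightarrow> 'k ff \<Rightarrow> int" where
  "branch_place t x = (if x = (0, 0) then 0 else ord t (nrm x))"

lemma branch_place_rat: "r \<noteq> 0 \<Longrightarrow> branch_place t (r, 0) = 2 * ord t r"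
  by (simp add: branch_place_def ord_power)

lemma branch_place_in_points:
  assumes odd: "odd (ord t (to_fract f))" shows "branch_place t \<in> Points"
proof -
  obtain m where m: "ord t (to_fract f) = 2 * m + 1" using odd by (elim oddE)
  obtain B where B: "B \<noteq> 0" "ord t B = - m" using ord_surj[where t = t and n = "- m"] by blast
  show ?thesis
  proof (rule pointsI[where x = "(0, B)"])
    show "branch_place t (x \<odot> y) = branch_place t x + branch_place t y" if "x \<noteq> (0, 0)" "y \<noteq> (0, 0)" for x y
      using that by (simp add: branch_place_def nrm_mul ord_mult)
    show "branch_place t (x \<boxplus> y) \<ge> min (branch_place t x) (branch_place t y)"
      if "x \<noteq> (0, 0)" "y \<noteq> (0, 0)" "x \<boxplus> y \<noteq> (0, 0)" for x y
    proof -
      let ?N = "min (branch_place t x) (branch_place t y)"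
      have *: "ord t (nrm x) \<ge> ?N" "ord t (nrm y) \<ge> ?N" using that by (auto simp: branch_place_def)
      have step: "r + s = 0 \<or> 2 * ord t (r + s) + e \<ge> N"
        if "r = 0 \<or> 2 * ord t r + e \<ge> N" "s = 0 \<or> 2 * ord t s + e \<ge> N" for r s e N
        using that ord_add[of r s t] by (cases "r = 0"; cases "s = 0") fastforce+
      have "ord t (nrm (x \<boxplus> y)) \<ge> ?N"
        using * step[where r = "fst x" and s = "fst y" and e = 0 and N = ?N]
          step[where r = "snd x" and s = "snd y" and e = "ord t (to_fract f)" and N = ?N]
        unfolding ord_nrm_ge_iff[OF odd that(1)] ord_nrm_ge_iff[OF odd that(2)] ord_nrm_ge_iff[OF odd that(3)]
        by (simp add: pls_eq)
      then show ?thesis using that by (simp add: branch_place_def)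
    qed
    show "branch_place t (0, B) = 1" using B m by (simp add: branch_place_def nrm_def ord_mult ord_power)
  qed (use B in \<open>auto simp: branch_place_def ord_power\<close>)
qed

text \<open>By parity the values of \<open>A\<close> and of \<open>B y\<close> differ, so the values on \<open>k(x)\<close> determine the value of the sum.\<close>

lemma point_eq_branch_place:
  assumes v: "v \<in> Points" and c: "c > 0" and over: "\<And>r. r \<noteq> 0 \<Longrightarrow> v (r, 0) = c * ord t r"
    and odd: "odd (ord t (to_fract f))"
  shows "v = branch_place t"
proof -
  have y: "2 * v (0, 1) = c * ord t (to_fract f)" using pt_y[OF v] over by simp
  then have "even c" using odd by (metis dvd_triv_left even_mult_iff)
  then obtain s where s: "c = 2 * s" "s > 0" using c by (elim evenE) auto
  have B: "v (0, B) = s * (2 * ord t B + ord t (to_fract f))" if "B \<noteq> 0" for B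
    using pt_snd[OF v that] over[OF that] y s by (simp add: algebra_simps)
  have eq: "v x = s * ord t (nrm x)" if "x \<noteq> (0, 0)" for x
  proof -
    obtain A B where x: "x = (A, B)" by force
    let ?a = "2 * ord t A" and ?b = "2 * ord t B + ord t (to_fract f)"
    have ne: "?a \<noteq> ?b" using odd by presburger
    have AB: "(A, B) = (A, 0) \<boxplus> (0, B)" "(A, B) = (0, B) \<boxplus> (A, 0)" by (simp_all add: ff_eqs)
    have "A \<noteq> 0 \<or> B \<noteq> 0" using that x by simp
    then consider "B = 0" "A \<noteq> 0" | "A = 0" "B \<noteq> 0" | "A \<noteq> 0" "B \<noteq> 0" "?a < ?b" | "A \<noteq> 0" "B \<noteq> 0" "?b < ?a"
      using ne by (metis linorder_neqE)
    then have "v x = s * (if B = 0 then ?a else if A = 0 then ?b else min ?a ?b)"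
    proof cases
      case 1 then show ?thesis using over[of A] s x by simp
    next
      case 2 then show ?thesis using B[of B] s x by simp
    next
      case 3
      then have "v (A, 0) < v (0, B)" using over[of A] B[of B] s by simp
      then show ?thesis unfolding x AB(1) using pt_add_less[OF v, of "(A, 0)" "(0, B)"] over[of A] s 3 by simp
    next
      case 4
      then have "v (0, B) < v (A, 0)" using over[of A] B[of B] s by simp
      then show ?thesis unfolding x AB(2) using pt_add_less[OF v, of "(0, B)" "(A, 0)"] B[of B] 4 by simp
    qed
    then show ?thesis using ord_nrm_branch[OF odd, of A B] that x by (simp add: Let_def)
  qed
  obtain x where "x \<noteq> (0, 0)" "v x = 1" using pt_surj[OF v] by blast
  then have "s * ord t (nrm x) = 1" using eq by simp
  then have "s = 1" using s by (metis zmult_eq_1_iff less_numeral_extra(1) not_less_iff_gr_or_eq neg_less_0_iff_less)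
  then show ?thesis using eq pt_zero[OF v] by (auto simp: branch_place_def)
qed

end

context hyperelliptic_curve
begin

section \<open>Points over an unramified point\<close>

abbreviation const :: "'k \<Rightarrow> 'k poly fract" where "const c \<equiv> to_fract [:c:]"
abbreviation scal :: "'k poly fract \<Rightarrow> 'k ff \<Rightarrow> 'k ff" (infixr \<open>*\<^sub>s\<close> 75) where "r *\<^sub>s x \<equiv> (r, 0) \<odot> x"

text \<open>The functions \<open>A + B y\<close> with \<open>A\<close> and \<open>B\<close> regular at \<open>a\<close> can be evaluated at the point \<open>(a, b)\<close>.\<close>

definition regular :: "'k \<Rightarrow> 'k ff \<Rightarrow> bool" where
  "regular a x \<longleftrightarrow> ord_ge (Some a) 0 (fst x) \<and> ord_ge (Some a) 0 (snd x)"

definition vanishes :: "'k \<Rightarrow> 'k \<Rightarrow> 'k ff \<Rightarrow> bool" where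
  "vanishes a b x \<longleftrightarrow> ord_ge (Some a) 1 (fst x + const b * snd x)"

abbreviation ff_unit :: "'k \<Rightarrow> 'k \<Rightarrow> 'k ff \<Rightarrow> bool" where
  "ff_unit a b x \<equiv> regular a x \<and> \<not> vanishes a b x"

text \<open>The order \<open>n\<close> at an unramified point, without completions: \<open>x\<close> is \<open>(x - a)\<^sup>n\<close> times a quotient of functions
  that are regular over \<open>a\<close> and nonzero at \<open>(a, b)\<close>.\<close>

definition has_val :: "'k \<Rightarrow> 'k \<Rightarrow> 'k ff \<Rightarrow> int \<Rightarrow> bool" where
  "has_val a b x n \<longleftrightarrow> (\<exists>s t. ff_unit a b s \<and> ff_unit a b t \<and> x \<odot> s = (lin a powi n) *\<^sub>s t)"

lemma has_valI:
  "ff_unit a b s \<Longrightarrow> ff_unit a b t \<Longrightarrow> x \<odot> s = (lin a powi n) *\<^sub>s t \<Longrightarrow> has_val a b x n"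
  unfolding has_val_def by blast

lemma has_valE:
  assumes "has_val a b x n"
  obtains s t where "ff_unit a b s" "ff_unit a b t" "x \<odot> s = (lin a powi n) *\<^sub>s t"
  using assms unfolding has_val_def by blast

lemma regular_add: "regular a x \<Longrightarrow> regular a y \<Longrightarrow> regular a (x \<boxplus> y)"
  by (auto simp: regular_def pls_eq intro: ord_ge_add)

lemma ord_ge_f: "ord_ge (Some a) 0 (to_fract f)"
  by (simp add: ord_ge_def ord_Some_f)

lemma ord_ge_0_mult: "ord_ge t 0 r \<Longrightarrow> ord_ge t 0 s \<Longrightarrow> ord_ge t 0 (r * s)"
  using ord_ge_mult[of t 0 r 0 s] by simp

lemma regular_mul: "regular a x \<Longrightarrow> regular a y \<Longrightarrow> regular a (x \<odot> y)"
  by (auto simp: regular_def mul_eq intro!: ord_ge_add ord_ge_0_mult ord_ge_f)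

lemma ord_ge_1_f_minus: "poly f a = b\<^sup>2 \<Longrightarrow> ord_ge (Some a) 1 (to_fract f - const b * const b)"
proof -
  assume b: "poly f a = b\<^sup>2"
  obtain q where q: "f = [:poly f a:] + [:-a, 1:] * q" by (rule poly_linear_decomp)
  have "to_fract f - const b * const b = to_fract (f - [:b\<^sup>2:])"
    by (simp add: power2_eq_square flip: to_fract_mult)
  also have "f - [:b\<^sup>2:] = [:-a, 1:] * q" using q b by (metis add_diff_cancel_left')
  finally have "to_fract f - const b * const b = lin a * to_fract q" by (simp only: to_fract_mult)
  moreover have "ord_ge (Some a) 1 (lin a)" unfolding ord_ge_def ord_lin by simp
  moreover have "ord_ge (Some a) 0 (to_fract q)"
    by (cases "q = 0") (auto simp: ord_ge_def ord_to_fract poly_ord_def)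
  ultimately show ?thesis using ord_ge_mult[of "Some a" 1 "lin a" 0 "to_fract q"] by simp
qed

lemma eval_regular: "regular a x \<Longrightarrow> ord_ge (Some a) 0 (fst x + const b * snd x)"
  by (auto simp: regular_def intro!: ord_ge_add ord_ge_0_mult)

lemma vanishes_mul:
  assumes "poly f a = b\<^sup>2" "regular a x" "regular a y"
  shows "vanishes a b (x \<odot> y) \<longleftrightarrow> vanishes a b x \<or> vanishes a b y"
proof -
  let ?e = "\<lambda>x. fst x + const b * snd x" and ?d = "to_fract f - const b * const b"
  have eq: "?e (x \<odot> y) = ?e x * ?e y + snd x * snd y * ?d" by (simp add: mul_eq algebra_simps)
  have "ord_ge (Some a) (0 + 1) (snd x * snd y * ?d)"
    using assms by (intro ord_ge_mult ord_ge_0_mult ord_ge_1_f_minus) (auto simp: regular_def)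
  then have d: "ord_ge (Some a) 1 (snd x * snd y * ?d)" by simp
  have "ord_ge (Some a) 1 (?e (x \<odot> y)) \<longleftrightarrow> ord_ge (Some a) 1 (?e x * ?e y)"
    unfolding eq using d ord_ge_add ord_ge_diff by (metis add_diff_cancel_right')
  moreover have "ord_ge (Some a) 1 (?e x * ?e y) \<longleftrightarrow> ord_ge (Some a) 1 (?e x) \<or> ord_ge (Some a) 1 (?e y)"
    using eval_regular[OF assms(2), of b] eval_regular[OF assms(3), of b]
    unfolding ord_ge_def by (auto simp: ord_mult)
  ultimately show ?thesis by (simp add: vanishes_def)
qed

lemma unit_mul: "poly f a = b\<^sup>2 \<Longrightarrow> ff_unit a b x \<Longrightarrow> ff_unit a b y \<Longrightarrow> ff_unit a b (x \<odot> y)"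
  by (simp add: regular_mul vanishes_mul)

lemma unit_rat: "ord_ge (Some a) 0 r \<Longrightarrow> \<not> ord_ge (Some a) 1 r \<Longrightarrow> ff_unit a b (r, 0)"
  by (simp add: regular_def vanishes_def) (simp add: ord_ge_def)

lemma unit_const: "c \<noteq> 0 \<Longrightarrow> ff_unit a b (const c, 0)"
  by (intro unit_rat) (auto simp: ord_ge_def)

lemma unit_one [simp]: "ff_unit a b (1, 0)"
  using unit_const[of 1 a b] by (simp flip: one_pCons)

lemma unit_nz: "ff_unit a b x \<Longrightarrow> x \<noteq> (0, 0)"
  by (auto simp: vanishes_def ord_ge_def)

lemma vanishes_scal:
  assumes "regular a x" "n > 0" shows "regular a (lin a powi n *\<^sub>s x)" "vanishes a b (lin a powi n *\<^sub>s x)"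
proof -
  have "ord_ge (Some a) n (lin a powi n)" unfolding ord_ge_def by (simp add: ord_power_int ord_lin del: lin_nonzero)
  then have ge: "ord_ge (Some a) 1 (lin a powi n)" using assms by (auto intro: ord_ge_mono)
  then have ge0: "ord_ge (Some a) 0 (lin a powi n)" by (auto intro: ord_ge_mono)
  have "ord_ge (Some a) 0 (0 :: 'k poly fract)" by (simp add: ord_ge_def)
  then show "regular a (lin a powi n *\<^sub>s x)" using ge0 assms
    by (intro regular_mul) (auto simp: regular_def)
  have "ord_ge (Some a) (1 + 0) (lin a powi n * (fst x + const b * snd x))"
    by (intro ord_ge_mult ge eval_regular assms)
  then show "vanishes a b (lin a powi n *\<^sub>s x)" by (simp add: vanishes_def mul_eq algebra_simps)
qed

lemma scal_cancel: "r \<noteq> 0 \<Longrightarrow> r *\<^sub>s x = r *\<^sub>s y \<longleftrightarrow> x = y"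
  by (simp add: mul_eq prod_eq_iff)

lemma scal_scal: "r *\<^sub>s s *\<^sub>s x = (r * s) *\<^sub>s x" by (simp add: mul_eq)

lemma linpow_nz: "lin a powi n \<noteq> 0" by (simp add: power_int_eq_0_iff)
lemma linpow_add: "lin a powi (m + n) = lin a powi m * lin a powi n" by (rule power_int_add) simp

lemma has_val_unique:
  assumes b: "poly f a = b\<^sup>2" and "has_val a b x n" "has_val a b x m" shows "n = m"
proof -
  have "\<not> n < m" if "has_val a b x n" "has_val a b x m" for n m
  proof
    assume less: "n < m"
    obtain s t s' t' where *: "ff_unit a b s" "ff_unit a b t" "x \<odot> s = lin a powi n *\<^sub>s t"
       "ff_unit a b s'" "ff_unit a b t'" "x \<odot> s' = lin a powi m *\<^sub>s t'" 
      by (metis \<open>has_val a b x n\<close> \<open>has_val a b x m\<close> has_valE)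
    have "lin a powi n *\<^sub>s (t \<odot> s') = (x \<odot> s) \<odot> s'" by (simp only: * mul_assoc)
    also have "\<dots> = (x \<odot> s') \<odot> s" by (simp only: mul_assoc mul_comm[of s])
    also have "\<dots> = lin a powi (n + (m - n)) *\<^sub>s (t' \<odot> s)" by (simp add: * mul_assoc)
    also have "\<dots> = lin a powi n *\<^sub>s lin a powi (m - n) *\<^sub>s (t' \<odot> s)"
      unfolding linpow_add scal_scal ..
    finally have "t \<odot> s' = lin a powi (m - n) *\<^sub>s (t' \<odot> s)" using scal_cancel[OF linpow_nz] by blast
    moreover have "ff_unit a b (t \<odot> s')" using unit_mul[OF b] * by blast
    moreover have "vanishes a b (lin a powi (m - n) *\<^sub>s (t' \<odot> s))"
      using vanishes_scal[of a "t' \<odot> s" "m - n"] less * regular_mul by simp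
    ultimately show False by simp
  qed
  then show ?thesis using assms by (meson linorder_neqE)
qed

lemma has_val_mul:
  assumes b: "poly f a = b\<^sup>2" and "has_val a b x n" "has_val a b y m" shows "has_val a b (x \<odot> y) (n + m)"
proof -
  obtain s t s' t' where *: "ff_unit a b s" "ff_unit a b t" "x \<odot> s = lin a powi n *\<^sub>s t"
     "ff_unit a b s'" "ff_unit a b t'" "y \<odot> s' = lin a powi m *\<^sub>s t'" 
    using assms unfolding has_val_def by blast
  have "(x \<odot> y) \<odot> (s \<odot> s') = (x \<odot> s) \<odot> (y \<odot> s')" by (simp add: ff_eqs algebra_simps)
  also have "\<dots> = lin a powi (n + m) *\<^sub>s (t \<odot> t')" unfolding * linpow_add by (simp add: ff_eqs algebra_simps)
  finally show ?thesis by (rule has_valI[OF unit_mul[OF b *(1) *(4)] unit_mul[OF b *(2) *(5)]])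
qed

lemma has_val_vanishing:
  assumes b: "poly f a = b\<^sup>2" and "has_val a b x n" "regular a x"
  shows "n \<ge> 0" "vanishes a b x \<Longrightarrow> n > 0"
proof -
  obtain s t where *: "ff_unit a b s" "ff_unit a b t" "x \<odot> s = lin a powi n *\<^sub>s t"
    using assms unfolding has_val_def by blast
  have "lin a powi (-n) *\<^sub>s lin a powi n *\<^sub>s t = t"
    unfolding scal_scal linpow_add[symmetric] by simp
  then have t: "t = lin a powi (-n) *\<^sub>s (x \<odot> s)" using * by simp
  show "n \<ge> 0"
  proof (rule ccontr)
    assume "\<not> n \<ge> 0"
    moreover have "regular a (x \<odot> s)" using assms *(1) by (intro regular_mul) auto
    ultimately have "vanishes a b (lin a powi (-n) *\<^sub>s (x \<odot> s))" by (intro vanishes_scal(2)) auto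
    then show False using *(2) t by metis
  qed
  assume van: "vanishes a b x"
  have "n \<noteq> 0"
  proof
    assume "n = 0"
    then have "t = x \<odot> s" using t by simp
    then show False using * van vanishes_mul[OF b] assms by blast
  qed
  then show "n > 0" using \<open>n \<ge> 0\<close> by simp
qed

text \<open>After removing a power of \<open>x - a\<close>, a function that vanishes at \<open>(a, b)\<close> does not vanish at \<open>(a, -b)\<close>; so its
  conjugate is a unit at \<open>(a, b)\<close>, and its order is that of the norm.\<close>

lemma has_val_exists:
  assumes b: "poly f a = b\<^sup>2" "b \<noteq> 0" and x: "x \<noteq> (0, 0)" obtains n where "has_val a b x n"
proof -
  obtain A B where AB: "x = (A, B)" by force
  define m where "m = (if A = 0 then ord (Some a) B else if B = 0 then ord (Some a) A
      else min (ord (Some a) A) (ord (Some a) B))"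
  define x' where "x' = lin a powi (-m) *\<^sub>s x"
  have x_eq: "x = lin a powi m *\<^sub>s x'"
    unfolding x'_def scal_scal linpow_add[symmetric] by simp
  have ordm: "ord (Some a) (lin a powi (- m) * r) = ord (Some a) r - m" if "r \<noteq> 0" for r
    using that ord_mult[OF linpow_nz, of r "Some a" a "-m"] ord_lin[of "Some a" a]
    by (simp add: ord_power_int del: mult_pCons_left)
  have m: "A \<noteq> 0 \<Longrightarrow> m \<le> ord (Some a) A" "B \<noteq> 0 \<Longrightarrow> m \<le> ord (Some a) B"
    "A \<noteq> 0 \<and> ord (Some a) A = m \<or> B \<noteq> 0 \<and> ord (Some a) B = m"
    using x AB by (auto simp: m_def)
  have x': "x' = (lin a powi (- m) * A, lin a powi (- m) * B)" unfolding x'_def AB mul_eq by simp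
  have reg: "regular a x'" unfolding regular_def ord_ge_def x' using m(1,2) by (auto simp: ordm)
  have nv: "\<not> (ord_ge (Some a) 1 (fst x') \<and> ord_ge (Some a) 1 (snd x'))"
    unfolding ord_ge_def x' using m(3) linpow_nz[of a "- m"] ordm[of A] ordm[of B] by fastforce
  have "\<exists>n. has_val a b x' n"
  proof (cases "vanishes a b x'")
    case False
    then have "has_val a b x' 0" using reg by (intro has_valI[where s = "(1, 0)" and t = x'] unit_one) simp_all
    then show ?thesis by blast
  next
    case True
    have c: "ord_ge (Some a) 1 r" if "ord_ge (Some a) 1 (const c * r)" "c \<noteq> 0" for c r
      using that by (auto simp: ord_ge_def ord_mult)
    have "ff_unit a b (cnj x')"
    proof -
      have "\<not> vanishes a b (cnj x')"
      proof
        assume "vanishes a b (cnj x')"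
        then have 2: "ord_ge (Some a) 1 (fst x' - const b * snd x')" by (simp add: vanishes_def cnj_def)
        have 1: "ord_ge (Some a) 1 (fst x' + const b * snd x')" using True by (simp add: vanishes_def)
        have "[:2 :: 'k:] = 1 + 1" by (simp add: one_pCons)
        then have "const 2 = 1 + 1" by (simp only: to_fract_add to_fract_1)
        then have two: "const 2 = 2" by simp
        have eq: "const 2 * p = (p + q) + (p - q)" "const 2 * q = (p + q) - (p - q)" for p q
          unfolding two by simp_all
        have "ord_ge (Some a) 1 (const 2 * fst x')" "ord_ge (Some a) 1 (const 2 * (const b * snd x'))"
          using ord_ge_add[OF 1 2] ord_ge_diff[OF 1 2] by (simp_all only: eq[where p = "fst x'" and q = "const b * snd x'"])
        then show False using nv c[OF _ two_nz] c[OF _ b(2)] by blast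
      qed
      then show ?thesis using reg by (simp add: regular_def cnj_def)
    qed
    moreover define j where "j = ord (Some a) (nrm x')"
    define r where "r = lin a powi (-j) * nrm x'"
    have "x' \<noteq> (0, 0)" using x x_eq by auto
    then have nz: "nrm x' \<noteq> 0" by simp
    have "ord (Some a) r = 0" "r \<noteq> 0"
      using ord_mult[OF linpow_nz nz, of "Some a" a "-j"] ord_lin[of "Some a" a] nz linpow_nz
      unfolding r_def j_def by (simp_all add: ord_power_int del: mult_pCons_left)
    then have "ff_unit a b (r, 0)" by (intro unit_rat) (auto simp: ord_ge_def)
    moreover have "x' \<odot> cnj x' = lin a powi j *\<^sub>s (r, 0)"
      unfolding mul_cnj r_def mul_rat mult.assoc[symmetric] linpow_add[symmetric] by simp
    ultimately show ?thesis using has_valI by blast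
  qed
  then obtain n where n: "has_val a b x' n" by blast
  have "has_val a b (lin a powi m, 0) m"
    by (rule has_valI[OF unit_one unit_one]) simp
  then have "has_val a b x (m + n)" using has_val_mul[OF b(1) _ n] x_eq by simp
  then show ?thesis using that by blast
qed

definition split_place :: "'k \<Rightarrow> 'k \<Rightarrow> 'k ff \<Rightarrow> int" where
  "split_place a b x = (if x = (0, 0) then 0 else (THE n. has_val a b x n))"

lemma split_place_eq: "poly f a = b\<^sup>2 \<Longrightarrow> x \<noteq> (0, 0) \<Longrightarrow> has_val a b x n \<Longrightarrow> split_place a b x = n"
  by (simp add: split_place_def) (rule the_equality, auto dest: has_val_unique)

lemma has_val_split_place:
  "poly f a = b\<^sup>2 \<Longrightarrow> b \<noteq> 0 \<Longrightarrow> x \<noteq> (0, 0) \<Longrightarrow> has_val a b x (split_place a b x)"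
  using has_val_exists[of a b x] split_place_eq[of a b x] by metis

lemma has_val_rat: "r \<noteq> 0 \<Longrightarrow> has_val a b (r, 0) (ord (Some a) r)"
proof -
  assume r: "r \<noteq> 0"
  let ?j = "ord (Some a) r" and ?r = "lin a powi (- ord (Some a) r) * r"
  have "ord (Some a) ?r = 0" "?r \<noteq> 0"
    using ord_mult[OF linpow_nz r, of "Some a" a "- ?j"] ord_lin[of "Some a" a] r linpow_nz
    by (simp_all add: ord_power_int del: mult_pCons_left)
  then have "ff_unit a b (?r, 0)" by (intro unit_rat) (auto simp: ord_ge_def)
  moreover have "(r, 0) \<odot> (1, 0) = lin a powi ?j *\<^sub>s (?r, 0)"
    unfolding mul_one mul_rat mult.assoc[symmetric] linpow_add[symmetric] by simp
  ultimately show ?thesis using has_valI[OF unit_one] by blast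
qed

lemma split_place_rat: "poly f a = b\<^sup>2 \<Longrightarrow> r \<noteq> 0 \<Longrightarrow> split_place a b (r, 0) = ord (Some a) r"
  by (intro split_place_eq has_val_rat) auto

lemma split_place_in_points:
  assumes b: "poly f a = b\<^sup>2" "b \<noteq> 0" shows "split_place a b \<in> Points"
proof (rule pointsI[where x = "(lin a, 0)"])
  note hv = has_val_split_place[OF b]
  show "split_place a b (x \<odot> y) = split_place a b x + split_place a b y" if "x \<noteq> (0, 0)" "y \<noteq> (0, 0)" for x y
    using that by (intro split_place_eq[OF b(1)] has_val_mul b hv) auto
  have add: "split_place a b (x \<boxplus> y) \<ge> split_place a b x"
    if nz: "x \<noteq> (0, 0)" "y \<noteq> (0, 0)" "x \<boxplus> y \<noteq> (0, 0)" and le: "split_place a b x \<le> split_place a b y" for x y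
  proof -
    let ?n = "split_place a b x" and ?m = "split_place a b y"
    obtain s t s' t' where *: "ff_unit a b s" "ff_unit a b t" "x \<odot> s = lin a powi ?n *\<^sub>s t"
     "ff_unit a b s'" "ff_unit a b t'" "y \<odot> s' = lin a powi ?m *\<^sub>s t'" 
      by (metis hv[OF nz(1)] hv[OF nz(2)] has_valE)
    define z where "z = (t \<odot> s') \<boxplus> (lin a powi (?m - ?n) *\<^sub>s (t' \<odot> s))"
    have "regular a (lin a powi (?m - ?n) *\<^sub>s (t' \<odot> s))"
      using vanishes_scal(1)[of a "t' \<odot> s" "?m - ?n"] le * regular_mul by (cases "?m = ?n") auto
    moreover have "regular a (t \<odot> s')" using * by (intro regular_mul) auto
    ultimately have "regular a z" unfolding z_def by (intro regular_add)
    have "(x \<boxplus> y) \<odot> (s \<odot> s') = ((x \<odot> s) \<odot> s') \<boxplus> ((y \<odot> s') \<odot> s)"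
      by (simp add: ff_eqs algebra_simps)
    also have "\<dots> = ((lin a powi ?n *\<^sub>s t) \<odot> s') \<boxplus> (((lin a powi ?n * lin a powi (?m - ?n)) *\<^sub>s t') \<odot> s)"
      unfolding * linpow_add[symmetric] by simp
    also have "\<dots> = lin a powi ?n *\<^sub>s z" unfolding z_def by (simp add: ff_eqs algebra_simps)
    finally have eq: "(x \<boxplus> y) \<odot> (s \<odot> s') = lin a powi ?n *\<^sub>s z" .
    have u: "ff_unit a b (s \<odot> s')" using unit_mul[OF b(1)] * by blast
    have "z \<noteq> (0, 0)"
    proof
      assume "z = (0, 0)"
      then have "(x \<boxplus> y) \<odot> (s \<odot> s') = (0, 0)" unfolding eq by simp
      then show False using nz unit_nz[OF u] unfolding mul_eq_0_iff by blast
    qed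
    then obtain j where j: "has_val a b z j" using has_val_exists[OF b] by blast
    then have "j \<ge> 0" using has_val_vanishing(1)[OF b(1) j] \<open>regular a z\<close> by blast
    have "has_val a b (lin a powi ?n, 0) ?n"
      by (rule has_valI[OF unit_one unit_one]) simp
    then have "has_val a b ((x \<boxplus> y) \<odot> (s \<odot> s')) (?n + j)" unfolding eq using has_val_mul[OF b(1) _ j] by blast
    moreover have "has_val a b (s \<odot> s') 0"
      using u by (intro has_valI[where s = "(1, 0)" and t = "s \<odot> s'"] unit_one) simp_all
    then have "has_val a b ((x \<boxplus> y) \<odot> (s \<odot> s')) (split_place a b (x \<boxplus> y) + 0)"
      using has_val_mul[OF b(1) hv[OF nz(3)]] by blast
    ultimately have "?n + j = split_place a b (x \<boxplus> y) + 0" by (rule has_val_unique[OF b(1)])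
    then show ?thesis using \<open>j \<ge> 0\<close> by simp
  qed
  show "split_place a b (x \<boxplus> y) \<ge> min (split_place a b x) (split_place a b y)"
    if "x \<noteq> (0, 0)" "y \<noteq> (0, 0)" "x \<boxplus> y \<noteq> (0, 0)" for x y
  proof -
    have "x \<boxplus> y = y \<boxplus> x" by (simp add: pls_eq add.commute)
    then show ?thesis using that add[of x y] add[of y x] 
      by (cases "split_place a b x \<le> split_place a b y") auto
  qed
  show "split_place a b (lin a, 0) = 1" using b split_place_rat[of a b "lin a"] ord_lin[of "Some a" a] by simp
  show "split_place a b (const c, 0) = 0" if "c \<noteq> 0" for c
    using split_place_rat[OF b(1), of "const c"] that by simp
qed (simp_all add: split_place_def)

lemma split_place_vanishing:
  assumes b: "poly f a = b\<^sup>2" "b \<noteq> 0" and "regular a x" "x \<noteq> (0, 0)" "vanishes a b x"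
  shows "split_place a b x > 0"
  using has_val_vanishing(2)[OF b(1) has_val_split_place[OF b]] assms by blast

lemma y_minus_b:
  "regular a (- const b, 1)" "vanishes a b (- const b, 1)" "((- const b, 1) :: 'k ff) \<noteq> (0, 0)"
  by (auto simp: regular_def vanishes_def) (auto simp: ord_ge_def)

text \<open>Positivity on \<open>y - b\<close> makes the point agree with evaluation at \<open>(a, b)\<close>, so that it vanishes on the units.\<close>

lemma point_eq_split_place:
  assumes v: "v \<in> Points" and c: "c > 0" and over: "\<And>r. r \<noteq> 0 \<Longrightarrow> v (r, 0) = c * ord (Some a) r"
    and b: "poly f a = b\<^sup>2" "b \<noteq> 0" and pos: "v (- const b, 1) > 0"
  shows "v = split_place a b"
proof -
  have unit: "v x = 0" if "ff_unit a b x" for x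
  proof -
    let ?e = "fst x + const b * snd x"
    have x: "x = (?e, 0) \<boxplus> (snd x *\<^sub>s (- const b, 1))" by (simp add: ff_eqs)
    have e: "?e \<noteq> 0" "ord (Some a) ?e = 0"
      using that eval_regular[of a x b] by (auto simp: vanishes_def ord_ge_def)
    have ve: "v (?e, 0) = 0" using over[OF e(1)] e by simp
    have "snd x *\<^sub>s (- const b, 1) = (0, 0) \<or> v (?e, 0) < v (snd x *\<^sub>s (- const b, 1))"
    proof (cases "snd x = 0")
      case False
      then have "v (snd x *\<^sub>s (- const b, 1)) = c * ord (Some a) (snd x) + v (- const b, 1)"
        using pt_mul[OF v, of "(snd x, 0)" "(- const b, 1)"] over by simp
      moreover have "ord (Some a) (snd x) \<ge> 0" using that False by (simp add: regular_def ord_ge_def)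
      then have "c * ord (Some a) (snd x) \<ge> 0" using c by simp
      ultimately show ?thesis using pos ve by simp
    qed simp
    then have "v ((?e, 0) \<boxplus> (snd x *\<^sub>s (- const b, 1))) = v (?e, 0)" using e by (intro pt_add_less'[OF v]) auto
    then show ?thesis using x ve by simp
  qed
  have eq: "v x = c * split_place a b x" if nz: "x \<noteq> (0, 0)" for x
  proof -
    let ?n = "split_place a b x"
    obtain s t where *: "ff_unit a b s" "ff_unit a b t" "x \<odot> s = lin a powi ?n *\<^sub>s t"
      by (rule has_valE[OF has_val_split_place[OF b nz]])
    have "v (x \<odot> s) = v x" using pt_mul[OF v nz unit_nz[OF *(1)]] unit *(1) by simp
    moreover have "v (lin a powi ?n *\<^sub>s t) = v (lin a powi ?n, 0) + v t"
      by (rule pt_mul[OF v _ unit_nz[OF *(2)]]) (simp add: linpow_nz)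
    moreover have "v (lin a powi ?n, 0) = c * ?n"
      unfolding over[OF linpow_nz] using ord_lin[of "Some a" a] by (simp add: ord_power_int)
    ultimately show ?thesis using unit *(2) *(3) by simp
  qed
  obtain x where x: "x \<noteq> (0, 0)" "v x = 1" using pt_surj[OF v] by blast
  then have "c * split_place a b x = 1" using eq by simp
  then have "c = 1" using c by (metis zmult_eq_1_iff less_numeral_extra(1) not_less_iff_gr_or_eq neg_less_0_iff_less)
  then show ?thesis using eq pt_zero[OF v] by (auto simp: split_place_def)
qed

text \<open>The norm of \<open>y - b\<close> vanishes at \<open>a\<close>, so one of \<open>y - b\<close> and \<open>y + b\<close> has positive value.\<close>

lemma point_over_split:
  assumes v: "v \<in> Points" and c: "c > 0" and over: "\<And>r. r \<noteq> 0 \<Longrightarrow> v (r, 0) = c * ord (Some a) r"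
    and a: "poly f a \<noteq> 0"
  obtains b where "poly f a = b\<^sup>2" "b \<noteq> 0" "v = split_place a b"
proof -
  obtain b where b: "b\<^sup>2 = poly f a" using nth_root_exists[of 2 "poly f a"] by auto
  then have bnz: "b \<noteq> 0" using a by auto
  let ?m = "(- const b, 1)" and ?p = "(- const (- b), 1)"
  have uc: "const (- b) = - const b" by (simp flip: to_fract_uminus)
  have prod: "?m \<odot> ?p = (to_fract f - const b * const b, 0)" by (simp add: mul_eq uc)
  have "nrm ?m \<noteq> 0" unfolding nrm_eq_0_iff by simp
  then have nz: "to_fract f - const b * const b \<noteq> 0" by (auto simp: nrm_def power2_eq_square)
  have "ord (Some a) (to_fract f - const b * const b) \<ge> 1"
    using ord_ge_1_f_minus[of a b] b nz by (simp add: ord_ge_def)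
  then have "c * ord (Some a) (to_fract f - const b * const b) > 0" using c by simp
  then have "v ?m + v ?p > 0" using over[OF nz] pt_mul[OF v, of ?m ?p] unfolding prod by simp
  then have "v ?m > 0 \<or> v ?p > 0" by linarith
  then show ?thesis
  proof
    assume "v ?m > 0"
    then have "v = split_place a b" using b bnz by (intro point_eq_split_place[OF v c over]) auto
    then show ?thesis using that[of b] b bnz by simp
  next
    assume "v ?p > 0"
    then have "v = split_place a (- b)" using b bnz by (intro point_eq_split_place[OF v c over]) auto
    then show ?thesis using that[of "- b"] b bnz by simp
  qed
qed

end

context hyperelliptic_curve
begin

section \<open>The points of the curve\<close>

abbreviation infinity :: "'k ff \<Rightarrow> int" where "infinity \<equiv> branch_place None"

definition place :: "'k \<Rightarrow> 'k \<Rightarrow> 'k ff \<Rightarrow> int" where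
  "place a b = (if b = 0 then branch_place (Some a) else split_place a b)"

lemma infinity_in_points [simp]: "infinity \<in> Points"
  by (rule branch_place_in_points) (simp add: odd_ord_f)

lemma place_in_points: "poly f a = b\<^sup>2 \<Longrightarrow> place a b \<in> Points"
  using branch_place_in_points[of "Some a"] split_place_in_points[of a b]
  by (cases "b = 0") (simp_all add: place_def odd_ord_f)

lemma branch_point_in_points: "poly f a = 0 \<Longrightarrow> place a 0 \<in> Points"
  by (rule place_in_points) simp

lemma infinity_rat: "r \<noteq> 0 \<Longrightarrow> infinity (r, 0) = 2 * ord None r"
  by (rule branch_place_rat)

lemma place_rat: "poly f a = b\<^sup>2 \<Longrightarrow> r \<noteq> 0 \<Longrightarrow> place a b (r, 0) = (if b = 0 then 2 else 1) * ord (Some a) r"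
  by (simp add: place_def branch_place_rat split_place_rat)

lemma points_cases:
  assumes v: "v \<in> Points"
  obtains "v = infinity" | a b where "poly f a = b\<^sup>2" "v = place a b"
proof -
  obtain t c where tc: "c > 0" "\<And>r. r \<noteq> 0 \<Longrightarrow> v (r, 0) = c * ord t r" by (rule point_over_line[OF v]) blast
  show ?thesis
  proof (cases t)
    case None
    then have "v = infinity" using point_eq_branch_place[OF v tc] by (simp add: odd_ord_f)
    then show ?thesis by (rule that(1))
  next
    case (Some a)
    show ?thesis
    proof (cases "poly f a = 0")
      case True
      then have "v = branch_place (Some a)" using point_eq_branch_place[OF v tc] Some by (simp add: odd_ord_f)
      then show ?thesis using that(2)[of a 0] True by (simp add: place_def)
    next
      case False
      obtain b where "poly f a = b\<^sup>2" "b \<noteq> 0" "v = split_place a b"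
        by (rule point_over_split[OF v tc(1) _ False]) (use tc(2) Some in auto)
      then show ?thesis using that(2)[of a b] by (simp add: place_def)
    qed
  qed
qed

lemma ex_sqrt: obtains b :: 'k where "c = b\<^sup>2"
  using nth_root_exists[of 2 c] by auto

lemma has_val_cnj: assumes "has_val a b x n" shows "has_val a (- b) (cnj x) n"
proof -
  obtain s t where *: "ff_unit a b s" "ff_unit a b t" "x \<odot> s = lin a powi n *\<^sub>s t" by (rule has_valE[OF assms])
  have u: "ff_unit a (- b) (cnj s)" if "ff_unit a b s" for s
  proof -
    have "const (- b) = - const b" by (simp flip: to_fract_uminus)
    then show ?thesis using that by (simp add: regular_def vanishes_def cnj_def)
  qed
  have "cnj x \<odot> cnj s = cnj (lin a powi n *\<^sub>s t)" unfolding *(3)[symmetric] cnj_mul ..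
  also have "\<dots> = lin a powi n *\<^sub>s cnj t" unfolding cnj_mul by (simp add: cnj_def)
  finally show ?thesis by (rule has_valI[OF u[OF *(1)] u[OF *(2)]])
qed

lemma infinity_cnj: "infinity (cnj x) = infinity x"
  by (simp add: branch_place_def)

lemma place_cnj: 
  assumes "poly f a = b\<^sup>2" shows "place a b (cnj x) = place a (- b) x"
proof (cases "b = 0 \<or> x = (0, 0)")
  case True
  then show ?thesis
  proof
    assume "b = 0" then show ?thesis by (simp add: place_def branch_place_def)
  next
    assume "x = (0, 0)"
    moreover have "cnj (0, 0) = (0, 0)" by (simp add: cnj_def)
    ultimately show ?thesis by (simp add: place_def branch_place_def split_place_def)
  qed
next
  case False
  have b: "poly f a = (- b)\<^sup>2" using assms by simp
  have "has_val a (- b) x (split_place a (- b) x)" using has_val_split_place[OF b] False by simp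
  then have "has_val a b (cnj x) (split_place a (- b) x)" using has_val_cnj[of a "- b"] by simp
  then have "split_place a b (cnj x) = split_place a (- b) x" using False by (intro split_place_eq[OF assms]) auto
  then show ?thesis using False by (simp add: place_def)
qed

lemma infinity_neq_place: "poly f a = b\<^sup>2 \<Longrightarrow> infinity \<noteq> place a b"
proof
  assume "poly f a = b\<^sup>2" "infinity = place a b"
  then have "place a b (lin a, 0) < 0" using infinity_rat[of "lin a"] ord_lin[of None a] by simp
  then show False using place_rat[OF \<open>poly f a = b\<^sup>2\<close>, of "lin a"] ord_lin[of "Some a" a] by (simp split: if_splits)
qed

lemma place_inject:
  assumes "poly f a = b\<^sup>2" "poly f a' = b'\<^sup>2" "place a b = place a' b'"
  shows "a = a'" "b = b'"
proof -
  have "place a b (lin a, 0) > 0" using place_rat[OF assms(1), of "lin a"] ord_lin[of "Some a" a] by simp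
  then have "ord (Some a') (lin a) \<noteq> 0" using place_rat[OF assms(2), of "lin a"] assms(3) by auto
  then show a: "a = a'" using ord_lin[of "Some a'" a] by (simp split: if_splits)
  show "b = b'"
  proof (rule ccontr)
    assume ne: "b \<noteq> b'"
    then have sq: "b'\<^sup>2 = b\<^sup>2" using assms a by simp
    then have b': "b' = - b" using ne power2_eq_iff[of b' b] by auto
    then have nz: "b \<noteq> 0" "b' \<noteq> 0" using ne by auto
    let ?m = "(- const b, 1) :: 'k ff" and ?p = "(- const b', 1) :: 'k ff"
    have v: "place a b \<in> Points" by (rule place_in_points[OF assms(1)])
    have m: "place a b ?m > 0" using split_place_vanishing[OF assms(1) nz(1) y_minus_b(1) y_minus_b(3) y_minus_b(2)] nz
      by (simp add: place_def)
    have "place a' b' ?p > 0"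
      using split_place_vanishing[OF assms(2) nz(2) y_minus_b(1) y_minus_b(3) y_minus_b(2)] nz
      by (simp add: place_def)
    then have p: "place a b ?p > 0" using assms(3) by simp
    have diff: "?p \<boxplus> (- fst ?m, - snd ?m) = (const (2 * b), 0)"
    proof -
      have "- const b' + const b = const (2 * b)" unfolding b' 
        by (simp flip: to_fract_uminus to_fract_add)
      then show ?thesis by (simp add: pls_eq)
    qed
    have "2 * b \<noteq> 0" using two_nz nz by simp
    then have "place a b (const (2 * b), 0) = 0" "(const (2 * b), 0) \<noteq> (0, 0)" using pt_const[OF v, of "2 * b"] by simp_all
    moreover have "place a b (- fst ?m, - snd ?m) = place a b ?m" by (rule pt_uminus[OF v])
    ultimately show False
      using pt_add[OF v, of ?p "(- fst ?m, - snd ?m)"] m p unfolding diff by simp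
  qed
qed

lemma points_cnj: "v \<in> Points \<Longrightarrow> v \<circ> cnj \<in> Points"
proof (elim points_cases)
  assume "v = infinity"
  then have "v \<circ> cnj = infinity" by (auto simp: infinity_cnj)
  then show ?thesis by simp
next
  fix a b assume *: "poly f a = b\<^sup>2" "v = place a b"
  then have "v \<circ> cnj = place a (- b)" by (auto simp: place_cnj)
  then show ?thesis using place_in_points[of a "- b"] * by simp
qed

text \<open>Over a finite point one takes a square root of the value of \<open>f\<close>.\<close>

lemma point_above: obtains v c where "v \<in> Points" "c > 0" "\<And>r. r \<noteq> 0 \<Longrightarrow> v (r, 0) = c * ord t r"
proof (cases t)
  case None then show ?thesis using that[of infinity 2] infinity_rat by simp
next
  case (Some a)
  obtain b where b: "poly f a = b\<^sup>2" by (rule ex_sqrt)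
  show ?thesis
    using that[OF place_in_points[OF b], of "if b = 0 then 2 else 1"] place_rat[OF b] Some by simp
qed

section \<open>Principal divisors\<close>

lemma finite_support_rat:
  assumes "r \<noteq> 0" shows "finite {v \<in> Points. v (r, 0) \<noteq> 0}"
  using assms
proof (induction r rule: fract_linear_induct)
  case (const c)
  then have "{v \<in> Points. v (const c, 0) \<noteq> 0} = {}" using pt_const by auto
  then show ?case by (simp only: finite.emptyI)
next
  case (lin a)
  obtain b where b: "poly f a = b\<^sup>2" by (rule ex_sqrt)
  have "v \<in> {infinity, place a b, place a (- b)}" if v: "v \<in> Points" "v (lin a, 0) \<noteq> 0" for v
    using v(1)
  proof (cases rule: points_cases)
    case (2 a' b')
    then have "a' = a" using v(2) place_rat[OF 2(1), of "lin a"] ord_lin[of "Some a'" a] by (simp split: if_splits)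
    then have "b'\<^sup>2 = b\<^sup>2" using 2 b by simp
    then show ?thesis using 2 \<open>a' = a\<close> by (auto simp: power2_eq_iff)
  qed simp
  then have "{v \<in> Points. v (lin a, 0) \<noteq> 0} \<subseteq> {infinity, place a b, place a (- b)}" by blast
  then show ?case by (rule finite_subset) simp
next
  case (mult r s)
  have "{v \<in> Points. v (r * s, 0) \<noteq> 0} \<subseteq> {v \<in> Points. v (r, 0) \<noteq> 0} \<union> {v \<in> Points. v (s, 0) \<noteq> 0}"
    using mult by (auto simp: pt_rat_mult)
  then show ?case using mult finite_subset by blast
next
  case (inverse r)
  have "{v \<in> Points. v (inverse r, 0) \<noteq> 0} \<subseteq> {v \<in> Points. v (r, 0) \<noteq> 0}"
    using inverse by (auto simp: pt_rat_inverse)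
  then show ?case using inverse finite_subset by blast
qed

lemma pt_nonneg:
  assumes v: "v \<in> Points" and "A \<noteq> 0 \<Longrightarrow> v (A, 0) = 0" "B \<noteq> 0 \<Longrightarrow> v (B, 0) = 0" "v (to_fract f, 0) = 0"
  shows "v (A, B) \<ge> 0"
proof -
  have y: "v (0, 1) = 0" using pt_y[OF v] assms by simp
  have B: "v (0, B) = 0" if "B \<noteq> 0" using pt_snd[OF v that] assms(3) that y by simp
  consider "A = 0" "B = 0" | "A = 0" "B \<noteq> 0" | "A \<noteq> 0" "B = 0" | "A \<noteq> 0" "B \<noteq> 0" by blast
  then show ?thesis
  proof cases
    case 4
    then show ?thesis using pt_add[OF v, of "(A, 0)" "(0, B)"] assms(2) B unfolding split_ff by simp
  qed (use assms B pt_zero[OF v] in simp_all)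
qed

lemma finite_support:
  assumes x: "x \<noteq> (0, 0)" shows "finite {v \<in> Points. v x \<noteq> 0}"
proof -
  let ?S = "\<lambda>r. {v \<in> Points. r \<noteq> 0 \<and> v (r, 0) \<noteq> 0}"
  obtain A B where AB: "x = (A, B)" by (cases x)
  have fin: "finite (?S r)" for r
    using finite_support_rat[of r] by (cases "r = 0") auto
  have "{v \<in> Points. v x \<noteq> 0} \<subseteq> ?S A \<union> ?S B \<union> ?S (to_fract f) \<union> ?S (nrm x)"
  proof (intro subsetI, rule ccontr)
    fix v assume v: "v \<in> {v \<in> Points. v x \<noteq> 0}" and n: "v \<notin> ?S A \<union> ?S B \<union> ?S (to_fract f) \<union> ?S (nrm x)"
    then have vP: "v \<in> Points" and vx: "v x \<noteq> 0" by auto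
    have *: "A \<noteq> 0 \<Longrightarrow> v (A, 0) = 0" "B \<noteq> 0 \<Longrightarrow> v (B, 0) = 0" "- B \<noteq> 0 \<Longrightarrow> v (- B, 0) = 0" "v (to_fract f, 0) = 0"
      using n vP pt_uminus[OF vP, of "(B, 0)"] by auto
    have "v (nrm x, 0) = 0" using n vP x by auto
    then have "v x + v (cnj x) = 0" using pt_nrm[OF vP x] by simp
    moreover have "v x \<ge> 0" unfolding AB by (rule pt_nonneg[OF vP *(1,2,4)])
    moreover have "v (cnj x) \<ge> 0" unfolding AB cnj_def fst_conv snd_conv by (rule pt_nonneg[OF vP *(1,3,4)])
    ultimately show False using vx by simp
  qed
  then show ?thesis by (rule finite_subset) (intro finite_UnI fin)
qed

definition pdiv :: "'k ff \<Rightarrow> ('k ff \<Rightarrow> int) \<Rightarrow>\<^sub>0 int" where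
  "pdiv x = Abs_poly_mapping (\<lambda>v. if v \<in> Points \<and> x \<noteq> (0, 0) then v x else 0)"

lemma lookup_pdiv:
  "Poly_Mapping.lookup (pdiv x) v = (if v \<in> Points \<and> x \<noteq> (0, 0) then v x else 0)"
proof -
  have "finite {v. (if v \<in> Points \<and> x \<noteq> (0, 0) then v x else 0) \<noteq> 0}"
    by (cases "x = (0, 0)") (use finite_support[of x] in \<open>simp_all add: if_distrib conj_commute cong: conj_cong\<close>)
  then show ?thesis unfolding pdiv_def by simp
qed

lemma divisor_degree_eq:
  "finite S \<Longrightarrow> Poly_Mapping.keys D \<subseteq> S \<Longrightarrow> divisor_degree D = (\<Sum>v\<in>S. Poly_Mapping.lookup D v)"
  unfolding divisor_degree_def by (rule sum.mono_neutral_left) (auto simp: in_keys_iff)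

lemma divisor_degree_add [simp]: "divisor_degree (D + D') = divisor_degree D + divisor_degree D'"
proof -
  let ?S = "Poly_Mapping.keys D \<union> Poly_Mapping.keys D'"
  have "divisor_degree (D + D') = (\<Sum>v\<in>?S. Poly_Mapping.lookup (D + D') v)"
    by (rule divisor_degree_eq) (use keys_add[of D D'] in auto)
  also have "\<dots> = (\<Sum>v\<in>?S. Poly_Mapping.lookup D v) + (\<Sum>v\<in>?S. Poly_Mapping.lookup D' v)"
    by (simp add: lookup_add sum.distrib)
  also have "\<dots> = divisor_degree D + divisor_degree D'"
    using divisor_degree_eq[of ?S D] divisor_degree_eq[of ?S D'] by simp
  finally show ?thesis .
qed

lemma divisor_degree_zero [simp]: "divisor_degree 0 = 0" by (simp add: divisor_degree_def)

lemma divisor_degree_uminus [simp]: "divisor_degree (- D) = - divisor_degree D"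
  using divisor_degree_add[of D "- D"] by simp

lemma divisor_degree_diff [simp]: "divisor_degree (D - D') = divisor_degree D - divisor_degree D'"
  using divisor_degree_add[of D "- D'"] by simp

lemma divisor_degree_of [simp]: "divisor_degree (frag_of v) = 1"
  by (simp add: divisor_degree_def)

lemma pdiv_mul: "x \<noteq> (0, 0) \<Longrightarrow> y \<noteq> (0, 0) \<Longrightarrow> pdiv (x \<odot> y) = pdiv x + pdiv y"
  by (rule poly_mapping_eqI) (simp add: lookup_pdiv lookup_add pt_mul)

lemma pdiv_one [simp]: "pdiv (1, 0) = 0"
  by (rule poly_mapping_eqI) (simp add: lookup_pdiv pt_one)

lemma pdiv_const: "c \<noteq> 0 \<Longrightarrow> pdiv (const c, 0) = 0"
  by (rule poly_mapping_eqI) (simp add: lookup_pdiv pt_const)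

lemma pdiv_rat_inverse: "r \<noteq> 0 \<Longrightarrow> pdiv (inverse r, 0) = - pdiv (r, 0)"
  by (rule poly_mapping_eqI) (simp add: lookup_pdiv pt_rat_inverse)

lemma pdiv_rat_mult: "r \<noteq> 0 \<Longrightarrow> s \<noteq> 0 \<Longrightarrow> pdiv (r * s, 0) = pdiv (r, 0) + pdiv (s, 0)"
  using pdiv_mul[of "(r, 0)" "(s, 0)"] by simp

lemma pdiv_rat_prod: "finite S \<Longrightarrow> (\<And>i. i \<in> S \<Longrightarrow> r i \<noteq> 0) \<Longrightarrow> pdiv (\<Prod>i\<in>S. r i, 0) = (\<Sum>i\<in>S. pdiv (r i, 0))"
  by (induction S rule: finite_induct) (simp_all add: pdiv_rat_mult)

lemma keys_pdiv: "Poly_Mapping.keys (pdiv x) \<subseteq> Points"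
  by (auto simp: in_keys_iff lookup_pdiv split: if_splits)

lemma pdiv_lin:
  assumes b: "poly f a = b\<^sup>2"
  shows "pdiv (lin a, 0) = frag_of (place a b) + frag_of (place a (- b)) - frag_of infinity - frag_of infinity"
proof (rule poly_mapping_eqI)
  fix v
  have b': "poly f a = (- b)\<^sup>2" using b by simp
  have ne: "place a b \<noteq> infinity" "place a (- b) \<noteq> infinity"
    using infinity_neq_place[OF b] infinity_neq_place[OF b'] by auto
  have bb: "place a b = place a (- b) \<longleftrightarrow> b = 0"
  proof
    assume "place a b = place a (- b)"
    then have "b = - b" by (rule place_inject(2)[OF b b'])
    then have "b + b = b + - b" by (rule arg_cong)
    then have "2 * b = 0" by (simp only: mult_2 add.right_inverse)
    then show "b = 0" using two_nz by simp
  qed simp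
  show "Poly_Mapping.lookup (pdiv (lin a, 0)) v =
    Poly_Mapping.lookup (frag_of (place a b) + frag_of (place a (- b)) - frag_of infinity - frag_of infinity) v"
  proof (cases "v \<in> Points")
    case False
    then have "v \<noteq> infinity" "v \<noteq> place a b" "v \<noteq> place a (- b)"
      using place_in_points[OF b] place_in_points[OF b'] by auto
    then show ?thesis using False by (simp add: lookup_pdiv lookup_add lookup_minus lookup_single)
  next
    case True
    then show ?thesis
    proof (cases rule: points_cases)
      case 1
      then show ?thesis using ne infinity_rat[of "lin a"] ord_lin[of None a]
        by (simp add: lookup_pdiv lookup_add lookup_minus lookup_single)
    next
      case (2 a' b')
      have n: "v \<noteq> infinity" using 2 infinity_neq_place by metis
      show ?thesis
      proof (cases "a' = a")
        case False
        then have "v \<noteq> place a b" "v \<noteq> place a (- b)"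
          using place_inject(1)[OF 2(1) b] place_inject(1)[OF 2(1) b'] 2 by auto
        then show ?thesis using n 2 True False place_rat[OF 2(1), of "lin a"] ord_lin[of "Some a'" a]
          by (simp add: lookup_pdiv lookup_add lookup_minus lookup_single)
      next
        case True
        then have "b' ^ 2 = b ^ 2" using 2 b by simp
        then have "b' = b \<or> b' = - b" by (simp add: power2_eq_iff)
        then have v: "v = place a b \<or> v = place a (- b)" and b0: "b' = 0 \<longleftrightarrow> b = 0" using 2(2) True by auto
        have lhs: "Poly_Mapping.lookup (pdiv (lin a, 0)) v = (if b = 0 then 2 else 1)"
          using \<open>v \<in> Points\<close> place_rat[OF 2(1), of "lin a"] ord_lin[of "Some a'" a] True b0
          unfolding 2(2) by (simp add: lookup_pdiv)
        show ?thesis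
        proof (cases "b = 0")
          case True
          then show ?thesis using v n unfolding lhs by (simp add: lookup_add lookup_minus lookup_single)
        next
          case False
          then have "(v = place a b) \<noteq> (v = place a (- b))" using bb v by metis
          then show ?thesis using n False unfolding lhs
            by (cases "v = place a b") (simp_all add: lookup_add lookup_minus lookup_single when_def)
        qed
      qed
    qed
  qed
qed

lemma degree_pdiv_rat: "r \<noteq> 0 \<Longrightarrow> divisor_degree (pdiv (r, 0)) = 0"
proof (induction r rule: fract_linear_induct)
  case (lin a)
  obtain b where b: "poly f a = b\<^sup>2" by (rule ex_sqrt)
  show ?case unfolding pdiv_lin[OF b] by simp
qed (simp_all add: pdiv_const pdiv_rat_mult pdiv_rat_inverse)

lemma degree_pdiv_cnj: "divisor_degree (pdiv (cnj x)) = divisor_degree (pdiv x)"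
proof -
  have 1: "v \<circ> cnj \<circ> cnj = v" for v :: "'k ff \<Rightarrow> int" by (auto simp: fun_eq_iff)
  have 2: "Poly_Mapping.lookup (pdiv (cnj x)) v = Poly_Mapping.lookup (pdiv x) (v \<circ> cnj)" for v
    using points_cnj[of v] points_cnj[of "v \<circ> cnj"] 1[of v] by (auto simp: lookup_pdiv)
  show ?thesis unfolding divisor_degree_def
  proof (rule sum.reindex_bij_witness[of _ "\<lambda>v. v \<circ> cnj" "\<lambda>v. v \<circ> cnj"])
    show "v \<circ> cnj \<in> Poly_Mapping.keys (pdiv x)" if "v \<in> Poly_Mapping.keys (pdiv (cnj x))" for v
      using that by (simp add: in_keys_iff 2)
    show "v \<circ> cnj \<in> Poly_Mapping.keys (pdiv (cnj x))" if "v \<in> Poly_Mapping.keys (pdiv x)" for v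
      using that by (simp add: in_keys_iff 2 1)
  qed (simp_all only: 1 2)
qed

text \<open>The involution permutes the points, so twice the degree is the degree of the divisor of the norm,
  which is a sum of divisors of linear polynomials.\<close>

lemma degree_pdiv [simp]: "divisor_degree (pdiv x) = 0"
proof (cases "x = (0, 0)")
  case True
  then have "pdiv x = 0" by (intro poly_mapping_eqI) (simp add: lookup_pdiv)
  then show ?thesis by simp
next
  case False
  then have "divisor_degree (pdiv x) + divisor_degree (pdiv (cnj x)) = divisor_degree (pdiv (nrm x, 0))"
    using pdiv_mul[of x "cnj x"] by (simp add: mul_cnj)
  then show ?thesis using degree_pdiv_rat[of "nrm x"] False by (simp add: degree_pdiv_cnj)
qed

lemma pdiv_inverse: assumes "x \<noteq> (0, 0)" obtains y where "y \<noteq> (0, 0)" "pdiv y = - pdiv x"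
proof -
  obtain y where y: "x \<odot> y = (1, 0)" "y \<noteq> (0, 0)" by (rule ff_inverse[OF assms])
  then have "pdiv x + pdiv y = 0" using pdiv_mul[OF assms y(2)] by simp
  then have "pdiv y = - pdiv x" by (simp add: eq_neg_iff_add_eq_0 add.commute)
  then show ?thesis by (rule that[OF y(2)])
qed

lemma principal_iff: "D \<in> principal_divisors f \<longleftrightarrow> (\<exists>x. x \<noteq> (0, 0) \<and> D = pdiv x)"
proof
  assume "D \<in> principal_divisors f"
  then obtain x where x: "Poly_Mapping.keys D \<subseteq> Points" "x \<noteq> (0, 0)" "\<forall>v\<in>Points. Poly_Mapping.lookup D v = v x"
    unfolding principal_divisors_def zero_eq by auto
  have "D = pdiv x"
  proof (rule poly_mapping_eqI)
    fix v
    have "v \<notin> Points \<Longrightarrow> Poly_Mapping.lookup D v = 0" using x(1) by (auto simp: in_keys_iff)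
    then show "Poly_Mapping.lookup D v = Poly_Mapping.lookup (pdiv x) v" using x by (simp add: lookup_pdiv)
  qed
  then show "\<exists>x. x \<noteq> (0, 0) \<and> D = pdiv x" using x(2) by blast
next
  assume "\<exists>x. x \<noteq> (0, 0) \<and> D = pdiv x"
  then obtain x where "x \<noteq> (0, 0)" "D = pdiv x" by blast
  moreover from this have "\<forall>v\<in>Points. Poly_Mapping.lookup D v = v x" by (simp add: lookup_pdiv)
  ultimately show "D \<in> principal_divisors f"
    unfolding principal_divisors_def zero_eq using keys_pdiv[of x] by (simp only: mem_Collect_eq carrier_free_Abelian_group_iff) blast
qed

text \<open>The trace \<open>2 A\<close> and the square \<open>B\<^sup>2 f\<close> have no poles on the projective line, so both are constant; as \<open>f\<close>
  has odd order at infinity, \<open>B = 0\<close>.\<close>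

lemma no_zeros_poles_imp_const:
  assumes z: "z \<noteq> (0, 0)" and v0: "\<And>v. v \<in> Points \<Longrightarrow> v z = 0"
  obtains c where "c \<noteq> 0" "z = (const c, 0)"
proof -
  obtain A B where AB: "z = (A, B)" by (cases z)
  have vc: "v (cnj z) = 0" if "v \<in> Points" for v using v0[OF points_cnj[OF that]] by simp
  have "[:2 :: 'k:] = 1 + 1" by (simp add: one_pCons)
  then have "const 2 = 1 + 1" by (simp only: to_fract_add to_fract_1)
  then have two: "r + r = const 2 * r" for r by (simp add: algebra_simps)
  have two0: "const 2 \<noteq> 0" using two_nz by simp
  have A: "v (A, 0) \<ge> 0" if v: "v \<in> Points" and "A \<noteq> 0" for v
  proof -
    have eq: "z \<boxplus> cnj z = (const 2 * A, 0)" unfolding AB by (simp add: pls_eq cnj_def two)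
    have "v (z \<boxplus> cnj z) \<ge> min (v z) (v (cnj z))"
      by (rule pt_add[OF v]) (use z that two0 eq in simp_all)
    then show ?thesis unfolding eq using v0[OF v] vc[OF v] pt_rat_mult[OF v two0 \<open>A \<noteq> 0\<close>] pt_const[OF v two_nz] by simp
  qed
  have B: "v (B\<^sup>2 * to_fract f, 0) \<ge> 0" if v: "v \<in> Points" and "B \<noteq> 0" for v
  proof -
    have eq: "z \<boxplus> (- fst (cnj z), - snd (cnj z)) = (const 2, 0) \<odot> (0, B)"
      unfolding AB by (simp add: pls_eq cnj_def two mul_eq)
    have "v (z \<boxplus> (- fst (cnj z), - snd (cnj z))) \<ge> min (v z) (v (- fst (cnj z), - snd (cnj z)))"
    proof (rule pt_add[OF v z])
      show "(- fst (cnj z), - snd (cnj z)) \<noteq> (0, 0)" using z unfolding AB cnj_def by simp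
      show "z \<boxplus> (- fst (cnj z), - snd (cnj z)) \<noteq> (0, 0)" unfolding eq using two0 that by simp
    qed
    then have "v (0, B) \<ge> 0"
      unfolding eq pt_uminus[OF v] using v0[OF v] vc[OF v] pt_mul[OF v, of "(const 2, 0)" "(0, B)"]
        pt_const[OF v two_nz] two0 that by simp
    moreover have "(0, B) \<odot> (0, B) = (B\<^sup>2 * to_fract f, 0)" by (simp add: mul_eq power2_eq_square)
    then have "v (B\<^sup>2 * to_fract f, 0) = v (0, B) + v (0, B)" 
      using pt_mul[OF v, of "(0, B)" "(0, B)"] that by simp
    ultimately show ?thesis by simp
  qed
  have nonneg: "ord t r \<ge> 0" if "r \<noteq> 0" "\<And>v. v \<in> Points \<Longrightarrow> v (r, 0) \<ge> 0" for r t
  proof -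
    obtain v c where v: "v \<in> Points" "c > 0" "\<And>r. r \<noteq> 0 \<Longrightarrow> v (r, 0) = c * ord t r"
      by (rule point_above[of t]) blast
    then show ?thesis using that(2)[OF v(1)] v(3)[OF that(1)] by (simp add: zero_le_mult_iff)
  qed
  have "B = 0"
  proof (rule ccontr)
    assume "B \<noteq> 0"
    then have nz: "B\<^sup>2 * to_fract f \<noteq> 0" by simp
    have "ord t (B\<^sup>2 * to_fract f) \<ge> 0" for t
      using nz by (rule nonneg) (rule B[OF _ \<open>B \<noteq> 0\<close>])
    then obtain c where "c \<noteq> 0" "B\<^sup>2 * to_fract f = const c"
      using no_poles_imp_const[OF nz] by blast
    then have "ord None (B\<^sup>2 * to_fract f) = 0" by simp
    then have "2 * (ord None B - int g) = 1" using \<open>B \<noteq> 0\<close> by (simp add: ord_mult ord_power ord_None_f)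
    then show False by (metis dvd_triv_left odd_one)
  qed
  then have nz: "A \<noteq> 0" using z AB by simp
  have "ord t A \<ge> 0" for t using nz by (rule nonneg) (rule A[OF _ nz])
  then obtain c where "c \<noteq> 0" "A = const c"
    using no_poles_imp_const[OF nz] by blast
  then show ?thesis using that AB \<open>B = 0\<close> by simp
qed

end

context hyperelliptic_curve
begin

section \<open>Divisors supported at the branch points\<close>

abbreviation branch_roots :: "'k set" where "branch_roots \<equiv> {a. poly f a = 0}"

definition branch_div :: "'k set \<Rightarrow> ('k ff \<Rightarrow> int) \<Rightarrow>\<^sub>0 int" where
  "branch_div S = (\<Sum>a\<in>S. frag_of (place a 0) - frag_of infinity)"

lemma finite_branch_roots [simp]: "finite branch_roots"
  by (rule poly_roots_finite) simp

lemma f_eq_prod: "f = (\<Prod>a\<in>branch_roots. [:-a, 1:])"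
proof -
  obtain A where A: "size A = degree f" "f = smult (lead_coeff f) (\<Prod>x\<in>#A. [:- x, 1:])"
    using alg_closed_imp_factorization[OF f_nz] by auto
  then have f: "f = (\<Prod>x\<in>#A. [:- x, 1:])" using monic_f by simp
  have cnt: "order a (\<Prod>x\<in>#A. [:- x, 1:]) = count A a" for a
  proof (induction A)
    case (add x A)
    have "order a [:-x, 1:] = (if x = a then 1 else 0)"
      using order_power_n_n[of a 1] by (auto simp: order_0I)
    moreover have "[:-x, 1:] * (\<Prod>x\<in>#A. [:- x, 1:]) \<noteq> 0" by (auto simp del: mult_pCons_left)
    ultimately show ?case using add by (simp add: order_mult del: mult_pCons_left)
  qed simp
  have roots: "branch_roots = set_mset A"
    using order_root[of f] cnt f f_nz by (metis (mono_tags, lifting) Collect_cong count_eq_zero_iff set_mset_def neq0_conv)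
  have "count A a \<le> 1" for a using cnt[of a] f squarefree_f unfolding rsquarefree_def by (metis le_refl zero_le)
  then have "A = mset_set (set_mset A)"
    by (intro multiset_eqI) (metis count_mset_set(1) count_mset_set(3) finite_set_mset le_antisym count_greater_eq_one_iff count_eq_zero_iff)
  then have "f = (\<Prod>x\<in>#mset_set (set_mset A). [:- x, 1:])" using f by simp
  then show ?thesis unfolding roots by (simp add: prod_unfold_prod_mset)
qed

lemma card_branch_roots: "card branch_roots = 2 * g + 1"
proof -
  have "degree (\<Prod>a\<in>branch_roots. [:-a, 1:]) = (\<Sum>a\<in>branch_roots. degree [:-a, 1:])"
    by (rule degree_prod_eq_sum_degree) simp
  then show ?thesis using degree_f f_eq_prod by simp
qed

lemma branch_div_empty [simp]: "branch_div {} = 0"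
  by (simp add: branch_div_def)

lemma keys_branch_div: "S \<subseteq> branch_roots \<Longrightarrow> Poly_Mapping.keys (branch_div S) \<subseteq> Points"
proof -
  assume S: "S \<subseteq> branch_roots"
  have "v \<in> Points" if v: "Poly_Mapping.lookup (branch_div S) v \<noteq> 0" for v
  proof (rule ccontr)
    assume n: "v \<notin> Points"
    have "Poly_Mapping.lookup (frag_of (place a 0) - frag_of infinity) v = 0" if "a \<in> S" for a
    proof -
      have "v \<noteq> place a 0" "v \<noteq> infinity" using n branch_point_in_points[of a] that S by auto
      then show ?thesis by (simp add: lookup_minus lookup_single)
    qed
    then show False using v by (simp add: branch_div_def lookup_sum)
  qed
  then show ?thesis by (auto simp: in_keys_iff)
qed

lemma degree_branch_div [simp]: "divisor_degree (branch_div S) = 0"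
  unfolding branch_div_def by (induction S rule: infinite_finite_induct) simp_all

lemma branch_div_double:
  assumes "S \<subseteq> branch_roots"
  shows "branch_div S + branch_div S = pdiv (\<Prod>a\<in>S. lin a, 0)"
proof -
  have fin: "finite S" using assms finite_branch_roots finite_subset by blast
  have "branch_div S + branch_div S = (\<Sum>a\<in>S. (frag_of (place a 0) - frag_of infinity) + (frag_of (place a 0) - frag_of infinity))"
    unfolding branch_div_def by (simp add: sum.distrib)
  also have "\<dots> = (\<Sum>a\<in>S. pdiv (lin a, 0))"
  proof (rule sum.cong)
    fix a assume "a \<in> S"
    then have "poly f a = 0\<^sup>2" using assms by auto
    from pdiv_lin[OF this] show "(frag_of (place a 0) - frag_of infinity) + (frag_of (place a 0) - frag_of infinity) = pdiv (lin a, 0)"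
      by simp
  qed simp
  also have "\<dots> = pdiv (\<Prod>a\<in>S. lin a, 0)" using fin by (simp add: pdiv_rat_prod)
  finally show ?thesis .
qed

lemma frag_double_cancel: "D + D = D' + D' \<Longrightarrow> D = D'" for D D' :: "'x \<Rightarrow>\<^sub>0 int"
proof (rule poly_mapping_eqI)
  fix v assume "D + D = D' + D'"
  then have "Poly_Mapping.lookup (D + D) v = Poly_Mapping.lookup (D' + D') v" by simp
  then show "Poly_Mapping.lookup D v = Poly_Mapping.lookup D' v" by (simp add: lookup_add)
qed

lemma prod_lin_nz: "finite S \<Longrightarrow> (\<Prod>a\<in>S. lin a) \<noteq> (0 :: 'k poly fract)"
  by simp

lemma ord_prod_lin: "finite S \<Longrightarrow> ord (Some b) (\<Prod>a\<in>S. lin a) = (if b \<in> S then 1 else 0 :: int)" for b :: 'k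
proof -
  assume "finite S"
  have "ord (Some b) (\<Prod>a\<in>S. lin a) = (\<Sum>a\<in>S. ord (Some b) (lin a))" by (rule ord_prod) simp
  also have "\<dots> = (\<Sum>a\<in>S. if a = b then 1 else 0)" by (rule sum.cong) (simp_all only: ord_lin option.case)
  finally show ?thesis using \<open>finite S\<close> by simp
qed

lemma branch_div_all_principal: "branch_div branch_roots = pdiv (0, 1)"
proof (rule frag_double_cancel)
  have "(\<Prod>a\<in>S. lin a) = to_fract (\<Prod>a\<in>S. [:-a, 1:])" for S :: "'k set"
    by (induction S rule: infinite_finite_induct) (simp_all del: mult_pCons_left)
  then have "(\<Prod>a\<in>branch_roots. lin a) = to_fract f" using f_eq_prod by simp
  then have "branch_div branch_roots + branch_div branch_roots = pdiv (to_fract f, 0)"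
    using branch_div_double[of branch_roots] by simp
  also have "(to_fract f, 0) = (0, 1) \<odot> (0, 1)" by (simp add: mul_eq)
  also have "pdiv ((0, 1) \<odot> (0, 1)) = pdiv (0, 1) + pdiv (0, 1)" by (rule pdiv_mul) simp_all
  finally show "branch_div branch_roots + branch_div branch_roots = pdiv (0, 1) + pdiv (0, 1)" .
qed

text \<open>If the divisor is that of \<open>x\<close>, then \<open>x\<^sup>2\<close> is a constant times the product of \<open>x - a\<close> for \<open>a\<close> in \<open>S\<close>.
  Hence \<open>x\<close> is \<open>A\<close> or \<open>B y\<close>; parity of orders gives the two cases.\<close>

lemma branch_div_principal_imp:
  assumes S: "S \<subseteq> branch_roots" and x: "x \<noteq> (0, 0)" and eq: "branch_div S = pdiv x"
  shows "S = {} \<or> S = branch_roots"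
proof -
  have fin: "finite S" using S finite_branch_roots finite_subset by blast
  let ?p = "\<Prod>a\<in>S. lin a"
  have p: "?p \<noteq> 0" using prod_lin_nz[OF fin] .
  define z where "z = (x \<odot> x) \<odot> (inverse ?p, 0)"
  have "pdiv z = pdiv x + pdiv x - pdiv (?p, 0)"
    unfolding z_def using x p by (simp add: pdiv_mul pdiv_rat_inverse)
  also have "\<dots> = 0" using branch_div_double[OF S] eq by simp
  finally have dz: "pdiv z = 0" .
  have zn: "z \<noteq> (0, 0)" unfolding z_def using x p by simp
  have "v z = 0" if "v \<in> Points" for v
    using arg_cong[OF dz, of "\<lambda>D. Poly_Mapping.lookup D v"] that zn by (simp add: lookup_pdiv)
  then obtain c where c: "c \<noteq> 0" "z = (const c, 0)" by (rule no_zeros_poles_imp_const[OF zn])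
  have "(const c * ?p, 0) = z \<odot> (?p, 0)" unfolding c by simp
  also have "\<dots> = x \<odot> x" unfolding z_def mul_assoc mul_rat using p by simp
  finally have xx: "x \<odot> x = (const c * ?p, 0)" by simp
  obtain A B where AB: "x = (A, B)" by (cases x)
  have e1: "A * A + B * B * to_fract f = const c * ?p" and e2: "A * B + B * A = 0"
    using xx unfolding AB mul_eq by simp_all
  have "[:2 :: 'k:] = 1 + 1" by (simp add: one_pCons)
  then have "const 2 = 1 + 1" by (simp only: to_fract_add to_fract_1)
  then have "const 2 * (A * B) = 0" using e2 by (simp add: algebra_simps)
  then have "A = 0 \<or> B = 0" using two_nz by simp
  have ordS: "ord (Some b) (const c * ?p) = (if b \<in> S then 1 else 0)" for b
    using ord_mult[of "const c" ?p] c(1) p ord_prod_lin[OF fin] by simp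
  from \<open>A = 0 \<or> B = 0\<close> show ?thesis
  proof
    assume "B = 0"
    then have "A \<noteq> 0" using x AB by simp
    then have "ord (Some b) (const c * ?p) = ord (Some b) A + ord (Some b) A" for b
      using e1 \<open>B = 0\<close> ord_mult[of A A] by simp
    then have ev: "even (ord (Some b) (const c * ?p))" for b by simp
    have "b \<notin> S" for b using ev[of b] unfolding ordS by (cases "b \<in> S") simp_all
    then show ?thesis by blast
  next
    assume "A = 0"
    then have "B \<noteq> 0" using x AB by simp
    then have "ord (Some b) (const c * ?p) = ord (Some b) B + ord (Some b) B + ord (Some b) (to_fract f)" for b
      using e1 \<open>A = 0\<close> ord_mult[of B B] ord_mult[of "B * B" "to_fract f"] by simp
    then have odd: "odd (ord (Some b) (const c * ?p))" if "b \<in> branch_roots" for b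
      using that by (simp add: ord_Some_f)
    have "b \<in> S" if "b \<in> branch_roots" for b using odd[OF that] unfolding ordS by (cases "b \<in> S") simp_all
    then show ?thesis using S by blast
  qed
qed

lemma branch_div_diff:
  assumes "S \<subseteq> branch_roots" "T \<subseteq> branch_roots"
  shows "branch_div S + branch_div T = branch_div ((S - T) \<union> (T - S)) + pdiv (\<Prod>a\<in>S \<inter> T. lin a, 0)"
proof -
  have fin: "finite S" "finite T" using assms finite_branch_roots finite_subset by blast+
  let ?h = "\<lambda>a. frag_of (place a 0) - frag_of infinity"
  have "branch_div S = sum ?h (S \<inter> T) + sum ?h (S - T)" unfolding branch_div_def by (rule sum.Int_Diff[OF fin(1)])
  moreover have "branch_div T = sum ?h (T \<inter> S) + sum ?h (T - S)" unfolding branch_div_def by (rule sum.Int_Diff[OF fin(2)])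
  moreover have "branch_div ((S - T) \<union> (T - S)) = sum ?h (S - T) + sum ?h (T - S)"
    unfolding branch_div_def by (rule sum.union_disjoint) (use fin in auto)
  moreover have "sum ?h (S \<inter> T) + sum ?h (S \<inter> T) = pdiv (\<Prod>a\<in>S \<inter> T. lin a, 0)"
    using branch_div_double[of "S \<inter> T"] assms unfolding branch_div_def by blast
  moreover have "T \<inter> S = S \<inter> T" by blast
  ultimately show ?thesis by (simp add: algebra_simps)
qed

text \<open>The norm of \<open>h\<close> has even orders, so it is a square \<open>u\<^sup>2\<close>. Then \<open>t = h / u\<close> has norm \<open>1\<close>, and Hilbert's
  Theorem 90 is explicit: \<open>t\<close> is \<open>w\<^sup>2\<close> divided by the norm of \<open>w = 1 + t\<close>.\<close>

lemma double_principal_imp_square_times_rational: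
  assumes h: "h \<noteq> (0, 0)" and D: "D + D = pdiv h"
  obtains r w where "r \<noteq> 0" "w \<noteq> (0, 0)" "h = (r, 0) \<odot> (w \<odot> w)"
proof -
  have vh: "v h = 2 * Poly_Mapping.lookup D v" if "v \<in> Points" for v
    using arg_cong[OF D, of "\<lambda>D. Poly_Mapping.lookup D v"] that h by (simp add: lookup_pdiv lookup_add)
  have ev: "even (ord (Some a) (nrm h))" for a
  proof -
    obtain b where b: "poly f a = b\<^sup>2" by (rule ex_sqrt)
    then have b': "poly f a = (- b)\<^sup>2" by simp
    note P = place_in_points[OF b] place_in_points[OF b']
    show ?thesis
    proof (cases "b = 0")
      case True
      then have "place a b h = ord (Some a) (nrm h)" using h by (simp add: place_def branch_place_def)
      then have "ord (Some a) (nrm h) = 2 * Poly_Mapping.lookup D (place a b)" using vh[OF P(1)] by simp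
      then show ?thesis by (metis dvd_triv_left)
    next
      case False
      have "place a b h + place a b (cnj h) = place a b (nrm h, 0)" by (rule pt_nrm[OF P(1) h])
      moreover have "place a b (nrm h, 0) = ord (Some a) (nrm h)"
        using place_rat[OF b, of "nrm h"] h False by simp
      ultimately have "ord (Some a) (nrm h) = 2 * Poly_Mapping.lookup D (place a b) + 2 * Poly_Mapping.lookup D (place a (- b))"
        using vh[OF P(1)] vh[OF P(2)] place_cnj[OF b, of h] by simp
      then show ?thesis by (metis dvd_triv_left distrib_left)
    qed
  qed
  have "nrm h \<noteq> 0" using h by simp
  then obtain u where u: "u \<noteq> 0" "nrm h = u\<^sup>2" using even_ord_imp_square ev by blast
  define t where "t = (inverse u, 0) \<odot> h"
  have h_eq: "h = (u, 0) \<odot> t" unfolding t_def mul_assoc[symmetric] mul_rat using u by simp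
  have nt: "nrm t = 1" unfolding t_def nrm_mul nrm_const u(2) power_mult_distrib[symmetric] using u(1) by simp
  have "\<exists>w. w \<noteq> (0, 0) \<and> (\<exists>s. s \<noteq> 0 \<and> t = (s, 0) \<odot> (w \<odot> w))"
  proof (cases "t = (-1, 0)")
    case True
    then have "t = (-1, 0) \<odot> ((1, 0) \<odot> (1, 0))" by simp
    then show ?thesis by (intro exI[of _ "(1, 0)"] conjI exI[of _ "-1"]) simp_all
  next
    case False
    define w where "w = (1, 0) \<boxplus> t"
    have w: "w \<noteq> (0, 0)"
    proof
      assume "w = (0, 0)"
      then have "1 + fst t = 0" "snd t = 0" unfolding w_def pls_eq by simp_all
      then have "fst t = -1" "snd t = 0" by (simp_all add: add_eq_0_iff)
      then have "t = (-1, 0)" by (simp add: prod_eq_iff)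
      then show False using False by simp
    qed
    then have nw: "nrm w \<noteq> 0" by simp
    have dist: "t \<odot> cnj w = t \<boxplus> (t \<odot> cnj t)" unfolding w_def by (simp add: ff_eqs algebra_simps)
    then have tw: "t \<odot> cnj w = w" unfolding mul_cnj nt w_def by (simp add: pls_eq add.commute)
    have "(nrm w, 0) \<odot> t = t \<odot> (w \<odot> cnj w)" unfolding mul_cnj by (rule mul_comm)
    also have "\<dots> = (t \<odot> cnj w) \<odot> w" unfolding mul_comm[of w] mul_assoc ..
    also have "\<dots> = w \<odot> w" unfolding tw ..
    finally have e: "(nrm w, 0) \<odot> t = w \<odot> w" .
    have "(inverse (nrm w), 0) \<odot> (w \<odot> w) = t"
      unfolding e[symmetric] mul_assoc[symmetric] mul_rat using nw by simp
    then have "t = (inverse (nrm w), 0) \<odot> (w \<odot> w)" ..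
    then show ?thesis using w nw by (intro exI[of _ w] conjI exI[of _ "inverse (nrm w)"]) simp_all
  qed
  then obtain w s where ws: "w \<noteq> (0, 0)" "s \<noteq> 0" "t = (s, 0) \<odot> (w \<odot> w)" by blast
  have "h = (u * s, 0) \<odot> (w \<odot> w)" unfolding h_eq ws(3) mul_assoc[symmetric] mul_rat ..
  then show ?thesis using that[of "u * s" w] u(1) ws by simp
qed

text \<open>In \<open>h = r w\<^sup>2\<close> only the linear factors of \<open>r\<close> with odd multiplicity count, and these belong to branch points.\<close>

lemma double_principal_imp_branch:
  assumes h: "h \<noteq> (0, 0)" and D: "D + D = pdiv h"
  obtains S x where "S \<subseteq> branch_roots" "x \<noteq> (0, 0)" "D = branch_div S + pdiv x"
proof -
  obtain r w where rw: "r \<noteq> 0" "w \<noteq> (0, 0)" "h = (r, 0) \<odot> (w \<odot> w)"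
    by (rule double_principal_imp_square_times_rational[OF h D])
  have hw: "pdiv h = pdiv (r, 0) + (pdiv w + pdiv w)" unfolding rw(3) using rw by (simp add: pdiv_mul)
  define S where "S = {a \<in> branch_roots. odd (ord (Some a) r)}"
  have S: "S \<subseteq> branch_roots" by (auto simp: S_def)
  have fin: "finite S" using S finite_branch_roots finite_subset by blast
  let ?p = "\<Prod>a\<in>S. lin a"
  have p: "?p \<noteq> 0" using prod_lin_nz[OF fin] .
  have "even (ord (Some a) (r / ?p))" for a
  proof -
    have o: "ord (Some a) (r / ?p) = ord (Some a) r - (if a \<in> S then 1 else 0)"
      using ord_divide[OF rw(1) p] ord_prod_lin[OF fin] by simp
    show ?thesis
    proof (cases "poly f a = 0")
      case True
      then have "a \<in> S \<longleftrightarrow> odd (ord (Some a) r)" by (simp add: S_def)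
      then show ?thesis unfolding o by (cases "a \<in> S") simp_all
    next
      case False
      obtain b where b: "poly f a = b\<^sup>2" by (rule ex_sqrt)
      then have "b \<noteq> 0" using False by auto
      have P: "place a b \<in> Points" by (rule place_in_points[OF b])
      have "Poly_Mapping.lookup (D + D) (place a b) = Poly_Mapping.lookup (pdiv (r, 0) + (pdiv w + pdiv w)) (place a b)"
        unfolding D hw ..
      then have "2 * Poly_Mapping.lookup D (place a b) = ord (Some a) r + 2 * place a b w"
        using P rw \<open>b \<noteq> 0\<close> place_rat[OF b rw(1)] by (simp add: lookup_add lookup_pdiv)
      then have "ord (Some a) r = 2 * (Poly_Mapping.lookup D (place a b) - place a b w)" by simp
      then have "even (ord (Some a) r)" by (metis dvd_triv_left)
      moreover have "a \<notin> S" using False by (simp add: S_def)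
      ultimately show ?thesis unfolding o by simp
    qed
  qed
  moreover have "r / ?p \<noteq> 0" using rw p by simp
  ultimately obtain s where s: "s \<noteq> 0" "r / ?p = s\<^sup>2" using even_ord_imp_square by blast
  then have "r = s * s * ?p" using p by (simp add: field_simps power2_eq_square)
  then have "pdiv (r, 0) = pdiv (s, 0) + pdiv (s, 0) + pdiv (?p, 0)" using s(1) p by (simp add: pdiv_rat_mult)
  then have "D + D = (branch_div S + (pdiv (s, 0) + pdiv w)) + (branch_div S + (pdiv (s, 0) + pdiv w))"
    unfolding D hw branch_div_double[OF S, symmetric] by (simp add: algebra_simps)
  then have "D = branch_div S + (pdiv (s, 0) + pdiv w)" by (rule frag_double_cancel)
  moreover have "pdiv (s, 0) + pdiv w = pdiv ((s, 0) \<odot> w)" using s rw by (simp add: pdiv_mul)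
  ultimately have "D = branch_div S + pdiv ((s, 0) \<odot> w)" by simp
  then show ?thesis using that[OF S, of "(s, 0) \<odot> w"] s rw by simp
qed

end

context hyperelliptic_curve
begin

section \<open>The 2-torsion of the Jacobian\<close>

abbreviation "Prin \<equiv> principal_divisors f"

definition Div0 :: "(('k ff \<Rightarrow> int) \<Rightarrow>\<^sub>0 int) set" where
  "Div0 = {D. Poly_Mapping.keys D \<subseteq> Points \<and> divisor_degree D = 0}"

definition cls :: "(('k ff \<Rightarrow> int) \<Rightarrow>\<^sub>0 int) \<Rightarrow> (('k ff \<Rightarrow> int) \<Rightarrow>\<^sub>0 int) set" where
  "cls D = (\<lambda>p. p + D) ` Prin"

lemma pdiv_in_Prin: "x \<noteq> (0, 0) \<Longrightarrow> pdiv x \<in> Prin"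
  unfolding principal_iff by (intro exI[of _ x] conjI refl)

lemma PrinE: assumes "D \<in> Prin" obtains x where "x \<noteq> (0, 0)" "D = pdiv x"
  using assms unfolding principal_iff by (elim exE conjE)

lemma zero_in_Prin [simp]: "0 \<in> Prin"
  using pdiv_in_Prin[of "(1, 0)"] by simp

lemma add_in_Prin: assumes "D \<in> Prin" "D' \<in> Prin" shows "D + D' \<in> Prin"
proof -
  obtain x where x: "x \<noteq> (0, 0)" "D = pdiv x" by (rule PrinE[OF assms(1)])
  obtain y where y: "y \<noteq> (0, 0)" "D' = pdiv y" by (rule PrinE[OF assms(2)])
  have "pdiv (x \<odot> y) \<in> Prin" by (rule pdiv_in_Prin) (simp add: x y)
  then show ?thesis using x y by (simp add: pdiv_mul)
qed

lemma uminus_in_Prin: assumes "D \<in> Prin" shows "- D \<in> Prin"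
proof -
  obtain x where x: "x \<noteq> (0, 0)" "D = pdiv x" by (rule PrinE[OF assms(1)])
  obtain y where "y \<noteq> (0, 0)" "pdiv y = - pdiv x" by (rule pdiv_inverse[OF x(1)])
  then show ?thesis using pdiv_in_Prin[of y] x by simp
qed

lemma diff_in_Prin: "D \<in> Prin \<Longrightarrow> D' \<in> Prin \<Longrightarrow> D - D' \<in> Prin"
  using add_in_Prin[of D "- D'"] uminus_in_Prin[of D'] by simp

lemma branch_div_in_Div0: "S \<subseteq> branch_roots \<Longrightarrow> branch_div S \<in> Div0"
  unfolding Div0_def using keys_branch_div[of S] by simp

lemma self_in_cls: "D \<in> cls D"
  unfolding cls_def by (rule image_eqI[of _ _ 0]) simp_all

lemma cls_eq_iff: "cls D = cls D' \<longleftrightarrow> D - D' \<in> Prin"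
proof
  assume "cls D = cls D'"
  then have "D \<in> cls D'" using self_in_cls[of D] by simp
  then show "D - D' \<in> Prin" by (auto simp: cls_def)
next
  assume *: "D - D' \<in> Prin"
  have "cls D \<subseteq> cls D'" if "D - D' \<in> Prin" for D D'
  proof
    fix E assume "E \<in> cls D"
    then obtain p where p: "p \<in> Prin" "E = p + D" by (auto simp: cls_def)
    have "p + (D - D') \<in> Prin" by (rule add_in_Prin[OF p(1) that])
    moreover have "E = (p + (D - D')) + D'" using p by simp
    ultimately show "E \<in> cls D'" unfolding cls_def by (rule image_eqI[rotated])
  qed
  moreover have "D' - D \<in> Prin" using uminus_in_Prin[OF *] by simp
  ultimately show "cls D = cls D'" using * by blast
qed

lemma one_jacobian: "\<one>\<^bsub>jacobian f\<^esub> = cls 0"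
  by (simp add: jacobian_def FactGroup_def cls_def)

lemma carrier_jacobian: "carrier (jacobian f) = cls ` Div0"
  by (auto simp: jacobian_def FactGroup_def RCOSETS_def r_coset_def cls_def degree_zero_divisor_group_def
      Div0_def free_Abelian_group_def)

lemma mult_jacobian: "cls D \<otimes>\<^bsub>jacobian f\<^esub> cls D' = cls (D + D')"
proof -
  have "cls D \<otimes>\<^bsub>jacobian f\<^esub> cls D' = (\<Union>a\<in>cls D. \<Union>b\<in>cls D'. {a + b})"
    by (auto simp: jacobian_def FactGroup_def set_mult_def degree_zero_divisor_group_def free_Abelian_group_def)
  also have "\<dots> = cls (D + D')"
  proof (intro equalityI subsetI)
    fix Z assume "Z \<in> (\<Union>a\<in>cls D. \<Union>b\<in>cls D'. {a + b})"
    then obtain p q where "p \<in> Prin" "q \<in> Prin" "Z = (p + D) + (q + D')" by (auto simp: cls_def)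
    then have "p + q \<in> Prin" "Z = (p + q) + (D + D')" by (simp_all add: add_in_Prin algebra_simps)
    then show "Z \<in> cls (D + D')" unfolding cls_def by (intro image_eqI)
  next
    fix Z assume "Z \<in> cls (D + D')"
    then obtain p where p: "p \<in> Prin" "Z = p + (D + D')" by (auto simp: cls_def)
    have "p + D \<in> cls D" using p by (simp add: cls_def)
    moreover have "Z = (p + D) + D'" using p by (simp add: add.assoc)
    ultimately show "Z \<in> (\<Union>a\<in>cls D. \<Union>b\<in>cls D'. {a + b})" using self_in_cls[of D'] by blast
  qed
  finally show ?thesis .
qed

definition torsion2 :: "(('k ff \<Rightarrow> int) \<Rightarrow>\<^sub>0 int) set set" where
  "torsion2 = {c \<in> carrier (jacobian f). c \<otimes>\<^bsub>jacobian f\<^esub> c = \<one>\<^bsub>jacobian f\<^esub>}"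

lemma cls_eq_zero_iff: "cls D = cls 0 \<longleftrightarrow> D \<in> Prin"
  by (simp add: cls_eq_iff)

lemma branch_cls_double: "S \<subseteq> branch_roots \<Longrightarrow> branch_div S + branch_div S \<in> Prin"
proof -
  assume S: "S \<subseteq> branch_roots"
  then have "finite S" using finite_branch_roots finite_subset by blast
  then have "pdiv (\<Prod>a\<in>S. lin a, 0) \<in> Prin" by (intro pdiv_in_Prin) simp
  then show ?thesis unfolding branch_div_double[OF S] .
qed

lemma branch_cls_in_torsion2: "S \<subseteq> branch_roots \<Longrightarrow> cls (branch_div S) \<in> torsion2"
  unfolding torsion2_def carrier_jacobian one_jacobian
  using branch_div_in_Div0[of S] branch_cls_double[of S] by (simp add: mult_jacobian cls_eq_zero_iff)

lemma torsion2_eq: "torsion2 = (\<lambda>S. cls (branch_div S)) ` Pow branch_roots"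
proof
  show "(\<lambda>S. cls (branch_div S)) ` Pow branch_roots \<subseteq> torsion2"
    using branch_cls_in_torsion2 by blast
  show "torsion2 \<subseteq> (\<lambda>S. cls (branch_div S)) ` Pow branch_roots"
  proof
    fix c assume "c \<in> torsion2"
    then obtain D where D: "D \<in> Div0" "c = cls D" "c \<otimes>\<^bsub>jacobian f\<^esub> c = cls 0"
      unfolding torsion2_def carrier_jacobian one_jacobian by auto
    then have "D + D \<in> Prin" by (simp add: mult_jacobian cls_eq_zero_iff)
    then obtain h where h: "h \<noteq> (0, 0)" "D + D = pdiv h" by (rule PrinE)
    obtain S x where S: "S \<subseteq> branch_roots" "x \<noteq> (0, 0)" "D = branch_div S + pdiv x"
      by (rule double_principal_imp_branch[OF h])
    then have "cls D = cls (branch_div S)" using pdiv_in_Prin[OF S(2)] by (simp add: cls_eq_iff)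
    then show "c \<in> (\<lambda>S. cls (branch_div S)) ` Pow branch_roots" using D(2) S(1) by simp
  qed
qed

lemma branch_cls_add:
  assumes "S \<subseteq> branch_roots" "T \<subseteq> branch_roots"
  shows "cls (branch_div S) \<otimes>\<^bsub>jacobian f\<^esub> cls (branch_div T) = cls (branch_div ((S - T) \<union> (T - S)))"
proof -
  have "finite (S \<inter> T)" using assms finite_branch_roots finite_subset by blast
  then have "pdiv (\<Prod>a\<in>S \<inter> T. lin a, 0) \<in> Prin" by (intro pdiv_in_Prin) simp
  then show ?thesis unfolding mult_jacobian branch_div_diff[OF assms] by (simp add: cls_eq_iff)
qed

text \<open>The sum of two such divisors is equivalent to the divisor of the symmetric difference, which is principal
  only if the difference is empty or everything.\<close>

lemma branch_cls_eq_iff: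
  assumes "S \<subseteq> branch_roots" "T \<subseteq> branch_roots"
  shows "cls (branch_div S) = cls (branch_div T) \<longleftrightarrow> S = T \<or> S = branch_roots - T"
proof -
  let ?U = "(S - T) \<union> (T - S)"
  have U: "?U \<subseteq> branch_roots" using assms by blast
  have fin: "finite (S \<inter> T)" using assms finite_branch_roots finite_subset by blast
  then have P: "pdiv (\<Prod>a\<in>S \<inter> T. lin a, 0) \<in> Prin" by (intro pdiv_in_Prin) simp
  note TT = branch_cls_double[OF assms(2)]
  have e: "branch_div S - branch_div T = branch_div ?U + (pdiv (\<Prod>a\<in>S \<inter> T. lin a, 0) - (branch_div T + branch_div T))"
    using branch_div_diff[OF assms] by (simp add: algebra_simps)
  have Q: "pdiv (\<Prod>a\<in>S \<inter> T. lin a, 0) - (branch_div T + branch_div T) \<in> Prin" by (rule diff_in_Prin[OF P TT])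
  have "branch_div S - branch_div T \<in> Prin \<longleftrightarrow> branch_div ?U \<in> Prin"
  proof
    assume "branch_div S - branch_div T \<in> Prin"
    from diff_in_Prin[OF this Q] show "branch_div ?U \<in> Prin" unfolding e by simp
  next
    assume "branch_div ?U \<in> Prin"
    from add_in_Prin[OF this Q] show "branch_div S - branch_div T \<in> Prin" unfolding e by simp
  qed
  also have "\<dots> \<longleftrightarrow> ?U = {} \<or> ?U = branch_roots"
  proof
    assume "branch_div ?U \<in> Prin"
    then obtain x where "x \<noteq> (0, 0)" "branch_div ?U = pdiv x" by (rule PrinE)
    then show "?U = {} \<or> ?U = branch_roots" by (rule branch_div_principal_imp[OF U])
  next
    assume "?U = {} \<or> ?U = branch_roots"
    then show "branch_div ?U \<in> Prin"
    proof
      assume "?U = branch_roots"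
      then show ?thesis using branch_div_all_principal pdiv_in_Prin[of "(0, 1)"] by simp
    qed (simp only: branch_div_empty zero_in_Prin)
  qed
  also have "\<dots> \<longleftrightarrow> S = T \<or> S = branch_roots - T" using assms by blast
  finally show ?thesis unfolding cls_eq_iff .
qed

text \<open>Each class has exactly one representative set that avoids a chosen root; addition of classes is symmetric
  difference of these sets.\<close>

lemma torsion2_iso:
  "sum_group {..<2 * g} (\<lambda>_. integer_mod_group 2) \<cong> (jacobian f)\<lparr>carrier := torsion2\<rparr>"
proof -
  let ?G = "sum_group {..<2 * g} (\<lambda>_. integer_mod_group 2) :: (nat \<Rightarrow> int) monoid"
  obtain \<rho> where \<rho>: "bij_betw \<rho> {..<2 * g + 1} branch_roots"
    using ex_bij_betw_nat_finite[OF finite_branch_roots] card_branch_roots by (auto simp: atLeast0LessThan)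
  have "carrier ?G = {x \<in> \<Pi>\<^sub>E i\<in>{..<2 * g}. carrier (integer_mod_group 2). finite {i \<in> {..<2 * g}. x i \<noteq> \<one>\<^bsub>integer_mod_group 2\<^esub>}}"
    by (rule carrier_sum_group) simp
  then have carr: "carrier ?G = {..<2 * g} \<rightarrow>\<^sub>E {0..<2}"
    by (simp add: carrier_integer_mod_group)
  define set where "set x = \<rho> ` {i. i < 2 * g \<and> x i = 1}" for x :: "nat \<Rightarrow> int"
  have inj: "inj_on \<rho> {..<2 * g + 1}" and img: "\<rho> ` {..<2 * g + 1} = branch_roots"
    using \<rho> by (auto simp: bij_betw_def)
  have mem_set: "\<rho> i \<in> set x \<longleftrightarrow> i < 2 * g \<and> x i = 1" if "i < 2 * g + 1" for i x
  proof
    assume "\<rho> i \<in> set x"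
    then obtain j where j: "j < 2 * g" "x j = 1" "\<rho> i = \<rho> j" by (auto simp: set_def)
    then have "i = j" using that by (intro inj_onD[OF inj]) auto
    then show "i < 2 * g \<and> x i = 1" using j by simp
  qed (auto simp: set_def)
  have sub: "set x \<subseteq> branch_roots" for x unfolding set_def img[symmetric] by auto
  have last: "\<rho> (2 * g) \<in> branch_roots" "\<rho> (2 * g) \<notin> set x" for x
    using img mem_set[of "2 * g" x] by auto
  let ?\<Psi> = "\<lambda>x. cls (branch_div (set x))"
  have "?\<Psi> \<in> iso ?G ((jacobian f)\<lparr>carrier := torsion2\<rparr>)"
  proof (rule isoI)
    show "?\<Psi> \<in> hom ?G ((jacobian f)\<lparr>carrier := torsion2\<rparr>)"
    proof (rule homI)
      show "?\<Psi> x \<in> carrier ((jacobian f)\<lparr>carrier := torsion2\<rparr>)" for x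
        using branch_cls_in_torsion2[OF sub] by simp
      fix x y assume xy: "x \<in> carrier ?G" "y \<in> carrier ?G"
      have "set (x \<otimes>\<^bsub>?G\<^esub> y) = (set x - set y) \<union> (set y - set x)"
      proof -
        have mult: "(x \<otimes>\<^bsub>?G\<^esub> y) i = (x i + y i) mod 2" if "i < 2 * g" for i
          using that by (simp add: mult_integer_mod_group)
        have iff: "\<rho> i \<in> set (x \<otimes>\<^bsub>?G\<^esub> y) \<longleftrightarrow> \<rho> i \<in> (set x - set y) \<union> (set y - set x)" if i: "i < 2 * g + 1" for i
        proof (cases "i < 2 * g")
          case True
          then have "x i \<in> {0..<2}" "y i \<in> {0..<2}" using PiE_mem[OF xy(1)[unfolded carr], of i] PiE_mem[OF xy(2)[unfolded carr], of i] by simp_all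
          then have "x i = 0 \<or> x i = 1" "y i = 0 \<or> y i = 1" by auto
          then show ?thesis using True unfolding Un_iff Diff_iff mem_set[OF i] mult[OF True] by (elim disjE) simp_all
        next
          case False then show ?thesis unfolding Un_iff Diff_iff mem_set[OF i] by simp
        qed
        show ?thesis
        proof (rule equalityI; rule subsetI)
          fix a assume a: "a \<in> set (x \<otimes>\<^bsub>?G\<^esub> y)"
          then obtain i where "i < 2 * g + 1" "a = \<rho> i" using sub[of "x \<otimes>\<^bsub>?G\<^esub> y"] unfolding img[symmetric] by auto
          then show "a \<in> (set x - set y) \<union> (set y - set x)" using iff[of i] a by simp
        next
          fix a assume a: "a \<in> (set x - set y) \<union> (set y - set x)"
          then obtain i where "i < 2 * g + 1" "a = \<rho> i" using sub[of x] sub[of y] unfolding img[symmetric] by auto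
          then show "a \<in> set (x \<otimes>\<^bsub>?G\<^esub> y)" using iff[of i] a by simp
        qed
      qed
      then show "?\<Psi> (x \<otimes>\<^bsub>?G\<^esub> y) = ?\<Psi> x \<otimes>\<^bsub>(jacobian f)\<lparr>carrier := torsion2\<rparr>\<^esub> ?\<Psi> y"
        using branch_cls_add[OF sub sub] by simp
    qed
    show "bij_betw ?\<Psi> (carrier ?G) (carrier ((jacobian f)\<lparr>carrier := torsion2\<rparr>))"
    proof (rule bij_betw_imageI)
      show "inj_on ?\<Psi> (carrier ?G)"
      proof (rule inj_onI)
        fix x y assume xy: "x \<in> carrier ?G" "y \<in> carrier ?G" "?\<Psi> x = ?\<Psi> y"
        then have "set x = set y" using branch_cls_eq_iff[OF sub sub, of x y] last by blast
        then have iff: "x i = 1 \<longleftrightarrow> y i = 1" if "i < 2 * g" for i using mem_set[of i x] mem_set[of i y] that by simp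
        show "x = y"
        proof (rule PiE_ext[OF xy(1,2)[unfolded carr]])
          fix i assume i: "i \<in> {..<2 * g}"
          then have "x i \<in> {0..<2}" "y i \<in> {0..<2}"
            using PiE_mem[OF xy(1)[unfolded carr], of i] PiE_mem[OF xy(2)[unfolded carr], of i] by simp_all
          then show "x i = y i" using iff[of i] i by auto
        qed
      qed
      show "?\<Psi> ` carrier ?G = carrier ((jacobian f)\<lparr>carrier := torsion2\<rparr>)"
      proof
        show "?\<Psi> ` carrier ?G \<subseteq> carrier ((jacobian f)\<lparr>carrier := torsion2\<rparr>)"
          using branch_cls_in_torsion2[OF sub] by auto
        show "carrier ((jacobian f)\<lparr>carrier := torsion2\<rparr>) \<subseteq> ?\<Psi> ` carrier ?G"
        proof
          fix c assume "c \<in> carrier ((jacobian f)\<lparr>carrier := torsion2\<rparr>)"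
          then obtain S where S: "S \<subseteq> branch_roots" "c = cls (branch_div S)" unfolding torsion2_eq by auto
          define T where "T = (if \<rho> (2 * g) \<in> S then branch_roots - S else S)"
          have T: "T \<subseteq> branch_roots" "\<rho> (2 * g) \<notin> T" using S by (auto simp: T_def)
          have "c = cls (branch_div T)" using branch_cls_eq_iff[OF S(1) T(1)] S by (auto simp: T_def)
          define x where "x = (\<lambda>i\<in>{..<2 * g}. if \<rho> i \<in> T then 1 else 0 :: int)"
          have "x \<in> carrier ?G" unfolding carr x_def by auto
          moreover have "set x = T"
          proof -
            have iff: "\<rho> i \<in> set x \<longleftrightarrow> \<rho> i \<in> T" if i: "i < 2 * g + 1" for i
              using T(2) i unfolding mem_set[OF i] x_def by (cases "i = 2 * g") auto
            show ?thesis
            proof (rule equalityI; rule subsetI)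
              fix a assume a: "a \<in> set x"
              then obtain i where "i < 2 * g + 1" "a = \<rho> i" using sub[of x] unfolding img[symmetric] by auto
              then show "a \<in> T" using iff[of i] a by simp
            next
              fix a assume a: "a \<in> T"
              then obtain i where "i < 2 * g + 1" "a = \<rho> i" using T(1) unfolding img[symmetric] by auto
              then show "a \<in> set x" using iff[of i] a by simp
            qed
          qed
          ultimately show "c \<in> ?\<Psi> ` carrier ?G" using \<open>c = cls (branch_div T)\<close> by (intro image_eqI[of _ _ x]) simp_all
        qed
      qed
    qed
  qed
  then show ?thesis by (rule is_isoI)
qed

end

context hyperelliptic_curve
begin

section \<open>The Galois action\<close>

definition ff_auto :: "('k ff \<Rightarrow> 'k ff) \<Rightarrow> ('k \<Rightarrow> 'k) \<Rightarrow> bool" where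
  "ff_auto \<tau> \<sigma> \<longleftrightarrow> bij \<tau> \<and> bij \<sigma> \<and> (\<forall>x y. \<tau> (x \<odot> y) = \<tau> x \<odot> \<tau> y) \<and> (\<forall>x y. \<tau> (x \<boxplus> y) = \<tau> x \<boxplus> \<tau> y)
     \<and> (\<forall>c. \<tau> (const c, 0) = (const (\<sigma> c), 0))"

context
  fixes \<tau> \<sigma>
  assumes auto: "ff_auto \<tau> \<sigma>"
begin

lemma fa_bij: "bij \<tau>" "bij \<sigma>"
  and fa_mul: "\<tau> (x \<odot> y) = \<tau> x \<odot> \<tau> y" and fa_pls: "\<tau> (x \<boxplus> y) = \<tau> x \<boxplus> \<tau> y"
  and fa_const: "\<tau> (const c, 0) = (const (\<sigma> c), 0)"
  using auto unfolding ff_auto_def by blast+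

lemma fa_inv [simp]: "\<tau> (inv_into UNIV \<tau> x) = x" "inv_into UNIV \<tau> (\<tau> x) = x"
  using fa_bij(1) by (simp_all add: bij_is_surj surj_f_inv_f bij_is_inj)

lemma fa_zero: "\<tau> (0, 0) = (0, 0)"
proof -
  have "\<tau> (0, 0) \<boxplus> \<tau> (0, 0) = \<tau> ((0, 0) \<boxplus> (0, 0))" by (rule fa_pls[symmetric])
  also have "(0, 0) \<boxplus> (0, 0) = (0, 0)" by (simp add: pls_eq)
  finally have "fst (\<tau> (0, 0)) + fst (\<tau> (0, 0)) = fst (\<tau> (0, 0))" "snd (\<tau> (0, 0)) + snd (\<tau> (0, 0)) = snd (\<tau> (0, 0))"
    unfolding pls_eq prod_eq_iff fst_conv snd_conv by blast+
  then show ?thesis unfolding add_cancel_left_left by (simp only: prod_eq_iff fst_conv snd_conv)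
qed

lemma fa_eq_zero_iff: "\<tau> x = (0, 0) \<longleftrightarrow> x = (0, 0)"
  using fa_zero fa_inv(2)[of x] fa_inv(2)[of "(0, 0)"] by metis

lemma ff_auto_inv: "ff_auto (inv_into UNIV \<tau>) (inv_into UNIV \<sigma>)"
proof -
  let ?\<tau> = "inv_into UNIV \<tau>" and ?\<sigma> = "inv_into UNIV \<sigma>"
  have "?\<tau> (x \<odot> y) = ?\<tau> x \<odot> ?\<tau> y" for x y
    using fa_inv(2)[of "?\<tau> x \<odot> ?\<tau> y"] unfolding fa_mul fa_inv(1) .
  moreover have "?\<tau> (x \<boxplus> y) = ?\<tau> x \<boxplus> ?\<tau> y" for x y
    using fa_inv(2)[of "?\<tau> x \<boxplus> ?\<tau> y"] unfolding fa_pls fa_inv(1) .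
  moreover have "?\<tau> (const c, 0) = (const (?\<sigma> c), 0)" for c
  proof -
    have "\<sigma> (?\<sigma> c) = c" using fa_bij(2) by (simp add: bij_is_surj surj_f_inv_f)
    then show ?thesis using fa_inv(2)[of "(const (?\<sigma> c), 0)"] unfolding fa_const by simp
  qed
  ultimately show ?thesis unfolding ff_auto_def using bij_imp_bij_inv[OF fa_bij(1)] bij_imp_bij_inv[OF fa_bij(2)] by blast
qed

lemma fa_sigma_zero_iff: "\<sigma> c = 0 \<longleftrightarrow> c = 0"
proof -
  have "\<sigma> c = 0 \<longleftrightarrow> (const (\<sigma> c), 0) = ((0, 0) :: 'k ff)" by simp
  also have "\<dots> \<longleftrightarrow> (const c, 0) = ((0, 0) :: 'k ff)" unfolding fa_const[symmetric] by (rule fa_eq_zero_iff)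
  finally show ?thesis by simp
qed

lemma points_comp_auto: assumes v: "v \<in> Points" shows "v \<circ> \<tau> \<in> Points"
proof -
  obtain x where x: "x \<noteq> (0, 0)" "v x = 1" using pt_surj[OF v] by (elim exE conjE)
  show ?thesis
  proof (rule pointsI[where x = "inv_into UNIV \<tau> x"])
    show "(v \<circ> \<tau>) (0, 0) = 0" using pt_zero[OF v] by (simp add: fa_zero)
    show "(v \<circ> \<tau>) (x \<odot> y) = (v \<circ> \<tau>) x + (v \<circ> \<tau>) y" if "x \<noteq> (0, 0)" "y \<noteq> (0, 0)" for x y
      unfolding o_apply fa_mul by (rule pt_mul[OF v]) (simp_all only: fa_eq_zero_iff that not_False_eq_True)
    show "(v \<circ> \<tau>) (x \<boxplus> y) \<ge> min ((v \<circ> \<tau>) x) ((v \<circ> \<tau>) y)"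
      if "x \<noteq> (0, 0)" "y \<noteq> (0, 0)" "x \<boxplus> y \<noteq> (0, 0)" for x y
      unfolding o_apply fa_pls
      by (rule pt_add[OF v]) (simp_all only: fa_eq_zero_iff that not_False_eq_True fa_pls[symmetric])
    show "(v \<circ> \<tau>) (const c, 0) = 0" if "c \<noteq> 0" for c
      unfolding o_apply fa_const by (rule pt_const[OF v]) (simp only: fa_sigma_zero_iff that not_False_eq_True)
    show "inv_into UNIV \<tau> x \<noteq> (0, 0)" using fa_zero x(1) fa_inv(1)[of x] by metis
    show "(v \<circ> \<tau>) (inv_into UNIV \<tau> x) = 1" using x by simp
  qed
qed

end

lemma points_comp_auto_iff: assumes "ff_auto \<tau> \<sigma>" shows "v \<circ> \<tau> \<in> Points \<longleftrightarrow> v \<in> Points"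
proof
  assume "v \<circ> \<tau> \<in> Points"
  then have "(v \<circ> \<tau>) \<circ> inv_into UNIV \<tau> \<in> Points" by (rule points_comp_auto[OF ff_auto_inv[OF assms]])
  moreover have "(v \<circ> \<tau>) \<circ> inv_into UNIV \<tau> = v" by (rule ext) (simp add: fa_inv[OF assms])
  ultimately show "v \<in> Points" by simp
qed (rule points_comp_auto[OF assms])

lemma divisor_conj_add: "divisor_conj \<tau> (D + D') = divisor_conj \<tau> D + divisor_conj \<tau> D'"
  by (simp add: divisor_conj_def frag_extend_add)

lemma divisor_conj_diff: "divisor_conj \<tau> (D - D') = divisor_conj \<tau> D - divisor_conj \<tau> D'"
  using divisor_conj_add[of \<tau> "D - D'" D'] by (simp add: algebra_simps)

lemma divisor_conj_of: "divisor_conj \<tau> (frag_of v) = frag_of (v \<circ> inv_into UNIV \<tau>)"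
  unfolding divisor_conj_def by (rule frag_extend_of)

lemma divisor_conj_sum: "divisor_conj \<tau> (\<Sum>i\<in>I. D i) = (\<Sum>i\<in>I. divisor_conj \<tau> (D i))"
proof (induction I rule: infinite_finite_induct)
  case (insert x F) then show ?case by (simp add: divisor_conj_add)
qed (simp_all add: divisor_conj_def frag_extend_0)

lemma lookup_divisor_conj:
  assumes "ff_auto \<tau> \<sigma>" shows "Poly_Mapping.lookup (divisor_conj \<tau> D) v = Poly_Mapping.lookup D (v \<circ> \<tau>)"
proof -
  have iff: "u \<circ> inv_into UNIV \<tau> = v \<longleftrightarrow> u = v \<circ> \<tau>" for u
  proof
    assume "u \<circ> inv_into UNIV \<tau> = v"
    then have "v \<circ> \<tau> = (u \<circ> inv_into UNIV \<tau>) \<circ> \<tau>" by simp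
    also have "\<dots> = u" by (rule ext) (simp only: o_apply fa_inv[OF assms])
    finally show "u = v \<circ> \<tau>" ..
  next
    assume "u = v \<circ> \<tau>"
    then have "u \<circ> inv_into UNIV \<tau> = (v \<circ> \<tau>) \<circ> inv_into UNIV \<tau>" by simp
    also have "\<dots> = v" by (rule ext) (simp only: o_apply fa_inv[OF assms])
    finally show "u \<circ> inv_into UNIV \<tau> = v" .
  qed
  have "Poly_Mapping.lookup (divisor_conj \<tau> D) v =
      (\<Sum>u\<in>Poly_Mapping.keys D. Poly_Mapping.lookup D u * (1 when u = v \<circ> \<tau>))"
    unfolding divisor_conj_def frag_extend_def lookup_sum
    by (rule sum.cong) (simp_all add: lookup_single iff[symmetric] when_def)
  also have "\<dots> = (\<Sum>u\<in>Poly_Mapping.keys D. if u = v \<circ> \<tau> then Poly_Mapping.lookup D (v \<circ> \<tau>) else 0)"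
    by (rule sum.cong) (auto simp: when_def)
  also have "\<dots> = Poly_Mapping.lookup D (v \<circ> \<tau>)" by (simp add: in_keys_iff)
  finally show ?thesis .
qed

lemma divisor_conj_pdiv: assumes "ff_auto \<tau> \<sigma>" shows "divisor_conj \<tau> (pdiv x) = pdiv (\<tau> x)"
  by (rule poly_mapping_eqI)
     (simp add: lookup_divisor_conj[OF assms] lookup_pdiv points_comp_auto_iff[OF assms] fa_eq_zero_iff[OF assms])

lemma divisor_conj_cls: assumes "ff_auto \<tau> \<sigma>" shows "divisor_conj \<tau> ` cls D = cls (divisor_conj \<tau> D)"
proof -
  have P: "divisor_conj \<tau> ` Prin = Prin"
  proof (rule equalityI; rule subsetI)
    fix E assume "E \<in> divisor_conj \<tau> ` Prin"
    then obtain F where "F \<in> Prin" "E = divisor_conj \<tau> F" by (rule imageE)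
    then obtain x where x: "x \<noteq> (0, 0)" "E = divisor_conj \<tau> (pdiv x)" by (elim PrinE) simp
    then have "\<tau> x \<noteq> (0, 0)" using fa_eq_zero_iff[OF assms, of x] by simp
    then show "E \<in> Prin" using pdiv_in_Prin[of "\<tau> x"] x divisor_conj_pdiv[OF assms, of x] by simp
  next
    fix E assume "E \<in> Prin"
    then obtain x where x: "x \<noteq> (0, 0)" "E = pdiv x" by (rule PrinE)
    let ?y = "inv_into UNIV \<tau> x"
    have y: "\<tau> ?y = x" by (rule fa_inv(1)[OF assms])
    then have "?y \<noteq> (0, 0)" using x(1) fa_zero[OF assms] by metis
    then have "pdiv ?y \<in> Prin" by (rule pdiv_in_Prin)
    moreover have "E = divisor_conj \<tau> (pdiv ?y)" unfolding divisor_conj_pdiv[OF assms] y x(2) ..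
    ultimately show "E \<in> divisor_conj \<tau> ` Prin" by (rule image_eqI[rotated])
  qed
  have "divisor_conj \<tau> ` cls D = (\<lambda>p. p + divisor_conj \<tau> D) ` (divisor_conj \<tau> ` Prin)"
    unfolding cls_def image_image divisor_conj_add ..
  then show ?thesis unfolding P cls_def .
qed

lemma point_eq_infinity: assumes "v \<in> Points" "v (lin 0, 0) < 0" shows "v = infinity"
  using assms(1)
proof (cases rule: points_cases)
  case (2 a b)
  have "ord (Some a) (lin 0) \<ge> 0" using ord_lin[of "Some a" 0] by (simp split: if_splits)
  then have "place a b (lin 0, 0) \<ge> 0" using place_rat[OF 2(1), of "lin 0"] by simp
  then show ?thesis using assms(2) 2(2) by simp
qed

lemma point_eq_branch_point: assumes "v \<in> Points" "v (lin a, 0) > 0" "poly f a = 0" shows "v = place a 0"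
  using assms(1)
proof (cases rule: points_cases)
  case 1
  then show ?thesis using infinity_rat[of "lin a"] ord_lin[of None a] assms(2) by simp
next
  case (2 a' b)
  have "ord (Some a') (lin a) \<noteq> 0" using place_rat[OF 2(1), of "lin a"] assms(2) unfolding 2(2) by auto
  then have "a' = a" using ord_lin[of "Some a'" a] by (simp split: if_splits)
  then have "b = 0" using 2(1) assms(3) by simp
  then show ?thesis using 2(2) \<open>a' = a\<close> by simp
qed

lemma conj_infinity:
  assumes auto: "ff_auto \<tau> \<sigma>" and x: "\<tau> (lin 0, 0) = (lin 0, 0)"
  shows "infinity \<circ> inv_into UNIV \<tau> = infinity"
proof (rule point_eq_infinity)
  show "infinity \<circ> inv_into UNIV \<tau> \<in> Points" by (rule points_comp_auto[OF ff_auto_inv[OF auto] infinity_in_points])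
  have "inv_into UNIV \<tau> (lin 0, 0) = (lin 0, 0)" using fa_inv(2)[OF auto, of "(lin 0, 0)"] unfolding x .
  then show "(infinity \<circ> inv_into UNIV \<tau>) (lin 0, 0) < 0"
    using infinity_rat[of "lin 0"] ord_lin[of None "0 :: 'k"] by simp
qed

lemma fa_lin:
  assumes auto: "ff_auto \<tau> \<sigma>" and x: "\<tau> (lin 0, 0) = (lin 0, 0)"
  shows "\<tau> (lin a, 0) = (lin (\<sigma> a), 0)"
proof -
  have e: "(lin 0, 0) = (lin a, 0) \<boxplus> (const a, 0)" for a :: 'k
    by (simp add: pls_eq flip: to_fract_add)
  have "(lin (\<sigma> a), 0) \<boxplus> (const (\<sigma> a), 0) = \<tau> ((lin a, 0) \<boxplus> (const a, 0))"
    unfolding e[symmetric] x ..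
  also have "\<dots> = \<tau> (lin a, 0) \<boxplus> (const (\<sigma> a), 0)" unfolding fa_pls[OF auto] fa_const[OF auto] ..
  finally show ?thesis by (simp add: pls_eq prod_eq_iff)
qed

lemma conj_branch_point:
  assumes auto: "ff_auto \<tau> \<sigma>" and x: "\<tau> (lin 0, 0) = (lin 0, 0)"
    and a: "poly f a = 0" "poly f (\<sigma> a) = 0"
  shows "place a 0 \<circ> inv_into UNIV \<tau> = place (\<sigma> a) 0"
proof (rule point_eq_branch_point)
  show "place a 0 \<circ> inv_into UNIV \<tau> \<in> Points"
    by (rule points_comp_auto[OF ff_auto_inv[OF auto] branch_point_in_points[OF a(1)]])
  have "inv_into UNIV \<tau> (lin (\<sigma> a), 0) = (lin a, 0)"
    using fa_inv(2)[OF auto, of "(lin a, 0)"] unfolding fa_lin[OF auto x] .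
  moreover have "place a 0 (lin a, 0) > 0" using place_rat[of a 0 "lin a"] a ord_lin[of "Some a" a] by simp
  ultimately show "(place a 0 \<circ> inv_into UNIV \<tau>) (lin (\<sigma> a), 0) > 0" by simp
qed (rule a)

lemma conj_branch_div:
  assumes auto: "ff_auto \<tau> \<sigma>" and x: "\<tau> (lin 0, 0) = (lin 0, 0)"
    and a: "S \<subseteq> branch_roots" "\<And>a. a \<in> S \<Longrightarrow> \<sigma> a \<in> branch_roots" "inj_on \<sigma> S"
  shows "divisor_conj \<tau> (branch_div S) = branch_div (\<sigma> ` S)"
proof -
  have "divisor_conj \<tau> (branch_div S) = (\<Sum>a\<in>S. frag_of (place (\<sigma> a) 0) - frag_of infinity)"
    unfolding branch_div_def divisor_conj_sum divisor_conj_diff divisor_conj_of conj_infinity[OF auto x]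
  proof (rule sum.cong[OF refl])
    fix b assume "b \<in> S"
    then have "poly f b = 0" "poly f (\<sigma> b) = 0" using a by auto
    then show "frag_of (place b 0 \<circ> inv_into UNIV \<tau>) - frag_of infinity = frag_of (place (\<sigma> b) 0) - frag_of infinity"
      using conj_branch_point[OF auto x] by simp
  qed
  also have "\<dots> = branch_div (\<sigma> ` S)" unfolding branch_div_def by (simp add: sum.reindex[OF a(3)])
  finally show ?thesis .
qed

lemma ff_x_eq: "ff_x = (lin 0, 0)" by (simp add: ff_x_def to_fract_def)
lemma ff_const_eq: "ff_const c = (const c, 0)" by (simp add: ff_const_def to_fract_def)

lemma ff_galois_imp_auto:
  assumes "\<tau> \<in> ff_galois k f"
  obtains \<sigma> where "\<sigma> \<in> absolute_galois k" "ff_auto \<tau> \<sigma>" "\<tau> (lin 0, 0) = (lin 0, 0)"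
proof -
  obtain \<sigma> where \<sigma>: "\<tau> \<in> ring_iso (function_field f) (function_field f)" "\<tau> ff_x = ff_x"
    "\<sigma> \<in> absolute_galois k" "\<forall>c. \<tau> (ff_const c) = ff_const (\<sigma> c)"
    using assms unfolding ff_galois_def mem_Collect_eq by (elim conjE bexE)
  have c: "carrier (function_field f) = UNIV" by (simp add: function_field_def)
  have "bij \<tau>" "\<tau> (x \<odot> y) = \<tau> x \<odot> \<tau> y" "\<tau> (x \<boxplus> y) = \<tau> x \<boxplus> \<tau> y" for x y
    using \<sigma>(1) unfolding ring_iso_def Ring.ring_hom_def c mem_Collect_eq Pi_def by blast+
  moreover have "bij \<sigma>" using \<sigma>(3) unfolding absolute_galois_iff by (elim conjE)
  moreover have "\<tau> (const c, 0) = (const (\<sigma> c), 0)" for c using \<sigma>(4) unfolding ff_const_eq by (elim allE)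
  ultimately have "ff_auto \<tau> \<sigma>" unfolding ff_auto_def by (intro conjI allI)
  then show ?thesis by (rule that[OF \<sigma>(3) _ \<sigma>(2)[unfolded ff_x_eq]])
qed

lemma rational_torsion_subset: "{c \<in> jacobian_rational_points k f. c \<otimes>\<^bsub>jacobian f\<^esub> c = \<one>\<^bsub>jacobian f\<^esub>} \<subseteq> torsion2"
  by (auto simp: jacobian_rational_points_def torsion2_def)

lemma group_sum_group_mod2: "Group.group (sum_group I (\<lambda>_. integer_mod_group 2))"
  by (rule sum_group) simp

lemma all_torsion_rational_if_roots_rational:
  assumes "branch_roots \<subseteq> k"
  shows "jacobian_rational_2_torsion k f \<cong> sum_group {..<2 * g} (\<lambda>_. integer_mod_group 2)"
proof -
  have "c \<in> jacobian_rational_points k f" if c: "c \<in> torsion2" for c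
  proof -
    obtain S where S: "S \<subseteq> branch_roots" "c = cls (branch_div S)" using c unfolding torsion2_eq by blast
    have "divisor_conj \<tau> ` c = c" if t: "\<tau> \<in> ff_galois k f" for \<tau>
    proof -
      obtain \<sigma> where \<sigma>: "\<sigma> \<in> absolute_galois k" "ff_auto \<tau> \<sigma>" "\<tau> (lin 0, 0) = (lin 0, 0)"
        by (rule ff_galois_imp_auto[OF t])
      have id: "\<sigma> a = a" if "a \<in> S" for a using \<sigma>(1) that S(1) assms unfolding absolute_galois_iff by blast
      have "divisor_conj \<tau> (branch_div S) = branch_div (\<sigma> ` S)"
        by (rule conj_branch_div[OF \<sigma>(2,3) S(1)]) (use id S(1) in \<open>auto simp: inj_on_def\<close>)
      moreover have "\<sigma> ` S = S" using id by simp
      ultimately show ?thesis unfolding S(2) divisor_conj_cls[OF \<sigma>(2)] by simp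
    qed
    moreover have "c \<in> carrier (jacobian f)" using c by (simp add: torsion2_def)
    ultimately show ?thesis by (simp add: jacobian_rational_points_def)
  qed
  then have "torsion2 \<subseteq> {c \<in> jacobian_rational_points k f. c \<otimes>\<^bsub>jacobian f\<^esub> c = \<one>\<^bsub>jacobian f\<^esub>}"
    by (simp add: torsion2_def subset_iff)
  then have "jacobian_rational_2_torsion k f = (jacobian f)\<lparr>carrier := torsion2\<rparr>"
    unfolding jacobian_rational_2_torsion_def using rational_torsion_subset[of k] by simp
  then show ?thesis using group.iso_sym[OF group_sum_group_mod2 torsion2_iso] by simp
qed

text \<open>A subset of the finite 2-torsion with the cardinality of the whole is the whole.\<close>

lemma all_torsion_rational_if_iso:
  assumes "jacobian_rational_2_torsion k f \<cong> sum_group {..<2 * g} (\<lambda>_. integer_mod_group 2)"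
  shows "torsion2 \<subseteq> jacobian_rational_points k f"
proof -
  let ?R = "{c \<in> jacobian_rational_points k f. c \<otimes>\<^bsub>jacobian f\<^esub> c = \<one>\<^bsub>jacobian f\<^esub>}"
  have cR: "carrier (jacobian_rational_2_torsion k f) = ?R" by (simp add: jacobian_rational_2_torsion_def)
  have eq: "card A = card B" if "bij_betw h A B" for A :: "'x set" and B :: "'y set" and h
    using bij_betw_same_card[OF that] .
  have "card ?R = card (carrier (sum_group {..<2 * g} (\<lambda>_. integer_mod_group 2) :: (nat \<Rightarrow> int) monoid))"
    using assms bij_betw_same_card unfolding is_iso_def iso_def cR by blast
  also have "\<dots> = card torsion2"
    using torsion2_iso bij_betw_same_card unfolding is_iso_def iso_def by fastforce
  finally have "card ?R = card torsion2" .
  moreover have "finite torsion2" unfolding torsion2_eq by simp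
  ultimately have "?R = torsion2" using rational_torsion_subset[of k] by (intro card_subset_eq)
  then show ?thesis by blast
qed

end

section \<open>The Frobenius automorphism\<close>

definition fract_map :: "('k::field \<Rightarrow> 'k) \<Rightarrow> 'k poly fract \<Rightarrow> 'k poly fract" where
  "fract_map \<sigma> r = (SOME s. \<exists>p q. q \<noteq> 0 \<and> r = to_fract p / to_fract q \<and> s = to_fract (map_poly \<sigma> p) / to_fract (map_poly \<sigma> q))"

context
  fixes \<sigma> :: "'k::field \<Rightarrow> 'k"
  assumes hom: "ring_hom_on UNIV \<sigma>"
begin

lemma map_poly_eq_0_iff_hom: "map_poly \<sigma> p = 0 \<longleftrightarrow> p = 0"
proof
  assume "map_poly \<sigma> p = 0"
  then have "\<sigma> (lead_coeff p) = 0" using coeff_rh[OF subring_UNIV hom, of p "degree p"] by simp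
  then have "lead_coeff p = 0" using rh_nonzero[OF subfield_UNIV hom UNIV_I] by blast
  then show "p = 0" by simp
qed simp

lemma fract_map_quotient:
  assumes "q \<noteq> 0"
  shows "fract_map \<sigma> (to_fract p / to_fract q) = to_fract (map_poly \<sigma> p) / to_fract (map_poly \<sigma> q)"
proof -
  let ?P = "\<lambda>s. \<exists>p' q'. q' \<noteq> 0 \<and> to_fract p / to_fract q = to_fract p' / to_fract q' \<and>
     s = to_fract (map_poly \<sigma> p') / to_fract (map_poly \<sigma> q')"
  have "?P (to_fract (map_poly \<sigma> p) / to_fract (map_poly \<sigma> q))"
    using assms by (intro exI[of _ p] exI[of _ q]) simp
  then have "?P (fract_map \<sigma> (to_fract p / to_fract q))" unfolding fract_map_def by (rule someI)
  then obtain p' q' where *: "q' \<noteq> 0" "to_fract p / to_fract q = to_fract p' / to_fract q'"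
     "fract_map \<sigma> (to_fract p / to_fract q) = to_fract (map_poly \<sigma> p') / to_fract (map_poly \<sigma> q')"
    by (elim exE conjE)
  have "to_fract (p * q') = to_fract (p' * q)"
    using *(1,2) assms unfolding to_fract_mult by (simp add: frac_eq_eq)
  then have "p * q' = p' * q" by (simp only: to_fract_eq_iff)
  then have "map_poly \<sigma> (p * q') = map_poly \<sigma> (p' * q)" by (rule arg_cong)
  then have "map_poly \<sigma> p * map_poly \<sigma> q' = map_poly \<sigma> p' * map_poly \<sigma> q"
    by (simp add: rh_poly_mult[OF subring_UNIV hom])
  then have "to_fract (map_poly \<sigma> p) * to_fract (map_poly \<sigma> q') = to_fract (map_poly \<sigma> p') * to_fract (map_poly \<sigma> q)"
    by (simp only: to_fract_mult[symmetric])
  then show ?thesis unfolding *(3) using assms *(1) map_poly_eq_0_iff_hom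
    by (simp add: frac_eq_eq)
qed

lemma fract_map_poly: "fract_map \<sigma> (to_fract p) = to_fract (map_poly \<sigma> p)"
  using fract_map_quotient[of 1 p] by (simp add: rh_poly_one[OF subring_UNIV hom])

lemma fract_map_mult: "fract_map \<sigma> (r * s) = fract_map \<sigma> r * fract_map \<sigma> s"
proof -
  obtain p q where 1: "q \<noteq> 0" "r = to_fract p / to_fract q" by (rule fract_cases)
  obtain p' q' where 2: "q' \<noteq> 0" "s = to_fract p' / to_fract q'" by (rule fract_cases)
  have "r * s = to_fract (p * p') / to_fract (q * q')" using 1 2 by simp
  then have "fract_map \<sigma> (r * s) = to_fract (map_poly \<sigma> (p * p')) / to_fract (map_poly \<sigma> (q * q'))"
    using fract_map_quotient[of "q * q'" "p * p'"] 1 2 by simp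
  then show ?thesis using 1 2 by (simp add: fract_map_quotient rh_poly_mult[OF subring_UNIV hom])
qed

lemma fract_map_add: "fract_map \<sigma> (r + s) = fract_map \<sigma> r + fract_map \<sigma> s"
proof -
  obtain p q where 1: "q \<noteq> 0" "r = to_fract p / to_fract q" by (rule fract_cases)
  obtain p' q' where 2: "q' \<noteq> 0" "s = to_fract p' / to_fract q'" by (rule fract_cases)
  have "r + s = to_fract (p * q' + p' * q) / to_fract (q * q')" using 1 2 by (simp add: add_frac_eq)
  then have "fract_map \<sigma> (r + s) = to_fract (map_poly \<sigma> (p * q' + p' * q)) / to_fract (map_poly \<sigma> (q * q'))"
    using fract_map_quotient[of "q * q'" "p * q' + p' * q"] 1 2 by simp
  then show ?thesis using 1 2 map_poly_eq_0_iff_hom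
    by (simp add: fract_map_quotient rh_poly_mult[OF subring_UNIV hom] rh_poly_add[OF subring_UNIV hom] add_frac_eq)
qed

end

lemma fract_map_inverse:
  assumes "ring_hom_on UNIV \<sigma>" "ring_hom_on UNIV \<rho>" "\<And>c. \<rho> (\<sigma> c) = c"
  shows "fract_map \<rho> (fract_map \<sigma> r) = r"
proof -
  obtain p q where 1: "q \<noteq> 0" "r = to_fract p / to_fract q" by (rule fract_cases)
  have "map_poly \<rho> (map_poly \<sigma> p) = p" for p
    by (rule poly_eqI) (simp add: coeff_rh[OF subring_UNIV] assms)
  then show ?thesis using 1 map_poly_eq_0_iff_hom[OF assms(1)] by (simp add: fract_map_quotient assms(1,2))
qed

context hyperelliptic_curve
begin

text \<open>The automorphism acts on the coefficients of rational functions; the multiplication is respected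
  because \<open>f\<close> is fixed.\<close>

lemma absolute_galois_extends:
  assumes \<sigma>: "\<sigma> \<in> absolute_galois k" and f: "f \<in> polys_over k"
  obtains \<tau> where "\<tau> \<in> ff_galois k f" "ff_auto \<tau> \<sigma>" "\<tau> (lin 0, 0) = (lin 0, 0)"
proof -
  have s: "bij \<sigma>" "\<And>x y. \<sigma> (x * y) = \<sigma> x * \<sigma> y" "\<And>x y. \<sigma> (x + y) = \<sigma> x + \<sigma> y" "\<sigma> 1 = 1" "\<And>c. c \<in> k \<Longrightarrow> \<sigma> c = c"
    using \<sigma> unfolding absolute_galois_iff by blast+
  have hom: "ring_hom_on UNIV \<sigma>" unfolding ring_hom_on_def using s by blast
  define \<rho> where "\<rho> = inv_into UNIV \<sigma>"
  have \<rho>: "\<rho> (\<sigma> c) = c" "\<sigma> (\<rho> c) = c" for c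
    unfolding \<rho>_def using s(1) by (simp_all add: bij_is_surj surj_f_inv_f bij_is_inj)
  have homr: "ring_hom_on UNIV \<rho>"
  proof -
    have "\<rho> (x * y) = \<rho> x * \<rho> y" for x y using \<rho>(1)[of "\<rho> x * \<rho> y"] unfolding s(2) \<rho>(2) .
    moreover have "\<rho> (x + y) = \<rho> x + \<rho> y" for x y using \<rho>(1)[of "\<rho> x + \<rho> y"] unfolding s(3) \<rho>(2) .
    moreover have "\<rho> 1 = 1" using \<rho>(1)[of 1] unfolding s(4) .
    ultimately show ?thesis unfolding ring_hom_on_def by blast
  qed
  let ?m = "fract_map \<sigma>"
  have m0: "?m 0 = 0" and m1: "?m 1 = 1"
    using fract_map_poly[OF hom, of 0] fract_map_poly[OF hom, of 1] by (simp_all add: rh_poly_one[OF subring_UNIV hom])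
  have mc: "?m (const c) = const (\<sigma> c)" for c
    unfolding fract_map_poly[OF hom] rh_poly_const[OF subring_UNIV hom] ..
  have ml: "?m (lin a) = lin (\<sigma> a)" for a
    unfolding fract_map_poly[OF hom] by (subst rh_poly_linear[OF subring_UNIV hom]) simp_all
  have s0: "\<sigma> 0 = 0" by (rule rh_zero[OF subring_UNIV hom])
  have "map_poly \<sigma> f = f"
  proof (rule poly_eqI)
    fix i
    have "coeff f i = 0 \<or> coeff f i \<in> k" using f coeff_in_coeffs[of f i] coeff_eq_0[of f i]
      unfolding polys_over_def by (cases "i \<le> degree f") auto
    then show "coeff (map_poly \<sigma> f) i = coeff f i" unfolding coeff_rh[OF subring_UNIV hom] using s(5) s0 by auto
  qed
  then have mf: "?m (to_fract f) = to_fract f" unfolding fract_map_poly[OF hom] by simp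
  define \<tau> :: "'k ff \<Rightarrow> 'k ff" where "\<tau> x = (?m (fst x), ?m (snd x))" for x
  have mul: "\<tau> (x \<odot> y) = \<tau> x \<odot> \<tau> y" for x y
    unfolding \<tau>_def mul_eq fst_conv snd_conv fract_map_add[OF hom] fract_map_mult[OF hom] mf ..
  have pls: "\<tau> (x \<boxplus> y) = \<tau> x \<boxplus> \<tau> y" for x y
    unfolding \<tau>_def pls_eq fst_conv snd_conv fract_map_add[OF hom] ..
  have bij: "bij \<tau>"
  proof (rule bij_betw_byWitness[where f' = "\<lambda>x. (fract_map \<rho> (fst x), fract_map \<rho> (snd x))"])
    show "\<forall>x\<in>UNIV. (fract_map \<rho> (fst (\<tau> x)), fract_map \<rho> (snd (\<tau> x))) = x"
      unfolding \<tau>_def fst_conv snd_conv using fract_map_inverse[OF hom homr \<rho>(1)] by simp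
    show "\<forall>x\<in>UNIV. \<tau> (fract_map \<rho> (fst x), fract_map \<rho> (snd x)) = x"
      unfolding \<tau>_def fst_conv snd_conv using fract_map_inverse[OF homr hom \<rho>(2)] by simp
  qed simp_all
  have const: "\<tau> (const c, 0) = (const (\<sigma> c), 0)" for c unfolding \<tau>_def fst_conv snd_conv mc m0 ..
  have x: "\<tau> (lin 0, 0) = (lin 0, 0)" unfolding \<tau>_def fst_conv snd_conv ml m0 s0 ..
  have y: "\<tau> (0, 1) = (0, 1)" unfolding \<tau>_def fst_conv snd_conv m0 m1 ..
  have auto: "ff_auto \<tau> \<sigma>" unfolding ff_auto_def using bij s(1) mul pls const by blast
  have c: "carrier (function_field f) = UNIV" by (simp add: function_field_def)
  have "\<tau> \<in> Ring.ring_hom (function_field f) (function_field f)"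
  proof (rule ring_hom_memI)
    show "\<tau> \<one>\<^bsub>function_field f\<^esub> = \<one>\<^bsub>function_field f\<^esub>" unfolding one_eq \<tau>_def fst_conv snd_conv m0 m1 ..
  qed (simp_all only: c UNIV_I mul pls)
  then have "\<tau> \<in> ring_iso (function_field f) (function_field f)" unfolding ring_iso_def c using bij by simp
  then have "\<tau> \<in> ff_galois k f"
    unfolding ff_galois_def mem_Collect_eq ff_x_eq ff_y_def ff_const_eq using x y const \<sigma> by blast
  then show ?thesis using that auto x by blast
qed

end

text \<open>The map \<open>z \<mapsto> z\<^sup>q\<close>, where \<open>q\<close> is the number of elements of a finite field \<open>k\<close>, is additive because
  \<open>z\<^sup>q - z\<close> is the product of all \<open>z - c\<close> with \<open>c \<in> k\<close>, and a monic polynomial whose roots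
  are the elements of an additive group is additive.\<close>

lemma frobenius_exists:
  fixes k :: "'k::alg_closed_field set"
  assumes k: "subring_set k" and fin: "finite k"
  obtains \<sigma> where "\<sigma> \<in> absolute_galois k" "\<And>z. \<sigma> z = z \<Longrightarrow> z \<in> k"
proof -
  let ?q = "card k"
  have q2: "?q \<ge> 2"
  proof -
    have "card {0, 1 :: 'k} \<le> ?q" using sr_zero[OF k] sr_one[OF k] by (intro card_mono fin) simp
    then show ?thesis by simp
  qed
  define P :: "'k poly" where "P = (\<Prod>c\<in>k. [:-c, 1:])"
  have degP: "degree P = ?q" unfolding P_def by (subst degree_prod_eq_sum_degree) simp_all
  have monP: "lead_coeff P = 1" unfolding P_def lead_coeff_prod by simp
  have rootP: "poly P z = 0 \<longleftrightarrow> z \<in> k" for z unfolding P_def poly_prod using fin by (auto simp: prod_zero_iff)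
  have vanish: "p = 0" if "degree p < ?q" "\<And>c. c \<in> k \<Longrightarrow> poly p c = 0" for p :: "'k poly"
  proof (rule ccontr)
    assume "p \<noteq> 0"
    then have "card k \<le> card {x. poly p x = 0}" using that(2) by (intro card_mono poly_roots_finite) auto
    also have "\<dots> \<le> degree p" using \<open>p \<noteq> 0\<close> by (rule card_poly_roots_bound)
    finally show False using that(1) by simp
  qed
  have pow: "c ^ ?q = c" if c: "c \<in> k" for c
  proof (cases "c = 0")
    case True then show ?thesis using q2 by (simp add: power_0_left)
  next
    case False
    let ?U = "k - {0}"
    have sub: "(\<lambda>x. c * x) ` ?U \<subseteq> ?U" using False c sr_mult[OF k] by auto
    have inj: "inj_on (\<lambda>x. c * x) ?U" using False by (auto simp: inj_on_def)
    have img: "(\<lambda>x. c * x) ` ?U = ?U"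
      by (rule card_subset_eq) (use fin sub card_image[OF inj] in auto)
    have "(\<Prod>x\<in>?U. x) = (\<Prod>x\<in>?U. c * x)"
      using prod.reindex[OF inj, of "\<lambda>x. x"] unfolding img by simp
    also have "\<dots> = c ^ card ?U * (\<Prod>x\<in>?U. x)" by (simp add: prod.distrib)
    finally have "c ^ card ?U = 1" using fin by simp
    moreover have "card ?U = ?q - 1" using sr_zero[OF k] fin by simp
    ultimately have "c ^ (?q - 1) * c = c" by simp
    then show ?thesis using q2 by (metis power_minus_mult less_le_trans zero_less_numeral)
  qed
  have P_eq: "P = monom 1 ?q - [:0, 1:]"
  proof -
    have "degree (P - (monom 1 ?q - [:0, 1:])) < ?q"
    proof (rule degree_lessI)
      show "P - (monom 1 ?q - [:0, 1:]) \<noteq> 0 \<or> ?q > 0" using q2 by simp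
      show "\<forall>i\<ge>?q. coeff (P - (monom 1 ?q - [:0, 1:])) i = 0"
      proof (intro allI impI)
        fix i assume i: "i \<ge> ?q"
        have "coeff [:0, 1 :: 'k:] i = 0" using i q2 by (intro coeff_eq_0) simp
        moreover have "coeff P i = (if i = ?q then 1 else 0)" using degP monP i by (auto simp: coeff_eq_0)
        ultimately show "coeff (P - (monom 1 ?q - [:0, 1:])) i = 0" by simp
      qed
    qed
    moreover have "poly (P - (monom 1 ?q - [:0, 1:])) c = 0" if "c \<in> k" for c
      using that rootP pow by (simp add: poly_monom)
    ultimately have "P - (monom 1 ?q - [:0, 1:]) = 0" by (rule vanish)
    then show ?thesis by simp
  qed
  have evalP: "poly P z = z ^ ?q - z" for z unfolding P_eq by (simp add: poly_monom)
  have addP: "poly P (z + w) = poly P z + poly P w" for z w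
  proof -
    let ?D = "P \<circ>\<^sub>p [:w, 1:] - P - [:poly P w:]"
    have d: "degree (P \<circ>\<^sub>p [:w, 1:]) = ?q" by (simp add: degree_pcompose degP)
    have l: "coeff (P \<circ>\<^sub>p [:w, 1:]) ?q = 1"
      using lead_coeff_comp[of "[:w, 1:]" P] monP d by simp
    have "degree ?D < ?q"
    proof (rule degree_lessI)
      show "?D \<noteq> 0 \<or> ?q > 0" using q2 by simp
      show "\<forall>i\<ge>?q. coeff ?D i = 0"
      proof (intro allI impI)
        fix i assume i: "i \<ge> ?q"
        have "coeff [:poly P w:] i = 0" using i q2 by (intro coeff_eq_0) simp
        moreover have "coeff P i = (if i = ?q then 1 else 0)" using degP monP i by (auto simp: coeff_eq_0)
        moreover have "coeff (P \<circ>\<^sub>p [:w, 1:]) i = (if i = ?q then 1 else 0)" using d l i by (auto simp: coeff_eq_0)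
        ultimately show "coeff ?D i = 0" by simp
      qed
    qed
    moreover have "poly ?D c = 0" if "c \<in> k" for c
    proof -
      have img: "(\<lambda>d. d - c) ` k = k"
      proof (rule card_subset_eq[OF fin])
        show "(\<lambda>d. d - c) ` k \<subseteq> k" using sr_diff[OF k _ that] by auto
        show "card ((\<lambda>d. d - c) ` k) = card k" by (rule card_image) (simp add: inj_on_def)
      qed
      have "poly P (c + w) = (\<Prod>d\<in>k. w - (d - c))" unfolding P_def poly_prod by (simp add: algebra_simps)
      also have "\<dots> = (\<Prod>d\<in>(\<lambda>d. d - c) ` k. w - d)" by (subst prod.reindex) (simp_all add: inj_on_def)
      also have "\<dots> = poly P w" unfolding img P_def poly_prod by simp
      finally show ?thesis using rootP that by (simp add: poly_pcompose add.commute)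
    qed
    ultimately have "?D = 0" by (rule vanish)
    then have "poly ?D z = 0" by simp
    then show ?thesis by (simp add: poly_pcompose add.commute algebra_simps)
  qed
  define \<sigma> where "\<sigma> z = z ^ ?q" for z :: 'k
  have mul: "\<sigma> (x * y) = \<sigma> x * \<sigma> y" for x y by (simp add: \<sigma>_def power_mult_distrib)
  have add: "\<sigma> (x + y) = \<sigma> x + \<sigma> y" for x y
    using addP[of x y] unfolding evalP \<sigma>_def by (simp add: algebra_simps)
  have s0: "\<sigma> 0 = 0" using q2 by (simp add: \<sigma>_def power_0_left)
  have "inj \<sigma>"
  proof (rule injI)
    fix x y assume "\<sigma> x = \<sigma> y"
    moreover have "\<sigma> x = \<sigma> (x - y) + \<sigma> y" using add[of "x - y" y] by simp
    ultimately have "\<sigma> (x - y) = 0" by simp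
    then show "x = y" by (simp add: \<sigma>_def)
  qed
  moreover have "surj \<sigma>"
  proof -
    have "\<exists>x. \<sigma> x = y" for y using nth_root_exists[of ?q y] q2 unfolding \<sigma>_def by simp
    then show ?thesis unfolding surj_def by metis
  qed
  ultimately have "bij \<sigma>" by (simp add: bij_def)
  then have "\<sigma> \<in> absolute_galois k"
    using mul add pow unfolding absolute_galois_iff by (simp add: \<sigma>_def)
  moreover have "z \<in> k" if "\<sigma> z = z" for z using that rootP[of z] unfolding evalP \<sigma>_def by simp
  ultimately show ?thesis by (rule that)
qed

context hyperelliptic_curve
begin

text \<open>If all 2-torsion is rational, Frobenius fixes the class of \<open>(a, 0) - \<infinity>\<close>; so it fixes \<open>a\<close>, or the image of \<open>a\<close>
  is the only element of the complement of \<open>a\<close>, which has \<open>2 g\<close> elements. The fixed points of Frobenius lie in \<open>k\<close>.\<close>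

theorem rational_2_torsion_full_iff:
  assumes k: "subring_set k" "finite k" and f: "f \<in> polys_over k"
  shows "jacobian_rational_2_torsion k f \<cong> sum_group {..<2 * g} (\<lambda>_. integer_mod_group 2) \<longleftrightarrow>
    branch_roots \<subseteq> k"
proof
  assume iso: "jacobian_rational_2_torsion k f \<cong> sum_group {..<2 * g} (\<lambda>_. integer_mod_group 2)"
  obtain \<sigma> where \<sigma>: "\<sigma> \<in> absolute_galois k" "\<And>z. \<sigma> z = z \<Longrightarrow> z \<in> k" by (rule frobenius_exists[OF k]) blast
  obtain \<tau> where \<tau>: "\<tau> \<in> ff_galois k f" "ff_auto \<tau> \<sigma>" "\<tau> (lin 0, 0) = (lin 0, 0)"
    by (rule absolute_galois_extends[OF \<sigma>(1) f])
  have hom: "ring_hom_on UNIV \<sigma>" using \<sigma>(1) unfolding absolute_galois_iff ring_hom_on_def by blast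
  have fix_f: "map_poly \<sigma> f = f"
  proof (rule poly_eqI)
    fix i
    have "\<sigma> (coeff f i) = coeff f i" using \<sigma>(1) f unfolding polys_over_iff[OF k(1)] absolute_galois_iff by blast
    then show "coeff (map_poly \<sigma> f) i = coeff f i" unfolding coeff_rh[OF subring_UNIV hom] .
  qed
  show "branch_roots \<subseteq> k"
  proof
    fix a assume a: "a \<in> branch_roots"
    then have "poly (map_poly \<sigma> f) (\<sigma> a) = \<sigma> 0" using rh_poly_eval[OF subring_UNIV hom, of f a] by simp
    then have sa: "\<sigma> a \<in> branch_roots" unfolding fix_f using rh_zero[OF subring_UNIV hom] by simp
    have sub: "{a} \<subseteq> branch_roots" "{\<sigma> a} \<subseteq> branch_roots" using a sa by auto
    have "divisor_conj \<tau> (branch_div {a}) = branch_div {\<sigma> a}"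
      using conj_branch_div[OF \<tau>(2,3) sub(1)] sa by simp
    moreover have "cls (branch_div {a}) \<in> jacobian_rational_points k f"
      using all_torsion_rational_if_iso[OF iso] branch_cls_in_torsion2[OF sub(1)] by blast
    then have "divisor_conj \<tau> ` cls (branch_div {a}) = cls (branch_div {a})"
      using \<tau>(1) by (simp add: jacobian_rational_points_def)
    ultimately have "cls (branch_div {\<sigma> a}) = cls (branch_div {a})" unfolding divisor_conj_cls[OF \<tau>(2)] by simp
    then have "{\<sigma> a} = {a} \<or> {\<sigma> a} = branch_roots - {a}" using branch_cls_eq_iff[OF sub(2) sub(1)] by simp
    moreover have "{\<sigma> a} \<noteq> branch_roots - {a}"
    proof
      assume "{\<sigma> a} = branch_roots - {a}"
      moreover have "card (branch_roots - {a}) = 2 * g" using a card_branch_roots by simp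
      ultimately have "2 * g = card {\<sigma> a}" by simp
      then show False by simp
    qed
    ultimately show "a \<in> k" using \<sigma>(2)[of a] by simp
  qed
qed (rule all_torsion_rational_if_roots_rational)

end

section \<open>The criterion\<close>

theorem theorem1p1:
  fixes K K\<^sub>f :: "'a::field_char_0 set"
    and g :: nat
    and f :: "'a poly"
    and \<theta> :: 'a
    and \<pp> :: "'a set"
    and \<iota> :: "'a set \<Rightarrow> 'k::alg_closed_field"
  assumes "number_field K"
    and "g > 0"
    and "degree f = 2 * g + 1" and "lead_coeff f = 1"
    and "f \<in> polys_over (carrier (ring_of_integers K))"
    and "ring_irreducible\<^bsub>poly_ring_over K\<^esub> f"
    and "splitting_field_of K f K\<^sub>f"
    and "\<theta> \<in> K\<^sub>f" and "poly f \<theta> = 0"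
    and "primeideal \<pp> (ring_of_integers K)"
    and "\<pp> <+>\<^bsub>ring_of_integers K\<^esub> (PIdl\<^bsub>ring_of_integers K\<^esub> 2) = carrier (ring_of_integers K)"
    and "(Idl\<^bsub>ring_of_integers (simple_ext K \<theta>)\<^esub> \<pp>) <+>\<^bsub>ring_of_integers (simple_ext K \<theta>)\<^esub> conductor K \<theta>
           = carrier (ring_of_integers (simple_ext K \<theta>))"
    and "algebraic_closure_via (residue_field K \<pp>) \<iota>"
    and "rsquarefree (reduction K \<pp> \<iota> f)"
  shows "splits_completely K K\<^sub>f \<pp> \<longleftrightarrow>
    jacobian_rational_2_torsion (\<iota> ` carrier (residue_field K \<pp>)) (reduction K \<pp> \<iota> f)
      \<cong> sum_group {..<2 * g} (\<lambda>_. integer_mod_group 2)"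
proof -
  let ?OK = "ints K"
  define \<phi> where "\<phi> a = \<iota> (\<pp> +>\<^bsub>ring_of_integers K\<^esub> a)" for a
  define F where "F = reduction K \<pp> \<iota> f"
  have K: "subfield_set K" using assms(1) subfield_ambientD by (auto simp: number_field_def)
  note OK = subring_ints[OF K]
  have p: "prime_set ?OK \<pp>" using assms(10) primeideal_iff_prime_set[OF OK] by (simp add: ring_of_integers_eq)
  note pI = prime_set_ideal[OF p]
  have idl: "ideal \<pp> (ring_of_integers K)" using pI ideal_iff_ideal_set[OF OK] by (simp add: ring_of_integers_eq)
  have \<iota>: "\<iota> \<in> Ring.ring_hom (residue_field K \<pp>) ambient" using assms(13) by (simp add: algebraic_closure_via_def)
  note res = residue_map[OF idl \<iota>, folded \<phi>_def]
  have hom: "ring_hom_on ?OK \<phi>" and img: "\<phi> ` ?OK = \<iota> ` carrier (residue_field K \<pp>)"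
    using res(1,2) unfolding \<phi>_def by simp_all
  have ker1: "\<phi> a = 0" if "a \<in> \<pp>" for a using res(3)[OF that] by (simp add: \<phi>_def)
  obtain b where b: "b \<in> ?OK" "2 * b - 1 \<in> \<pp>" by (rule odd_residue[OF assms(11) K pI])
  have algb: "algebraic_int b" using b(1) by (simp add: ints_def)
  obtain N where N: "N \<noteq> 0" "of_int N \<in> \<pp>" by (rule odd_int_in_ideal[OF OK pI b(1) algb b(2)])
  have max: "maximal_set ?OK \<pp>" by (rule prime_set_imp_maximal[OF OK _ p N]) (simp add: ints_def)
  have ker: "\<phi> a = 0 \<longleftrightarrow> a \<in> \<pp>" if a: "a \<in> ?OK" for a
  proof
    assume "\<phi> a = 0"
    show "a \<in> \<pp>"
    proof (rule ccontr)
      assume "a \<notin> \<pp>"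
      then obtain y where y: "y \<in> ?OK" "a * y - 1 \<in> \<pp>" using max a unfolding maximal_set_def by blast
      have "\<phi> (a * y - 1) = 0" by (rule ker1[OF y(2)])
      then show False
        using rh_diff[OF OK hom sr_mult[OF OK a y(1)] sr_one[OF OK]] rh_mult[OF OK hom a y(1)] rh_one[OF OK hom] \<open>\<phi> a = 0\<close>
        by simp
    qed
  qed (rule ker1)
  have two: "(2 :: 'k) \<noteq> 0"
  proof
    assume zero: "(2 :: 'k) = 0"
    have "b + b - 1 \<in> \<pp>" using b(2) unfolding mult_2 .
    then have "\<phi> (b + b - 1) = 0" by (rule ker1)
    then have "\<phi> b + \<phi> b - 1 = 0"
      unfolding rh_diff[OF OK hom sr_add[OF OK b(1) b(1)] sr_one[OF OK]] rh_add[OF OK hom b(1) b(1)] rh_one[OF OK hom] .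
    then have "2 * \<phi> b = 1" by (simp only: mult_2 right_minus_eq)
    then show False unfolding zero by simp
  qed
  have NK: "of_int N = (0 :: 'k)" using ker1[OF N(2)] rh_of_int[OF OK hom] by simp
  have fin: "finite (\<phi> ` ?OK)" by (rule finite_residue_image[OF assms(1) hom N(1) NK])
  have f_int: "f \<in> polys_over ?OK" using assms(5) by (simp add: ring_of_integers_eq)
  have F_eq: "F = map_poly \<phi> f" by (simp add: F_def reduction_def \<phi>_def[abs_def])
  interpret C: hyperelliptic_curve F g
  proof
    show "degree F = 2 * g + 1" using rh_degree_monic(1)[OF OK hom assms(4)] assms(3) F_eq by simp
    show "lead_coeff F = 1" using rh_degree_monic(2)[OF OK hom assms(4)] F_eq by simp
  qed (use assms(2) assms(14) two in \<open>simp_all add: F_def\<close>)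
  have Fk: "F \<in> polys_over (\<phi> ` ?OK)"
    unfolding polys_over_iff[OF image_subring[OF OK hom]] F_eq coeff_rh[OF OK hom]
    using f_int[unfolded polys_over_iff[OF OK]] by blast
  have "?OK \<subseteq> K" by (auto simp: ints_def)
  then have fK: "f \<in> polys_over K" using f_int polys_over_mono by blast
  have "splitting_field K K\<^sub>f f {r. poly f r = 0}"
    by (rule splitting_field_instance[OF K fK assms(6) _ assms(4,7)]) (simp add: assms(3))
  then have isf: "integral_splitting_field K K\<^sub>f f {r. poly f r = 0} \<pp> N"
    by (intro integral_splitting_field.intro integral_splitting_field_axioms.intro f_int p N)
  have Z1: "finite {a. poly F a = 0}" using C.f_nz by (rule poly_roots_finite)
  have Z2: "map_poly \<phi> f = (\<Prod>a\<in>{a. poly F a = 0}. [:-a, 1:])" unfolding F_eq[symmetric] by (rule C.f_eq_prod)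
  have Z3: "card {a. poly F a = 0} = degree f" unfolding assms(3) by (rule C.card_branch_roots)
  have "splits_completely K K\<^sub>f \<pp> \<longleftrightarrow> {a. poly F a = 0} \<subseteq> \<phi> ` ?OK"
    by (rule splits_completely_iff_roots_residual[OF isf hom _ Z1 Z2 Z3]) (rule ker)
  also have "\<dots> \<longleftrightarrow> jacobian_rational_2_torsion (\<phi> ` ?OK) F \<cong> sum_group {..<2 * g} (\<lambda>_. integer_mod_group 2)"
    by (rule C.rational_2_torsion_full_iff[OF image_subring[OF OK hom] fin Fk, symmetric])
  finally show ?thesis unfolding img F_def .
qed

end
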